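(* Let $2<q<p<6$, let $V:\mathbb{R}^3\to\mathbb{R}$ and $f,g:\mathbb{R}^3\times\mathbb{R}\to\mathbb{R}$, and put $F(x,u)=\int_0^u f(x,s)\,ds$. Assume that $u\mapsto f(x,u)-g(x,u)$ is odd for a.e. $x\in\mathbb{R}^3$, and: (V) $V\in L^\infty(\mathbb{R}^3)$, $V=V(r,x_3)$ is cylindrically symmetric, $1$-periodic in $x_3$, and $\inf\sigma\left(-\Delta+\frac1{r^2}+V(r,x_3)\right)>0$. (F1) $f$ is measurable in $x$, $1$-periodic in $x_3$, continuous in $u$, $O(2)\times\{I\}$-invariant in $x$, and $|f(x,u)|\le c(1+|u|^{p-1})$ for some $c>0$, all $u\in\mathbb{R}$ and a.e. $x\in\mathbb{R}^3$. (F2) $f(x,u)=o(|u|)$ uniformly in $x$ as $u\to0$. (F3) $F(x,u)/|u|^q\to+\infty$ uniformly in $x$ as $|u|\to+\infty$, and $F(x,u)\ge0$ for all $u\in\mathbb{R}$ and a.e. $x$. (F4) $u\mapsto f(x,u)/|u|^{q-1}$ is nondecreasing on $(-\infty,0)$ and on $(0,+\infty)$. (G1) $g$ is measurable in $x$, $1$-periodic in $x_3$, continuous in $u$, $O(2)\times\{I\}$-invariant in $x$, and $|g(x,u)|\le c(1+|u|^{q-1})$ for some $c>0$, all $u\in\mathbb{R}$ and a.e. $x$. (G2) $g(x,u)=o(|u|)$ uniformly in $x$ as $u\to0$. (G3) $u\mapsto g(x,u)/|u|^{q-1}$ is nonincreasing on $(-\infty,0)$ and on $(0,+\infty)$, and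 $g(x,u)u\ge0$ for all $u\in\mathbb{R}$ and a.e. $x$. Then there exist infinitely many pairs $\pm u\in H^1(\mathbb{R}^3)$ of cylindrically symmetric weak solutions, with $\int_{\mathbb{R}^3}\frac{u^2}{r^2}\,dx<+\infty$, to $$-\Delta u+\frac{u}{r^2}+V(r,x_3)u=f(x,u)-g(x,u)\quad\text{in }\mathbb{R}^3.$$
   Context: Write $x=(x_1,x_2,x_3)\in\mathbb{R}^3$, $r=\sqrt{x_1^2+x_2^2}$. A function on $\mathbb{R}^3$ is cylindrically symmetric if it depends only on $(r,x_3)$. $O(2)\times\{I\}$-invariance in $x$ of $f$ means $f(Ax,u)=f(x,u)$ for all $A\in O(2)\times\{I\}$ ($O(2)$ acting on $(x_1,x_2)$). $\sigma(\cdot)$ denotes the spectrum of the self-adjoint operator on $L^2(\mathbb{R}^3)$ associated with the quadratic form $\int_{\mathbb{R}^3}|\nabla u|^2+\frac{u^2}{r^2}+Vu^2\,dx$. $X$ is the Hilbert space of all cylindrically symmetric $u\in H^1(\mathbb{R}^3)$ with $\int_{\mathbb{R}^3}\frac{u^2}{r^2}\,dx<+\infty$, with norm $\|u\|_X^2=\int_{\mathbb{R}^3}|\nabla u|^2+\frac{u^2}{r^2}+u^2\,dx$. With $G(x,u)=\int_0^u g(x,s)\,ds$, the energy functional $\mathcal{J}:X\to\mathbb{R}$ is $$\mathcal{J}(u)=\frac12\int_{\mathbb{R}^3}|\nabla u|^2+\frac{u^2}{r^2}+V(r,x_3)u^2\,dx-\int_{\mathbb{R}^3}F(x,u)\,dx+\int_{\mathbb{R}^3}G(x,u)\,dx.$$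 A (cylindrically symmetric) weak solution is by definition a critical point $u\in X$ of $\mathcal{J}$ on $X$. *)

theory Defs
  imports "HOL-Analysis.Analysis"
begin

text \<open>
  Functions on R^3 are real-valued; elements of the Lebesgue and Sobolev spaces are represented
  by Lebesgue measurable functions, identified up to almost everywhere equality.
\<close>

definition rad :: "real^3 \<Rightarrow> real" where
  "rad x = sqrt ((x$1)^2 + (x$2)^2)"

definition e3 :: "real^3" where
  "e3 = axis 3 1"

text \<open>The action of the element of O(2) x {I} with upper left block \<open>B\<close>.\<close>

definition O2_act :: "real^2^2 \<Rightarrow> real^3 \<Rightarrow> real^3" where
  "O2_act B x = (let y = B *v vector [x$1, x$2] in vector [y$1, y$2, x$3])"

text \<open>Up to a null set, since the functions concerned are classes modulo a.e. equality.\<close>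

definition cyl_sym :: "(real^3 \<Rightarrow> real) \<Rightarrow> bool" where
  "cyl_sym u \<longleftrightarrow> (\<exists>w. AE x in lebesgue. u x = w (rad x) (x$3))"

definition L2 :: "(real^3 \<Rightarrow> 'b::euclidean_space) set" where
  "L2 = {u. u \<in> borel_measurable lebesgue \<and> integrable lebesgue (\<lambda>x. (norm (u x))^2)}"

definition L2_norm :: "(real^3 \<Rightarrow> real) \<Rightarrow> real" where
  "L2_norm u = sqrt (LINT x|lebesgue. (u x)^2)"

definition Linf :: "(real^3 \<Rightarrow> real) set" where
  "Linf = {u. u \<in> borel_measurable lebesgue \<and> (\<exists>C. AE x in lebesgue. \<bar>u x\<bar> \<le> C)}"

definition loc_integrable :: "(real^3 \<Rightarrow> 'b::euclidean_space) \<Rightarrow> bool" where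
  "loc_integrable u \<longleftrightarrow> (\<forall>K. compact K \<longrightarrow> set_integrable lebesgue K u)"

definition pderiv_at :: "3 \<Rightarrow> (real^3 \<Rightarrow> real) \<Rightarrow> real^3 \<Rightarrow> real" where
  "pderiv_at i \<phi> x = frechet_derivative \<phi> (at x) (axis i 1)"

primrec Ck :: "nat \<Rightarrow> (real^3 \<Rightarrow> real) \<Rightarrow> bool" where
  "Ck 0 \<phi> \<longleftrightarrow> continuous_on UNIV \<phi>"
| "Ck (Suc k) \<phi> \<longleftrightarrow> (\<forall>x. \<phi> differentiable (at x)) \<and> (\<forall>i. Ck k (pderiv_at i \<phi>))"

definition test_fun :: "(real^3 \<Rightarrow> real) \<Rightarrow> bool" where
  "test_fun \<phi> \<longleftrightarrow> (\<forall>k. Ck k \<phi>) \<and> (\<exists>K. compact K \<and> (\<forall>x. x \<notin> K \<longrightarrow> \<phi> x = 0))"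

definition has_weak_grad :: "(real^3 \<Rightarrow> real) \<Rightarrow> (real^3 \<Rightarrow> real^3) \<Rightarrow> bool" where
  "has_weak_grad u D \<longleftrightarrow> loc_integrable u \<and> loc_integrable D \<and>
     (\<forall>\<phi> i. test_fun \<phi> \<longrightarrow>
        (LINT x|lebesgue. u x * pderiv_at i \<phi> x) = - (LINT x|lebesgue. D x $ i * \<phi> x))"

text \<open>Weak gradients are unique up to null sets, so the choice is immaterial.\<close>

definition wgrad :: "(real^3 \<Rightarrow> real) \<Rightarrow> real^3 \<Rightarrow> real^3" where
  "wgrad u = (SOME D. has_weak_grad u D)"

definition H1 :: "(real^3 \<Rightarrow> real) set" where
  "H1 = {u \<in> L2. \<exists>D\<in>L2. has_weak_grad u D}"

text \<open>
  The operator -Laplace + 1/r^2 + V: its graph consists of the pairs \<open>(u, w)\<close> with \<open>u\<close> in the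
  form domain, \<open>w\<close> in \<open>L2\<close>, and form value \<open>\<langle>w, v\<rangle>\<close> at every \<open>(u, v)\<close> with \<open>v\<close> in the form domain.
  No symmetry is imposed on the form domain: the operator acts in the whole of L^2(R^3).
\<close>

definition form_dom :: "(real^3 \<Rightarrow> real) set" where
  "form_dom = {u \<in> H1. integrable lebesgue (\<lambda>x. (u x)^2 / (rad x)^2)}"

definition qform :: "(real^3 \<Rightarrow> real) \<Rightarrow> (real^3 \<Rightarrow> real) \<Rightarrow> (real^3 \<Rightarrow> real) \<Rightarrow> real" where
  "qform V u v = (LINT x|lebesgue. wgrad u x \<bullet> wgrad v x + u x * v x / (rad x)^2 + V x * u x * v x)"

definition op_graph :: "(real^3 \<Rightarrow> real) \<Rightarrow> ((real^3 \<Rightarrow> real) \<times> (real^3 \<Rightarrow> real)) set" where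
  "op_graph V = {(u, w). u \<in> form_dom \<and> w \<in> L2 \<and>
     (\<forall>v\<in>form_dom. qform V u v = (LINT x|lebesgue. w x * v x))}"

text \<open>
  \<open>l\<close> is in the resolvent set iff (operator - \<open>l\<close>) maps its domain bijectively onto L^2 with
  bounded inverse; the norm estimate contains injectivity. Real \<open>l\<close> and real-valued
  L^2 suffice, as the operator is real and self-adjoint: its complexification has real spectrum.
\<close>

definition resolvent_set :: "(real^3 \<Rightarrow> real) \<Rightarrow> real set" where
  "resolvent_set V = {l.
     (\<forall>h\<in>L2. \<exists>(u, w)\<in>op_graph V. AE x in lebesgue. w x - l * u x = h x) \<and>
     (\<exists>C. \<forall>(u, w)\<in>op_graph V. L2_norm u \<le> C * L2_norm (\<lambda>x. w x - l * u x))}"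

definition op_spectrum :: "(real^3 \<Rightarrow> real) \<Rightarrow> real set" where
  "op_spectrum V = - resolvent_set V"

definition X_space :: "(real^3 \<Rightarrow> real) set" where
  "X_space = {u \<in> H1. cyl_sym u \<and> integrable lebesgue (\<lambda>x. (u x)^2 / (rad x)^2)}"

definition X_norm :: "(real^3 \<Rightarrow> real) \<Rightarrow> real" where
  "X_norm u = sqrt (LINT x|lebesgue. (norm (wgrad u x))^2 + (u x)^2 / (rad x)^2 + (u x)^2)"

text \<open>The interval integral is oriented, so this is the usual primitive also for \<open>t < 0\<close>.\<close>

definition primitive :: "(real^3 \<Rightarrow> real \<Rightarrow> real) \<Rightarrow> real^3 \<Rightarrow> real \<Rightarrow> real" where
  "primitive f x t = (LBINT s=ereal 0..ereal t. f x s)"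

definition energy ::
  "(real^3 \<Rightarrow> real) \<Rightarrow> (real^3 \<Rightarrow> real \<Rightarrow> real) \<Rightarrow> (real^3 \<Rightarrow> real \<Rightarrow> real) \<Rightarrow> (real^3 \<Rightarrow> real) \<Rightarrow> real" where
  "energy V f g u =
     1/2 * (LINT x|lebesgue. (norm (wgrad u x))^2 + (u x)^2 / (rad x)^2 + V x * (u x)^2)
     - (LINT x|lebesgue. primitive f x (u x)) + (LINT x|lebesgue. primitive g x (u x))"

text \<open>Frechet derivative of a functional on \<open>X_space\<close> with respect to \<open>X_norm\<close>.\<close>

definition has_X_derivative ::
  "((real^3 \<Rightarrow> real) \<Rightarrow> real) \<Rightarrow> ((real^3 \<Rightarrow> real) \<Rightarrow> real) \<Rightarrow> (real^3 \<Rightarrow> real) \<Rightarrow> bool" where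
  "has_X_derivative J L u \<longleftrightarrow>
     (\<forall>v\<in>X_space. \<forall>w\<in>X_space. \<forall>a b. L (\<lambda>x. a * v x + b * w x) = a * L v + b * L w) \<and>
     (\<exists>C. \<forall>v\<in>X_space. \<bar>L v\<bar> \<le> C * X_norm v) \<and>
     (\<forall>\<epsilon>>0. \<exists>\<delta>>0. \<forall>h\<in>X_space. X_norm h < \<delta> \<longrightarrow>
        \<bar>J (\<lambda>x. u x + h x) - J u - L h\<bar> \<le> \<epsilon> * X_norm h)"

definition X_critical_point :: "((real^3 \<Rightarrow> real) \<Rightarrow> real) \<Rightarrow> (real^3 \<Rightarrow> real) \<Rightarrow> bool" where
  "X_critical_point J u \<longleftrightarrow> u \<in> X_space \<and> has_X_derivative J (\<lambda>_. 0) u"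

definition weak_solution ::
  "(real^3 \<Rightarrow> real) \<Rightarrow> (real^3 \<Rightarrow> real \<Rightarrow> real) \<Rightarrow> (real^3 \<Rightarrow> real \<Rightarrow> real) \<Rightarrow> (real^3 \<Rightarrow> real) \<Rightarrow> bool" where
  "weak_solution V f g u \<longleftrightarrow> X_critical_point (energy V f g) u"

definition ae_class :: "(real^3 \<Rightarrow> real) \<Rightarrow> (real^3 \<Rightarrow> real) set" where
  "ae_class u = {v \<in> borel_measurable lebesgue. AE x in lebesgue. v x = u x}"

end

theory Submission
  imports Defs "HOL-Computational_Algebra.Polynomial" "HOL-Library.Diagonal_Subsequence"
begin

text \<open>
  The energy is \<open>E u = b u u / 2 - K u\<close>, where the spectral assumption makes \<open>b\<close> an inner product
  equivalent to that of \<open>X\<close> and \<open>K\<close> integrates the primitive of \<open>h = f - g\<close>. Since \<open>h(x,u) / |u|^(q-1)\<close> is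
  nondecreasing on both half-lines, every ray meets the Nehari set \<open>b u u = K' u u\<close>, on which \<open>E\<close> is
  bounded below by a multiple of \<open>b u u\<close>; Ekeland's principle then yields a bounded Palais--Smale sequence
  with \<open>L^p\<close> norm bounded below. By a Sobolev inequality for dyadic averages some cell of fixed size carries
  a definite \<open>L^2\<close> mass of each term. By cylindrical symmetry a cell far from the axis has many disjoint
  rotated copies of the same mass, so the cell lies at bounded distance from the axis, and an integer translation along the
  axis brings it to a fixed ball. The weak limit is therefore a nonzero critical point. Its integer
  translates are critical too, and no two of them agree up to sign, because a nonzero \<open>L^2\<close> function
  cannot have periodic absolute value. Oddness of \<open>h\<close> makes the negatives critical as well.
\<close>

section \<open>Test functions\<close>

text \<open>The derivative of \<open>K\<close> is merely continuous, so the Nehari set need not be a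
  manifold and no Lagrange multiplier is at hand. Instead, the maximum \<open>\<Psi>\<close> of the
  energy along a ray is treated as a continuous function on the unit sphere, and its Ekeland points
  are exploited by one-sided estimates in which the ray parameter is frozen. Bisecting one direction
  at a time serves three purposes. The difference of consecutive averages compares two translated
  boxes, so a weak gradient controls it directly. Summing these differences gives an L^p estimate
  with gain 2^(-m(1-p/6)) at generation m, which is where p < 6 enters. The averages of one
  generation are countably many bounded numbers, so a diagonal argument yields local compactness.
  Weak limits are norm limits of convex combinations of tails; only a weighted L2 distance and
  individual bounded functionals have to pass to them. Criticality is relative to
  \<open>X_space\<close>, so all test directions are cylindrically symmetric as well.\<close>

primrec smooth_upto :: "nat => (real => real) => bool" where
  "smooth_upto 0 a \<longleftrightarrow> continuous_on UNIV a"
| "smooth_upto (Suc n) a \<longleftrightarrow> (\<exists>a'. (\<forall>x. (a has_real_derivative a' x) (at x)) \<and> smooth_upto n a')"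

lemma smooth_upto_SucI:
  "(\<And>x. (a has_real_derivative a' x) (at x)) ==> smooth_upto n a' ==> smooth_upto (Suc n) a" by auto

lemma smooth_upto_Suc_D: "smooth_upto (Suc n) a ==> smooth_upto n a"
proof (induction n arbitrary: a)
  case 0
  then obtain a' where "\<forall>x. (a has_real_derivative a' x) (at x)" by auto
  then have "continuous_on UNIV a" by (meson DERIV_isCont continuous_at_imp_continuous_on)
  then show ?case by simp
next
  case (Suc n)
  then obtain a' where a': "\<forall>x. (a has_real_derivative a' x) (at x)" "smooth_upto (Suc n) a'" by auto
  from Suc.IH[OF a'(2)] a'(1) show ?case by auto
qed

lemma smooth_upto_add:
  "smooth_upto n a ==> smooth_upto n b ==> smooth_upto n (\<lambda>x. a x + b x)"
proof (induction n arbitrary: a b)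
  case 0
  then show ?case by (auto intro!: continuous_intros)
next
  case (Suc n)
  then obtain a' b' where a': "\<And>x. (a has_real_derivative a' x) (at x)" "smooth_upto n a'"
    and b': "\<And>x. (b has_real_derivative b' x) (at x)" "smooth_upto n b'" by auto
  show ?case by (rule smooth_upto_SucI[where a'="\<lambda>x. a' x + b' x"])
      (use a' b' Suc.IH in \<open>auto intro!: derivative_eq_intros\<close>)
qed

lemma smooth_upto_mult:
  "smooth_upto n a ==> smooth_upto n b ==> smooth_upto n (\<lambda>x. a x * b x)"
proof (induction n arbitrary: a b)
  case 0
  then show ?case by (auto intro!: continuous_intros)
next
  case (Suc n)
  then obtain a' b' where a': "\<And>x. (a has_real_derivative a' x) (at x)" "smooth_upto n a'"
    and b': "\<And>x. (b has_real_derivative b' x) (at x)" "smooth_upto n b'" by auto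
  have "smooth_upto n a" "smooth_upto n b" using Suc.prems smooth_upto_Suc_D by blast+
  then have s: "smooth_upto n (\<lambda>x. a' x * b x + b' x * a x)" using Suc.IH a' b' by (intro smooth_upto_add) auto
  show ?case by (rule smooth_upto_SucI[OF _ s]) (use a' b' in \<open>auto intro!: derivative_eq_intros\<close>)
qed

lemma smooth_upto_const: "smooth_upto n (\<lambda>x. c)"
proof (induction n arbitrary: c)
  case (Suc n)
  show ?case by (rule smooth_upto_SucI[OF _ Suc[of 0]]) simp
qed simp

lemma smooth_upto_affine: "smooth_upto n a ==> smooth_upto n (\<lambda>x. a (c * x + d))"
proof (induction n arbitrary: a)
  case 0
  then show ?case by (auto intro!: continuous_intros continuous_on_compose2[of UNIV a])
next
  case (Suc n)
  then obtain a' where a': "\<And>x. (a has_real_derivative a' x) (at x)" "smooth_upto n a'" by auto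
  have s: "smooth_upto n (\<lambda>x. c * a' (c * x + d))" by (intro smooth_upto_mult smooth_upto_const Suc.IH a')
  have "((\<lambda>x. a (c * x + d)) has_real_derivative c * a' (c * x + d)) (at x)" for x
    by (rule DERIV_chain2[OF a'(1), THEN DERIV_cong]) (auto intro!: derivative_eq_intros)
  from smooth_upto_SucI[OF this s] show ?case .
qed

text \<open>The polynomial parameter makes the family stable under differentiation;
  \<open>exp_bump 1\<close> is the classical flat function exp(-1/t).\<close>

definition exp_bump :: "real poly => real => real" where
  "exp_bump P t = (if t > 0 then poly P (inverse t) * exp (- inverse t) else 0)"

lemma poly_times_exp_tendsto_0: "((\<lambda>s::real. poly Q s * exp (- s)) \<longlongrightarrow> 0) at_top"
proof -
  have "((\<lambda>s::real. \<Sum>i\<le>degree Q. coeff Q i * (s ^ i / exp s)) \<longlongrightarrow> (\<Sum>i\<le>degree Q. coeff Q i * 0)) at_top"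
    by (intro tendsto_sum tendsto_mult tendsto_const tendsto_power_div_exp_0)
  then show ?thesis by (simp add: poly_altdef sum_distrib_right exp_minus divide_inverse mult.assoc)
qed

text \<open>With s = 1/t, differentiating P(s) exp(-s) in t brings down -s^2, so P becomes s^2 (P -
  P'); \<open>monom 1 2\<close> is s^2. At the origin the quotient from the right is s P(s) exp(-s)
  with s tending to infinity.\<close>

lemma exp_bump_DERIV:
  "(exp_bump P has_real_derivative exp_bump (monom 1 2 * (P - pderiv P)) t) (at t)"
proof -
  consider "t > 0" | "t < 0" | "t = 0" by linarith
  then show ?thesis
  proof cases
    case 1
    have "((\<lambda>t. poly P (inverse t) * exp (- inverse t)) has_real_derivative
        exp_bump (monom 1 2 * (P - pderiv P)) t) (at t)" using 1 by (auto intro!: derivative_eq_intros DERIV_chain2[OF poly_DERIV]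
          simp: exp_bump_def poly_monom algebra_simps power2_eq_square)
    then show ?thesis by (rule has_field_derivative_transform_within_open[where S="{0<..}"])
        (use 1 in \<open>auto simp: exp_bump_def\<close>)
  next
    case 2
    have "((\<lambda>t. 0) has_real_derivative exp_bump (monom 1 2 * (P - pderiv P)) t) (at t)" using 2 by (simp add: exp_bump_def)
    then show ?thesis by (rule has_field_derivative_transform_within_open[where S="{..<0}"])
        (use 2 in \<open>auto simp: exp_bump_def\<close>)
  next
    case 3
    have "((\<lambda>h. exp_bump P h / h) \<longlongrightarrow> 0) (at_left 0)"
      by (rule tendsto_eventually) (auto simp: exp_bump_def eventually_at_filter)
    moreover have "((\<lambda>h. exp_bump P h / h) \<longlongrightarrow> 0) (at_right 0)"
    proof -
      have "((\<lambda>s::real. poly ([:0,1:] * P) s * exp (- s)) \<longlongrightarrow> 0) at_top" by (rule poly_times_exp_tendsto_0)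
      moreover have "eventually (\<lambda>s. poly ([:0,1:] * P) s * exp (- s) = exp_bump P (inverse s) / inverse s) at_top"
        using eventually_gt_at_top[of 0] by eventually_elim (auto simp: exp_bump_def field_simps)
      ultimately have "((\<lambda>s::real. exp_bump P (inverse s) / inverse s) \<longlongrightarrow> 0) at_top" by (rule Lim_transform_eventually)
      then show ?thesis by (simp add: filterlim_at_right_to_top)
    qed
    ultimately have "((\<lambda>h. exp_bump P h / h) \<longlongrightarrow> 0) (at 0)" by (simp add: filterlim_split_at)
    then show ?thesis using 3 by (simp add: DERIV_def exp_bump_def)
  qed
qed

lemma smooth_upto_exp_bump: "smooth_upto n (exp_bump P)"
proof (induction n arbitrary: P)
  case 0
  have "continuous_on UNIV (exp_bump P)" by (meson DERIV_isCont continuous_at_imp_continuous_on exp_bump_DERIV)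
  then show ?case by simp
next
  case (Suc n)
  then show ?case using exp_bump_DERIV smooth_upto_SucI by blast
qed

text \<open>At distance d inside the interval a factor is exp(-1/(n d)), which tends to 1 as
  \<open>n\<close> grows. Only the limit, the indicator of the open interval, is wanted; the bumps
  themselves need not equal 1 anywhere.\<close>

definition cutoff :: "nat => real => real => real => real" where
  "cutoff n a b t = exp_bump 1 (real n * (t - a)) * exp_bump 1 (real n * (b - t))"

lemma exp_bump_1_bounds: "0 \<le> exp_bump 1 t" "exp_bump 1 t \<le> 1" by (auto simp: exp_bump_def)

lemma cutoff_bounds: "0 \<le> cutoff n a b t" "cutoff n a b t \<le> 1" by (auto simp: cutoff_def exp_bump_1_bounds intro!: mult_le_one)

lemma cutoff_outside: "t \<le> a \<or> b \<le> t ==> cutoff n a b t = 0" by (auto simp: cutoff_def exp_bump_def zero_less_mult_iff)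

lemma smooth_upto_cutoff: "smooth_upto k (cutoff n a b)"
proof -
  have "smooth_upto k (\<lambda>t. exp_bump 1 (real n * t + (- real n * a)) * exp_bump 1 ((- real n) * t + real n * b))"
    by (intro smooth_upto_mult smooth_upto_affine smooth_upto_exp_bump)
  moreover have "(\<lambda>t. exp_bump 1 (real n * t + (- real n * a)) * exp_bump 1 ((- real n) * t + real n * b)) = cutoff n a b"
    by (auto simp: cutoff_def algebra_simps)
  ultimately show ?thesis by simp
qed

lemma exp_bump_tendsto_1: "t > 0 ==> (\<lambda>n. exp_bump 1 (real n * t)) \<longlonglongrightarrow> 1"
proof -
  assume t: "t > 0"
  have "(\<lambda>n. exp (- (inverse (real n) * inverse t))) \<longlonglongrightarrow> exp (- (0 * inverse t))"
    by (intro tendsto_intros lim_inverse_n)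
  moreover have "eventually (\<lambda>n. exp (- (inverse (real n) * inverse t)) = exp_bump 1 (real n * t)) sequentially"
    using eventually_gt_at_top[of 0] by eventually_elim (use t in \<open>auto simp: exp_bump_def\<close>)
  ultimately show ?thesis using Lim_transform_eventually by fastforce
qed

lemma cutoff_tendsto: "(\<lambda>n. cutoff n a b t) \<longlonglongrightarrow> indicator {a<..<b} t"
proof (cases "a < t \<and> t < b")
  case True
  have "(\<lambda>n. exp_bump 1 (real n * (t - a)) * exp_bump 1 (real n * (b - t))) \<longlonglongrightarrow> 1 * 1"
    by (intro tendsto_mult exp_bump_tendsto_1) (use True in auto)
  then show ?thesis using True by (simp add: cutoff_def)
next
  case False
  then have "cutoff n a b t = 0" for n by (intro cutoff_outside) linarith
  with False show ?thesis by simp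
qed

section \<open>Test functions as products of one-variable factors\<close>

definition tensor :: "(3 => real => real) => real^3 => real" where
  "tensor a x = (\<Prod>i\<in>UNIV. a i (x$i))"

lemma tensor_upd: "tensor (a(i := c)) x = c (x$i) * (\<Prod>j\<in>UNIV-{i}. a j (x$j))"
proof -
  have "(\<Prod>j\<in>UNIV-{i}. (a(i := c)) j (x$j)) = (\<Prod>j\<in>UNIV-{i}. a j (x$j))" by (rule prod.cong) auto
  then show ?thesis unfolding tensor_def by (subst prod.remove[of _ i]) auto
qed

lemma tensor_has_derivative:
  assumes "\<And>i x. (a i has_real_derivative a' i x) (at x)"
  shows "(tensor a has_derivative (\<lambda>h. \<Sum>i\<in>UNIV. h$i * tensor (a(i := a' i)) x)) (at x)"
proof -
  have "((\<lambda>x::real^3. a i (x$i)) has_derivative (\<lambda>h. h$i * a' i (x$i))) (at x)" for i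
  proof -
    have "((\<lambda>x::real^3. x$i) has_derivative (\<lambda>h. h$i)) (at x)"
      by (rule bounded_linear_imp_has_derivative) (rule bounded_linear_vec_nth)
    from has_derivative_compose[OF this assms[of i "x$i", unfolded has_field_derivative_def]]
    show ?thesis by (simp add: mult.commute)
  qed
  then have "((\<lambda>x. \<Prod>i\<in>UNIV. a i (x$i)) has_derivative
      (\<lambda>h. \<Sum>i\<in>UNIV. (h$i * a' i (x$i)) * (\<Prod>j\<in>UNIV-{i}. a j (x$j)))) (at x)" by (intro has_derivative_prod) auto
  then show ?thesis by (simp add: tensor_upd mult.assoc) (simp add: tensor_def[abs_def])
qed

lemma pderiv_at_tensor:
  assumes "\<And>i x. (a i has_real_derivative a' i x) (at x)"
  shows "pderiv_at j (tensor a) = tensor (a(j := a' j))"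
proof
  fix x
  have "frechet_derivative (tensor a) (at x) = (\<lambda>h. \<Sum>i\<in>UNIV. h$i * tensor (a(i := a' i)) x)"
    using frechet_derivative_at[OF tensor_has_derivative[OF assms]] by simp
  then have "pderiv_at j (tensor a) x = (\<Sum>i\<in>UNIV. axis j 1 $ i * tensor (a(i := a' i)) x)" by (simp add: pderiv_at_def)
  also have "\<dots> = (\<Sum>i\<in>UNIV. if i = j then tensor (a(i := a' i)) x else 0)" by (rule sum.cong) (auto simp: axis_def)
  finally show "pderiv_at j (tensor a) x = tensor (a(j := a' j)) x" by simp
qed

text \<open>A partial derivative of a tensor product is again a tensor product, with one factor
  differentiated, so the induction on the order closes.\<close>

lemma Ck_tensor: "(\<And>i. smooth_upto k (a i)) ==> Ck k (tensor a)"
proof (induction k arbitrary: a)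
  case 0
  then have c: "\<And>i. continuous_on UNIV (a i)" by simp
  have "continuous_on UNIV (\<lambda>x::real^3. a i (x$i))" for i by (rule continuous_on_compose2[OF c]) (auto intro!: continuous_intros)
  then have "continuous_on UNIV (\<lambda>x::real^3. \<Prod>i\<in>UNIV. a i (x$i))" by (intro continuous_on_prod) auto
  then show ?case by (simp add: tensor_def[abs_def])
next
  case (Suc k)
  from Suc.prems have "\<forall>i. \<exists>a'. (\<forall>x. (a i has_real_derivative a' x) (at x)) \<and> smooth_upto k a'" by simp
  then obtain a' where a': "\<And>i x. (a i has_real_derivative a' i x) (at x)" "\<And>i. smooth_upto k (a' i)" by metis
  have "Ck k (pderiv_at j (tensor a))" for j unfolding pderiv_at_tensor[of a a', OF a'(1)]
    by (rule Suc.IH) (use Suc.prems a'(2) smooth_upto_Suc_D in auto)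
  moreover have "tensor a differentiable (at x)" for x using tensor_has_derivative[of a a' x, OF a'(1)] differentiableI by blast
  ultimately show ?case by simp
qed

lemma tensor_outside:
  assumes "\<And>i t. t \<le> l$i \<or> r$i \<le> t ==> a i t = 0" "x \<notin> box l r"
  shows "tensor a x = 0"
proof -
  obtain i where "x$i \<le> l$i \<or> r$i \<le> x$i" using assms(2) by (auto simp: mem_box_cart not_less)
  then have "a i (x$i) = 0" by (rule assms(1))
  then show ?thesis unfolding tensor_def by auto
qed

lemma test_fun_tensor:
  assumes "\<And>k i. smooth_upto k (a i)" "\<And>i t. t \<le> l$i \<or> r$i \<le> t ==> a i t = 0"
  shows "test_fun (tensor a)" unfolding test_fun_def
proof (intro conjI allI exI[of _ "cbox l r"])
  show "Ck k (tensor a)" for k by (rule Ck_tensor) (rule assms)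
  show "compact (cbox l r)" by (rule compact_cbox)
  show "x \<notin> cbox l r \<longrightarrow> tensor a x = 0" for x using tensor_outside[of l r a x, OF assms(2)] box_subset_cbox by blast
qed

abbreviation box_cutoff :: "nat => real^3 => real^3 => real^3 => real" where
  "box_cutoff n l r \<equiv> tensor (\<lambda>i. cutoff n (l$i) (r$i))"

lemma test_fun_box_cutoff: "test_fun (box_cutoff n l r)" by (rule test_fun_tensor[where l=l and r=r]) (auto simp: smooth_upto_cutoff cutoff_outside)

lemma box_cutoff_bounds: "0 \<le> box_cutoff n l r x" "box_cutoff n l r x \<le> indicator (box l r) x"
proof -
  show "0 \<le> box_cutoff n l r x" unfolding tensor_def by (intro prod_nonneg) (auto simp: cutoff_bounds)
  have "box_cutoff n l r x \<le> 1" unfolding tensor_def by (intro prod_le_1) (auto simp: cutoff_bounds)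
  moreover have "x \<notin> box l r ==> box_cutoff n l r x = 0" by (rule tensor_outside[of l r]) (auto simp: cutoff_outside)
  ultimately show "box_cutoff n l r x \<le> indicator (box l r) x" by (auto simp: indicator_def)
qed

lemma box_cutoff_tendsto: "(\<lambda>n. box_cutoff n l r x) \<longlonglongrightarrow> indicator (box l r) x"
proof -
  have "(\<lambda>n. \<Prod>i\<in>UNIV. cutoff n (l$i) (r$i) (x$i)) \<longlonglongrightarrow> (\<Prod>i\<in>UNIV. indicator {l$i<..<r$i} (x$i))"
    by (intro tendsto_prod cutoff_tendsto)
  moreover have "(\<Prod>i\<in>UNIV. indicator {l$i<..<r$i} (x$i) :: real) = indicator (box l r) x"
  proof (cases "x \<in> box l r")
    case True
    then show ?thesis by (auto simp: mem_box_cart)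
  next
    case False
    then obtain i where "x$i \<notin> {l$i<..<r$i}" by (auto simp: mem_box_cart)
    then have "indicator {l$i<..<r$i} (x$i) = (0::real)" by simp
    then have "(\<Prod>i\<in>UNIV. indicator {l$i<..<r$i} (x$i) :: real) = 0" using prod_zero_iff[of "UNIV::3 set"] by auto
    with False show ?thesis by simp
  qed
  ultimately show ?thesis by (simp add: tensor_def)
qed

lemma test_fun_measurable: "test_fun \<phi> ==> \<phi> \<in> borel_measurable lebesgue"
proof -
  assume "test_fun \<phi>"
  then have "Ck 0 \<phi>" unfolding test_fun_def by blast
  then have "\<phi> \<in> borel_measurable borel" by (simp add: borel_measurable_continuous_onI)
  then show ?thesis by (simp add: measurable_completion)
qed

lemma loc_integrable_box: "loc_integrable u ==> set_integrable lebesgue (box l r) u" unfolding loc_integrable_def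
  by (meson box_subset_cbox compact_cbox lmeasurable_box fmeasurableD set_integrable_subset)

text \<open>Box indicators are not test functions; they are reached as dominated limits of test
  functions, with the modulus of \<open>u\<close> on the box as majorant.\<close>

lemma integral_box_cutoff_tendsto:
  fixes u :: "real^3 => real"
  assumes "loc_integrable u"
  shows "integrable lebesgue (\<lambda>x. u x * box_cutoff n l r x)"
    and "(\<lambda>n. LINT x|lebesgue. u x * box_cutoff n l r x) \<longlonglongrightarrow> (LINT x:box l r|lebesgue. u x)"
proof -
  have i: "integrable lebesgue (\<lambda>x. indicator (box l r) x * u x)" using loc_integrable_box[OF assms] by (simp add: set_integrable_def)
  have eq: "u x * box_cutoff n l r x = (indicator (box l r) x * u x) * box_cutoff n l r x" for n x
    using box_cutoff_bounds[of n l r x] by (auto simp: indicator_def split: if_splits)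
  have m: "(\<lambda>x. u x * box_cutoff n l r x) \<in> borel_measurable lebesgue" for n
    unfolding eq by (rule borel_measurable_times[OF borel_measurable_integrable[OF i]
        test_fun_measurable[OF test_fun_box_cutoff]])
  have b: "norm (u x * box_cutoff n l r x) \<le> abs (indicator (box l r) x * u x)" for n x
  proof -
    have "abs (u x) * box_cutoff n l r x \<le> abs (u x) * indicator (box l r) x" by (intro mult_left_mono box_cutoff_bounds) auto
    then show ?thesis using box_cutoff_bounds(1)[of n l r x] by (simp add: abs_mult mult.commute)
  qed
  show "integrable lebesgue (\<lambda>x. u x * box_cutoff n l r x)"
    by (rule Bochner_Integration.integrable_bound[OF integrable_abs[OF i] m]) (use b in auto)
  have "(\<lambda>n. LINT x|lebesgue. u x * box_cutoff n l r x) \<longlonglongrightarrow> (LINT x|lebesgue. indicator (box l r) x * u x)"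
  proof (rule integral_dominated_convergence[where w="\<lambda>x. abs (indicator (box l r) x * u x)"])
    show "AE x in lebesgue. (\<lambda>n. u x * box_cutoff n l r x) \<longlonglongrightarrow> indicator (box l r) x * u x"
      by (subst mult.commute) (intro AE_I2 tendsto_mult box_cutoff_tendsto tendsto_const)
  qed (use i m b in auto)
  then show "(\<lambda>n. LINT x|lebesgue. u x * box_cutoff n l r x) \<longlonglongrightarrow> (LINT x:box l r|lebesgue. u x)"
    by (simp add: set_lebesgue_integral_def)
qed

lemma continuous_has_antiderivative:
  fixes a :: "real => real"
  assumes "continuous_on UNIV a"
  obtains F where "\<And>x. (F has_real_derivative a x) (at x)"
proof -
  have "\<exists>F. \<forall>x::real. (-\<infinity>::ereal) < x \<longrightarrow> x < (\<infinity>::ereal) \<longrightarrow> (F has_vector_derivative a x) (at x)"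
    by (rule einterval_antiderivative) (use assms continuous_on_eq_continuous_at in auto)
  then show ?thesis using that by (auto simp: has_real_derivative_iff_has_vector_derivative)
qed

text \<open>Test the weak derivative against \<open>\<integral>\<^sub>0\<^sup>h \<phi>(x - s e\<^sub>i) ds\<close>, whose \<open>i\<close>-th
  derivative is \<open>\<phi> - \<phi>(\<cdot> - h e\<^sub>i)\<close>, and let \<open>\<phi>\<close> tend to the indicator of the box.\<close>

lemma weak_grad_box_shift:
  assumes D: "has_weak_grad u D" and h: "h > 0"
  shows "\<bar>(LINT x:box l r|lebesgue. u x) - (LINT x:box (l + h *\<^sub>R axis i 1) (r + h *\<^sub>R axis i 1)|lebesgue. u x)\<bar>
    \<le> h * (LINT x:box l (r + h *\<^sub>R axis i 1)|lebesgue. abs (D x $ i))"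
proof -
  let ?e = "h *\<^sub>R axis i 1 :: real^3"
  have lu: "loc_integrable u" and lD: "loc_integrable D" using D by (auto simp: has_weak_grad_def)
  have lDi: "loc_integrable (\<lambda>x. abs (D x $ i))" unfolding loc_integrable_def set_integrable_def
  proof (intro allI impI)
    fix K :: "(real^3) set" assume "compact K"
    then have "integrable lebesgue (\<lambda>x. indicator K x *\<^sub>R D x)" using lD by (simp add: loc_integrable_def set_integrable_def)
    then have "integrable lebesgue (\<lambda>x. abs ((indicator K x *\<^sub>R D x) \<bullet> axis i 1))"
      by (intro integrable_abs integrable_inner_left) auto
    then show "integrable lebesgue (\<lambda>x. indicator K x *\<^sub>R \<bar>D x $ i\<bar>)" by (simp add: inner_axis abs_mult)
  qed
  have bound: "\<bar>(LINT x|lebesgue. u x * box_cutoff n l r x) -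
      (LINT x|lebesgue. u x * box_cutoff n (l + ?e) (r + ?e) x)\<bar>
    \<le> h * (LINT x:box l (r + ?e)|lebesgue. abs (D x $ i))" for n
  proof -
    let ?a = "\<lambda>j. cutoff n (l$j) (r$j)"
    have ci: "continuous_on UNIV (?a i)" using smooth_upto_cutoff[of 0] by simp
    obtain F where F: "\<And>x. (F has_real_derivative ?a i x) (at x)" by (rule continuous_has_antiderivative[OF ci]) (rule that; assumption)
    define \<Phi> where "\<Phi> t = F t - F (t - h)" for t
    have d\<Phi>: "(\<Phi> has_real_derivative (?a i t - ?a i (t - h))) (at t)" for t
    proof -
      have "((\<lambda>t. F (t - h)) has_real_derivative ?a i (t - h) * 1) (at t)" by (rule DERIV_chain2[OF F]) (auto intro!: derivative_eq_intros)
      then show ?thesis unfolding \<Phi>_def by (intro DERIV_diff F) simp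
    qed
    have sh: "?a i (t - h) = cutoff n ((l + ?e)$i) ((r + ?e)$i) t" for t by (simp add: cutoff_def algebra_simps)
    \<comment> \<open>One mean value identity supplies all that is needed of \<open>\<Phi>\<close>:
      values between 0 and \<open>h\<close>, since the cutoff lies in [0,1], and support in the
      interval lengthened by \<open>h\<close>.\<close>
    have mv: "\<exists>\<xi>. t - h < \<xi> \<and> \<xi> < t \<and> \<Phi> t = h * ?a i \<xi>" for t
      using MVT2[of "t - h" t F "?a i"] F h unfolding \<Phi>_def by auto
    have \<Phi>b: "0 \<le> \<Phi> t" "\<Phi> t \<le> h" for t using mv[of t] h cutoff_bounds[of n "l$i" "r$i"] by (auto simp: mult_left_le)
    have \<Phi>0: "\<Phi> t = 0" if "t \<le> l$i \<or> r$i + h \<le> t" for t using mv[of t] that cutoff_outside[of _ "l$i" "r$i" n] by fastforce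
    have s\<Phi>: "smooth_upto k \<Phi>" for k
    proof -
      have "smooth_upto k (\<lambda>t. ?a i t + (-1) * ?a i (1 * t + (-h)))"
        by (intro smooth_upto_add smooth_upto_mult smooth_upto_const smooth_upto_affine smooth_upto_cutoff)
      then have "smooth_upto (Suc k) \<Phi>" by (intro smooth_upto_SucI[OF d\<Phi>]) simp
      then show ?thesis by (rule smooth_upto_Suc_D)
    qed
    define b where "b = ?a(i := \<Phi>)"
    have b0: "b j t = 0" if "t \<le> l$j \<or> (r + ?e)$j \<le> t" for j t
      using that \<Phi>0 by (auto simp: b_def cutoff_outside axis_def split: if_splits)
    have tb: "test_fun (tensor b)" by (rule test_fun_tensor[where l=l and r="r + ?e", OF _ b0])
        (auto simp: b_def s\<Phi> smooth_upto_cutoff)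
    \<comment> \<open>Differentiating a tensor product asks for a derivative of every factor,
      although only the \<open>i\<close>-th enters the partial derivative; the others are taken
      abstractly from smoothness.\<close>
    have "\<forall>j. \<exists>b'. \<forall>x. (b j has_real_derivative b' x) (at x)"
    proof
      fix j
      have "smooth_upto (Suc 0) (b j)" using s\<Phi> smooth_upto_cutoff by (auto simp: b_def simp del: smooth_upto.simps)
      then show "\<exists>b'. \<forall>x. (b j has_real_derivative b' x) (at x)" by auto
    qed
    then obtain b0' where b0': "\<And>j x. (b j has_real_derivative b0' j x) (at x)" by metis
    define b' where "b' = b0'(i := \<lambda>t. ?a i t - ?a i (t - h))"
    have b': "(b j has_real_derivative b' j x) (at x)" for j x using b0'[of j x] d\<Phi>[of x] by (auto simp: b'_def b_def)
    have pd: "pderiv_at i (tensor b) x = box_cutoff n l r x - box_cutoff n (l + ?e) (r + ?e) x" for x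
    proof -
      have "pderiv_at i (tensor b) x = tensor (?a(i := \<lambda>t. ?a i t - ?a i (t - h))) x"
        unfolding pderiv_at_tensor[of b b', OF b'] by (simp add: b_def b'_def)
      also have "\<dots> = ?a i (x$i) * (\<Prod>j\<in>UNIV-{i}. ?a j (x$j))
          - cutoff n ((l + ?e)$i) ((r + ?e)$i) (x$i) * (\<Prod>j\<in>UNIV-{i}. ?a j (x$j))" by (simp add: tensor_upd sh left_diff_distrib)
      also have "?a i (x$i) * (\<Prod>j\<in>UNIV-{i}. ?a j (x$j)) = box_cutoff n l r x"
      proof -
        have "?a(i := ?a i) = ?a" by (auto simp: fun_eq_iff)
        then show ?thesis using tensor_upd[of ?a i "?a i" x] by metis
      qed
      also have "(\<Prod>j\<in>UNIV-{i}. ?a j (x$j)) = (\<Prod>j\<in>UNIV-{i}. cutoff n ((l + ?e)$j) ((r + ?e)$j) (x$j))"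
        by (rule prod.cong) (auto simp: axis_def)
      also have "cutoff n ((l + ?e)$i) ((r + ?e)$i) (x$i) * \<dots> = box_cutoff n (l + ?e) (r + ?e) x"
      proof -
        let ?c = "\<lambda>j. cutoff n ((l + ?e)$j) ((r + ?e)$j)"
        have "?c(i := ?c i) = ?c" by (auto simp: fun_eq_iff)
        then show ?thesis using tensor_upd[of ?c i "?c i" x] by metis
      qed
      finally show ?thesis .
    qed
    have tbb: "abs (tensor b x) \<le> h * indicator (box l (r + ?e)) x" for x
    proof (cases "x \<in> box l (r + ?e)")
      case True
      have "tensor b x = \<Phi> (x$i) * (\<Prod>j\<in>UNIV-{i}. ?a j (x$j))" unfolding b_def by (rule tensor_upd)
      moreover have "0 \<le> (\<Prod>j\<in>UNIV-{i}. ?a j (x$j))" "(\<Prod>j\<in>UNIV-{i}. ?a j (x$j)) \<le> 1"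
        by (auto intro!: prod_nonneg prod_le_1 simp: cutoff_bounds)
      ultimately show ?thesis using True \<Phi>b[of "x$i"] h by (auto simp: abs_mult intro: order_trans[OF mult_left_le])
    next
      case False
      then show ?thesis using tensor_outside[of l "r + ?e" b x] b0 by auto
    qed
    have "(LINT x|lebesgue. u x * box_cutoff n l r x) - (LINT x|lebesgue. u x * box_cutoff n (l + ?e) (r + ?e) x)
      = (LINT x|lebesgue. u x * pderiv_at i (tensor b) x)" unfolding pd right_diff_distrib
      by (rule Bochner_Integration.integral_diff[symmetric]) (rule integral_box_cutoff_tendsto(1)[OF lu])+
    also have "\<dots> = - (LINT x|lebesgue. D x $ i * tensor b x)" using D tb unfolding has_weak_grad_def by blast
    finally have "\<bar>(LINT x|lebesgue. u x * box_cutoff n l r x) - (LINT x|lebesgue. u x * box_cutoff n (l + ?e) (r + ?e) x)\<bar>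
       = \<bar>LINT x|lebesgue. D x $ i * tensor b x\<bar>" by simp
    also have "\<dots> \<le> (LINT x|lebesgue. h * (indicator (box l (r + ?e)) x * abs (D x $ i)))"
    proof (rule order_trans[OF integral_abs_bound integral_mono'])
      show "integrable lebesgue (\<lambda>x. h * (indicator (box l (r + ?e)) x * abs (D x $ i)))"
        using loc_integrable_box[OF lDi] by (auto simp: set_integrable_def)
      show "abs (D x $ i * tensor b x) \<le> h * (indicator (box l (r + ?e)) x * abs (D x $ i))" for x
        using mult_left_mono[OF tbb[of x], of "abs (D x $ i)"] by (simp add: abs_mult algebra_simps)
    qed (use h in simp)
    finally show ?thesis by (simp add: set_lebesgue_integral_def)
  qed
  have "(\<lambda>n. \<bar>(LINT x|lebesgue. u x * box_cutoff n l r x) -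
      (LINT x|lebesgue. u x * box_cutoff n (l + ?e) (r + ?e) x)\<bar>) \<longlonglongrightarrow>
     \<bar>(LINT x:box l r|lebesgue. u x) - (LINT x:box (l + ?e) (r + ?e)|lebesgue. u x)\<bar>"
    by (intro tendsto_intros integral_box_cutoff_tendsto lu)
  then show ?thesis by (rule LIMSEQ_le_const2) (use bound in auto)
qed

lemma box_integrals_zero:
  fixes f :: "real^3 => real"
  assumes "loc_integrable f" "\<And>n. (LINT x|lebesgue. f x * box_cutoff n l r x) = 0"
  shows "(LINT x:box l r|lebesgue. f x) = 0" using integral_box_cutoff_tendsto(2)[OF assms(1), of l r] assms(2) by (simp add: LIMSEQ_const_iff)

section \<open>Dyadic cells\<close>

text \<open>Prepares Tonelli for the product of two completed measures.\<close>

lemma sigma_finite_lebesgue: "sigma_finite_measure (lebesgue :: 'a::euclidean_space measure)"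
proof -
  obtain A :: "'a set set" where A: "countable A" "A \<subseteq> sets lborel" "\<Union>A = space lborel" "\<forall>a\<in>A. emeasure lborel a \<noteq> \<infinity>"
    using lborel.sigma_finite_countable by blast
  show ?thesis
  proof
    show "\<exists>A. countable A \<and> A \<subseteq> sets lebesgue \<and> \<Union>A = space lebesgue \<and> (\<forall>a\<in>A. emeasure lebesgue (a::'a set) \<noteq> \<infinity>)"
    proof (intro exI conjI)
      show "A \<subseteq> sets lebesgue" using A(2) by (auto intro: sets_completionI_sets)
      show "\<forall>a\<in>A. emeasure lebesgue a \<noteq> \<infinity>"
      proof
        fix a assume "a \<in> A"
        then have "a \<in> sets lborel" "emeasure lborel a \<noteq> \<infinity>" using A(2,4) by auto
        then show "emeasure lebesgue a \<noteq> \<infinity>" by (simp add: emeasure_completion)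
      qed
    qed (use A in auto)
  qed
qed

interpretation lebesgue_pair: pair_sigma_finite "lebesgue :: (real^3) measure" "lebesgue :: (real^3) measure"
  by (simp add: pair_sigma_finite_def sigma_finite_lebesgue)

text \<open>One direction is halved per generation, in cyclic order: a cell has two children that
  are translates of each other, and its shape stays close to a cube.\<close>

definition dir :: "nat => 3" where
  "dir m = (if m mod 3 = 0 then 1 else if m mod 3 = 1 then 2 else 3)"

text \<open>The number of bisections in direction \<open>i\<close> among the first \<open>m\<close>, the directions being
  taken in turn.\<close>

primrec nsplit :: "3 => nat => nat" where
  "nsplit i 0 = 0"
| "nsplit i (Suc m) = nsplit i m + (if i = dir m then 1 else 0)"

lemma dir_cycle: "{dir m, dir (m + 1), dir (m + 2)} = UNIV" "distinct [dir m, dir (m + 1), dir (m + 2)]"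
proof -
  have "m mod 3 = 0 \<and> Suc m mod 3 = 1 \<and> Suc (Suc m) mod 3 = 2
    \<or> m mod 3 = 1 \<and> Suc m mod 3 = 2 \<and> Suc (Suc m) mod 3 = 0
    \<or> m mod 3 = 2 \<and> Suc m mod 3 = 0 \<and> Suc (Suc m) mod 3 = 1" by presburger
  then have d: "dir m = 1 \<and> dir (m + 1) = 2 \<and> dir (m + 2) = 3
    \<or> dir m = 2 \<and> dir (m + 1) = 3 \<and> dir (m + 2) = 1
    \<or> dir m = 3 \<and> dir (m + 1) = 1 \<and> dir (m + 2) = 2" by (elim disjE conjE) (simp_all add: dir_def)
  show "{dir m, dir (m + 1), dir (m + 2)} = UNIV" using d by (elim disjE conjE) (simp_all add: UNIV_3 insert_commute)
  show "distinct [dir m, dir (m + 1), dir (m + 2)]" using d by (elim disjE conjE) simp_all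
qed

lemma nsplit_add_3: "nsplit i (m + 3) = nsplit i m + 1"
proof -
  have "nsplit i (m + 3) = nsplit i m + (if i = dir m then 1 else 0) + (if i = dir (m+1) then 1 else 0)
      + (if i = dir (m+2) then 1 else 0)" by (simp add: eval_nat_numeral)
  moreover have "i \<in> {dir m, dir (m + 1), dir (m + 2)}" unfolding dir_cycle by simp
  ultimately show ?thesis using dir_cycle(2)[of m] by (elim insertE) auto
qed

text \<open>Each direction is halved once in any three consecutive generations, so every side is at
  most 2^(-(m-2)/3). The offset 2 is for a direction whose turn has not yet come.\<close>

lemma nsplit_bound: "m \<le> 3 * nsplit i m + 2"
proof (induction m rule: less_induct)
  case (less m)
  show ?case
  proof (cases "m < 3")
    case False
    then have "m - 3 \<le> 3 * nsplit i (m - 3) + 2" by (intro less) auto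
    moreover have "nsplit i m = nsplit i (m - 3) + 1" using nsplit_add_3[of i "m - 3"] False by simp
    ultimately show ?thesis by simp
  qed simp
qed

lemma sum_nsplit: "(\<Sum>i\<in>UNIV. nsplit i m) = m" by (induction m) (simp_all add: sum.distrib)

lemma floor_half: "\<lfloor>t::real\<rfloor> = \<lfloor>2 * t\<rfloor> div 2"
proof -
  have "\<lfloor>2 * t\<rfloor> = 2 * \<lfloor>t\<rfloor> \<or> \<lfloor>2 * t\<rfloor> = 2 * \<lfloor>t\<rfloor> + 1" by linarith
  then show ?thesis by auto
qed

definition cell_index :: "nat => real^3 => 3 => int" where
  "cell_index m x i = \<lfloor>2 ^ nsplit i m * x$i\<rfloor>"

text \<open>As level sets of an integer label, the cells of one generation form a partition by
  construction, and measurability reduces to that of the floor function; the description as a box is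
  derived afterwards.\<close>

definition cell :: "nat => real^3 => (real^3) set" where
  "cell m x = {y. cell_index m y = cell_index m x}"

lemma cell_refl: "x \<in> cell m x" by (simp add: cell_def)

lemma cell_eq: "y \<in> cell m x ==> cell m y = cell m x" by (simp add: cell_def)

lemma cell_sym: "y \<in> cell m x \<longleftrightarrow> x \<in> cell m y" by (auto simp: cell_def)

lemma cell_index_Suc: "cell_index m x i = (if i = dir m then cell_index (Suc m) x i div 2 else cell_index (Suc m) x i)"
proof -
  have "\<lfloor>2 ^ nsplit i m * x$i\<rfloor> = \<lfloor>2 * (2 ^ nsplit i m * x$i)\<rfloor> div 2" by (rule floor_half)
  then show ?thesis by (simp add: cell_index_def mult.assoc)
qed

lemma cell_Suc_subset: "cell (Suc m) x \<subseteq> cell m x"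
proof
  fix y assume "y \<in> cell (Suc m) x"
  then have "cell_index (Suc m) y = cell_index (Suc m) x" by (simp add: cell_def)
  then have "cell_index m y i = cell_index m x i" for i by (simp add: cell_index_Suc[of m])
  then show "y \<in> cell m x" by (auto simp: cell_def)
qed

lemma cell_mono: "m \<le> n ==> cell n x \<subseteq> cell m x" by (induction n) (use cell_Suc_subset in \<open>auto simp: le_Suc_eq\<close>)

lemma cell_index_borel: "(\<lambda>x. cell_index m x) \<in> measurable borel (count_space UNIV)" unfolding measurable_count_space_eq2_countable
proof (intro conjI ballI)
  fix j :: "3 => int"
  have "(\<lambda>x. cell_index m x) -` {j} \<inter> space borel = (\<Inter>i. {x. \<lfloor>2 ^ nsplit i m * x$i\<rfloor> = j i})"
    by (auto simp: cell_index_def fun_eq_iff)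
  also have "\<dots> \<in> sets borel" by measurable
  finally show "(\<lambda>x. cell_index m x) -` {j} \<inter> space borel \<in> sets borel" .
qed auto

lemma cell_borel: "cell m x \<in> sets borel"
proof -
  have "(\<lambda>x. cell_index m x) -` {cell_index m x} \<inter> space borel \<in> sets borel" by (rule measurable_sets[OF cell_index_borel]) auto
  then show ?thesis by (simp add: cell_def vimage_def)
qed

lemma cell_lebesgue[measurable, simp]: "cell m x \<in> sets lebesgue" using cell_borel[of m x] by (simp add: sets_completionI_sets)

lemma cell_index_lebesgue: "(\<lambda>x. cell_index m x) \<in> measurable lebesgue (count_space UNIV)"
  using cell_index_borel by (simp add: measurable_completion)

definition cell_min :: "nat => real^3 => real^3" where
  "cell_min m x = (\<chi> i. of_int (cell_index m x i) / 2 ^ nsplit i m)"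

definition cell_max :: "nat => real^3 => real^3" where
  "cell_max m x = (\<chi> i. (of_int (cell_index m x i) + 1) / 2 ^ nsplit i m)"

definition half_box :: "real^3 => real^3 => (real^3) set" where
  "half_box l r = {y. \<forall>i. l$i \<le> y$i \<and> y$i < r$i}"

lemma cell_half_box: "cell m x = half_box (cell_min m x) (cell_max m x)"
proof -
  have "\<lfloor>2 ^ k * t\<rfloor> = j \<longleftrightarrow> of_int j / 2 ^ k \<le> t \<and> t < (of_int j + 1) / 2 ^ k" for k j and t :: real
    by (simp add: floor_eq_iff divide_le_eq less_divide_eq mult.commute)
  then show ?thesis by (auto simp: cell_def half_box_def fun_eq_iff cell_min_def cell_max_def cell_index_def[of m])
qed

lemma half_box_box: "box l r \<subseteq> half_box l r" "half_box l r \<subseteq> cbox l r" by (auto simp: half_box_def mem_box_cart less_imp_le)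

text \<open>Cells are half-open, whereas the cutoffs approximate open boxes; the two differ by a
  part of the faces, which is null.\<close>

lemma AE_half_box: "AE x in lebesgue. x \<in> half_box l r \<longleftrightarrow> x \<in> box l r"
proof (rule AE_I')
  show "cbox l r - box l r \<in> null_sets lebesgue" using negligible_frontier_interval negligible_iff_null_sets by blast
  show "{x \<in> space lebesgue. \<not> (x \<in> half_box l r \<longleftrightarrow> x \<in> box l r)} \<subseteq> cbox l r - box l r"
    using half_box_box[of l r] by auto
qed

lemma half_box_lebesgue: "half_box l r \<in> sets lebesgue"
proof -
  have "half_box l r = (\<Inter>i. {y. l$i \<le> y$i \<and> y$i < r$i})" by (auto simp: half_box_def)
  also have "\<dots> \<in> sets borel" by measurable
  finally show ?thesis by (simp add: sets_completionI_sets)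
qed

text \<open>The side lengths multiply to 2^(-m) because the bisections in the three directions add
  up to \<open>m\<close>.\<close>

lemma cell_emeasure: "emeasure lebesgue (cell m x) = ennreal (1 / 2 ^ m)"
proof -
  let ?l = "cell_min m x" and ?r = "cell_max m x"
  have "emeasure lebesgue (cell m x) = emeasure lebesgue (box ?l ?r)" unfolding cell_half_box
    by (rule emeasure_eq_AE) (use AE_half_box half_box_lebesgue in auto)
  also have "\<dots> = ennreal (\<Prod>b\<in>Basis. (?r - ?l) \<bullet> b)"
  proof -
    have "\<forall>b\<in>Basis. ?l \<bullet> b \<le> ?r \<bullet> b"
      by (auto simp: cell_min_def cell_max_def Basis_vec_def inner_axis divide_right_mono)
    then show ?thesis by (simp add: emeasure_completion emeasure_lborel_box)
  qed
  also have "(\<Prod>b\<in>Basis. (?r - ?l) \<bullet> b) = (\<Prod>i\<in>UNIV. (?r - ?l) $ i)"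
  proof -
    have B: "(Basis :: (real^3) set) = (\<lambda>i. axis i 1) ` UNIV" by (auto simp: Basis_vec_def)
    have "inj (\<lambda>i::3. axis i (1::real))" by (auto simp: inj_on_def axis_eq_axis)
    then show ?thesis by (simp add: B prod.reindex inner_axis)
  qed
  also have "\<dots> = (\<Prod>i\<in>UNIV. (1/2) ^ nsplit i m)"
    by (rule prod.cong) (auto simp: cell_min_def cell_max_def add_divide_distrib power_one_over)
  also have "\<dots> = (1/2) ^ (\<Sum>i\<in>UNIV. nsplit i m)" by (simp add: power_sum)
  also have "\<dots> = 1 / 2 ^ m" by (simp add: sum_nsplit power_one_over)
  finally show ?thesis .
qed

lemma cell_measure: "measure lebesgue (cell m x) = 1 / 2 ^ m" by (simp add: measure_def cell_emeasure)

lemma cell_subset_cbox: "cell m x \<subseteq> cbox (cell_min m x) (cell_max m x)" unfolding cell_half_box by (rule half_box_box)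

lemma loc_integrable_cell: "loc_integrable f ==> set_integrable lebesgue (cell m x) f" unfolding loc_integrable_def
  by (meson cell_subset_cbox compact_cbox cell_lebesgue set_integrable_subset)

text \<open>The factor 3 counts the coordinates, through the bound of the Euclidean norm by the sum
  norm. In particular two points of a cell of any generation are at distance at most 3.\<close>

lemma cell_dist:
  assumes "y \<in> cell m x" shows "dist y x \<le> 3 * (1/2) ^ (m div 3)"
proof -
  have "abs (y$i - x$i) \<le> (1/2) ^ (m div 3)" for i
  proof -
    have "\<lfloor>2 ^ nsplit i m * y$i\<rfloor> = \<lfloor>2 ^ nsplit i m * x$i\<rfloor>"
      using assms by (auto simp: cell_def fun_eq_iff cell_index_def)
    then have "abs (2 ^ nsplit i m * y$i - 2 ^ nsplit i m * x$i) \<le> 1" by linarith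
    then have "2 ^ nsplit i m * abs (y$i - x$i) \<le> 1" by (simp add: abs_mult flip: right_diff_distrib)
    then have "abs (y$i - x$i) \<le> (1/2) ^ nsplit i m" by (simp add: field_simps power_one_over)
    also have "\<dots> \<le> (1/2) ^ (m div 3)" by (rule power_decreasing) (use nsplit_bound[of m i] in auto)
    finally show ?thesis .
  qed
  then have "(\<Sum>i\<in>UNIV. abs ((y - x)$i)) \<le> (\<Sum>i\<in>(UNIV::3 set). (1/2) ^ (m div 3))" by (intro sum_mono) auto
  then show ?thesis using norm_le_l1_cart[of "y - x"] by (simp add: dist_norm)
qed

lemma cell_small: "e > 0 ==> \<exists>m. cell m x \<subseteq> ball x e"
proof -
  assume "e > 0"
  then obtain n where "(1/2::real) ^ n < e / 3" using real_arch_pow_inv[of "e/3" "1/2"] by auto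
  then have "y \<in> cell (3 * n) x ==> dist x y < e" for y using cell_dist[of y "3 * n" x] by (auto simp: dist_commute)
  then show ?thesis by (intro exI[of _ "3 * n"]) auto
qed

lemma countable_cells: "countable {cell m x | m x. True}"
proof -
  have "{cell m x | m x. True} \<subseteq> (\<Union>m. (\<lambda>j. {y. cell_index m y = j}) ` UNIV)" by (auto simp: cell_def)
  moreover have "countable (\<Union>m. (\<lambda>j. {y. cell_index m y = j}) ` UNIV)" by (intro countable_UN) auto
  ultimately show ?thesis by (rule countable_subset)
qed

text \<open>Cells shrink to their points, so an open set is the union of the countably many cells
  that it contains.\<close>

lemma sigma_sets_cells: "sigma_sets UNIV (insert {} {cell m x | m x. True}) = sets borel"
proof
  show "sigma_sets UNIV (insert {} {cell m x | m x. True}) \<subseteq> sets (borel :: (real^3) measure)"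
    using sets.sigma_sets_subset[of "insert {} {cell m x | m x. True}" borel] cell_borel by auto
  let ?S = "sigma UNIV (insert {} {cell m x | m x. True})"
  have S: "sets ?S = sigma_sets UNIV (insert {} {cell m x | m x. True})" by (simp add: sets_measure_of)
  have "U \<in> sets ?S" if "open U" for U
  proof -
    let ?C = "{c \<in> {cell m x | m x. True}. c \<subseteq> U}"
    have "U \<subseteq> \<Union>?C"
    proof
      fix x assume "x \<in> U"
      then obtain e where e: "e > 0" "ball x e \<subseteq> U" using \<open>open U\<close> openE by blast
      then obtain m where "cell m x \<subseteq> U" using cell_small[of e x] by blast
      then show "x \<in> \<Union>?C" using cell_refl by blast
    qed
    then have "U = \<Union>?C" by blast
    also have "\<dots> \<in> sets ?S" by (rule sets.countable_Union) (auto simp: S intro: countable_subset[OF _ countable_cells])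
    finally show ?thesis .
  qed
  then have "sigma_sets UNIV {U::(real^3) set. open U} \<subseteq> sets ?S" using sets.sigma_sets_subset[of "{U. open U}" ?S] by auto
  then show "sets borel \<subseteq> sigma_sets UNIV (insert {} {cell m x | m x. True})" unfolding S by (simp add: borel_def)
qed

text \<open>By nesting of generations, two cells are disjoint or one contains the other.\<close>

lemma Int_stable_cells: "Int_stable (insert {} {cell m x | m x. True})"
proof -
  have *: "cell m x \<inter> cell n y \<in> insert {} {cell m x | m x. True}" if "m \<le> n" for m n x y
  proof (cases "cell m x \<inter> cell n y = {}")
    case False
    then obtain z where z: "z \<in> cell m x" "z \<in> cell n y" by blast
    then have "cell n z \<subseteq> cell m z" using that cell_mono by blast
    then have "cell n y \<subseteq> cell m x" using z cell_eq by metis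
    then have "cell m x \<inter> cell n y = cell n y" by blast
    then show ?thesis by auto
  qed auto
  have *: "cell m x \<inter> cell n y \<in> insert {} {cell m x | m x. True}" for m n x y
  proof (cases "m \<le> n")
    case False
    then have "n \<le> m" by simp
    from *[OF this, of y x] show ?thesis by (subst Int_commute)
  qed (rule *)
  show ?thesis unfolding Int_stable_def
  proof (intro ballI)
    fix a b assume ab: "a \<in> insert {} {cell m x | m x. True}" "b \<in> insert {} {cell m x | m x. True}"
    show "a \<inter> b \<in> insert {} {cell m x | m x. True}"
    proof (cases "a = {} \<or> b = {}")
      case False
      then obtain m x n y where "a = cell m x" "b = cell n y" using ab by blast
      with * show ?thesis by simp
    qed auto
  qed
qed

text \<open>Dynkin's argument for a signed integrand: cells are a generating family stable under
  intersection, and the vanishing total integral is what lets complements through.\<close>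

lemma integrable_cell_integrals_zero:
  fixes f :: "real^3 => real"
  assumes f: "integrable lebesgue f" "(LINT x|lebesgue. f x) = 0"
    and c: "\<And>m x. (LINT y:cell m x|lebesgue. f y) = 0"
  shows "AE x in lebesgue. f x = 0"
proof -
  have fs: "set_integrable lebesgue A f" if "A \<in> sets lebesgue" for A
    unfolding set_integrable_def by (rule integrable_mult_indicator[OF that f(1)])
  have sub: "insert {} {cell m x | m x. True} \<subseteq> Pow UNIV" by auto
  have b: "(LINT y:A|lebesgue. f y) = 0" if "A \<in> sigma_sets UNIV (insert {} {cell m x | m x. True})" for A using Int_stable_cells sub that
  proof (induction rule: sigma_sets_induct_disjoint)
    case (basic A)
    then show ?case using c by (auto simp: set_lebesgue_integral_def)
  next
    case (compl A)
    then have A: "A \<in> sets lebesgue" using sigma_sets_cells sets_completionI_sets by auto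
    have "(LINT y:UNIV - A|lebesgue. f y) = (LINT y|lebesgue. f y - indicator A y * f y)"
      unfolding set_lebesgue_integral_def by (rule Bochner_Integration.integral_cong) (auto simp: indicator_def)
    also have "\<dots> = 0"
      using fs[OF A] f compl by (subst Bochner_Integration.integral_diff) (auto simp: set_integrable_def set_lebesgue_integral_def)
    finally show ?case .
  next
    case (union A)
    have A: "A i \<in> sets lebesgue" for i using union(2)[of ] sigma_sets_cells sets_completionI_sets by auto
    have "(LINT y:(\<Union>i. A i)|lebesgue. f y) = (\<Sum>i. (LINT y:(A i)|lebesgue. f y))" by (rule lebesgue_integral_countable_add)
        (use A union(1) in \<open>auto simp: disjoint_family_on_def intro!: fs\<close>)
    then show ?case using union by simp
  qed (simp add: set_lebesgue_integral_def)
  have "AE x in lebesgue. f x = (\<lambda>_. 0) x"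
  proof (rule density_unique_real)
    fix A :: "(real^3) set" assume A: "A \<in> sets lebesgue"
    \<comment> \<open>Cells generate Borel sets only; a Lebesgue set is exchanged for its Borel part
      at the cost of a null set.\<close>
    let ?B = "main_part lborel A"
    have B: "?B \<in> sets borel" using A main_part_sets[of A lborel] by simp
    have "AE x in lebesgue. x \<in> A \<longleftrightarrow> x \<in> ?B" using AE_in_main_part[OF A] by (auto simp: AE_completion_iff)
    then have "(LINT y:A|lebesgue. f y) = (LINT y:?B|lebesgue. f y)" unfolding set_lebesgue_integral_def
      using fs[OF A] fs[of ?B] B unfolding set_integrable_def by (intro integral_cong_AE) (auto simp: sets_completionI_sets indicator_def[abs_def])
    also have "\<dots> = 0" by (rule b) (use B in \<open>simp only: sigma_sets_cells\<close>)
    finally show "(LINT y:A|lebesgue. f y) = (LINT y:A|lebesgue. 0)" by (simp add: set_lebesgue_integral_def)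
  qed (use f in auto)
  then show ?thesis by simp
qed

text \<open>Truncation to a unit cell makes the function integrable with zero total
  integral.\<close>

lemma cell_integrals_zero:
  fixes f :: "real^3 => real"
  assumes f: "loc_integrable f" and c: "\<And>m x. (LINT y:cell m x|lebesgue. f y) = 0"
  shows "AE x in lebesgue. f x = 0"
proof -
  have "AE y in lebesgue. indicator (cell 0 x) y * f y = 0" for x
  proof (rule integrable_cell_integrals_zero)
    show "integrable lebesgue (\<lambda>y. indicator (cell 0 x) y * f y)" using loc_integrable_cell[OF f] by (simp add: set_integrable_def)
    show "(LINT y|lebesgue. indicator (cell 0 x) y * f y) = 0" using c[of 0 x] by (simp add: set_lebesgue_integral_def)
    fix m z
    show "(LINT y:cell m z|lebesgue. indicator (cell 0 x) y * f y) = 0"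
    proof (cases "cell m z \<inter> cell 0 x = {}")
      case True
      then have *: "indicator (cell m z) y * (indicator (cell 0 x) y * f y) = 0" for y by (auto simp: indicator_def)
      show ?thesis unfolding set_lebesgue_integral_def real_scaleR_def * by simp
    next
      case False
      then obtain y where y: "y \<in> cell m z" "y \<in> cell 0 x" by blast
      then have "cell m y \<subseteq> cell 0 y" using cell_mono by blast
      then have "cell m z \<subseteq> cell 0 x" using y cell_eq by metis
      then have *: "indicator (cell m z) y * (indicator (cell 0 x) y * f y) = indicator (cell m z) y * f y" for y by (auto simp: indicator_def)
      show ?thesis using c[of m z] unfolding set_lebesgue_integral_def real_scaleR_def * .
    qed
  qed
  \<comment> \<open>Unit cells are indexed by their integer corners, so only countably many
    exceptional null sets are united.\<close>
  then have "AE y in lebesgue. \<forall>j::3=>int. indicator (cell 0 (\<chi> i. of_int (j i))) y * f y = 0" unfolding AE_all_countable by blast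
  then show ?thesis
  proof (rule AE_mp, intro AE_I2 impI)
    fix y assume y: "\<forall>j::3=>int. indicator (cell 0 (\<chi> i. of_int (j i))) y * f y = 0"
    have "y \<in> cell 0 (\<chi> i. of_int (cell_index 0 y i))" by (simp add: cell_def cell_index_def[abs_def])
    with y show "f y = 0" by (metis indicator_simps(1) mult_1)
  qed
qed

text \<open>Tonelli together with the symmetry of lying in the same cell: for fixed y the inner
  integral is the measure 2^(-m) of the cell of y. Integrating a cell integral over its base point
  thus takes the place of a sum over all cells of the generation.\<close>

lemma nn_integral_cell:
  fixes g :: "real^3 => ennreal"
  assumes [measurable]: "g \<in> borel_measurable lebesgue"
  shows "(\<integral>\<^sup>+x. (\<integral>\<^sup>+y. indicator (cell m x) y * g y \<partial>lebesgue) \<partial>lebesgue) = ennreal (1 / 2 ^ m) * (\<integral>\<^sup>+y. g y \<partial>lebesgue)"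
proof -
  have [measurable]: "(\<lambda>p. indicator (cell m (fst p)) (snd p) * g (snd p)) \<in> borel_measurable (lebesgue \<Otimes>\<^sub>M lebesgue)"
  proof -
    have "{p. snd p \<in> cell m (fst p)} = (\<Union>j. {x. cell_index m x = j} \<times> {x. cell_index m x = j})" by (auto simp: cell_def)
    also have "\<dots> \<in> sets (lebesgue \<Otimes>\<^sub>M lebesgue)"
    proof -
      have "(\<lambda>x. cell_index m x) -` {j} \<inter> space lebesgue \<in> sets lebesgue" for j
        by (rule measurable_sets[OF cell_index_lebesgue]) auto
      then have "{x. cell_index m x = j} \<in> sets lebesgue" for j by (simp add: vimage_def)
      then show ?thesis by (intro sets.countable_UN' pair_measureI) auto
    qed
    finally have "indicator {p. snd p \<in> cell m (fst p)} \<in> borel_measurable (lebesgue \<Otimes>\<^sub>M (lebesgue :: (real^3) measure))"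
      by (rule borel_measurable_indicator)
    moreover have "(\<lambda>p. indicator (cell m (fst p)) (snd p) :: ennreal) = indicator {p. snd p \<in> cell m (fst p)}"
      by (auto simp: fun_eq_iff indicator_def)
    ultimately have "(\<lambda>p. indicator (cell m (fst p)) (snd p) :: ennreal) \<in> borel_measurable (lebesgue \<Otimes>\<^sub>M lebesgue)" by simp
    then show ?thesis by measurable
  qed
  have "(\<integral>\<^sup>+x. (\<integral>\<^sup>+y. indicator (cell m x) y * g y \<partial>lebesgue) \<partial>lebesgue)
      = (\<integral>\<^sup>+y. (\<integral>\<^sup>+x. indicator (cell m x) y * g y \<partial>lebesgue) \<partial>lebesgue)"
    by (rule lebesgue_pair.Fubini'[symmetric]) (simp add: case_prod_beta')
  also have "\<dots> = (\<integral>\<^sup>+y. (\<integral>\<^sup>+x. g y * indicator (cell m y) x \<partial>lebesgue) \<partial>lebesgue)"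
    by (intro nn_integral_cong) (auto simp: cell_sym indicator_def)
  also have "\<dots> = (\<integral>\<^sup>+y. g y * ennreal (1 / 2 ^ m) \<partial>lebesgue)"
    by (intro nn_integral_cong) (simp add: nn_integral_cmult_indicator cell_emeasure)
  also have "\<dots> = ennreal (1 / 2 ^ m) * (\<integral>\<^sup>+y. g y \<partial>lebesgue)" by (subst mult.commute) (simp add: nn_integral_cmult)
  finally show ?thesis .
qed

section \<open>Cell averages and the Sobolev inequality\<close>

lemma L2_D: "u \<in> L2 ==> u \<in> borel_measurable lebesgue" "u \<in> L2 ==> integrable lebesgue (\<lambda>x. (norm (u x))^2)"
  by (auto simp: L2_def)

lemma L2_real_iff: "(u :: real^3 => real) \<in> L2 \<longleftrightarrow> u \<in> borel_measurable lebesgue \<and> integrable lebesgue (\<lambda>x. (u x)^2)"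
  by (auto simp: L2_def)

lemma L2_mult:
  fixes f g :: "real^3 => real"
  assumes "f \<in> L2" "g \<in> L2"
  shows "integrable lebesgue (\<lambda>x. f x * g x)"
    and "\<bar>LINT x|lebesgue. f x * g x\<bar> \<le> sqrt (LINT x|lebesgue. (f x)^2) * sqrt (LINT x|lebesgue. (g x)^2)"
proof -
  have [measurable]: "f \<in> borel_measurable lebesgue" "g \<in> borel_measurable lebesgue"
    and i: "integrable lebesgue (\<lambda>x. (f x)^2)" "integrable lebesgue (\<lambda>x. (g x)^2)" using assms by (auto simp: L2_real_iff)
  have le: "abs (f x * g x) \<le> (f x)^2 + (g x)^2" for x
  proof -
    have "0 \<le> (abs (f x) - abs (g x))^2" by simp
    then have "2 * (abs (f x) * abs (g x)) \<le> (f x)^2 + (g x)^2" by (simp add: power2_diff)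
    moreover have "0 \<le> abs (f x) * abs (g x)" by simp
    ultimately show ?thesis unfolding abs_mult by linarith
  qed
  show fg: "integrable lebesgue (\<lambda>x. f x * g x)" by (rule Bochner_Integration.integrable_bound[OF Bochner_Integration.integrable_add[OF i]])
      (use le in auto)
  have "(\<integral>\<^sup>+x. ennreal \<bar>f x\<bar> * ennreal \<bar>g x\<bar> \<partial>lebesgue)\<^sup>2
      \<le> (\<integral>\<^sup>+x. ennreal \<bar>f x\<bar> ^ 2 \<partial>lebesgue) * (\<integral>\<^sup>+x. ennreal \<bar>g x\<bar> ^ 2 \<partial>lebesgue)"
    by (rule Cauchy_Schwarz_nn_integral) measurable
  also have "(\<integral>\<^sup>+x. ennreal \<bar>f x\<bar> ^ 2 \<partial>lebesgue) = ennreal (LINT x|lebesgue. (f x)^2)"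
    using i by (subst nn_integral_eq_integral[symmetric]) (auto simp: ennreal_power)
  also have "(\<integral>\<^sup>+x. ennreal \<bar>g x\<bar> ^ 2 \<partial>lebesgue) = ennreal (LINT x|lebesgue. (g x)^2)"
    using i by (subst nn_integral_eq_integral[symmetric]) (auto simp: ennreal_power)
  also have "(\<integral>\<^sup>+x. ennreal \<bar>f x\<bar> * ennreal \<bar>g x\<bar> \<partial>lebesgue) = ennreal (LINT x|lebesgue. abs (f x * g x))"
    using integrable_abs[OF fg] by (subst nn_integral_eq_integral[symmetric]) (auto simp: ennreal_mult abs_mult)
  finally have "(LINT x|lebesgue. abs (f x * g x))^2 \<le> (LINT x|lebesgue. (f x)^2) * (LINT x|lebesgue. (g x)^2)"
    by (simp add: ennreal_power flip: ennreal_mult)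
  then have "LINT x|lebesgue. abs (f x * g x) \<le> sqrt ((LINT x|lebesgue. (f x)^2) * (LINT x|lebesgue. (g x)^2))" by (rule real_le_rsqrt)
  then show "\<bar>LINT x|lebesgue. f x * g x\<bar> \<le> sqrt (LINT x|lebesgue. (f x)^2) * sqrt (LINT x|lebesgue. (g x)^2)"
    unfolding real_sqrt_mult by (rule order_trans[OF integral_abs_bound])
qed

lemma L2_indicator: "S \<in> lmeasurable ==> (indicator S :: real^3 => real) \<in> L2"
proof -
  assume S: "S \<in> lmeasurable"
  have "(indicator S x)^2 = (indicator S x :: real)" for x :: "real^3" by (simp add: indicator_def)
  then show ?thesis using S by (auto simp: L2_real_iff fmeasurable_def)
qed

lemma L2_set_integrable:
  fixes u :: "real^3 => 'b::euclidean_space"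
  assumes u: "u \<in> L2" and S: "S \<in> lmeasurable"
  shows "set_integrable lebesgue S u"
proof -
  have [measurable]: "u \<in> borel_measurable lebesgue" "S \<in> sets lebesgue" using u S by (auto simp: L2_D)

  have n: "(\<lambda>x. norm (u x)) \<in> L2" using u by (auto simp: L2_def)
  have "integrable lebesgue (\<lambda>x. indicator S x * norm (u x))" by (rule L2_mult(1)[OF L2_indicator[OF S] n])
  then show ?thesis unfolding set_integrable_def by (rule Bochner_Integration.integrable_bound) auto
qed

lemma L2_loc_integrable: "u \<in> L2 ==> loc_integrable u" unfolding loc_integrable_def using L2_set_integrable lmeasurable_compact by blast

text \<open>The conditional expectation on the cells of generation \<open>m\<close>; the factor is
  the inverse of the cell measure.\<close>

definition avg :: "nat => (real^3 => real) => real^3 => real" where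
  "avg m u x = 2 ^ m * (LINT y:cell m x|lebesgue. u y)"

lemma cell_lmeasurable[simp]: "cell m x \<in> lmeasurable" by (simp add: fmeasurable_def cell_emeasure)

lemma avg_cell: "y \<in> cell m x ==> avg m u y = avg m u x" by (simp add: avg_def cell_eq)

lemma avg_measurable[measurable]: "avg m u \<in> borel_measurable lebesgue"
proof -
  have "avg m u = (\<lambda>j. 2 ^ m * (LINT y:{y. cell_index m y = j}|lebesgue. u y)) \<circ> cell_index m"
    by (auto simp: avg_def cell_def fun_eq_iff)
  also have "\<dots> \<in> borel_measurable lebesgue" by (rule measurable_comp[OF cell_index_lebesgue]) auto
  finally show ?thesis .
qed

lemma avg_diff:
  assumes "loc_integrable u" "loc_integrable v"
  shows "avg m (\<lambda>x. u x - v x) x = avg m u x - avg m v x"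
  using loc_integrable_cell[OF assms(1), of m x] loc_integrable_cell[OF assms(2), of m x] by (simp add: avg_def set_integral_diff right_diff_distrib)

text \<open>Cauchy-Schwarz against the indicator of the cell, that is, Jensen's inequality for the
  average.\<close>

lemma avg_sq_le:
  assumes "u \<in> L2" shows "(avg m u x)^2 \<le> 2 ^ m * (LINT y:cell m x|lebesgue. (u y)^2)"
proof -
  let ?c = "cell m x"
  have iu: "(\<lambda>y. indicator ?c y * u y) \<in> L2"
  proof -
    have "integrable lebesgue (\<lambda>y. indicator ?c y *\<^sub>R (u y)^2)"
      using assms by (intro integrable_mult_indicator) (auto simp: L2_real_iff)
    moreover have "indicator ?c y *\<^sub>R (u y)^2 = (indicator ?c y * u y)^2" for y by (auto simp: indicator_def)
    ultimately show ?thesis using assms by (auto simp: L2_real_iff)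
  qed
  have s: "(indicator ?c y :: real)^2 = indicator ?c y" for y by (simp add: indicator_def)
  have "\<bar>LINT y|lebesgue. indicator ?c y * (indicator ?c y * u y)\<bar>
     \<le> sqrt (LINT y|lebesgue. (indicator ?c y)^2) * sqrt (LINT y|lebesgue. (indicator ?c y * u y)^2)"
    by (rule L2_mult(2)[OF L2_indicator[OF cell_lmeasurable] iu])
  also have "(LINT y|lebesgue. (indicator ?c y)^2) = (1 / 2 ^ m :: real)" unfolding s by (simp add: cell_measure)
  also have "(LINT y|lebesgue. (indicator ?c y * u y)^2) = (LINT y:?c|lebesgue. (u y)^2)"
    unfolding power_mult_distrib s by (simp add: set_lebesgue_integral_def)
  also have "(LINT y|lebesgue. indicator ?c y * (indicator ?c y * u y)) = (LINT y:?c|lebesgue. u y)"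
    unfolding set_lebesgue_integral_def by (rule Bochner_Integration.integral_cong) (auto simp: indicator_def)
  finally have "\<bar>LINT y:?c|lebesgue. u y\<bar>^2 \<le> (sqrt (1 / 2 ^ m) * sqrt (LINT y:?c|lebesgue. (u y)^2))^2" by (rule power_mono) simp
  also have "\<dots> = 1 / 2 ^ m * (LINT y:?c|lebesgue. (u y)^2)" by (simp add: power_mult_distrib real_sqrt_pow2 set_lebesgue_integral_def)
  finally have "2 ^ m * 2 ^ m * (LINT y:?c|lebesgue. u y)^2 \<le> 2 ^ m * 2 ^ m * (1 / 2 ^ m * (LINT y:?c|lebesgue. (u y)^2))"
    by (intro mult_left_mono) auto
  then show ?thesis by (simp add: avg_def power_mult_distrib power2_eq_square ac_simps)
qed

lemma set_integral_mono_UNIV: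
  fixes g :: "real^3 => real"
  assumes "integrable lebesgue g" "\<And>x. 0 \<le> g x" "S \<in> sets lebesgue"
  shows "(LINT y:S|lebesgue. g y) \<le> (LINT y|lebesgue. g y)" unfolding set_lebesgue_integral_def
  by (rule integral_mono) (use assms integrable_mult_indicator[OF assms(3,1)] in \<open>auto simp: indicator_def\<close>)

lemma avg_sq_le': "u \<in> L2 ==> (avg m u x)^2 \<le> 2 ^ m * (LINT y|lebesgue. (u y)^2)"
  by (rule order_trans[OF avg_sq_le], assumption, intro mult_left_mono set_integral_mono_UNIV)
    (auto simp: L2_real_iff)

lemma ennreal_cell_integral:
  fixes g :: "real^3 => real"
  assumes "integrable lebesgue g" "\<And>x. 0 \<le> g x"
  shows "ennreal (LINT y:cell m x|lebesgue. g y) = (\<integral>\<^sup>+y. indicator (cell m x) y * ennreal (g y) \<partial>lebesgue)"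
proof -
  have "ennreal (LINT y:cell m x|lebesgue. g y) = (\<integral>\<^sup>+y. ennreal (indicator (cell m x) y *\<^sub>R g y) \<partial>lebesgue)"
    unfolding set_lebesgue_integral_def
    by (rule nn_integral_eq_integral[symmetric]) (use assms integrable_mult_indicator[OF cell_lebesgue assms(1)] in auto)
  also have "\<dots> = (\<integral>\<^sup>+y. indicator (cell m x) y * ennreal (g y) \<partial>lebesgue)"
    by (rule nn_integral_cong) (auto simp: indicator_def)
  finally show ?thesis .
qed

text \<open>Integrating the pointwise Jensen bound over the base point brings the factor 2^(-m),
  which cancels the normalisation 2^m: averaging is a contraction.\<close>

lemma avg_L2:
  assumes "u \<in> L2"
  shows "avg m u \<in> L2" "(LINT x|lebesgue. (avg m u x)^2) \<le> (LINT x|lebesgue. (u x)^2)"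
proof -
  have i: "integrable lebesgue (\<lambda>x. (u x)^2)" and [measurable]: "u \<in> borel_measurable lebesgue" using assms by (auto simp: L2_real_iff)
  have "(\<integral>\<^sup>+x. ennreal ((avg m u x)^2) \<partial>lebesgue)
      \<le> (\<integral>\<^sup>+x. (\<integral>\<^sup>+y. indicator (cell m x) y * ennreal (2 ^ m * (u y)^2) \<partial>lebesgue) \<partial>lebesgue)"
  proof (rule nn_integral_mono)
    fix x
    have "ennreal ((avg m u x)^2) \<le> ennreal (LINT y:cell m x|lebesgue. 2 ^ m * (u y)^2)"
      using avg_sq_le[OF assms, of m x] by (intro ennreal_leI) simp
    also have "\<dots> = (\<integral>\<^sup>+y. indicator (cell m x) y * ennreal (2 ^ m * (u y)^2) \<partial>lebesgue)"
      by (rule ennreal_cell_integral) (use i in auto)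
    finally show "ennreal ((avg m u x)^2) \<le> (\<integral>\<^sup>+y. indicator (cell m x) y * ennreal (2 ^ m * (u y)^2) \<partial>lebesgue)" .
  qed
  also have "\<dots> = ennreal (1 / 2 ^ m) * (\<integral>\<^sup>+y. ennreal (2 ^ m * (u y)^2) \<partial>lebesgue)"
    by (rule nn_integral_cell) measurable
  also have "\<dots> = ennreal (1 / 2 ^ m) * ennreal (2 ^ m * (LINT y|lebesgue. (u y)^2))" using i by (subst nn_integral_eq_integral) auto
  also have "\<dots> = ennreal (LINT y|lebesgue. (u y)^2)" by (subst ennreal_mult[symmetric]) auto
  finally have le: "(\<integral>\<^sup>+x. ennreal ((avg m u x)^2) \<partial>lebesgue) \<le> ennreal (LINT y|lebesgue. (u y)^2)" .
  have ia: "integrable lebesgue (\<lambda>x. (avg m u x)^2)" by (rule integrableI_bounded) (use le in \<open>auto intro: le_less_trans\<close>)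
  then show "avg m u \<in> L2" by (simp add: L2_real_iff avg_measurable)
  have "ennreal (LINT x|lebesgue. (avg m u x)^2) = (\<integral>\<^sup>+x. ennreal ((avg m u x)^2) \<partial>lebesgue)"
    using ia by (intro nn_integral_eq_integral[symmetric]) auto
  with le have "ennreal (LINT x|lebesgue. (avg m u x)^2) \<le> ennreal (LINT y|lebesgue. (u y)^2)" by simp
  then show "(LINT x|lebesgue. (avg m u x)^2) \<le> (LINT x|lebesgue. (u x)^2)" by (subst (asm) ennreal_le_iff) auto
qed

text \<open>The tower property of conditional expectations. For a nonnegative function it is
  Tonelli, since a finer cell lies inside or outside the coarse one; the general case is a
  difference of two nonnegative functions.\<close>

lemma cell_integral_avg:
  assumes u: "loc_integrable u" "u \<in> borel_measurable lebesgue" and kn: "k \<le> n"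
  shows "set_integrable lebesgue (cell k z) (avg n u)"
    "(LINT x:cell k z|lebesgue. avg n u x) = (LINT x:cell k z|lebesgue. u x)"
proof -
  let ?c = "cell k z"
  have pos: "set_integrable lebesgue ?c (avg n g) \<and> (LINT x:?c|lebesgue. avg n g x) = (LINT x:?c|lebesgue. g x)"
    if g: "loc_integrable g" "\<And>x. 0 \<le> g x" for g
  proof -
    have ig: "integrable lebesgue (\<lambda>x. indicator ?c x * g x)" using loc_integrable_cell[OF g(1)] by (simp add: set_integrable_def)
    have gn: "integrable lebesgue (\<lambda>y. indicator (cell n x) y * g y)" for x
      using loc_integrable_cell[OF g(1)] by (simp add: set_integrable_def)
    have a0: "0 \<le> avg n g x" for x using g(2) by (simp add: avg_def set_lebesgue_integral_def integral_nonneg_AE)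
    have sub: "cell n x \<subseteq> ?c" if "x \<in> ?c" for x using cell_mono[OF kn, of x] cell_eq[OF that] by simp
    have dis: "cell n x \<inter> ?c = {}" if "x \<notin> ?c" for x using cell_mono[OF kn, of x] cell_eq cell_refl that by (metis disjoint_iff subsetD)
    have "(\<integral>\<^sup>+x. ennreal (indicator ?c x * avg n g x) \<partial>lebesgue)
       = (\<integral>\<^sup>+x. (\<integral>\<^sup>+y. indicator (cell n x) y * ennreal (2 ^ n * (indicator ?c y * g y)) \<partial>lebesgue) \<partial>lebesgue)"
    proof (rule nn_integral_cong)
      fix x
      have "indicator ?c x * avg n g x = (LINT y:cell n x|lebesgue. 2 ^ n * (indicator ?c y * g y))"
      proof (cases "x \<in> ?c")
        case True
        have "(LINT y:cell n x|lebesgue. 2 ^ n * (indicator ?c y * g y)) = (LINT y:cell n x|lebesgue. 2 ^ n * g y)"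
          unfolding set_lebesgue_integral_def using sub[OF True] by (intro Bochner_Integration.integral_cong) (auto simp: indicator_def)
        then show ?thesis using True by (simp add: avg_def)
      next
        case False
        have "indicator (cell n x) y *\<^sub>R (2 ^ n * (indicator ?c y * g y)) = 0" for y using dis[OF False] by (auto simp: indicator_def)
        then show ?thesis using False unfolding set_lebesgue_integral_def by (simp only: indicator_simps) simp
      qed
      then have "ennreal (indicator ?c x * avg n g x) = ennreal (LINT y:cell n x|lebesgue. 2 ^ n * (indicator ?c y * g y))" by simp
      also have "\<dots> = (\<integral>\<^sup>+y. indicator (cell n x) y * ennreal (2 ^ n * (indicator ?c y * g y)) \<partial>lebesgue)"
        by (rule ennreal_cell_integral) (use ig g in auto)
      finally show "ennreal (indicator ?c x * avg n g x) = \<dots>" .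
    qed
    also have "\<dots> = ennreal (1 / 2 ^ n) * (\<integral>\<^sup>+y. ennreal (2 ^ n * (indicator ?c y * g y)) \<partial>lebesgue)"
      by (rule nn_integral_cell) (use borel_measurable_integrable[OF ig] in measurable)
    also have "\<dots> = ennreal (1 / 2 ^ n) * ennreal (2 ^ n * (LINT y|lebesgue. indicator ?c y * g y))"
      using ig g by (subst nn_integral_eq_integral) auto
    also have "\<dots> = ennreal (LINT y|lebesgue. indicator ?c y * g y)" using g by (subst ennreal_mult[symmetric]) (auto intro!: integral_nonneg_AE)
    finally have eq: "(\<integral>\<^sup>+x. ennreal (indicator ?c x * avg n g x) \<partial>lebesgue) = ennreal (LINT y|lebesgue. indicator ?c y * g y)" .
    have "integrable lebesgue (\<lambda>x. indicator ?c x * avg n g x)"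
      by (rule integrableI_bounded) (use eq a0 in \<open>auto simp: abs_mult\<close>)
    moreover have "(LINT x|lebesgue. indicator ?c x * avg n g x) = (LINT y|lebesgue. indicator ?c y * g y)"
      using eq a0 g(2) by (subst integral_eq_nn_integral) (auto intro!: integral_nonneg_AE)
    ultimately show ?thesis by (simp add: set_integrable_def set_lebesgue_integral_def)
  qed
  let ?p = "\<lambda>x. abs (u x)" and ?q = "\<lambda>x. abs (u x) - u x"
  have lp: "loc_integrable ?p" unfolding loc_integrable_def
  proof (intro allI impI)
    fix K :: "(real^3) set" assume "compact K"
    then have "set_integrable lebesgue K u" using u by (simp add: loc_integrable_def)
    then show "set_integrable lebesgue K ?p" by (rule set_integrable_abs)
  qed
  have lq: "loc_integrable ?q" using lp u(1) unfolding loc_integrable_def by (auto intro: set_integral_diff)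
  have P: "set_integrable lebesgue ?c (avg n ?p)" "(LINT x:?c|lebesgue. avg n ?p x) = (LINT x:?c|lebesgue. ?p x)" using pos[OF lp] by auto
  have Q: "set_integrable lebesgue ?c (avg n ?q)" "(LINT x:?c|lebesgue. avg n ?q x) = (LINT x:?c|lebesgue. ?q x)" using pos[OF lq] by auto
  have eq: "avg n u x = avg n ?p x - avg n ?q x" for x using avg_diff[OF lp lq, of n x] by simp
  show "set_integrable lebesgue ?c (avg n u)" unfolding eq[abs_def] by (rule set_integral_diff[OF P(1) Q(1)])
  have "(LINT x:?c|lebesgue. avg n u x) = (LINT x:?c|lebesgue. ?p x) - (LINT x:?c|lebesgue. ?q x)"
    unfolding eq by (subst set_integral_diff(2)[OF P(1) Q(1)]) (simp add: P Q)
  also have "\<dots> = (LINT x:?c|lebesgue. ?p x - ?q x)"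
    by (rule set_integral_diff(2)[symmetric, OF loc_integrable_cell[OF lp] loc_integrable_cell[OF lq]])
  finally show "(LINT x:?c|lebesgue. avg n u x) = (LINT x:?c|lebesgue. u x)" by simp
qed

section \<open>Increments of the averages from one generation to the next\<close>

lemma half_box_set_integral:
  fixes f :: "real^3 => real"
  assumes [measurable]: "f \<in> borel_measurable lebesgue"
  shows "(LINT x:half_box l r|lebesgue. f x) = (LINT x:box l r|lebesgue. f x)"
proof -
  have [measurable]: "half_box l r \<in> sets lebesgue" "box l r \<in> sets lebesgue" by (auto simp: half_box_lebesgue)
  have "AE x in lebesgue. indicator (half_box l r) x *\<^sub>R f x = indicator (box l r) x *\<^sub>R f x"
    using AE_half_box[of l r] by (rule AE_mp) (auto simp: indicator_def)
  then show ?thesis unfolding set_lebesgue_integral_def by (intro integral_cong_AE) auto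
qed

text \<open>The translation \<open>e\<close> is half a side in direction \<open>dir m\<close>. The
  parity of the finer label decides which half is the child containing \<open>x\<close>; a
  disjunction is enough, because only the absolute difference of the integrals over the halves
  matters later.\<close>

lemma cell_bisect:
  fixes m x
  defines "e \<equiv> (1 / 2 ^ Suc (nsplit (dir m) m)) *\<^sub>R axis (dir m) 1 :: real^3"
  obtains l r where "cell m x = half_box l (r + e)" "half_box l r \<inter> half_box (l + e) (r + e) = {}"
    "cell m x = half_box l r \<union> half_box (l + e) (r + e)"
    "cell (Suc m) x = half_box l r \<or> cell (Suc m) x = half_box (l + e) (r + e)"
proof -
  let ?d = "dir m"
  let ?h = "1 / 2 ^ Suc (nsplit ?d m) :: real"
  define l where "l = cell_min m x"
  define r where "r = cell_max m x - e"
  have hpos: "?h > 0" by simp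
  have rd: "r$?d = l$?d + ?h" by (simp add: r_def l_def e_def cell_min_def cell_max_def add_divide_distrib)
  have ed: "e$?d = ?h" "\<And>i. i \<noteq> ?d ==> e$i = 0" by (auto simp: e_def axis_def)
  have 1: "cell m x = half_box l (r + e)" by (simp add: cell_half_box l_def r_def)
  have 2: "half_box l r \<inter> half_box (l + e) (r + e) = {}"
  proof -
    have "y$?d < r$?d" "l$?d + ?h \<le> y$?d" if "y \<in> half_box l r" "y \<in> half_box (l + e) (r + e)" for y
      using that ed(1) by (auto simp: half_box_def dest: spec[of _ ?d])
    then show ?thesis using rd by fastforce
  qed
  have 3: "half_box l (r + e) = half_box l r \<union> half_box (l + e) (r + e)"
  proof (intro set_eqI)
    fix y
    have hb: "y \<in> half_box a b \<longleftrightarrow> (a$?d \<le> y$?d \<and> y$?d < b$?d) \<and> (\<forall>i. i \<noteq> ?d \<longrightarrow> a$i \<le> y$i \<and> y$i < b$i)" for a b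
      unfolding half_box_def mem_Collect_eq by metis
    define OK where "OK \<longleftrightarrow> (\<forall>i. i \<noteq> ?d \<longrightarrow> l$i \<le> y$i \<and> y$i < r$i)"
    have a: "y \<in> half_box l (r + e) \<longleftrightarrow> (l$?d \<le> y$?d \<and> y$?d < r$?d + ?h) \<and> OK"
      unfolding hb OK_def vector_add_component ed(1) using ed(2) by simp
    have b: "y \<in> half_box l r \<longleftrightarrow> (l$?d \<le> y$?d \<and> y$?d < r$?d) \<and> OK" unfolding hb OK_def by simp
    have c: "y \<in> half_box (l + e) (r + e) \<longleftrightarrow> (l$?d + ?h \<le> y$?d \<and> y$?d < r$?d + ?h) \<and> OK"
      unfolding hb OK_def vector_add_component ed(1) using ed(2) by simp
    have s: "(l$?d \<le> y$?d \<and> y$?d < r$?d + ?h) =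
        (l$?d \<le> y$?d \<and> y$?d < r$?d \<or> l$?d + ?h \<le> y$?d \<and> y$?d < r$?d + ?h)"
    proof -
      have key: "b = a + c ==> 0 < c ==> (a \<le> t \<and> t < b + c) = (a \<le> t \<and> t < b \<or> a + c \<le> t \<and> t < b + c)"
        for a b c t :: real by auto
      show ?thesis using key[OF rd hpos, of "y $ ?d"] .
    qed
    have fin: "X = (Y \<or> Z) ==> (X \<and> W) = (Y \<and> W \<or> Z \<and> W)" for X Y Z W :: bool by blast
    show "y \<in> half_box l (r + e) \<longleftrightarrow> y \<in> half_box l r \<union> half_box (l + e) (r + e)"
      using fin[OF s, of OK] by (simp only: Un_iff a b c)
  qed
  let ?k = "cell_index m x ?d" and ?k' = "cell_index (Suc m) x ?d"
  have k: "?k = ?k' div 2" by (subst cell_index_Suc) simp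
  have ki: "cell_index (Suc m) x i = cell_index m x i" if "i \<noteq> ?d" for i using that cell_index_Suc[of m x i] by simp
  have 4: "cell (Suc m) x = half_box l r \<or> cell (Suc m) x = half_box (l + e) (r + e)"
  proof (cases "even ?k'")
    case True
    then have kk: "real_of_int ?k' = 2 * real_of_int ?k" using k by auto
    have "cell_min (Suc m) x $ i = l $ i \<and> cell_max (Suc m) x $ i = r $ i" for i
    proof (cases "i = ?d")
      case True
      then show ?thesis using kk by (simp add: l_def r_def ed cell_min_def cell_max_def field_simps)
    next
      case False
      then show ?thesis using ki[OF False] ed(2)[OF False] by (simp add: l_def r_def cell_min_def cell_max_def)
    qed
    then have "cell_min (Suc m) x = l" "cell_max (Suc m) x = r" by (auto simp: vec_eq_iff)
    then show ?thesis by (simp add: cell_half_box)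
  next
    case False
    then have "?k' = 2 * ?k + 1" unfolding k by presburger
    then have kk: "real_of_int ?k' = 2 * real_of_int ?k + 1" by simp
    have "cell_min (Suc m) x $ i = (l + e) $ i \<and> cell_max (Suc m) x $ i = (r + e) $ i" for i
    proof (cases "i = ?d")
      case True
      then show ?thesis using kk by (simp add: l_def r_def ed cell_min_def cell_max_def field_simps)
    next
      case False
      then show ?thesis using ki[OF False] ed(2)[OF False] by (simp add: l_def r_def cell_min_def cell_max_def)
    qed
    then have "cell_min (Suc m) x = l + e" "cell_max (Suc m) x = r + e" by (auto simp: vec_eq_iff)
    then show ?thesis by (simp add: cell_half_box)
  qed
  show ?thesis by (rule that[of l r]) (use 1 2 3 4 in auto)
qed

lemma component_sq_le: "((v::real^'n)$i)^2 \<le> (norm v)^2" using power_mono[OF component_le_norm_cart[of v i], of 2] by simp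

lemma measurable_component:
  "D \<in> borel_measurable M ==> (\<lambda>y. (D y :: real^'n) $ i) \<in> borel_measurable M"
proof -
  assume "D \<in> borel_measurable M"
  then have "(\<lambda>y. D y \<bullet> axis i 1) \<in> borel_measurable M" by measurable
  then show ?thesis by (simp add: inner_axis)
qed

lemma L2_component: "D \<in> L2 ==> (\<lambda>y. (D y :: real^'n) $ i) \<in> L2"
proof -
  assume D: "D \<in> L2"
  have m: "(\<lambda>y. D y $ i) \<in> borel_measurable lebesgue" by (rule measurable_component[OF L2_D(1)[OF D]])
  have "integrable lebesgue (\<lambda>y. (D y $ i)^2)" by (rule Bochner_Integration.integrable_bound[OF L2_D(2)[OF D]])
      (use m in \<open>auto simp: component_sq_le\<close>)
  with m show ?thesis by (simp add: L2_real_iff)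
qed

lemma L2_abs: "(u :: real^3 => real) \<in> L2 ==> (\<lambda>x. abs (u x)) \<in> L2" by (auto simp: L2_real_iff)

text \<open>With L and U the integrals over the halves, a child has average 2^(m+1) L or 2^(m+1) U
  and the parent 2^m (L + U), so the difference is 2^m (L - U) up to sign. The halves are translates
  by \<open>?h\<close>, hence |L - U| is at most \<open>?h\<close> times the integral of a partial
  derivative over the cell. Jensen bounds the square by \<open>?h^2\<close> 2^m times the gradient
  energy of the cell, and \<open>nsplit_bound\<close> turns the coefficient into 2^(m/3).\<close>

lemma avg_Suc_diff:
  assumes u: "u \<in> L2" and D: "D \<in> L2" "has_weak_grad u D"
  shows "(avg (Suc m) u x - avg m u x)^2 \<le> 2 powr (m / 3) * (LINT y:cell m x|lebesgue. (norm (D y))^2)"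
proof -
  let ?d = "dir m" let ?n = "nsplit ?d m"
  let ?h = "1 / 2 ^ Suc ?n :: real"
  let ?e = "?h *\<^sub>R axis ?d 1 :: real^3"
  obtain l r where lr: "cell m x = half_box l (r + ?e)" "half_box l r \<inter> half_box (l + ?e) (r + ?e) = {}"
    "cell m x = half_box l r \<union> half_box (l + ?e) (r + ?e)"
    "cell (Suc m) x = half_box l r \<or> cell (Suc m) x = half_box (l + ?e) (r + ?e)" by (rule cell_bisect[of m x]) (rule that; assumption)
  have um[measurable]: "u \<in> borel_measurable lebesgue" and Dm[measurable]: "D \<in> borel_measurable lebesgue" using u D L2_D by auto
  have Di: "(\<lambda>y. abs (D y $ ?d)) \<in> L2" by (intro L2_abs L2_component D)
  let ?c = "cell m x"
  define L where "L = (LINT y:half_box l r|lebesgue. u y)"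
  define U where "U = (LINT y:half_box (l + ?e) (r + ?e)|lebesgue. u y)"
  have si: "set_integrable lebesgue ?c u" by (rule loc_integrable_cell[OF L2_loc_integrable[OF u]])
  have T: "(LINT y:?c|lebesgue. u y) = L + U" unfolding lr(3) L_def U_def
    by (rule set_integral_Un[OF lr(2)]) (rule set_integrable_subset[OF si half_box_lebesgue], use lr(3) in blast)+
  have "abs (L - U) \<le> ?h * (LINT x:box l (r + ?e)|lebesgue. abs (D x $ ?d))"
    unfolding L_def U_def half_box_set_integral[OF um] by (rule weak_grad_box_shift[OF D(2)]) simp
  also have "(LINT x:box l (r + ?e)|lebesgue. abs (D x $ ?d)) = (LINT x:?c|lebesgue. abs (D x $ ?d))"
    unfolding lr(1) by (rule half_box_set_integral[symmetric]) (use L2_D(1)[OF Di] in simp)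
  finally have LU: "abs (L - U) \<le> ?h * (LINT x:?c|lebesgue. abs (D x $ ?d))" .
  have "avg (Suc m) u x - avg m u x = 2 ^ m * (L - U) \<or> avg (Suc m) u x - avg m u x = - (2 ^ m * (L - U))"
    using lr(4) by (auto simp: avg_def T L_def U_def algebra_simps)
  then have "abs (avg (Suc m) u x - avg m u x) = 2 ^ m * abs (L - U)" by (auto simp: abs_mult)
  also have "\<dots> \<le> 2 ^ m * (?h * (LINT x:?c|lebesgue. abs (D x $ ?d)))" by (rule mult_left_mono[OF LU]) simp
  also have "\<dots> = ?h * avg m (\<lambda>y. abs (D y $ ?d)) x" by (simp add: avg_def)
  finally have "abs (avg (Suc m) u x - avg m u x)^2 \<le> (?h * avg m (\<lambda>y. abs (D y $ ?d)) x)^2" by (rule power_mono) simp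
  also have "\<dots> \<le> ?h^2 * (2 ^ m * (LINT y:?c|lebesgue. abs (D y $ ?d)^2))"
    unfolding power_mult_distrib by (intro mult_left_mono avg_sq_le[OF Di]) simp
  also have "\<dots> \<le> ?h^2 * (2 ^ m * (LINT y:?c|lebesgue. (norm (D y))^2))"
  proof (intro mult_left_mono)
    show "(LINT y:?c|lebesgue. abs (D y $ ?d)^2) \<le> (LINT y:?c|lebesgue. (norm (D y))^2)" unfolding set_lebesgue_integral_def
    proof (rule integral_mono)
      show "integrable lebesgue (\<lambda>y. indicator ?c y *\<^sub>R \<bar>D y $ ?d\<bar>^2)"
        using Di by (intro integrable_mult_indicator) (auto simp: L2_real_iff)
      show "integrable lebesgue (\<lambda>y. indicator ?c y *\<^sub>R (norm (D y))^2)" using L2_D[OF D(1)] by (intro integrable_mult_indicator) auto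
      show "indicator ?c y *\<^sub>R \<bar>D y $ ?d\<bar>^2 \<le> indicator ?c y *\<^sub>R (norm (D y))^2" for y
        by (auto simp: indicator_def component_sq_le)
    qed
  qed auto
  also have "\<dots> = (?h^2 * 2 ^ m) * (LINT y:?c|lebesgue. (norm (D y))^2)" by simp
  also have "\<dots> \<le> 2 powr (m / 3) * (LINT y:?c|lebesgue. (norm (D y))^2)"
  proof (rule mult_right_mono)
    have "?h^2 * 2 ^ m = 2 powr (real m - 2 * real (Suc ?n))"
    proof -
      have "2 powr (real m - real (2 * Suc ?n)) = 2 ^ m / 2 ^ (2 * Suc ?n)" unfolding powr_diff by (subst powr_realpow, simp)+ (rule refl)
      moreover have "?h^2 = 1 / 2 ^ (2 * Suc ?n)" unfolding power_divide power_mult[symmetric] by (simp add: mult.commute)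
      ultimately show ?thesis by simp
    qed
    also have "\<dots> \<le> 2 powr (m / 3)" using nsplit_bound[of m ?d] by (intro powr_mono) auto
    finally show "?h^2 * 2 ^ m \<le> 2 powr (m / 3)" .
  qed (auto simp: set_lebesgue_integral_def intro!: integral_nonneg_AE)
  finally show ?thesis by simp
qed

text \<open>If I is the gradient energy of the cell and S the total one, then I^(p/2) is at most
  S^(p/2-1) I, which is linear in I and can be summed over cells. The result is 2^(mp/6) times the
  factor 2^(-m) of the cell measure, a decay exactly when p < 6.\<close>

lemma avg_Suc_diff_powr:
  assumes u: "u \<in> L2" and D: "D \<in> L2" "has_weak_grad u D" and p: "2 \<le> p"
  defines "S \<equiv> LINT y|lebesgue. (norm (D y))^2"
  shows "(\<integral>\<^sup>+x. ennreal (abs (avg (Suc m) u x - avg m u x) powr p) \<partial>lebesgue)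
    \<le> ennreal (2 powr (- (1 - p / 6) * m) * S powr (p / 2))"
proof -
  have iD: "integrable lebesgue (\<lambda>y. (norm (D y))^2)" and [measurable]: "D \<in> borel_measurable lebesgue" using L2_D D by auto
  have S0: "0 \<le> S" unfolding S_def by (rule integral_nonneg_AE) auto
  define c where "c = 2 powr (m * p / 6) * S powr (p / 2 - 1)"
  have c0: "0 \<le> c" by (simp add: c_def)
  have pt: "abs (avg (Suc m) u x - avg m u x) powr p \<le> (LINT y:cell m x|lebesgue. c * (norm (D y))^2)" for x
  proof -
    let ?w = "avg (Suc m) u x - avg m u x"
    define I where "I = (LINT y:cell m x|lebesgue. (norm (D y))^2)"
    have I0: "0 \<le> I" unfolding I_def set_lebesgue_integral_def by (rule integral_nonneg_AE) auto
    have IS: "I \<le> S" unfolding I_def S_def by (rule set_integral_mono_UNIV[OF iD]) auto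
    have "abs ?w powr p = (?w^2) powr (p / 2)"
    proof (cases "?w = 0")
      case False
      have "(abs ?w powr 2) powr (p/2) = abs ?w powr p" by (simp only: powr_powr) simp
      moreover have "abs ?w powr 2 = ?w^2" using False powr_realpow[of "abs ?w" 2] by simp
      ultimately show ?thesis by metis
    qed simp
    also have "\<dots> \<le> (2 powr (m / 3) * I) powr (p / 2)" unfolding I_def using p by (intro powr_mono2 avg_Suc_diff u D) auto
    also have "\<dots> = 2 powr (m * p / 6) * I powr (p / 2)" using I0 by (simp add: powr_mult powr_powr)
    also have "I powr (p / 2) = I powr (p / 2 - 1) * I" using I0 powr_add[of I "p/2 - 1" 1] by simp
    also have "2 powr (m * p / 6) * (I powr (p / 2 - 1) * I) \<le> 2 powr (m * p / 6) * (S powr (p / 2 - 1) * I)"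
      using p I0 IS by (intro mult_left_mono mult_right_mono powr_mono2) auto
    finally show ?thesis by (simp add: c_def I_def mult.assoc)
  qed
  have "(\<integral>\<^sup>+x. ennreal (abs (avg (Suc m) u x - avg m u x) powr p) \<partial>lebesgue)
     \<le> (\<integral>\<^sup>+x. (\<integral>\<^sup>+y. indicator (cell m x) y * ennreal (c * (norm (D y))^2) \<partial>lebesgue) \<partial>lebesgue)"
  proof (rule nn_integral_mono)
    fix x
    have "ennreal (abs (avg (Suc m) u x - avg m u x) powr p) \<le> ennreal (LINT y:cell m x|lebesgue. c * (norm (D y))^2)"
      by (rule ennreal_leI[OF pt])
    also have "\<dots> = (\<integral>\<^sup>+y. indicator (cell m x) y * ennreal (c * (norm (D y))^2) \<partial>lebesgue)"
      by (rule ennreal_cell_integral) (use iD c0 in auto)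
    finally show "ennreal (abs (avg (Suc m) u x - avg m u x) powr p) \<le> \<dots>" .
  qed
  also have "\<dots> = ennreal (1 / 2 ^ m) * (\<integral>\<^sup>+y. ennreal (c * (norm (D y))^2) \<partial>lebesgue)"
    by (rule nn_integral_cell) measurable
  also have "\<dots> = ennreal (1 / 2 ^ m) * ennreal (c * S)" using iD c0 by (subst nn_integral_eq_integral) (auto simp: S_def)
  also have "\<dots> = ennreal (1 / 2 ^ m * (c * S))" by (rule ennreal_mult[symmetric]) (use c0 S0 in auto)
  also have "1 / 2 ^ m * (c * S) = (2 powr (m * p / 6) / 2 ^ m) * (S powr (p / 2 - 1) * S)" by (simp add: c_def)
  also have "S powr (p / 2 - 1) * S = S powr (p / 2)" using S0 powr_add[of S "p/2 - 1" 1] by simp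
  also have "2 powr (m * p / 6) / 2 ^ m = 2 powr (- (1 - p / 6) * m)" by (simp add: powr_realpow[symmetric] powr_diff[symmetric] algebra_simps)
  finally show ?thesis .
qed

text \<open>Writing \<open>u - avg k u\<close> as the telescoping series of the differences \<open>w\<^sub>j\<close> of successive
  averages, \<open>B = \<Sum>\<^sub>j |w\<^sub>j|\<^sup>p / \<tau>\<^sup>j\<close> controls the sum, because
  \<open>|w\<^sub>j| \<le> (\<tau>\<^sup>j B)\<^sup>1\<^sup>/\<^sup>p\<close> is a geometric sequence.\<close>

lemma avg_limit:
  assumes u: "u \<in> L2" and D: "D \<in> L2" "has_weak_grad u D" and p: "2 \<le> p" "p < 6"
  defines "S \<equiv> LINT y|lebesgue. (norm (D y))^2"
  defines "\<tau> \<equiv> 2 powr (- (1 - p / 6) / 2)"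
  shows "\<exists>v B. B \<in> borel_measurable lebesgue \<and> (\<forall>x. 0 \<le> B x) \<and>
     (\<integral>\<^sup>+x. ennreal (B x) \<partial>lebesgue) \<le> ennreal (\<tau> ^ (2 * k) / (1 - \<tau>) * S powr (p / 2)) \<and>
     (AE x in lebesgue. (\<lambda>m. avg m u x) \<longlonglongrightarrow> v x \<and>
        (\<forall>n\<ge>k. abs (avg n u x - avg k u x) \<le> B x powr (1 / p) / (1 - \<tau> powr (1 / p))))"
proof -
  have \<tau>: "0 < \<tau>" "\<tau> < 1" using p by (auto simp: \<tau>_def powr_less_one)
  define \<rho> where "\<rho> = \<tau> powr (1 / p)"
  have \<rho>: "0 < \<rho>" "\<rho> < 1" using \<tau> p powr_less_mono2[of "1/p" \<tau> 1] by (auto simp: \<rho>_def)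
  define w where "w j x = abs (avg (Suc j) u x - avg j u x)" for j x
  have [measurable]: "w j \<in> borel_measurable lebesgue" for j unfolding w_def by measurable
  \<comment> \<open>\<open>\<tau>\<close> is the square root of the decay rate of the p-th powers,
    so dividing them by \<open>\<tau> ^ j\<close> still leaves a summable factor
    \<open>\<tau> ^ j\<close>.\<close>
  have \<tau>j: "2 powr (- (1 - p / 6) * real j) = \<tau> ^ (2 * j)" for j
    by (simp add: \<tau>_def powr_power) (rule arg_cong[where f="\<lambda>t. 2 powr t"], simp add: field_simps)
  have wi: "(\<integral>\<^sup>+x. ennreal (w j x powr p) \<partial>lebesgue) \<le> ennreal (\<tau> ^ (2 * j) * S powr (p / 2))" for j
    unfolding w_def S_def \<tau>j[symmetric] by (rule avg_Suc_diff_powr[OF u D p(1)])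
  define Bn where "Bn x = (\<Sum>j. ennreal (w (k + j) x powr p / \<tau> ^ j))" for x
  have [measurable]: "Bn \<in> borel_measurable lebesgue" unfolding Bn_def by measurable
  have "(\<integral>\<^sup>+x. Bn x \<partial>lebesgue) = (\<Sum>j. \<integral>\<^sup>+x. ennreal (w (k + j) x powr p / \<tau> ^ j) \<partial>lebesgue)"
    unfolding Bn_def by (rule nn_integral_suminf) measurable
  also have "\<dots> \<le> (\<Sum>j. ennreal (\<tau> ^ (2 * k) * S powr (p / 2) * \<tau> ^ j))"
  proof (rule suminf_le)
    fix j
    have "(\<integral>\<^sup>+x. ennreal (w (k + j) x powr p / \<tau> ^ j) \<partial>lebesgue)
        = (\<integral>\<^sup>+x. ennreal (1 / \<tau> ^ j) * ennreal (w (k + j) x powr p) \<partial>lebesgue)"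
      using \<tau> by (intro nn_integral_cong) (simp add: ennreal_mult[symmetric])
    also have "\<dots> = ennreal (1 / \<tau> ^ j) * (\<integral>\<^sup>+x. ennreal (w (k + j) x powr p) \<partial>lebesgue)"
      by (rule nn_integral_cmult) measurable
    also have "\<dots> \<le> ennreal (1 / \<tau> ^ j) * ennreal (\<tau> ^ (2 * (k + j)) * S powr (p / 2))" by (rule mult_left_mono[OF wi]) simp
    also have "\<dots> = ennreal (1 / \<tau> ^ j * (\<tau> ^ (2 * (k + j)) * S powr (p / 2)))" by (rule ennreal_mult[symmetric]) (use \<tau> in auto)
    also have "1 / \<tau> ^ j * (\<tau> ^ (2 * (k + j)) * S powr (p / 2)) = \<tau> ^ (2 * k) * S powr (p / 2) * \<tau> ^ j"
    proof -
      have e: "\<tau> ^ (2 * (k + j)) = \<tau> ^ (2 * k) * (\<tau> ^ j * \<tau> ^ j)" by (simp add: algebra_simps flip: power_add)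
      show ?thesis unfolding e using \<tau> by simp
    qed
    finally show "(\<integral>\<^sup>+x. ennreal (w (k + j) x powr p / \<tau> ^ j) \<partial>lebesgue) \<le> ennreal (\<tau> ^ (2 * k) * S powr (p / 2) * \<tau> ^ j)" .
  qed auto
  also have "\<dots> = ennreal (\<Sum>j. \<tau> ^ (2 * k) * S powr (p / 2) * \<tau> ^ j)"
    using \<tau> by (intro suminf_ennreal2) (auto intro!: summable_mult summable_geometric)
  also have "(\<Sum>j. \<tau> ^ (2 * k) * S powr (p / 2) * \<tau> ^ j) = \<tau> ^ (2 * k) / (1 - \<tau>) * S powr (p / 2)"
    using \<tau> by (subst suminf_mult) (auto intro!: summable_geometric simp: suminf_geometric)
  finally have Bi: "(\<integral>\<^sup>+x. Bn x \<partial>lebesgue) \<le> ennreal (\<tau> ^ (2 * k) / (1 - \<tau>) * S powr (p / 2))" .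
  then have "(\<integral>\<^sup>+x. Bn x \<partial>lebesgue) \<noteq> \<infinity>" by (auto simp: top_unique)
  then have fin: "AE x in lebesgue. Bn x \<noteq> \<infinity>" by (intro nn_integral_PInf_AE) auto
  define B where "B x = enn2real (Bn x)" for x
  have B0: "0 \<le> B x" for x by (simp add: B_def)
  have main: "(\<lambda>m. avg m u x) \<longlonglongrightarrow> lim (\<lambda>m. avg m u x) \<and>
     (\<forall>n\<ge>k. abs (avg n u x - avg k u x) \<le> B x powr (1 / p) / (1 - \<rho>))" if "Bn x \<noteq> \<infinity>" for x
  proof -
    have BB: "Bn x = ennreal (B x)" using that by (simp add: B_def ennreal_enn2real top.not_eq_extremum)
    define b where "b = B x powr (1 / p)"
    have wb: "w (k + j) x \<le> b * \<rho> ^ j" for j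
    proof -
      have "ennreal (w (k + j) x powr p / \<tau> ^ j) \<le> Bn x"
        unfolding Bn_def using sum_le_suminf[of "\<lambda>j. ennreal (w (k + j) x powr p / \<tau> ^ j)" "{j}"] by simp
      then have "w (k + j) x powr p / \<tau> ^ j \<le> B x" unfolding BB by (simp add: B0)
      then have "w (k + j) x powr p \<le> B x * \<tau> ^ j" using \<tau> by (simp add: divide_le_eq)
      then have "(w (k + j) x powr p) powr (1 / p) \<le> (B x * \<tau> ^ j) powr (1 / p)" using p by (intro powr_mono2) auto
      moreover have "(w (k + j) x powr p) powr (1 / p) = w (k + j) x" using p by (simp add: powr_powr w_def)
      moreover have "(B x * \<tau> ^ j) powr (1 / p) = b * \<rho> ^ j"
        using \<tau> B0[of x] by (simp add: powr_mult b_def \<rho>_def powr_power powr_powr powr_realpow[symmetric] mult.commute)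
      ultimately show ?thesis by simp
    qed
    have b0: "0 \<le> b" by (simp add: b_def)
    have tel: "avg (k + n) u x - avg k u x = (\<Sum>j<n. avg (Suc (k + j)) u x - avg (k + j) u x)" for n by (induction n) auto
    have sm: "summable (\<lambda>j. avg (Suc (k + j)) u x - avg (k + j) u x)"
    proof (rule summable_comparison_test')
      show "summable (\<lambda>j. b * \<rho> ^ j)" using \<rho> by (intro summable_mult summable_geometric) auto
      show "norm (avg (Suc (k + j)) u x - avg (k + j) u x) \<le> b * \<rho> ^ j" if "j \<ge> 0" for j using wb[of j] by (simp add: w_def)
    qed
    have "(\<lambda>n. avg (k + n) u x) = (\<lambda>n. (\<Sum>j<n. avg (Suc (k + j)) u x - avg (k + j) u x) + avg k u x)"
      by (simp add: tel[symmetric])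
    moreover have "\<dots> \<longlonglongrightarrow> (\<Sum>j. avg (Suc (k + j)) u x - avg (k + j) u x) + avg k u x"
      by (intro tendsto_add tendsto_const summable_LIMSEQ sm)
    ultimately have "(\<lambda>n. avg (n + k) u x) \<longlonglongrightarrow> (\<Sum>j. avg (Suc (k + j)) u x - avg (k + j) u x) + avg k u x"
      by (simp add: add.commute)
    then have "convergent (\<lambda>m. avg m u x)" using LIMSEQ_offset convergent_def by blast
    moreover have "abs (avg n u x - avg k u x) \<le> b / (1 - \<rho>)" if "n \<ge> k" for n
    proof -
      define d where "d = n - k"
      have d: "n = k + d" using that by (simp add: d_def)
      have "abs (avg n u x - avg k u x) \<le> (\<Sum>j<d. w (k + j) x)" unfolding d tel w_def by (rule sum_abs)
      also have "\<dots> \<le> (\<Sum>j<d. b * \<rho> ^ j)" by (rule sum_mono[OF wb])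
      also have "\<dots> \<le> (\<Sum>j. b * \<rho> ^ j)" using \<rho> b0 by (intro sum_le_suminf summable_mult summable_geometric) auto
      also have "\<dots> = b / (1 - \<rho>)" using \<rho> by (subst suminf_mult) (auto intro!: summable_geometric simp: suminf_geometric)
      finally show ?thesis .
    qed
    ultimately show ?thesis by (simp add: convergent_LIMSEQ_iff b_def)
  qed
  show ?thesis
  proof (rule exI[of _ "\<lambda>x. lim (\<lambda>m. avg m u x)"], rule exI[of _ B], intro conjI allI B0)
    show "B \<in> borel_measurable lebesgue" unfolding B_def by measurable
    have "(\<integral>\<^sup>+x. ennreal (B x) \<partial>lebesgue) = (\<integral>\<^sup>+x. Bn x \<partial>lebesgue)"
      by (rule nn_integral_cong_AE, rule AE_mp[OF fin])
        (auto simp: B_def ennreal_enn2real top.not_eq_extremum)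
    then show "(\<integral>\<^sup>+x. ennreal (B x) \<partial>lebesgue) \<le> ennreal (\<tau> ^ (2 * k) / (1 - \<tau>) * S powr (p / 2))"
      using Bi by simp
    show "AE x in lebesgue. (\<lambda>m. avg m u x) \<longlonglongrightarrow> lim (\<lambda>m. avg m u x) \<and>
        (\<forall>n\<ge>k. abs (avg n u x - avg k u x) \<le> B x powr (1 / p) / (1 - \<tau> powr (1 / p)))"
      by (rule AE_mp[OF fin], rule AE_I2, rule impI, unfold \<rho>_def[symmetric]) (rule main)
  qed
qed

text \<open>A martingale argument: the averages converge almost everywhere with an integrable
  majorant on each cell, so by the tower property their limit has the cell integrals of
  \<open>u\<close>, and cell integrals determine a locally integrable function.\<close>

lemma avg_tendsto_AE:
  assumes u: "u \<in> L2" and D: "D \<in> L2" "has_weak_grad u D"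
  shows "AE x in lebesgue. (\<lambda>m. avg m u x) \<longlonglongrightarrow> u x"
proof -
  have um[measurable]: "u \<in> borel_measurable lebesgue" using L2_D u by auto
  note lu = L2_loc_integrable[OF u]
  define v where "v x = lim (\<lambda>m. avg m u x)" for x
  have [measurable]: "v \<in> borel_measurable lebesgue" unfolding v_def by measurable
  have ex: "\<exists>B. integrable lebesgue B \<and> (AE x in lebesgue. (\<lambda>m. avg m u x) \<longlonglongrightarrow> v x \<and>
        (\<forall>n\<ge>k. abs (avg n u x - avg k u x) \<le> 1 / (1 - (2 powr (-1/3)) powr (1/2)) * (1 + B x)))" for k
  proof -
    obtain v' B where B: "B \<in> borel_measurable lebesgue" "\<And>x. 0 \<le> B x"
      "(\<integral>\<^sup>+x. ennreal (B x) \<partial>lebesgue) \<le> ennreal ((2 powr (- (1 - 2 / 6) / 2)) ^ (2 * k) / (1 - 2 powr (- (1 - 2 / 6) / 2)) * (LINT y|lebesgue. (norm (D y))^2) powr (2 / 2))"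
      and ae: "AE x in lebesgue. (\<lambda>m. avg m u x) \<longlonglongrightarrow> v' x \<and>
        (\<forall>n\<ge>k. abs (avg n u x - avg k u x) \<le> B x powr (1 / 2) / (1 - (2 powr (- (1 - 2 / 6) / 2)) powr (1 / 2)))"
      using avg_limit[OF u D, of 2 k] by auto
    have iB: "integrable lebesgue B" by (rule integrableI_bounded) (use B in \<open>auto intro: le_less_trans\<close>)
    have r: "(2 powr (-1/3)) powr (1/2) < (1::real)" by (simp add: powr_powr powr_less_one)
    have "AE x in lebesgue. (\<lambda>m. avg m u x) \<longlonglongrightarrow> v x \<and>
        (\<forall>n\<ge>k. abs (avg n u x - avg k u x) \<le> 1 / (1 - (2 powr (-1/3)) powr (1/2)) * (1 + B x))"
    proof (rule AE_mp[OF ae], intro AE_I2 impI)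
      fix x assume x: "(\<lambda>m. avg m u x) \<longlonglongrightarrow> v' x \<and>
        (\<forall>n\<ge>k. abs (avg n u x - avg k u x) \<le> B x powr (1 / 2) / (1 - (2 powr (- (1 - 2 / 6) / 2)) powr (1 / 2)))"
      \<comment> \<open>The majorant at hand is the root of an integrable function; 1 + B is
        integrable over a cell.\<close>
      have s: "B x powr (1/2) \<le> 1 + B x"
      proof -
        have "(sqrt (B x) - 1)^2 \<ge> 0" by simp
        then have "2 * sqrt (B x) \<le> 1 + B x" using B(2)[of x] by (simp add: power2_diff)
        then show ?thesis using B(2)[of x] by (simp add: powr_half_sqrt)
      qed
      have "v x = v' x" unfolding v_def using x limI by blast
      moreover have "abs (avg n u x - avg k u x) \<le> 1 / (1 - (2 powr (-1/3)) powr (1/2)) * (1 + B x)" if "n \<ge> k" for n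
      proof -
        have "abs (avg n u x - avg k u x) \<le> B x powr (1 / 2) / (1 - (2 powr (-1/3)) powr (1 / 2))" using x that by simp
        also have "\<dots> \<le> (1 + B x) / (1 - (2 powr (-1/3)) powr (1 / 2))" using s r by (intro divide_right_mono) auto
        finally show ?thesis by simp
      qed
      ultimately show "(\<lambda>m. avg m u x) \<longlonglongrightarrow> v x \<and> (\<forall>n\<ge>k. abs (avg n u x - avg k u x) \<le> 1 / (1 - (2 powr (-1/3)) powr (1/2)) * (1 + B x))"
        using x by auto
    qed
    with iB show ?thesis by blast
  qed
  have cellv: "set_integrable lebesgue (cell k z) v \<and> (LINT x:cell k z|lebesgue. v x) = (LINT x:cell k z|lebesgue. u x)" for k z
  proof -
    let ?c = "cell k z" and ?C = "1 / (1 - (2 powr (-1/3)) powr (1/2)) :: real"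
    obtain B where B: "integrable lebesgue B" and ae: "AE x in lebesgue. (\<lambda>m. avg m u x) \<longlonglongrightarrow> v x \<and>
        (\<forall>n\<ge>k. abs (avg n u x - avg k u x) \<le> ?C * (1 + B x))" using ex[of k] by auto
    let ?s = "\<lambda>n x. indicator ?c x * avg (n + k) u x" and ?f = "\<lambda>x. indicator ?c x * v x"
    let ?W = "\<lambda>x. indicator ?c x *\<^sub>R (abs (avg k u z) + ?C) + ?C * abs (B x)"
    have r: "(2 powr (-1/3)) powr (1/2) < (1::real)" by (simp add: powr_powr powr_less_one)
    have W: "integrable lebesgue ?W"
      using B cell_lmeasurable[of k z] by (intro Bochner_Integration.integrable_add integrable_mult_right integrable_abs)
        (auto simp: fmeasurable_def)
    have lim: "AE x in lebesgue. (\<lambda>n. ?s n x) \<longlonglongrightarrow> ?f x"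
      by (rule AE_mp[OF ae], rule AE_I2, rule impI) (intro tendsto_mult tendsto_const LIMSEQ_ignore_initial_segment, blast)
    \<comment> \<open>On the cell the coarse average is the constant \<open>avg k u z\<close>, so
      the uniform distance from it bounds all finer averages at once.\<close>
    have dom: "AE x in lebesgue. norm (?s n x) \<le> ?W x" for n
    proof (rule AE_mp[OF ae], intro AE_I2 impI)
      fix x assume "(\<lambda>m. avg m u x) \<longlonglongrightarrow> v x \<and> (\<forall>n\<ge>k. abs (avg n u x - avg k u x) \<le> ?C * (1 + B x))"
      then have "abs (avg (n + k) u x - avg k u x) \<le> ?C * (1 + B x)" by simp
      also have "\<dots> \<le> ?C * (1 + abs (B x))" using r by (intro mult_left_mono) auto
      finally have a: "abs (avg (n + k) u x) \<le> abs (avg k u x) + ?C + ?C * abs (B x)" by (simp add: algebra_simps add_divide_distrib)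
      show "norm (?s n x) \<le> ?W x"
      proof (cases "x \<in> ?c")
        case True
        then show ?thesis using a avg_cell[OF True, of u] by simp
      next
        case False
        then show ?thesis using r by simp
      qed
    qed
    have m: "?f \<in> borel_measurable lebesgue" "\<And>n. ?s n \<in> borel_measurable lebesgue" by measurable
    have "integrable lebesgue ?f" by (rule integrable_dominated_convergence[OF m W lim dom])
    moreover have "(\<lambda>n. LINT x|lebesgue. ?s n x) \<longlonglongrightarrow> (LINT x|lebesgue. ?f x)"
      by (rule integral_dominated_convergence[OF m W lim dom])
    moreover have "(LINT x|lebesgue. ?s n x) = (LINT x:?c|lebesgue. u x)" for n
      using cell_integral_avg(2)[OF lu um, of k "n + k" z] by (simp add: set_lebesgue_integral_def)
    ultimately show ?thesis by (simp add: set_integrable_def set_lebesgue_integral_def LIMSEQ_const_iff)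
  qed
  have "AE y in lebesgue. indicator (cell 0 x) y * (u y - v y) = 0" for x
  proof (rule cell_integrals_zero)
    have iuv: "integrable lebesgue (\<lambda>y. indicator (cell 0 x) y * (u y - v y))"
      using set_integral_diff(1)[OF loc_integrable_cell[OF lu] conjunct1[OF cellv]] by (simp add: set_integrable_def)
    show "loc_integrable (\<lambda>y. indicator (cell 0 x) y * (u y - v y))" unfolding loc_integrable_def set_integrable_def
      by (intro allI impI integrable_mult_indicator iuv) (simp add: lmeasurable_compact fmeasurableD)
    fix m z
    have uv: "(LINT y:cell n t|lebesgue. u y - v y) = 0" for n t
      using set_integral_diff(2)[OF loc_integrable_cell[OF lu, of n t] conjunct1[OF cellv]] conjunct2[OF cellv[of n t]] by simp
    show "(LINT y:cell m z|lebesgue. indicator (cell 0 x) y * (u y - v y)) = 0"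
    proof (cases "cell m z \<inter> cell 0 x = {}")
      case True
      then have *: "indicator (cell m z) y * (indicator (cell 0 x) y * (u y - v y)) = 0" for y by (auto simp: indicator_def)
      show ?thesis unfolding set_lebesgue_integral_def real_scaleR_def * by simp
    next
      case False
      then obtain y where y: "y \<in> cell m z" "y \<in> cell 0 x" by blast
      then have "cell m y \<subseteq> cell 0 y" using cell_mono by blast
      then have "cell m z \<subseteq> cell 0 x" using y cell_eq by metis
      then have *: "indicator (cell m z) y * (indicator (cell 0 x) y * (u y - v y)) = indicator (cell m z) y * (u y - v y)" for y
        by (auto simp: indicator_def)
      show ?thesis using uv[of m z] unfolding set_lebesgue_integral_def real_scaleR_def * .
    qed
  qed
  then have "AE y in lebesgue. \<forall>j::3=>int. indicator (cell 0 (\<chi> i. of_int (j i))) y * (u y - v y) = 0"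
    unfolding AE_all_countable by blast
  moreover obtain B where "AE x in lebesgue. (\<lambda>m. avg m u x) \<longlonglongrightarrow> v x \<and>
        (\<forall>n\<ge>0. abs (avg n u x - avg 0 u x) \<le> 1 / (1 - (2 powr (-1/3)) powr (1/2)) * (1 + B x))" using ex[of 0] by blast
  ultimately show ?thesis
  proof eventually_elim
    case (elim y)
    have "y \<in> cell 0 (\<chi> i. of_int (cell_index 0 y i))" by (simp add: cell_def cell_index_def[abs_def])
    with elim(1) have "u y - v y = 0" by (metis indicator_simps(1) mult_1)
    with elim(2) show ?case by simp
  qed
qed

text \<open>The uniform bound on differences of averages is passed to the limit in the finer
  generation, where the average becomes \<open>u\<close>; the rate \<open>\<theta>\<close> is
  \<open>\<tau>^2\<close>. This smallness, uniform on bounded sets, is the common source of the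
  embedding, of local compactness and of non-vanishing.\<close>

lemma avg_approx:
  assumes p: "2 \<le> p" "p < 6"
  obtains C \<theta> where "C > 0" "0 < \<theta>" "\<theta> < 1"
    "\<And>u D k. u \<in> L2 ==> D \<in> L2 ==> has_weak_grad u D ==>
      integrable lebesgue (\<lambda>x. abs (u x - avg k u x) powr p) \<and>
      (LINT x|lebesgue. abs (u x - avg k u x) powr p) \<le> C * \<theta> ^ k * (LINT y|lebesgue. (norm (D y))^2) powr (p / 2)"
proof -
  define \<tau> where "\<tau> = 2 powr (- (1 - p / 6) / 2)"
  have \<tau>: "0 < \<tau>" "\<tau> < 1" using p by (auto simp: \<tau>_def powr_less_one)
  define \<rho> where "\<rho> = \<tau> powr (1 / p)"
  have \<rho>: "0 < \<rho>" "\<rho> < 1" using \<tau> p powr_less_mono2[of "1/p" \<tau> 1] by (auto simp: \<rho>_def)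
  define K where "K = (1 / (1 - \<rho>)) powr p"
  have K: "K > 0" using \<rho> by (simp add: K_def)
  show ?thesis
  proof (rule that[of "K / (1 - \<tau>)" "\<tau>^2"])
    show "K / (1 - \<tau>) > 0" "0 < \<tau>^2" "\<tau>^2 < 1" using \<tau> K by (auto simp: power_less_one_iff)
    fix u :: "real^3 => real" and D :: "real^3 => real^3" and k
    assume u: "u \<in> L2" and D: "D \<in> L2" "has_weak_grad u D"
    let ?S = "LINT y|lebesgue. (norm (D y))^2"
    have [measurable]: "u \<in> borel_measurable lebesgue" using L2_D u by auto
    obtain v B where B: "B \<in> borel_measurable lebesgue" "\<And>x. 0 \<le> B x"
      "(\<integral>\<^sup>+x. ennreal (B x) \<partial>lebesgue) \<le> ennreal (\<tau> ^ (2 * k) / (1 - \<tau>) * ?S powr (p / 2))"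
      and ae: "AE x in lebesgue. (\<lambda>m. avg m u x) \<longlonglongrightarrow> v x \<and>
        (\<forall>n\<ge>k. abs (avg n u x - avg k u x) \<le> B x powr (1 / p) / (1 - \<rho>))"
      using avg_limit[OF u D p, of k] unfolding \<tau>_def[symmetric] \<rho>_def[symmetric] by auto
    have le: "AE x in lebesgue. abs (u x - avg k u x) powr p \<le> K * B x" using ae avg_tendsto_AE[OF u D]
    proof eventually_elim
      case (elim x)
      have "(\<lambda>n. abs (avg n u x - avg k u x)) \<longlonglongrightarrow> abs (u x - avg k u x)" by (intro tendsto_intros elim)
      then have "abs (u x - avg k u x) \<le> B x powr (1 / p) / (1 - \<rho>)" by (rule LIMSEQ_le_const2) (use elim in auto)
      then have "abs (u x - avg k u x) powr p \<le> (B x powr (1 / p) / (1 - \<rho>)) powr p" using p by (intro powr_mono2) auto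
      also have "\<dots> = K * B x" using p \<rho> B(2)[of x] by (simp add: K_def powr_divide powr_powr)
      finally show ?case .
    qed
    have iB: "integrable lebesgue B" by (rule integrableI_bounded) (use B in \<open>auto intro: le_less_trans\<close>)
    have i: "integrable lebesgue (\<lambda>x. abs (u x - avg k u x) powr p)"
      by (rule Bochner_Integration.integrable_bound[OF integrable_mult_right[OF iB, of K]])
        (use le K B(2) in \<open>auto simp: abs_mult\<close>)
    have "(LINT x|lebesgue. B x) \<le> \<tau> ^ (2 * k) / (1 - \<tau>) * ?S powr (p / 2)"
    proof -
      have "ennreal (LINT x|lebesgue. B x) = (\<integral>\<^sup>+x. ennreal (B x) \<partial>lebesgue)"
        using iB B by (intro nn_integral_eq_integral[symmetric]) auto
      with B(3) have "ennreal (LINT x|lebesgue. B x) \<le> ennreal (\<tau> ^ (2 * k) / (1 - \<tau>) * ?S powr (p / 2))" by simp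
      then show ?thesis using \<tau> by (subst (asm) ennreal_le_iff) auto
    qed
    moreover have "(LINT x|lebesgue. abs (u x - avg k u x) powr p) \<le> (LINT x|lebesgue. K * B x)"
      by (rule integral_mono_AE[OF i _ le]) (use iB in simp)
    ultimately have "(LINT x|lebesgue. abs (u x - avg k u x) powr p) \<le> K * (\<tau> ^ (2 * k) / (1 - \<tau>) * ?S powr (p / 2))"
      using K by (simp only: integral_mult_right_zero) (meson less_imp_le mult_left_mono order_trans)
    then show "integrable lebesgue (\<lambda>x. abs (u x - avg k u x) powr p) \<and>
      (LINT x|lebesgue. abs (u x - avg k u x) powr p) \<le> K / (1 - \<tau>) * (\<tau>^2) ^ k * ?S powr (p / 2)" using i by (simp add: power_mult)
  qed
qed

section \<open>Weak gradients and completeness\<close>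

lemma pderiv_at_outside:
  assumes "closed K" "\<And>x. x \<notin> K ==> \<phi> x = 0" "x \<notin> K"
  shows "pderiv_at i \<phi> x = 0"
proof -
  have "open (- K)" "x \<in> - K" using assms by auto
  then have "((\<lambda>y. 0) has_derivative (\<lambda>h. 0)) (at x)" by simp
  then have "(\<phi> has_derivative (\<lambda>h. 0)) (at x)"
    by (rule has_derivative_transform_within_open[OF _ \<open>open (- K)\<close> \<open>x \<in> - K\<close>]) (use assms in auto)
  from frechet_derivative_at[OF this] show ?thesis by (metis pderiv_at_def)
qed

lemma continuous_lebesgue_measurable: "continuous_on UNIV \<psi> ==> (\<psi> :: real^3 => real) \<in> borel_measurable lebesgue"
  by (simp add: measurable_completion borel_measurable_continuous_onI)

lemma compact_support_bounded:
  fixes \<psi> :: "real^3 => real"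
  assumes "continuous_on UNIV \<psi>" "compact K" "\<And>x. x \<notin> K ==> \<psi> x = 0"
  obtains B where "B > 0" "\<And>x. abs (\<psi> x) \<le> B * indicator K x"
proof -
  have "bounded (\<psi> ` K)" by (intro compact_imp_bounded compact_continuous_image continuous_on_subset[OF assms(1)] assms(2)) simp
  then obtain B where B: "B > 0" "\<forall>y\<in>\<psi> ` K. norm y \<le> B" using bounded_pos by blast
  show ?thesis by (rule that[OF B(1)]) (use B(2) assms(3) in \<open>auto simp: indicator_def\<close>)
qed

lemma integrable_loc_compact_support:
  fixes u \<psi> :: "real^3 => real"
  assumes u: "loc_integrable u" and \<psi>: "continuous_on UNIV \<psi>" "compact K" "\<And>x. x \<notin> K ==> \<psi> x = 0"
  shows "integrable lebesgue (\<lambda>x. u x * \<psi> x)"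
proof -
  obtain B where B: "B > 0" "\<And>x. abs (\<psi> x) \<le> B * indicator K x"
    by (rule compact_support_bounded[OF \<psi>]) (assumption, (rule that; assumption))
  have i: "integrable lebesgue (\<lambda>x. indicator K x * u x)" using u \<psi>(2) by (simp add: loc_integrable_def set_integrable_def)
  have eq: "u x * \<psi> x = (indicator K x * u x) * \<psi> x" for x using \<psi>(3)[of x] by (auto simp: indicator_def)
  show ?thesis
  proof (rule Bochner_Integration.integrable_bound)
    show "integrable lebesgue (\<lambda>x. B * (indicator K x * u x))" using i by simp
    show "(\<lambda>x. u x * \<psi> x) \<in> borel_measurable lebesgue"
      unfolding eq by (rule borel_measurable_times[OF borel_measurable_integrable[OF i] continuous_lebesgue_measurable[OF \<psi>(1)]])
    show "AE x in lebesgue. norm (u x * \<psi> x) \<le> norm (B * (indicator K x * u x))"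
      using mult_left_mono[OF B(2), of "abs (u _)"] B(1) by (intro AE_I2) (simp add: abs_mult ac_simps)
  qed
qed

lemma compact_support_L2:
  fixes \<psi> :: "real^3 => real"
  assumes \<psi>: "continuous_on UNIV \<psi>" "compact K" "\<And>x. x \<notin> K ==> \<psi> x = 0"
  shows "\<psi> \<in> L2"
proof -
  obtain B where B: "B > 0" "\<And>x. abs (\<psi> x) \<le> B * indicator K x"
    by (rule compact_support_bounded[OF \<psi>]) (assumption, (rule that; assumption))
  have [measurable]: "\<psi> \<in> borel_measurable lebesgue" by (rule continuous_lebesgue_measurable[OF \<psi>(1)])
  have "integrable lebesgue (\<lambda>x. (\<psi> x)^2)"
  proof (rule Bochner_Integration.integrable_bound)
    show "integrable lebesgue (\<lambda>x. B^2 * indicator K x :: real)"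
      using lmeasurable_compact[OF \<psi>(2)] by (intro integrable_mult_right) (auto simp: fmeasurable_def)
    have "(\<psi> x)^2 \<le> B^2 * indicator K x" for x using power_mono[OF B(2)[of x], of 2] by (auto simp: indicator_def)
    then show "AE x in lebesgue. norm ((\<psi> x)^2) \<le> norm (B^2 * indicator K x :: real)" by (intro AE_I2) (simp add: abs_mult)
  qed simp
  then show ?thesis by (simp add: L2_real_iff)
qed

lemma test_fun_cases:
  assumes "test_fun \<phi>"
  obtains K where "compact K" "continuous_on UNIV \<phi>" "\<And>x. x \<notin> K ==> \<phi> x = 0"
    "\<And>i. continuous_on UNIV (pderiv_at i \<phi>)" "\<And>i x. x \<notin> K ==> pderiv_at i \<phi> x = 0"
proof -
  obtain K where K: "compact K" "\<And>x. x \<notin> K ==> \<phi> x = 0" using assms unfolding test_fun_def by blast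
  have "Ck 0 \<phi>" "Ck (Suc 0) \<phi>" using assms unfolding test_fun_def by blast+
  then have "continuous_on UNIV \<phi>" "\<And>i. continuous_on UNIV (pderiv_at i \<phi>)" by auto
  moreover have "pderiv_at i \<phi> x = 0" if "x \<notin> K" for i x by (rule pderiv_at_outside[OF compact_imp_closed[OF K(1)] K(2) that])
  ultimately show ?thesis using that K by blast
qed

lemma loc_integrable_component:
  assumes "loc_integrable (D :: real^3 => real^3)" shows "loc_integrable (\<lambda>x. D x $ i)" unfolding loc_integrable_def set_integrable_def
proof (intro allI impI)
  fix K :: "(real^3) set" assume "compact K"
  then have "integrable lebesgue (\<lambda>x. indicator K x *\<^sub>R D x)" using assms by (simp add: loc_integrable_def set_integrable_def)
  then have "integrable lebesgue (\<lambda>x. (indicator K x *\<^sub>R D x) \<bullet> axis i 1)" by (intro integrable_inner_left) auto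
  then show "integrable lebesgue (\<lambda>x. indicator K x *\<^sub>R D x $ i)" by (simp add: inner_axis)
qed

lemma loc_integrable_lin:
  fixes u v :: "real^3 => 'b::euclidean_space"
  shows "loc_integrable u ==> loc_integrable v ==> loc_integrable (\<lambda>x. a *\<^sub>R u x + b *\<^sub>R v x)"
proof -
  assume u: "loc_integrable u" and v: "loc_integrable v"
  have eq: "indicator K x *\<^sub>R (a *\<^sub>R u x + b *\<^sub>R v x) =
      a *\<^sub>R (indicator K x *\<^sub>R u x) + b *\<^sub>R (indicator K x *\<^sub>R v x)" for K x by (simp add: scaleR_add_right mult.commute)
  show ?thesis unfolding loc_integrable_def set_integrable_def eq
  proof (intro allI impI Bochner_Integration.integrable_add integrable_scaleR_right)
    fix K :: "(real^3) set" assume "compact K"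
    then show "integrable lebesgue (\<lambda>x. indicator K x *\<^sub>R u x)" "integrable lebesgue (\<lambda>x. indicator K x *\<^sub>R v x)"
      using u v by (auto simp: loc_integrable_def set_integrable_def)
  qed
qed

lemma has_weak_gradD:
  "has_weak_grad u D ==> test_fun \<phi> ==>
    (LINT x|lebesgue. u x * pderiv_at i \<phi> x) = - (LINT x|lebesgue. D x $ i * \<phi> x)" by (simp add: has_weak_grad_def)

lemma has_weak_grad_lin:
  assumes "has_weak_grad u D" "has_weak_grad v E"
  shows "has_weak_grad (\<lambda>x. a * u x + b * v x) (\<lambda>x. a *\<^sub>R D x + b *\<^sub>R E x)"
proof -
  have l: "loc_integrable u" "loc_integrable D" "loc_integrable v" "loc_integrable E" using assms by (auto simp: has_weak_grad_def)
  show ?thesis unfolding has_weak_grad_def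
  proof (intro conjI allI impI)
    show "loc_integrable (\<lambda>x. a * u x + b * v x)" using loc_integrable_lin[OF l(1,3)] by simp
    show "loc_integrable (\<lambda>x. a *\<^sub>R D x + b *\<^sub>R E x)" by (rule loc_integrable_lin[OF l(2,4)])
    fix \<phi> i assume \<phi>: "test_fun \<phi>"
    obtain K where K: "compact K" "continuous_on UNIV \<phi>" "\<And>x. x \<notin> K ==> \<phi> x = 0"
      "\<And>i. continuous_on UNIV (pderiv_at i \<phi>)" "\<And>i x. x \<notin> K ==> pderiv_at i \<phi> x = 0"
      by (rule test_fun_cases[OF \<phi>]) (rule that; assumption)
    have i: "integrable lebesgue (\<lambda>x. u x * pderiv_at i \<phi> x)" "integrable lebesgue (\<lambda>x. v x * pderiv_at i \<phi> x)"
      by (rule integrable_loc_compact_support[OF l(1) K(4,1,5)], assumption)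
        (rule integrable_loc_compact_support[OF l(3) K(4,1,5)], assumption)
    have j: "integrable lebesgue (\<lambda>x. D x $ i * \<phi> x)" "integrable lebesgue (\<lambda>x. E x $ i * \<phi> x)"
      by (rule integrable_loc_compact_support[OF loc_integrable_component K(2) K(1) K(3)], rule l, assumption)+
    have e: "(LINT x|lebesgue. u x * pderiv_at i \<phi> x) = - (LINT x|lebesgue. D x $ i * \<phi> x)"
      "(LINT x|lebesgue. v x * pderiv_at i \<phi> x) = - (LINT x|lebesgue. E x $ i * \<phi> x)"
      using assms \<phi> unfolding has_weak_grad_def by blast+
    have "(LINT x|lebesgue. (a * u x + b * v x) * pderiv_at i \<phi> x)
        = (LINT x|lebesgue. a * (u x * pderiv_at i \<phi> x) + b * (v x * pderiv_at i \<phi> x))" by (simp add: algebra_simps)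
    also have "\<dots> = a * (LINT x|lebesgue. u x * pderiv_at i \<phi> x) + b * (LINT x|lebesgue. v x * pderiv_at i \<phi> x)"
      using i by (subst Bochner_Integration.integral_add) auto
    also have "\<dots> = - (a * (LINT x|lebesgue. D x $ i * \<phi> x) + b * (LINT x|lebesgue. E x $ i * \<phi> x))" unfolding e by simp
    also have "a * (LINT x|lebesgue. D x $ i * \<phi> x) + b * (LINT x|lebesgue. E x $ i * \<phi> x)
        = (LINT x|lebesgue. a * (D x $ i * \<phi> x) + b * (E x $ i * \<phi> x))" using j by (subst Bochner_Integration.integral_add) auto
    also have "\<dots> = (LINT x|lebesgue. (a *\<^sub>R D x + b *\<^sub>R E x) $ i * \<phi> x)" by (simp add: algebra_simps)
    finally show "(LINT x|lebesgue. (a * u x + b * v x) * pderiv_at i \<phi> x)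
       = - (LINT x|lebesgue. (a *\<^sub>R D x + b *\<^sub>R E x) $ i * \<phi> x)" .
  qed
qed

lemma loc_integrable_measurable:
  fixes D :: "real^3 => 'b::euclidean_space"
  assumes "loc_integrable D" shows "D \<in> borel_measurable lebesgue"
proof (rule borel_measurable_LIMSEQ_metric)
  show "(\<lambda>x. indicator (cball 0 (real n)) x *\<^sub>R D x) \<in> borel_measurable lebesgue" for n
    using assms compact_cball[of 0 "real n"] unfolding loc_integrable_def set_integrable_def by (meson borel_measurable_integrable)
  show "(\<lambda>n. indicator (cball 0 (real n)) x *\<^sub>R D x) \<longlonglongrightarrow> D x" for x
  proof (rule tendsto_eventually)
    obtain N where "norm x \<le> real N" using real_arch_simple by blast
    then show "eventually (\<lambda>n. indicator (cball 0 (real n)) x *\<^sub>R D x = D x) sequentially"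
      by (intro eventually_sequentiallyI[of N]) (auto simp: indicator_def)
  qed
qed

lemma has_weak_grad_cong:
  assumes "has_weak_grad u D" "AE x in lebesgue. u x = v x" "AE x in lebesgue. D x = E x"
    "loc_integrable v" "loc_integrable E"
  shows "has_weak_grad v E" unfolding has_weak_grad_def
proof (intro conjI allI impI assms(4,5))
  fix \<phi> i assume \<phi>: "test_fun \<phi>"
  obtain K where K: "compact K" "continuous_on UNIV \<phi>" "\<And>x. x \<notin> K ==> \<phi> x = 0"
      "\<And>i. continuous_on UNIV (pderiv_at i \<phi>)" "\<And>i x. x \<notin> K ==> pderiv_at i \<phi> x = 0"
    by (rule test_fun_cases[OF \<phi>]) (rule that; assumption)
  have [measurable]: "\<phi> \<in> borel_measurable lebesgue" "pderiv_at i \<phi> \<in> borel_measurable lebesgue"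
    by (rule continuous_lebesgue_measurable, rule K)+
  have m: "u \<in> borel_measurable lebesgue" "v \<in> borel_measurable lebesgue"
    "D \<in> borel_measurable lebesgue" "E \<in> borel_measurable lebesgue" using assms by (auto simp: has_weak_grad_def loc_integrable_measurable)
  note [measurable] = m(1,2) measurable_component[OF m(3)] measurable_component[OF m(4)]
  have "(LINT x|lebesgue. v x * pderiv_at i \<phi> x) = (LINT x|lebesgue. u x * pderiv_at i \<phi> x)"
    by (rule integral_cong_AE) (use assms(2) in auto)
  also have "\<dots> = - (LINT x|lebesgue. D x $ i * \<phi> x)" using assms(1) \<phi> unfolding has_weak_grad_def by blast
  also have "(LINT x|lebesgue. D x $ i * \<phi> x) = (LINT x|lebesgue. E x $ i * \<phi> x)" by (rule integral_cong_AE) (use assms(3) in auto)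
  finally show "(LINT x|lebesgue. v x * pderiv_at i \<phi> x) = - (LINT x|lebesgue. E x $ i * \<phi> x)" .
qed

text \<open>Box cutoffs are test functions and approximate cells, so every component of the
  difference of two weak gradients has vanishing cell integrals.\<close>

lemma has_weak_grad_unique:
  assumes "has_weak_grad u D" "has_weak_grad u E"
  shows "AE x in lebesgue. D x = E x"
proof -
  have l: "loc_integrable D" "loc_integrable E" using assms by (auto simp: has_weak_grad_def)
  have "AE x in lebesgue. D x $ i - E x $ i = 0" for i
  proof (rule cell_integrals_zero)
    have li: "loc_integrable (\<lambda>x. D x $ i)" "loc_integrable (\<lambda>x. E x $ i)" by (rule loc_integrable_component, rule l)+
    show lf: "loc_integrable (\<lambda>x. D x $ i - E x $ i)" using loc_integrable_lin[OF li, of 1 "-1"] by simp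
    fix m z
    have "(LINT y:cell m z|lebesgue. D y $ i - E y $ i) = (LINT y:box (cell_min m z) (cell_max m z)|lebesgue. D y $ i - E y $ i)"
      unfolding cell_half_box by (rule half_box_set_integral[OF loc_integrable_measurable[OF lf]])
    also have "\<dots> = 0"
    proof (rule box_integrals_zero[OF lf])
      fix n
      let ?\<phi> = "box_cutoff n (cell_min m z) (cell_max m z)"
      have "(LINT x|lebesgue. D x $ i * ?\<phi> x) = (LINT x|lebesgue. E x $ i * ?\<phi> x)"
        using has_weak_gradD[OF assms(1) test_fun_box_cutoff, of i n "cell_min m z" "cell_max m z"]
          has_weak_gradD[OF assms(2) test_fun_box_cutoff, of i n "cell_min m z" "cell_max m z"] by simp
      then show "(LINT x|lebesgue. (D x $ i - E x $ i) * ?\<phi> x) = 0" unfolding left_diff_distrib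
        by (subst Bochner_Integration.integral_diff) (auto intro!: integral_box_cutoff_tendsto(1) li)
    qed
    finally show "(LINT y:cell m z|lebesgue. D y $ i - E y $ i) = 0" .
  qed
  then have "AE x in lebesgue. \<forall>i\<in>UNIV. D x $ i - E x $ i = 0" by (intro AE_finite_allI) auto
  then show ?thesis by (rule AE_mp) (auto simp: vec_eq_iff)
qed

lemma L2_cong_AE:
  assumes "u \<in> L2" "v \<in> borel_measurable lebesgue" "AE x in lebesgue. u x = v x"
  shows "v \<in> L2"
proof -
  have "integrable lebesgue (\<lambda>x. (norm (v x))^2)" by (rule Bochner_Integration.integrable_cong_AE_imp[OF L2_D(2)[OF assms(1)]])
      (use assms in auto)
  with assms(2) show ?thesis by (auto simp: L2_def)
qed

text \<open>The choice in \<open>wgrad\<close> may return another weak gradient than the square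
  integrable one in the definition of \<open>H1\<close>; uniqueness transfers the
  integrability.\<close>

lemma wgrad_H1:
  assumes "u \<in> H1" shows "has_weak_grad u (wgrad u)" "wgrad u \<in> L2"
proof -
  obtain D where D: "D \<in> L2" "has_weak_grad u D" using assms by (auto simp: H1_def)
  show w: "has_weak_grad u (wgrad u)" unfolding wgrad_def using D(2) by (rule someI[where P="has_weak_grad u"])
  then have "wgrad u \<in> borel_measurable lebesgue" by (intro loc_integrable_measurable) (simp add: has_weak_grad_def)
  then show "wgrad u \<in> L2" by (rule L2_cong_AE[OF D(1)]) (rule has_weak_grad_unique[OF D(2) w])
qed

lemma wgrad_eq_AE: "has_weak_grad u D ==> AE x in lebesgue. wgrad u x = D x"
  by (rule has_weak_grad_unique[of u]) (auto simp: wgrad_def intro: someI[where P="has_weak_grad u"])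

section \<open>Completeness of L2 and closedness of the weak gradient\<close>

lemma L2_lin:
  fixes u v :: "real^3 => 'b::euclidean_space"
  assumes "u \<in> L2" "v \<in> L2" shows "(\<lambda>x. a *\<^sub>R u x + b *\<^sub>R v x) \<in> L2"
proof -
  have [measurable]: "u \<in> borel_measurable lebesgue" "v \<in> borel_measurable lebesgue" using assms L2_D by auto
  have "integrable lebesgue (\<lambda>x. (norm (a *\<^sub>R u x + b *\<^sub>R v x))^2)"
  proof (rule Bochner_Integration.integrable_bound)
    show "integrable lebesgue (\<lambda>x. 2 * a^2 * (norm (u x))^2 + 2 * b^2 * (norm (v x))^2)"
      by (intro Bochner_Integration.integrable_add integrable_mult_right L2_D assms)
    have "(norm (a *\<^sub>R u x + b *\<^sub>R v x))^2 \<le> 2 * a^2 * (norm (u x))^2 + 2 * b^2 * (norm (v x))^2" for x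
    proof -
      have "(norm (a *\<^sub>R u x + b *\<^sub>R v x))^2 \<le> (norm (a *\<^sub>R u x) + norm (b *\<^sub>R v x))^2"
        by (intro power_mono norm_triangle_ineq) auto
      also have "\<dots> \<le> 2 * (norm (a *\<^sub>R u x))^2 + 2 * (norm (b *\<^sub>R v x))^2"
        using zero_le_power2[of "norm (a *\<^sub>R u x) - norm (b *\<^sub>R v x)"] by (simp add: power2_sum power2_diff)
      finally show ?thesis by (simp add: power_mult_distrib)
    qed
    then show "AE x in lebesgue. norm ((norm (a *\<^sub>R u x + b *\<^sub>R v x))^2) \<le> norm (2 * a^2 * (norm (u x))^2 + 2 * b^2 * (norm (v x))^2)"
      by (intro AE_I2) (simp add: order_trans[OF _ abs_ge_self])
  qed simp
  then show ?thesis by (auto simp: L2_def)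
qed

lemma L2_diff: "u \<in> L2 ==> v \<in> L2 ==> (\<lambda>x. u x - v x) \<in> L2" using L2_lin[of u v 1 "-1"] by simp

lemma summable_integral_AE:
  fixes f :: "nat => 'a => real"
  assumes "\<And>n. integrable M (f n)" "\<And>n x. 0 \<le> f n x" "summable (\<lambda>n. LINT x|M. f n x)"
  shows "AE x in M. summable (\<lambda>n. f n x)"
proof -
  have [measurable]: "f n \<in> borel_measurable M" for n using assms(1) by auto
  have "(\<integral>\<^sup>+x. (\<Sum>n. ennreal (f n x)) \<partial>M) = (\<Sum>n. \<integral>\<^sup>+x. ennreal (f n x) \<partial>M)"
    by (rule nn_integral_suminf) measurable
  also have "\<dots> = (\<Sum>n. ennreal (LINT x|M. f n x))" using assms by (intro suminf_cong nn_integral_eq_integral) auto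
  also have "\<dots> = ennreal (\<Sum>n. LINT x|M. f n x)" using assms by (intro suminf_ennreal2) (auto intro!: integral_nonneg_AE)
  finally have "(\<integral>\<^sup>+x. (\<Sum>n. ennreal (f n x)) \<partial>M) \<noteq> \<infinity>" by simp
  then have "AE x in M. (\<Sum>n. ennreal (f n x)) \<noteq> \<infinity>" by (intro nn_integral_PInf_AE) auto
  then show ?thesis by (rule AE_mp) (auto intro!: AE_I2 summable_suminf_not_top assms(2))
qed

text \<open>Riesz-Fischer for vector values. A subsequence converging almost everywhere is returned
  along with the norm limit, because pointwise relations between components have to survive the
  passage to the limit.\<close>

lemma L2_complete:
  fixes f :: "nat => real^3 => 'b::euclidean_space"
  assumes f: "\<And>n. f n \<in> L2"
    and cauchy: "\<And>e. e > 0 ==> \<exists>N. \<forall>m\<ge>N. \<forall>n\<ge>N. (LINT x|lebesgue. (norm (f m x - f n x))^2) < e"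
  obtains g r where "g \<in> L2" "strict_mono (r :: nat => nat)" "AE x in lebesgue. (\<lambda>n. f (r n) x) \<longlonglongrightarrow> g x"
    "(\<lambda>n. LINT x|lebesgue. (norm (f n x - g x))^2) \<longlonglongrightarrow> 0"
proof -
  have fm[measurable]: "f n \<in> borel_measurable lebesgue" for n using f L2_D by auto
  have dm: "(\<lambda>x. f m x - f n x) \<in> L2" for m n by (rule L2_diff[OF f f])
  have dmi: "integrable lebesgue (\<lambda>x. (norm (f m x - f n x))^2)" for m n using L2_D(2)[OF dm] .
  have "\<forall>k. \<exists>N. \<forall>m\<ge>N. \<forall>n\<ge>N. (LINT x|lebesgue. (norm (f m x - f n x))^2) < (1/4) ^ k" using cauchy by simp
  then obtain N where N: "\<And>k m n. m \<ge> N k ==> n \<ge> N k ==> (LINT x|lebesgue. (norm (f m x - f n x))^2) < (1/4) ^ k" by metis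
  \<comment> \<open>Along \<open>r\<close> consecutive terms are within 4^(-k) in squared distance,
    which leaves the summable 2^(-k) after weighting with 2^k.\<close>
  define r where "r = rec_nat (N 0) (\<lambda>k q. max (Suc q) (N (Suc k)))"
  have r_Suc: "r (Suc k) = max (Suc (r k)) (N (Suc k))" for k by (simp add: r_def)
  have rN: "r k \<ge> N k" for k by (cases k) (auto simp: r_def)
  have rmono: "strict_mono r" by (rule strict_monoI_Suc) (simp add: r_Suc less_max_iff_disj)
  have r_le: "r k \<le> r (Suc k)" for k by (simp add: r_Suc)
  let ?d = "\<lambda>k x. norm (f (r (Suc k)) x - f (r k) x)"
  have sm: "AE x in lebesgue. summable (\<lambda>k. 2 ^ k * (?d k x)^2)"
  proof (rule summable_integral_AE)
    show "integrable lebesgue (\<lambda>x. 2 ^ k * (?d k x)^2)" for k using dmi by simp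
    show "summable (\<lambda>k. LINT x|lebesgue. 2 ^ k * (?d k x)^2)"
    proof (rule summable_comparison_test')
      show "summable (\<lambda>k. (1/2::real) ^ k)" by (rule summable_geometric) simp
      fix k :: nat assume "k \<ge> 0"
      have "(LINT x|lebesgue. (?d k x)^2) \<le> (1/4) ^ k" using N[of k "r (Suc k)" "r k"] rN[of k] r_le[of k] by simp
      then have "2 ^ k * (LINT x|lebesgue. (?d k x)^2) \<le> 2 ^ k * (1/4) ^ k" by (rule mult_left_mono) simp
      also have "\<dots> = (1/2) ^ k" by (simp flip: power_mult_distrib)
      finally show "norm (LINT x|lebesgue. 2 ^ k * (?d k x)^2) \<le> (1/2) ^ k" by (simp add: abs_mult)
    qed
  qed auto
  have conv: "AE x in lebesgue. convergent (\<lambda>k. f (r k) x)"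
  proof (rule AE_mp[OF sm], intro AE_I2 impI)
    fix x assume s: "summable (\<lambda>k. 2 ^ k * (?d k x)^2)"
    have "summable (\<lambda>k. ?d k x)"
    proof (rule summable_comparison_test')
      show "summable (\<lambda>k. (1/2::real) ^ k + 2 ^ k * (?d k x)^2)" by (intro summable_add s summable_geometric) simp
      fix k :: nat assume "k \<ge> 0"
      \<comment> \<open>Expanding this square bounds the increment by 2^(-k) plus the weighted
        squared increment, and both are summable.\<close>
      have "0 \<le> (1/2) ^ k * (1 - 2 ^ k * ?d k x)^2" by simp
      also have "\<dots> = (1/2) ^ k - 2 * ?d k x + 2 ^ k * (?d k x)^2"
        by (simp add: power2_diff algebra_simps power_mult_distrib power_one_over field_simps power2_eq_square)
      finally have "2 * ?d k x \<le> (1/2) ^ k + 2 ^ k * (?d k x)^2" by simp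
      moreover have "0 \<le> ?d k x" by simp
      ultimately have "?d k x \<le> (1/2) ^ k + 2 ^ k * (?d k x)^2" by linarith
      then show "norm (?d k x) \<le> (1/2) ^ k + 2 ^ k * (?d k x)^2" by simp
    qed
    then have "summable (\<lambda>k. f (r (Suc k)) x - f (r k) x)" by (rule summable_norm_cancel)
    then have "convergent (\<lambda>n. \<Sum>k<n. f (r (Suc k)) x - f (r k) x)" by (simp add: summable_iff_convergent)
    then have "convergent (\<lambda>n. f (r n) x - f (r 0) x)" by (simp add: sum_lessThan_telescope[of "\<lambda>k. f (r k) x"])
    then have "convergent (\<lambda>n. (f (r n) x - f (r 0) x) + f (r 0) x)" by (intro convergent_add convergent_const)
    then show "convergent (\<lambda>k. f (r k) x)" by simp
  qed
  define g where "g x = lim (\<lambda>k. f (r k) x)" for x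
  have gm[measurable]: "g \<in> borel_measurable lebesgue" unfolding g_def by (rule borel_measurable_lim_metric) measurable
  have ae: "AE x in lebesgue. (\<lambda>k. f (r k) x) \<longlonglongrightarrow> g x"
    using conv by (rule AE_mp) (auto simp: g_def convergent_LIMSEQ_iff)
  \<comment> \<open>Fatou along the subsequence estimates the distance to the pointwise limit for
    every late index, not only for those selected by \<open>r\<close>.\<close>
  have fat: "(\<integral>\<^sup>+x. ennreal ((norm (f m x - g x))^2) \<partial>lebesgue) \<le> ennreal ((1/4) ^ k)" if "m \<ge> N k" for m k
  proof -
    have "(\<integral>\<^sup>+x. ennreal ((norm (f m x - g x))^2) \<partial>lebesgue)
        = (\<integral>\<^sup>+x. liminf (\<lambda>n. ennreal ((norm (f m x - f (r n) x))^2)) \<partial>lebesgue)"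
    proof (rule nn_integral_cong_AE, rule AE_mp[OF ae], intro AE_I2 impI)
      fix x assume "(\<lambda>k. f (r k) x) \<longlonglongrightarrow> g x"
      then have "(\<lambda>n. ennreal ((norm (f m x - f (r n) x))^2)) \<longlonglongrightarrow> ennreal ((norm (f m x - g x))^2)"
        by (intro tendsto_ennrealI tendsto_intros)
      then show "ennreal ((norm (f m x - g x))^2) = liminf (\<lambda>n. ennreal ((norm (f m x - f (r n) x))^2))"
        by (intro lim_imp_Liminf[symmetric]) auto
    qed
    also have "\<dots> \<le> liminf (\<lambda>n. \<integral>\<^sup>+x. ennreal ((norm (f m x - f (r n) x))^2) \<partial>lebesgue)"
      by (rule nn_integral_liminf) measurable
    also have "\<dots> \<le> ennreal ((1/4) ^ k)"
    proof (rule Liminf_le)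
      show "eventually (\<lambda>n. (\<integral>\<^sup>+x. ennreal ((norm (f m x - f (r n) x))^2) \<partial>lebesgue) \<le> ennreal ((1/4) ^ k)) sequentially"
      proof (rule eventually_sequentiallyI[of k])
        fix n assume "k \<le> n"
        then have "r n \<ge> N k" using rN[of k] strict_mono_mono[OF rmono] by (meson monoD order_trans)
        then have "(LINT x|lebesgue. (norm (f m x - f (r n) x))^2) \<le> (1/4) ^ k" using N[OF that] by (simp add: less_imp_le)
        then show "(\<integral>\<^sup>+x. ennreal ((norm (f m x - f (r n) x))^2) \<partial>lebesgue) \<le> ennreal ((1/4) ^ k)"
          using dmi by (subst nn_integral_eq_integral) (auto intro: ennreal_leI)
      qed
    qed simp
    finally show ?thesis .
  qed
  have di: "(\<lambda>x. f m x - g x) \<in> L2 \<and> (LINT x|lebesgue. (norm (f m x - g x))^2) \<le> (1/4) ^ k" if "m \<ge> N k" for m k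
  proof -
    have i: "integrable lebesgue (\<lambda>x. (norm (f m x - g x))^2)"
      by (rule integrableI_bounded) (use fat[OF that] in \<open>auto intro: le_less_trans\<close>)
    moreover have "ennreal (LINT x|lebesgue. (norm (f m x - g x))^2) = (\<integral>\<^sup>+x. ennreal ((norm (f m x - g x))^2) \<partial>lebesgue)"
      using i by (intro nn_integral_eq_integral[symmetric]) auto
    ultimately have "ennreal (LINT x|lebesgue. (norm (f m x - g x))^2) \<le> ennreal ((1/4) ^ k)" using fat[OF that] by simp
    then have "(LINT x|lebesgue. (norm (f m x - g x))^2) \<le> (1/4) ^ k" by (subst (asm) ennreal_le_iff) auto
    with i show ?thesis by (auto simp: L2_def)
  qed
  have gL: "g \<in> L2" using L2_diff[OF f[of "N 0"] conjunct1[OF di[of 0 "N 0"]]] by simp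
  have "(\<lambda>n. LINT x|lebesgue. (norm (f n x - g x))^2) \<longlonglongrightarrow> 0"
  proof (rule LIMSEQ_I)
    fix e :: real assume "e > 0"
    then obtain k where k: "(1/4::real) ^ k < e" using real_arch_pow_inv[of e "1/4"] by auto
    have "norm ((LINT x|lebesgue. (norm (f n x - g x))^2) - 0) < e" if "n \<ge> N k" for n using conjunct2[OF di[OF that]] k by simp
    then show "\<exists>no. \<forall>n\<ge>no. norm ((LINT x|lebesgue. (norm (f n x - g x))^2) - 0) < e" by blast
  qed
  with gL rmono ae show ?thesis by (rule that)
qed

lemma L2_tendsto_mult:
  fixes u :: "real^3 => real"
  assumes "\<And>n. f n \<in> L2" "u \<in> L2" "\<psi> \<in> L2" "(\<lambda>n. LINT x|lebesgue. (f n x - u x)^2) \<longlonglongrightarrow> 0"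
  shows "(\<lambda>n. LINT x|lebesgue. f n x * \<psi> x) \<longlonglongrightarrow> (LINT x|lebesgue. u x * \<psi> x)"
proof -
  have "(\<lambda>n. sqrt (LINT x|lebesgue. (f n x - u x)^2) * sqrt (LINT x|lebesgue. (\<psi> x)^2)) \<longlonglongrightarrow> sqrt 0 * sqrt (LINT x|lebesgue. (\<psi> x)^2)"
    by (intro tendsto_intros assms(4))
  then have lim0: "(\<lambda>n. sqrt (LINT x|lebesgue. (f n x - u x)^2) * sqrt (LINT x|lebesgue. (\<psi> x)^2)) \<longlonglongrightarrow> 0" by simp
  have "(\<lambda>n. (LINT x|lebesgue. f n x * \<psi> x) - (LINT x|lebesgue. u x * \<psi> x)) \<longlonglongrightarrow> 0"
  proof (rule Lim_null_comparison[OF _ lim0])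
    show "eventually (\<lambda>n. norm ((LINT x|lebesgue. f n x * \<psi> x) - (LINT x|lebesgue. u x * \<psi> x))
        \<le> sqrt (LINT x|lebesgue. (f n x - u x)^2) * sqrt (LINT x|lebesgue. (\<psi> x)^2)) sequentially"
    proof (intro always_eventually allI)
      fix n
      have "(LINT x|lebesgue. f n x * \<psi> x) - (LINT x|lebesgue. u x * \<psi> x) = (LINT x|lebesgue. (f n x - u x) * \<psi> x)"
        unfolding left_diff_distrib by (rule Bochner_Integration.integral_diff[symmetric]) (intro L2_mult(1) assms)+
      then show "norm ((LINT x|lebesgue. f n x * \<psi> x) - (LINT x|lebesgue. u x * \<psi> x))
        \<le> sqrt (LINT x|lebesgue. (f n x - u x)^2) * sqrt (LINT x|lebesgue. (\<psi> x)^2)"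
        using L2_mult(2)[OF L2_diff[OF assms(1)[of n] assms(2)] assms(3)] by simp
    qed
  qed
  then show ?thesis by (simp add: LIM_zero_iff)
qed

text \<open>Test functions and their partial derivatives are square integrable, so both sides of the
  integration by parts are continuous in L2.\<close>

lemma has_weak_grad_limit:
  assumes f: "\<And>n. f n \<in> L2" "u \<in> L2" "(\<lambda>n. LINT x|lebesgue. (f n x - u x)^2) \<longlonglongrightarrow> 0"
    and D: "\<And>n. D n \<in> L2" "E \<in> L2" "(\<lambda>n. LINT x|lebesgue. (norm (D n x - E x))^2) \<longlonglongrightarrow> 0"
    and w: "\<And>n. has_weak_grad (f n) (D n)"
  shows "has_weak_grad u E" unfolding has_weak_grad_def
proof (intro conjI allI impI L2_loc_integrable f D)
  fix \<phi> i assume \<phi>: "test_fun \<phi>"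
  obtain K where K: "compact K" "continuous_on UNIV \<phi>" "\<And>x. x \<notin> K ==> \<phi> x = 0"
      "\<And>i. continuous_on UNIV (pderiv_at i \<phi>)" "\<And>i x. x \<notin> K ==> pderiv_at i \<phi> x = 0"
    by (rule test_fun_cases[OF \<phi>]) (rule that; assumption)
  have a: "\<phi> \<in> L2" "pderiv_at i \<phi> \<in> L2" by (rule compact_support_L2[OF K(2,1,3)], assumption) (rule compact_support_L2[OF K(4,1,5)])
  have Di: "(\<lambda>n. LINT x|lebesgue. (D n x $ i - E x $ i)^2) \<longlonglongrightarrow> 0"
  proof (rule Lim_null_comparison[OF _ D(3)], intro always_eventually allI)
    fix n
    have "(LINT x|lebesgue. (D n x $ i - E x $ i)^2) \<le> (LINT x|lebesgue. (norm (D n x - E x))^2)"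
    proof (rule integral_mono)
      show "integrable lebesgue (\<lambda>x. (norm (D n x - E x))^2)" using L2_D(2)[OF L2_diff[OF D(1,2)]] .
      show "integrable lebesgue (\<lambda>x. (D n x $ i - E x $ i)^2)" using L2_component[OF L2_diff[OF D(1,2)], of n i] by (simp add: L2_real_iff)
      show "(D n x $ i - E x $ i)^2 \<le> (norm (D n x - E x))^2" for x using component_sq_le[of "D n x - E x" i] by simp
    qed
    then show "norm (LINT x|lebesgue. (D n x $ i - E x $ i)^2) \<le> (LINT x|lebesgue. (norm (D n x - E x))^2)" by simp
  qed
  have "(\<lambda>n. LINT x|lebesgue. f n x * pderiv_at i \<phi> x) \<longlonglongrightarrow> (LINT x|lebesgue. u x * pderiv_at i \<phi> x)"
    by (rule L2_tendsto_mult[OF f(1,2) a(2) f(3)])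
  moreover have "(\<lambda>n. - (LINT x|lebesgue. D n x $ i * \<phi> x)) \<longlonglongrightarrow> - (LINT x|lebesgue. E x $ i * \<phi> x)"
    by (intro tendsto_minus L2_tendsto_mult[OF L2_component[OF D(1)] L2_component[OF D(2)] a(1) Di])
  moreover have "(LINT x|lebesgue. f n x * pderiv_at i \<phi> x) = - (LINT x|lebesgue. D n x $ i * \<phi> x)" for n
    using w \<phi> unfolding has_weak_grad_def by blast
  ultimately show "(LINT x|lebesgue. u x * pderiv_at i \<phi> x) = - (LINT x|lebesgue. E x $ i * \<phi> x)" using LIMSEQ_unique by auto
qed

section \<open>The Hilbert space of cylindrically symmetric functions\<close>

lemma rad_measurable[measurable]: "rad \<in> borel_measurable lebesgue"
proof -
  have "continuous_on UNIV rad" unfolding rad_def[abs_def] by (intro continuous_intros)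
  then show ?thesis by (rule continuous_lebesgue_measurable)
qed

text \<open>The inner product of \<open>X_space\<close> is the L2 inner product of these triples, so
  completeness reduces to that of one L2 space with values in a Euclidean space. On the axis the
  quotient is 0 by convention, which concerns a null set only.\<close>

definition jet :: "(real^3 => real) => real^3 => (real^3) \<times> real \<times> real" where
  "jet u x = (wgrad u x, u x / rad x, u x)"

lemma inner_jet: "jet u x \<bullet> jet v x = wgrad u x \<bullet> wgrad v x + u x * v x / (rad x)^2 + u x * v x"
  by (simp add: jet_def power2_eq_square)

lemma norm_jet: "(norm (jet u x))^2 = (norm (wgrad u x))^2 + (u x)^2 / (rad x)^2 + (u x)^2"
  unfolding power2_norm_eq_inner inner_jet by (simp add: power2_eq_square)

lemma form_domI:
  assumes "u \<in> L2" "D \<in> L2" "has_weak_grad u D" "(\<lambda>x. u x / rad x) \<in> L2"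
  shows "u \<in> form_dom" using assms by (auto simp: form_dom_def H1_def L2_real_iff power_divide)

lemma form_domD:
  assumes "u \<in> form_dom"
  shows "u \<in> L2" "wgrad u \<in> L2" "has_weak_grad u (wgrad u)" "(\<lambda>x. u x / rad x) \<in> L2"
proof -
  have H: "u \<in> H1" using assms by (simp add: form_dom_def)
  show L: "u \<in> L2" using H by (simp add: H1_def)
  show "wgrad u \<in> L2" "has_weak_grad u (wgrad u)" using wgrad_H1[OF H] by auto
  show "(\<lambda>x. u x / rad x) \<in> L2" using assms L by (auto simp: form_dom_def L2_real_iff power_divide)
qed

lemma X_space_iff: "u \<in> X_space \<longleftrightarrow> u \<in> form_dom \<and> cyl_sym u" by (auto simp: X_space_def form_dom_def)

lemma L2_Pair: "(\<lambda>x. (f x, g x)) \<in> L2 \<longleftrightarrow> f \<in> L2 \<and> g \<in> L2"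
proof
  assume L: "(\<lambda>x. (f x, g x)) \<in> L2"
  have m: "(\<lambda>x. (f x, g x)) \<in> borel_measurable lebesgue" and i: "integrable lebesgue (\<lambda>x. (norm (f x))^2 + (norm (g x))^2)"
    using L by (auto simp: L2_def norm_Pair)
  have fm[measurable]: "f \<in> borel_measurable lebesgue" "g \<in> borel_measurable lebesgue"
    using borel_measurable_continuous_on[OF continuous_on_fst[OF continuous_on_id] m]
      borel_measurable_continuous_on[OF continuous_on_snd[OF continuous_on_id] m] by simp_all
  have "integrable lebesgue (\<lambda>x. (norm (f x))^2)" "integrable lebesgue (\<lambda>x. (norm (g x))^2)"
    by (rule Bochner_Integration.integrable_bound[OF i]; simp)+
  then show "f \<in> L2 \<and> g \<in> L2" by (simp add: L2_def)
next
  assume "f \<in> L2 \<and> g \<in> L2"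
  then show "(\<lambda>x. (f x, g x)) \<in> L2" by (auto simp: L2_def norm_Pair intro!: borel_measurable_Pair)
qed

lemma jet_L2: "u \<in> form_dom ==> jet u \<in> L2" using form_domD[of u] unfolding jet_def[abs_def] L2_Pair by blast

lemma L2_inner:
  fixes f g :: "real^3 => 'b::euclidean_space"
  assumes "f \<in> L2" "g \<in> L2" shows "integrable lebesgue (\<lambda>x. f x \<bullet> g x)"
proof (rule Bochner_Integration.integrable_bound)
  have n: "(\<lambda>x. norm (f x)) \<in> L2" "(\<lambda>x. norm (g x)) \<in> L2" using assms by (auto simp: L2_def)
  show "integrable lebesgue (\<lambda>x. norm (f x) * norm (g x))" by (rule L2_mult(1)[OF n])
  show "(\<lambda>x. f x \<bullet> g x) \<in> borel_measurable lebesgue" using assms by (intro borel_measurable_inner L2_D)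
  show "AE x in lebesgue. norm (f x \<bullet> g x) \<le> norm (norm (f x) * norm (g x))" by (intro AE_I2) (simp add: Cauchy_Schwarz_ineq2)
qed

lemma form_dom_lin:
  assumes "u \<in> form_dom" "v \<in> form_dom"
  shows "(\<lambda>x. a * u x + b * v x) \<in> form_dom"
    and "AE x in lebesgue. jet (\<lambda>x. a * u x + b * v x) x = a *\<^sub>R jet u x + b *\<^sub>R jet v x"
proof -
  note u = form_domD[OF assms(1)] and v = form_domD[OF assms(2)]
  have w: "has_weak_grad (\<lambda>x. a * u x + b * v x) (\<lambda>x. a *\<^sub>R wgrad u x + b *\<^sub>R wgrad v x)"
    by (rule has_weak_grad_lin[OF u(3) v(3)])
  show "(\<lambda>x. a * u x + b * v x) \<in> form_dom"
  proof (rule form_domI[OF _ _ w])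
    show "(\<lambda>x. a * u x + b * v x) \<in> L2" using L2_lin[OF u(1) v(1)] by simp
    show "(\<lambda>x. a *\<^sub>R wgrad u x + b *\<^sub>R wgrad v x) \<in> L2" by (rule L2_lin[OF u(2) v(2)])
    show "(\<lambda>x. (a * u x + b * v x) / rad x) \<in> L2" using L2_lin[OF u(4) v(4), of a b] by (simp add: add_divide_distrib)
  qed
  show "AE x in lebesgue. jet (\<lambda>x. a * u x + b * v x) x = a *\<^sub>R jet u x + b *\<^sub>R jet v x"
    using wgrad_eq_AE[OF w] by (rule AE_mp) (auto simp: jet_def add_divide_distrib)
qed

lemma form_dom_AE:
  assumes "u \<in> form_dom" "v \<in> form_dom" "AE x in lebesgue. u x = v x"
  shows "AE x in lebesgue. jet u x = jet v x"
proof -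
  note u = form_domD[OF assms(1)] and v = form_domD[OF assms(2)]
  have "has_weak_grad v (wgrad u)" by (rule has_weak_grad_cong[OF u(3) assms(3)]) (auto intro: L2_loc_integrable u v)
  from wgrad_eq_AE[OF this] assms(3) show ?thesis by eventually_elim (simp add: jet_def)
qed

lemma cyl_sym_lin: "cyl_sym u ==> cyl_sym v ==> cyl_sym (\<lambda>x. a * u x + b * v x)"
proof -
  assume "cyl_sym u" "cyl_sym v"
  then obtain w w' where "AE x in lebesgue. u x = w (rad x) (x$3)" "AE x in lebesgue. v x = w' (rad x) (x$3)" unfolding cyl_sym_def by blast
  then have "AE x in lebesgue. a * u x + b * v x = (\<lambda>r z. a * w r z + b * w' r z) (rad x) (x$3)" by eventually_elim simp
  then show ?thesis unfolding cyl_sym_def by (rule exI[where x="\<lambda>r z. a * w r z + b * w' r z"])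
qed

lemma X_space_lin: "u \<in> X_space ==> v \<in> X_space ==> (\<lambda>x. a * u x + b * v x) \<in> X_space"
  by (simp add: X_space_iff form_dom_lin cyl_sym_lin)

lemma zero_form_dom: "(\<lambda>x. 0) \<in> form_dom"
proof (rule form_domI)
  show "has_weak_grad (\<lambda>x. 0) (\<lambda>x. 0)" by (simp add: has_weak_grad_def loc_integrable_def set_integrable_def)
qed (simp_all add: L2_def)

lemma zero_X_space: "(\<lambda>x. 0) \<in> X_space" by (auto simp: X_space_iff zero_form_dom cyl_sym_def intro: exI[of _ "\<lambda>r z. 0"])

lemma X_space_add: "u \<in> X_space ==> v \<in> X_space ==> (\<lambda>x. u x + v x) \<in> X_space" using X_space_lin[of u v 1 1] by simp

lemma X_space_diff: "u \<in> X_space ==> v \<in> X_space ==> (\<lambda>x. u x - v x) \<in> X_space" using X_space_lin[of u v 1 "-1"] by simp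

lemma X_space_scale: "u \<in> X_space ==> (\<lambda>x. a * u x) \<in> X_space" using X_space_lin[of u u a 0] by simp

lemma X_space_uminus: "u \<in> X_space ==> (\<lambda>x. - u x) \<in> X_space" using X_space_scale[of u "-1"] by simp

section \<open>The quotient by almost everywhere equality as a Hilbert space type\<close>

definition X_eq :: "(real^3 => real) => (real^3 => real) => bool" where
  "X_eq u v \<longleftrightarrow> u \<in> X_space \<and> v \<in> X_space \<and> (AE x in lebesgue. u x = v x)"

\<comment> \<open>A type is formed so that derivatives, closed sets and completeness come from type
  classes. The equivalence is partial because only members of \<open>X_space\<close> have
  classes.\<close>
quotient_type xfun = "real^3 => real" / partial: X_eq
  morphisms rep cls
proof (rule part_equivpI)
  show "\<exists>x. X_eq x x" using zero_X_space by (auto simp: X_eq_def)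
  show "symp X_eq" by (auto simp: symp_def X_eq_def)
  show "transp X_eq"
  proof (rule transpI)
    fix u v w assume "X_eq u v" "X_eq v w"
    then have "AE x in lebesgue. u x = v x" "AE x in lebesgue. v x = w x" "u \<in> X_space" "w \<in> X_space" by (auto simp: X_eq_def)
    moreover from this(1,2) have "AE x in lebesgue. u x = w x" by eventually_elim simp
    ultimately show "X_eq u w" by (simp add: X_eq_def)
  qed
qed

lemma rep_X: "rep U \<in> X_space" using Quotient_rep_reflp[OF Quotient_xfun, of U] by (simp add: X_eq_def)

lemma rep_form_dom: "rep U \<in> form_dom" using rep_X X_space_iff by blast

lemma rep_abs: "u \<in> X_space ==> AE x in lebesgue. rep (cls u) x = u x" using Quotient_rep_abs[OF Quotient_xfun, of u] by (simp add: X_eq_def)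

lemma abs_rep: "cls (rep U) = U" by (rule Quotient_abs_rep[OF Quotient_xfun])

lemma abs_eqI: "u \<in> X_space ==> v \<in> X_space ==> AE x in lebesgue. u x = v x ==> cls u = cls v"
  using Quotient_rel[OF Quotient_xfun, of u v] by (simp add: X_eq_def)

lemma xfun_eqI: "AE x in lebesgue. rep U x = rep V x ==> U = V" using abs_eqI[OF rep_X[of U] rep_X[of V]] by (simp add: abs_rep)

instantiation xfun :: real_inner
begin

definition zero_xfun :: xfun where "zero_xfun = cls (\<lambda>x. 0)"
definition plus_xfun :: "xfun => xfun => xfun" where "plus_xfun U V = cls (\<lambda>x. rep U x + rep V x)"
definition minus_xfun :: "xfun => xfun => xfun" where "minus_xfun U V = cls (\<lambda>x. rep U x - rep V x)"
definition uminus_xfun :: "xfun => xfun" where "uminus_xfun U = cls (\<lambda>x. - rep U x)"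
definition scaleR_xfun :: "real => xfun => xfun" where "scaleR_xfun a U = cls (\<lambda>x. a * rep U x)"
definition inner_xfun :: "xfun => xfun => real" where
  "inner_xfun U V = (LINT x|lebesgue. jet (rep U) x \<bullet> jet (rep V) x)"
definition norm_xfun :: "xfun => real" where "norm_xfun U = sqrt (inner U U)"
definition dist_xfun :: "xfun => xfun => real" where "dist_xfun U V = norm (U - V)"
definition sgn_xfun :: "xfun => xfun" where "sgn_xfun U = inverse (norm U) *\<^sub>R U"
definition uniformity_xfun :: "(xfun \<times> xfun) filter" where
  "uniformity_xfun = (INF e\<in>{0<..}. principal {(U, V). dist U V < e})"
definition open_xfun :: "xfun set => bool" where
  "open_xfun S = (\<forall>U\<in>S. eventually (\<lambda>(U', V). U' = U \<longrightarrow> V \<in> S) uniformity)"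

lemma rep_zero_AE: "AE x in lebesgue. rep 0 x = 0" unfolding zero_xfun_def by (rule rep_abs[OF zero_X_space])
lemma rep_plus_AE: "AE x in lebesgue. rep (U + V) x = rep U x + rep V x" unfolding plus_xfun_def by (rule rep_abs) (rule X_space_add[OF rep_X rep_X])
lemma rep_minus_AE: "AE x in lebesgue. rep (U - V) x = rep U x - rep V x"
  unfolding minus_xfun_def by (rule rep_abs) (rule X_space_diff[OF rep_X rep_X])
lemma rep_uminus_AE: "AE x in lebesgue. rep (- U) x = - rep U x" unfolding uminus_xfun_def by (rule rep_abs) (rule X_space_uminus[OF rep_X])
lemma rep_scaleR_AE: "AE x in lebesgue. rep (a *\<^sub>R U) x = a * rep U x"
  unfolding scaleR_xfun_def by (rule rep_abs) (rule X_space_scale[OF rep_X])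

text \<open>\<open>rep\<close> and \<open>wgrad\<close> are arbitrary choices, so jets respect the
  vector operations only up to null sets; the identities are used under integrals.\<close>

lemma jet_plus_AE: "AE x in lebesgue. jet (rep (U + V)) x = jet (rep U) x + jet (rep V) x"
proof -
  have "AE x in lebesgue. jet (rep (U + V)) x = jet (\<lambda>x. 1 * rep U x + 1 * rep V x) x"
    by (rule form_dom_AE[OF rep_form_dom form_dom_lin(1)[OF rep_form_dom rep_form_dom]]) (use rep_plus_AE in simp)
  with form_dom_lin(2)[OF rep_form_dom[of U] rep_form_dom[of V], of 1 1]
  show ?thesis by eventually_elim simp
qed

lemma jet_scaleR_AE: "AE x in lebesgue. jet (rep (a *\<^sub>R U)) x = a *\<^sub>R jet (rep U) x"
proof -
  have "AE x in lebesgue. jet (rep (a *\<^sub>R U)) x = jet (\<lambda>x. a * rep U x + 0 * rep U x) x"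
    by (rule form_dom_AE[OF rep_form_dom form_dom_lin(1)[OF rep_form_dom rep_form_dom]]) (use rep_scaleR_AE in simp)
  with form_dom_lin(2)[OF rep_form_dom[of U] rep_form_dom[of U], of a 0]
  show ?thesis by eventually_elim simp
qed

lemma jet_rep_measurable[measurable]: "jet (rep U) \<in> borel_measurable lebesgue" using jet_L2[OF rep_form_dom] L2_D by blast

lemma integrable_jet: "integrable lebesgue (\<lambda>x. jet (rep U) x \<bullet> jet (rep V) x)"
  by (rule L2_inner[OF jet_L2[OF rep_form_dom] jet_L2[OF rep_form_dom]])

instance
proof
  fix U V W :: xfun and a b :: real
  show "U + V + W = U + (V + W)"
    by (rule xfun_eqI) (use rep_plus_AE[of "U + V" W] rep_plus_AE[of U V] rep_plus_AE[of U "V + W"] rep_plus_AE[of V W] in eventually_elim, simp)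
  show "U + V = V + U" by (rule xfun_eqI) (use rep_plus_AE[of U V] rep_plus_AE[of V U] in eventually_elim, simp)
  show "0 + U = U" by (rule xfun_eqI) (use rep_plus_AE[of 0 U] rep_zero_AE in eventually_elim, simp)
  show "- U + U = 0" by (rule xfun_eqI) (use rep_plus_AE[of "- U" U] rep_zero_AE rep_uminus_AE[of U] in eventually_elim, simp)
  show "U - V = U + - V" by (rule xfun_eqI) (use rep_plus_AE[of U "- V"] rep_minus_AE[of U V] rep_uminus_AE[of V] in eventually_elim, simp)
  show "a *\<^sub>R (U + V) = a *\<^sub>R U + a *\<^sub>R V"
    by (rule xfun_eqI) (use rep_plus_AE[of "a *\<^sub>R U" "a *\<^sub>R V"] rep_plus_AE[of U V] rep_scaleR_AE[of a "U + V"]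
      rep_scaleR_AE[of a U] rep_scaleR_AE[of a V] in eventually_elim, simp add: algebra_simps)
  show "(a + b) *\<^sub>R U = a *\<^sub>R U + b *\<^sub>R U"
    by (rule xfun_eqI) (use rep_plus_AE[of "a *\<^sub>R U" "b *\<^sub>R U"] rep_scaleR_AE[of "a + b" U]
      rep_scaleR_AE[of a U] rep_scaleR_AE[of b U] in eventually_elim, simp add: algebra_simps)
  show "a *\<^sub>R b *\<^sub>R U = (a * b) *\<^sub>R U"
    by (rule xfun_eqI) (use rep_scaleR_AE[of a "b *\<^sub>R U"] rep_scaleR_AE[of "a * b" U] rep_scaleR_AE[of b U] in eventually_elim, simp)
  show "1 *\<^sub>R U = U" by (rule xfun_eqI) (use rep_scaleR_AE[of 1 U] in eventually_elim, simp)
  show "dist U V = norm (U - V)" by (rule dist_xfun_def)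
  show "sgn U = inverse (norm U) *\<^sub>R U" by (rule sgn_xfun_def)
  show "(uniformity :: (xfun \<times> xfun) filter) = (INF e\<in>{0<..}. principal {(U, V). dist U V < e})" by (rule uniformity_xfun_def)
  show "open S = (\<forall>U\<in>S. eventually (\<lambda>(U', V). U' = U \<longrightarrow> V \<in> S) uniformity)" for S :: "xfun set"
    by (rule open_xfun_def)
  show "norm U = sqrt (inner U U)" by (rule norm_xfun_def)
  show "inner U V = inner V U" by (simp add: inner_xfun_def inner_commute)
  show "inner (U + V) W = inner U W + inner V W"
  proof -
    have "inner (U + V) W = (LINT x|lebesgue. jet (rep U) x \<bullet> jet (rep W) x + jet (rep V) x \<bullet> jet (rep W) x)" unfolding inner_xfun_def
      by (rule integral_cong_AE) (measurable, use jet_plus_AE[of U V] in eventually_elim, simp add: inner_add_left)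
    also have "\<dots> = inner U W + inner V W" unfolding inner_xfun_def by (rule Bochner_Integration.integral_add[OF integrable_jet integrable_jet])
    finally show ?thesis .
  qed
  show "inner (a *\<^sub>R U) V = a * inner U V"
  proof -
    have "inner (a *\<^sub>R U) V = (LINT x|lebesgue. a * (jet (rep U) x \<bullet> jet (rep V) x))" unfolding inner_xfun_def
      by (rule integral_cong_AE) (measurable, use jet_scaleR_AE[of a U] in eventually_elim, simp)
    then show ?thesis by (simp add: inner_xfun_def)
  qed
  show "0 \<le> inner U U" unfolding inner_xfun_def by (rule integral_nonneg_AE) simp
  show "inner U U = 0 \<longleftrightarrow> U = 0"
  proof
    assume "inner U U = 0"
    then have "AE x in lebesgue. jet (rep U) x \<bullet> jet (rep U) x = 0"
      unfolding inner_xfun_def by (subst (asm) integral_nonneg_eq_0_iff_AE[OF integrable_jet]) auto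
    then have "AE x in lebesgue. jet (rep U) x = 0" by eventually_elim (simp only: inner_eq_zero_iff)
    then have "AE x in lebesgue. rep U x = rep 0 x" using rep_zero_AE by eventually_elim (simp add: jet_def zero_prod_def)
    then show "U = 0" by (rule xfun_eqI)
  next
    assume "U = 0"
    have z: "AE x in lebesgue. jet (rep (0 *\<^sub>R U)) x = 0" using jet_scaleR_AE[of 0 U] by eventually_elim simp
    have "0 *\<^sub>R U = U" unfolding \<open>U = 0\<close>
      by (rule xfun_eqI) (use rep_zero_AE rep_scaleR_AE[of 0 0] in eventually_elim, simp)
    with z have "AE x in lebesgue. jet (rep U) x \<bullet> jet (rep U) x = 0" by (auto elim: AE_mp)
    then show "inner U U = 0" unfolding inner_xfun_def by (rule integral_eq_zero_AE)
  qed
qed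

end

lemma jet_minus_AE: "AE x in lebesgue. jet (rep (U - V)) x = jet (rep U) x - jet (rep V) x"
  using jet_plus_AE[of U "(-1) *\<^sub>R V"] jet_scaleR_AE[of "-1" V] by eventually_elim simp

lemma norm_xfun_sq: "(norm U)^2 = (LINT x|lebesgue. (norm (jet (rep U) x))^2)" unfolding power2_norm_eq_inner inner_xfun_def ..

lemma norm_xfun_diff_sq: "(norm (U - V))^2 = (LINT x|lebesgue. (norm (jet (rep U) x - jet (rep V) x))^2)" unfolding norm_xfun_sq
  by (rule integral_cong_AE) (measurable, use jet_minus_AE[of U V] in eventually_elim, simp)

text \<open>The profile of the limit is the pointwise limit of the profiles; countably many
  exceptional null sets are united.\<close>

lemma cyl_sym_limit:
  assumes "\<And>n. cyl_sym (f n)" "AE x in lebesgue. (\<lambda>n. f n x) \<longlonglongrightarrow> g x"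
  shows "cyl_sym g"
proof -
  have "\<forall>n. \<exists>w. AE x in lebesgue. f n x = w (rad x) (x$3)" using assms(1) by (simp add: cyl_sym_def)
  then obtain w where "\<And>n. AE x in lebesgue. f n x = w n (rad x) (x$3)" by metis
  then have "AE x in lebesgue. \<forall>n. f n x = w n (rad x) (x$3)" by (simp add: AE_all_countable)
  then have "AE x in lebesgue. g x = (\<lambda>r z. lim (\<lambda>n. w n r z)) (rad x) (x$3)" using assms(2) by eventually_elim (simp add: limI)
  then show ?thesis unfolding cyl_sym_def by (rule exI[where x="\<lambda>r z. lim (\<lambda>n. w n r z)"])
qed

text \<open>The limit triple has to be the jet of its own last entry: for the gradient this is
  closedness in L2, for the middle entry it follows because pointwise convergence along
  \<open>r\<close> respects division by \<open>rad\<close>.\<close>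

lemma form_dom_limit:
  assumes u: "\<And>n. u n \<in> form_dom" and J: "J \<in> L2" and lim: "(\<lambda>n. LINT x|lebesgue. (norm (jet (u n) x - J x))^2) \<longlonglongrightarrow> 0"
    and ae: "AE x in lebesgue. (\<lambda>n. jet (u (r n)) x) \<longlonglongrightarrow> J x"
  shows "(\<lambda>x. snd (snd (J x))) \<in> form_dom" "AE x in lebesgue. jet (\<lambda>x. snd (snd (J x))) x = J x"
proof -
  define D where "D x = fst (J x)" for x
  define w where "w x = fst (snd (J x))" for x
  define v where "v x = snd (snd (J x))" for x
  have Jeq: "J = (\<lambda>x. (D x, w x, v x))" by (simp add: D_def w_def v_def fun_eq_iff)
  have L: "D \<in> L2" "w \<in> L2" "v \<in> L2" using J unfolding Jeq L2_Pair by auto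
  note f = form_domD[OF u]
  have i: "integrable lebesgue (\<lambda>x. (norm (jet (u n) x - J x))^2)" for n using L2_D(2)[OF L2_diff[OF jet_L2[OF u] J]] .
  have le: "(norm (wgrad (u n) x - D x))^2 \<le> (norm (jet (u n) x - J x))^2" "(u n x - v x)^2 \<le> (norm (jet (u n) x - J x))^2" for n x
    by (simp_all add: jet_def Jeq norm_Pair)
  have 1: "(\<lambda>n. LINT x|lebesgue. (norm (wgrad (u n) x - D x))^2) \<longlonglongrightarrow> 0"
    by (rule Lim_null_comparison[OF _ lim], intro always_eventually allI)
      (simp add: integral_mono'[OF i le(1)])
  have 2: "(\<lambda>n. LINT x|lebesgue. (u n x - v x)^2) \<longlonglongrightarrow> 0"
    by (rule Lim_null_comparison[OF _ lim], intro always_eventually allI)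
      (simp add: integral_mono'[OF i le(2)])
  have hw: "has_weak_grad v D" by (rule has_weak_grad_limit[OF f(1) L(3) 2 f(2) L(1) 1 f(3)])
  have wv: "AE x in lebesgue. v x / rad x = w x" using ae
  proof eventually_elim
    case (elim x)
    have "(\<lambda>n. fst (snd (jet (u (r n)) x))) \<longlonglongrightarrow> w x" "(\<lambda>n. snd (snd (jet (u (r n)) x))) \<longlonglongrightarrow> v x"
      unfolding w_def v_def by (intro tendsto_fst tendsto_snd elim)+
    then have "(\<lambda>n. u (r n) x / rad x) \<longlonglongrightarrow> w x" "(\<lambda>n. u (r n) x * inverse (rad x)) \<longlonglongrightarrow> v x * inverse (rad x)"
      by (auto simp: jet_def intro!: tendsto_mult_right)
    then show "v x / rad x = w x" unfolding divide_inverse by (rule LIMSEQ_unique[rotated])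
  qed
  have [measurable]: "v \<in> borel_measurable lebesgue" using L(3) L2_D by auto
  have vr: "(\<lambda>x. v x / rad x) \<in> L2" by (rule L2_cong_AE[OF L(2)]) (measurable, use wv in eventually_elim, simp)
  show "(\<lambda>x. snd (snd (J x))) \<in> form_dom" unfolding v_def[symmetric] by (rule form_domI[OF L(3,1) hw vr])
  show "AE x in lebesgue. jet (\<lambda>x. snd (snd (J x))) x = J x" unfolding v_def[symmetric] using wgrad_eq_AE[OF hw] wv
    by eventually_elim (simp add: jet_def Jeq)
qed

instance xfun :: complete_space
proof
  fix U :: "nat => xfun" assume C: "Cauchy U"
  let ?f = "\<lambda>n. jet (rep (U n))"
  have fL: "?f n \<in> L2" for n by (rule jet_L2[OF rep_form_dom])
  have c: "\<exists>N. \<forall>m\<ge>N. \<forall>n\<ge>N. (LINT x|lebesgue. (norm (?f m x - ?f n x))^2) < e" if e: "e > 0" for e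
  proof -
    obtain N where N: "\<And>m n. m \<ge> N ==> n \<ge> N ==> dist (U m) (U n) < sqrt e" using metric_CauchyD[OF C, of "sqrt e"] e by auto
    have "(LINT x|lebesgue. (norm (?f m x - ?f n x))^2) < e" if "m \<ge> N" "n \<ge> N" for m n
    proof -
      have "(norm (U m - U n))^2 < (sqrt e)^2" using N[OF that] by (intro power_strict_mono) (auto simp: dist_norm)
      then show ?thesis using \<open>e > 0\<close> by (simp add: norm_xfun_diff_sq)
    qed
    then show ?thesis by blast
  qed
  obtain J r where J: "J \<in> L2" "strict_mono (r :: nat => nat)" "AE x in lebesgue. (\<lambda>n. ?f (r n) x) \<longlonglongrightarrow> J x"
    "(\<lambda>n. LINT x|lebesgue. (norm (?f n x - J x))^2) \<longlonglongrightarrow> 0"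
    by (rule L2_complete[of ?f, OF fL c]) (assumption, (rule that; assumption))
  let ?v = "\<lambda>x. snd (snd (J x))"
  have v: "?v \<in> form_dom" "AE x in lebesgue. jet ?v x = J x" by (rule form_dom_limit[OF rep_form_dom J(1,4,3)])+
  have cs: "cyl_sym ?v"
  proof (rule cyl_sym_limit)
    show "cyl_sym (rep (U (r n)))" for n using rep_X X_space_iff by blast
    show "AE x in lebesgue. (\<lambda>n. rep (U (r n)) x) \<longlonglongrightarrow> ?v x" using J(3)
    proof eventually_elim
      case (elim x)
      have "(\<lambda>n. snd (snd (?f (r n) x))) \<longlonglongrightarrow> ?v x" by (intro tendsto_snd elim)
      then show ?case by (simp add: jet_def)
    qed
  qed
  have vX: "?v \<in> X_space" using v cs by (simp add: X_space_iff)
  have jv: "AE x in lebesgue. jet (rep (cls ?v)) x = J x" using form_dom_AE[OF rep_form_dom v(1) rep_abs[OF vX]] v(2) by eventually_elim simp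
  have [measurable]: "J \<in> borel_measurable lebesgue" using J(1) L2_D by auto
  have "(norm (U n - cls ?v))^2 = (LINT x|lebesgue. (norm (?f n x - J x))^2)" for n unfolding norm_xfun_diff_sq
    by (rule integral_cong_AE) (measurable, use jv in eventually_elim, simp)
  then have "(\<lambda>n. (norm (U n - cls ?v))^2) \<longlonglongrightarrow> 0" using J(4) by simp
  then have "(\<lambda>n. sqrt ((norm (U n - cls ?v))^2)) \<longlonglongrightarrow> sqrt 0" by (rule tendsto_real_sqrt)
  then have "U \<longlonglongrightarrow> cls ?v" by (simp add: tendsto_iff dist_norm)
  then show "convergent U" by (rule convergentI)
qed

lemma jet_abs_AE: "u \<in> X_space ==> AE x in lebesgue. jet (rep (cls u)) x = jet u x"
  by (rule form_dom_AE[OF rep_form_dom _ rep_abs]) (simp_all add: X_space_iff)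

lemma X_norm_abs: "u \<in> X_space ==> X_norm u = norm (cls u)"
proof -
  assume u: "u \<in> X_space"
  have [measurable]: "jet u \<in> borel_measurable lebesgue" using u jet_L2 L2_D X_space_iff by blast
  have "(norm (cls u))^2 = (LINT x|lebesgue. (norm (jet u x))^2)" unfolding norm_xfun_sq
    by (rule integral_cong_AE) (measurable, use jet_abs_AE[OF u] in eventually_elim, simp)
  then have "sqrt ((norm (cls u))^2) = X_norm u" by (simp add: X_norm_def norm_jet)
  then show ?thesis by simp
qed

lemma rep_L2: "rep U \<in> L2" "wgrad (rep U) \<in> L2" "has_weak_grad (rep U) (wgrad (rep U))" using form_domD[OF rep_form_dom] by auto

lemma rep_measurable[measurable]: "rep U \<in> borel_measurable lebesgue" using rep_L2 L2_D by auto

lemma integral_rep_sq_le: "(LINT x|lebesgue. (rep U x)^2) \<le> (norm U)^2"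
  "(LINT x|lebesgue. (norm (wgrad (rep U) x))^2) \<le> (norm U)^2" unfolding norm_xfun_sq
  by (rule integral_mono'[OF L2_D(2)[OF jet_L2[OF rep_form_dom]]]; simp add: norm_jet)+

section \<open>Compactness\<close>

lemma powr_add_le:
  assumes "(0::real) \<le> a" "0 \<le> b" "0 \<le> p"
  shows "(a + b) powr p \<le> 2 powr p * (a powr p + b powr p)"
proof -
  have "(a + b) powr p \<le> (2 * max a b) powr p" using assms by (intro powr_mono2) auto
  also have "\<dots> = 2 powr p * (max a b) powr p" using assms by (simp add: powr_mult)
  also have "\<dots> \<le> 2 powr p * (a powr p + b powr p)" by (intro mult_left_mono) (auto simp: max_def)
  finally show ?thesis .
qed

text \<open>Interpolation: where an average is at most \<open>s\<close>, its p-th power is at most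
  s^(p-2) times its square. For the embedding \<open>s\<close> is the norm, for non-vanishing it is
  a small threshold.\<close>

lemma avg_powr_le:
  assumes u: "u \<in> L2" and p: "2 \<le> p" and bd: "\<And>x. abs (avg k u x) \<le> s"
  shows "integrable lebesgue (\<lambda>x. abs (avg k u x) powr p)"
    "(LINT x|lebesgue. abs (avg k u x) powr p) \<le> s powr (p - 2) * (LINT x|lebesgue. (u x)^2)"
proof -
  have le: "abs (avg k u x) powr p \<le> s powr (p - 2) * (avg k u x)^2" for x
  proof (cases "avg k u x = 0")
    case False
    have "abs (avg k u x) powr p = abs (avg k u x) powr (p - 2) * abs (avg k u x) powr 2" by (simp only: powr_add[symmetric]) simp
    also have "abs (avg k u x) powr 2 = (avg k u x)^2" using False powr_realpow[of "abs (avg k u x)" 2] by simp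
    also have "abs (avg k u x) powr (p - 2) * (avg k u x)^2 \<le> s powr (p - 2) * (avg k u x)^2"
      using p bd by (intro mult_right_mono powr_mono2) auto
    finally show ?thesis .
  qed simp
  have i: "integrable lebesgue (\<lambda>x. s powr (p - 2) * (avg k u x)^2)" using avg_L2(1)[OF u] by (simp add: L2_real_iff)
  show i2: "integrable lebesgue (\<lambda>x. abs (avg k u x) powr p)" by (rule Bochner_Integration.integrable_bound[OF i]) (use le in auto)
  have "(LINT x|lebesgue. abs (avg k u x) powr p) \<le> (LINT x|lebesgue. s powr (p - 2) * (avg k u x)^2)" by (rule integral_mono[OF i2 i le])
  also have "\<dots> \<le> s powr (p - 2) * (LINT x|lebesgue. (u x)^2)" using avg_L2(2)[OF u] by (simp add: mult_left_mono)
  finally show "(LINT x|lebesgue. abs (avg k u x) powr p) \<le> s powr (p - 2) * (LINT x|lebesgue. (u x)^2)" .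
qed

lemma rep_avg_approx:
  assumes p: "2 \<le> p" "p < 6"
  obtains C \<theta> where "C > 0" "0 < \<theta>" "\<theta> < 1"
    "\<And>U k. integrable lebesgue (\<lambda>x. abs (rep U x - avg k (rep U) x) powr p) \<and>
      (LINT x|lebesgue. abs (rep U x - avg k (rep U) x) powr p) \<le> C * \<theta> ^ k * norm U powr p"
proof -
  obtain C \<theta> where C: "C > 0" "0 < \<theta>" "\<theta> < 1"
    "\<And>u D k. u \<in> L2 ==> D \<in> L2 ==> has_weak_grad u D ==>
      integrable lebesgue (\<lambda>x. abs (u x - avg k u x) powr p) \<and>
      (LINT x|lebesgue. abs (u x - avg k u x) powr p) \<le> C * \<theta> ^ k * (LINT y|lebesgue. (norm (D y))^2) powr (p / 2)"
    by (rule avg_approx[OF p]) (rule that; assumption)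
  show ?thesis
  proof (rule that[OF C(1-3)])
    fix U k
    have "C * \<theta> ^ k * (LINT y|lebesgue. (norm (wgrad (rep U) y))^2) powr (p / 2) \<le> C * \<theta> ^ k * ((norm U)^2) powr (p / 2)"
      using C p by (intro mult_left_mono powr_mono2 integral_rep_sq_le) (auto intro!: integral_nonneg_AE)
    also have "((norm U)^2) powr (p / 2) = norm U powr p"
    proof (cases "U = 0")
      case False
      have "(norm U powr 2) powr (p/2) = norm U powr p" by (simp only: powr_powr) simp
      moreover have "norm U powr 2 = (norm U)^2" using False powr_realpow[of "norm U" 2] by simp
      ultimately show ?thesis by metis
    qed simp
    finally show "integrable lebesgue (\<lambda>x. abs (rep U x - avg k (rep U) x) powr p) \<and>
      (LINT x|lebesgue. abs (rep U x - avg k (rep U) x) powr p) \<le> C * \<theta> ^ k * norm U powr p" using C(4)[OF rep_L2, of U k] by auto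
  qed
qed

lemma abs_avg_le: "abs (avg k (rep U) x) \<le> sqrt (2 ^ k) * norm U"
proof -
  have "(avg k (rep U) x)^2 \<le> 2 ^ k * (norm U)^2" using avg_sq_le'[OF rep_L2(1), of k U x] integral_rep_sq_le(1)[of U]
    by (meson mult_left_mono order_trans zero_le_numeral zero_le_power)
  then have "sqrt ((avg k (rep U) x)^2) \<le> sqrt (2 ^ k * (norm U)^2)" by (rule real_sqrt_le_mono)
  then show ?thesis by (simp add: real_sqrt_mult)
qed

text \<open>Averages over unit cells are bounded by the norm, so interpolation with L2 controls
  their p-th power; the remainder is covered by the approximation estimate at generation 0.\<close>

lemma sobolev:
  assumes p: "2 \<le> p" "p < 6"
  obtains C where "C > 0" "\<And>U. integrable lebesgue (\<lambda>x. abs (rep U x) powr p)"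
    "\<And>U. (LINT x|lebesgue. abs (rep U x) powr p) \<le> C * norm U powr p"
proof -
  obtain C \<theta> where C: "C > 0" "0 < \<theta>" "\<theta> < 1"
    "\<And>U k. integrable lebesgue (\<lambda>x. abs (rep U x - avg k (rep U) x) powr p) \<and>
      (LINT x|lebesgue. abs (rep U x - avg k (rep U) x) powr p) \<le> C * \<theta> ^ k * norm U powr p"
    by (rule rep_avg_approx[OF p]) (rule that; assumption)
  have *: "integrable lebesgue (\<lambda>x. abs (rep U x) powr p) \<and>
      (LINT x|lebesgue. abs (rep U x) powr p) \<le> 2 powr p * (C + 1) * norm U powr p" for U
  proof -
    let ?u = "rep U"
    have a: "integrable lebesgue (\<lambda>x. abs (avg 0 ?u x) powr p)"
      "(LINT x|lebesgue. abs (avg 0 ?u x) powr p) \<le> (sqrt (2 ^ 0) * norm U) powr (p - 2) * (LINT x|lebesgue. (?u x)^2)"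
      by (rule avg_powr_le[OF rep_L2(1) p(1) abs_avg_le])+
    have "(sqrt (2 ^ 0) * norm U) powr (p - 2) * (LINT x|lebesgue. (?u x)^2) \<le> norm U powr (p - 2) * (norm U)^2"
      by (simp add: mult_left_mono integral_rep_sq_le)
    also have "norm U powr (p - 2) * (norm U)^2 = norm U powr p"
    proof (cases "U = 0")
      case False
      have "norm U powr 2 = (norm U)^2" using False powr_realpow[of "norm U" 2] by simp
      then show ?thesis using powr_add[of "norm U" "p - 2" 2] by simp
    qed simp
    finally have a2: "(LINT x|lebesgue. abs (avg 0 ?u x) powr p) \<le> norm U powr p" using a(2) by linarith
    have b: "integrable lebesgue (\<lambda>x. abs (?u x - avg 0 ?u x) powr p)"
      "(LINT x|lebesgue. abs (?u x - avg 0 ?u x) powr p) \<le> C * norm U powr p" using C(4)[of U 0] by auto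
    let ?g = "\<lambda>x. 2 powr p * (abs (?u x - avg 0 ?u x) powr p + abs (avg 0 ?u x) powr p)"
    have g: "integrable lebesgue ?g" using a(1) b(1) by simp
    have le: "abs (?u x) powr p \<le> ?g x" for x
    proof -
      have "abs (?u x) powr p \<le> (abs (?u x - avg 0 ?u x) + abs (avg 0 ?u x)) powr p" using p by (intro powr_mono2) auto
      also have "\<dots> \<le> ?g x" using p by (intro powr_add_le) auto
      finally show ?thesis .
    qed
    have i: "integrable lebesgue (\<lambda>x. abs (?u x) powr p)" by (rule Bochner_Integration.integrable_bound[OF g]) (use le in auto)
    have "(LINT x|lebesgue. abs (?u x) powr p) \<le> (LINT x|lebesgue. ?g x)" by (rule integral_mono[OF i g le])
    also have "\<dots> = 2 powr p * ((LINT x|lebesgue. abs (?u x - avg 0 ?u x) powr p) + (LINT x|lebesgue. abs (avg 0 ?u x) powr p))"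
      using a(1) b(1) by simp
    also have "\<dots> \<le> 2 powr p * (C * norm U powr p + norm U powr p)" using a2 b(2) by (intro mult_left_mono add_mono) auto
    also have "\<dots> = 2 powr p * (C + 1) * norm U powr p" by (simp add: algebra_simps)
    finally show ?thesis using i by simp
  qed
  show ?thesis by (rule that[of "2 powr p * (C + 1)"]) (use * C in auto)
qed

text \<open>A bounded, integrable weight with a positive lower bound on each ball: a single weighted
  norm then stands for L2 convergence on all balls. Dividing by 1 plus the volume of the ball keeps
  the integral of the n-th summand below 2^(-n).\<close>

definition weight :: "real^3 => real" where
  "weight x = (\<Sum>n. (1/2) ^ n / (1 + measure lebesgue (cball (0::real^3) (real n))) * indicator (cball (0::real^3) (real n)) x)"

lemma weight_summable:
  "summable (\<lambda>n. (1/2) ^ n / (1 + measure lebesgue (cball (0::real^3) (real n))) * indicator (cball (0::real^3) (real n)) x)"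
proof (rule summable_comparison_test')
  show "summable (\<lambda>n. (1/2::real) ^ n)" by (rule summable_geometric) simp
  fix n :: nat assume "n \<ge> 0"
  have "(1/2) ^ n / (1 + measure lebesgue (cball (0::real^3) (real n))) \<le> (1/2) ^ n / 1" by (intro divide_left_mono) (auto simp: add_pos_nonneg)
  then show "norm ((1/2) ^ n / (1 + measure lebesgue (cball (0::real^3) (real n))) * indicator (cball (0::real^3) (real n)) x) \<le> (1/2::real) ^ n"
    by (auto simp: indicator_def)
qed

lemma cball_lebesgue[measurable]: "cball (a :: real^3) r \<in> sets lebesgue" by (simp add: lmeasurable_cball fmeasurableD)

lemma weight_measurable[measurable]: "weight \<in> borel_measurable lebesgue" unfolding weight_def[abs_def] by measurable

lemma weight_nonneg: "0 \<le> weight x" unfolding weight_def by (rule suminf_nonneg[OF weight_summable]) simp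

lemma weight_le: "weight x \<le> 2"
proof -
  have "weight x \<le> (\<Sum>n. (1/2::real) ^ n)" unfolding weight_def
  proof (rule suminf_le[OF _ weight_summable])
    fix n
    have "(1/2) ^ n / (1 + measure lebesgue (cball (0::real^3) (real n))) \<le> (1/2) ^ n / 1" by (intro divide_left_mono) (auto simp: add_pos_nonneg)
    then show "(1/2) ^ n / (1 + measure lebesgue (cball (0::real^3) (real n))) * indicator (cball (0::real^3) (real n)) x \<le> (1/2::real) ^ n"
      by (auto simp: indicator_def)
  qed (auto intro: summable_geometric)
  then show ?thesis by (simp add: suminf_geometric)
qed

lemma weight_lower: "\<exists>c>0. \<forall>x\<in>cball 0 (real n). c \<le> weight x"
proof (intro exI conjI ballI)
  let ?c = "(1/2) ^ n / (1 + measure lebesgue (cball (0::real^3) (real n))) :: real"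
  show "?c > 0" by (simp add: add_pos_nonneg)
  fix x :: "real^3" assume "x \<in> cball 0 (real n)"
  then show "?c \<le> weight x" unfolding weight_def using sum_le_suminf[OF weight_summable[of x], of "{n}"] by simp
qed

lemma weight_pos: "0 < weight x"
proof -
  obtain n where "norm x \<le> real n" using real_arch_simple by blast
  then have "x \<in> cball 0 (real n)" by simp
  then show ?thesis using weight_lower[of n] by fastforce
qed

lemma weight_integrable: "integrable lebesgue weight"
proof (rule integrableI_bounded)
  let ?c = "\<lambda>n. (1/2) ^ n / (1 + measure lebesgue (cball (0::real^3) (real n))) :: real"
  have c0: "0 \<le> ?c n" for n by (simp add: add_nonneg_nonneg)
  have "(\<integral>\<^sup>+x. ennreal (norm (weight x)) \<partial>lebesgue) = (\<integral>\<^sup>+x. (\<Sum>n. ennreal (?c n * indicator (cball (0::real^3) (real n)) x)) \<partial>lebesgue)"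
  proof (rule nn_integral_cong)
    fix x
    have "(\<Sum>n. ennreal (?c n * indicator (cball (0::real^3) (real n)) x)) = ennreal (weight x)"
      unfolding weight_def by (rule suminf_ennreal2[OF _ weight_summable]) (use c0 in auto)
    then show "ennreal (norm (weight x)) = (\<Sum>n. ennreal (?c n * indicator (cball (0::real^3) (real n)) x))" using weight_nonneg[of x] by simp
  qed
  also have "\<dots> = (\<Sum>n. \<integral>\<^sup>+x. ennreal (?c n * indicator (cball (0::real^3) (real n)) x) \<partial>lebesgue)"
    by (rule nn_integral_suminf) measurable
  also have "\<dots> \<le> (\<Sum>n. ennreal ((1/2) ^ n))"
  proof (rule suminf_le)
    fix n
    let ?m = "measure lebesgue (cball (0::real^3) (real n))"
    have "(\<integral>\<^sup>+x. ennreal (?c n * indicator (cball (0::real^3) (real n)) x) \<partial>lebesgue) = ennreal (?c n) * emeasure lebesgue (cball (0::real^3) (real n))"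
      using c0 by (subst nn_integral_cmult_indicator[symmetric]) (auto simp: ennreal_mult' intro!: nn_integral_cong split: split_indicator)
    also have "emeasure lebesgue (cball (0::real^3) (real n)) = ennreal ?m"
      by (rule emeasure_eq_measure2) (use lmeasurable_cball fmeasurableD2 in auto)
    also have "ennreal (?c n) * ennreal ?m = ennreal (?c n * ?m)" by (rule ennreal_mult[symmetric]) (use c0 in auto)
    also have "\<dots> \<le> ennreal ((1/2) ^ n)" by (intro ennreal_leI) (simp add: divide_le_eq add_pos_nonneg)
    finally show "(\<integral>\<^sup>+x. ennreal (?c n * indicator (cball (0::real^3) (real n)) x) \<partial>lebesgue) \<le> ennreal ((1/2) ^ n)" .
  qed auto
  also have "\<dots> = ennreal (\<Sum>n. (1/2) ^ n)" by (intro suminf_ennreal2) (auto intro: summable_geometric)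
  also have "\<dots> < \<infinity>" by simp
  finally show "(\<integral>\<^sup>+x. ennreal (norm (weight x)) \<partial>lebesgue) < \<infinity>" .
qed measurable

lemma weight_mult_integrable:
  assumes "integrable lebesgue (g :: real^3 => real)" shows "integrable lebesgue (\<lambda>x. weight x * g x)"
proof (rule Bochner_Integration.integrable_bound)
  show "integrable lebesgue (\<lambda>x. 2 * g x)" using assms by simp
  show "AE x in lebesgue. norm (weight x * g x) \<le> norm (2 * g x)"
    using weight_le weight_nonneg by (intro AE_I2) (auto simp: abs_mult intro!: mult_right_mono)
qed (use assms in measurable)

text \<open>This is the square of a distance, which is why its triangle inequality carries a factor
  2.\<close>

definition wdist :: "(real^3 => real) => (real^3 => real) => real" where
  "wdist u v = (LINT x|lebesgue. weight x * (u x - v x)^2)"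

lemma sq_add_le: "((a::real) + b)^2 \<le> 2 * a^2 + 2 * b^2" using zero_le_power2[of "a - b"] by (simp add: power2_sum power2_diff)

lemma wdist_le_L2:
  assumes "(\<lambda>x. u x - v x) \<in> L2" shows "wdist u v \<le> 2 * (LINT x|lebesgue. (u x - v x)^2)"
proof -
  have i: "integrable lebesgue (\<lambda>x. (u x - v x)^2)" using assms by (simp add: L2_real_iff)
  have "wdist u v \<le> (LINT x|lebesgue. 2 * (u x - v x)^2)" unfolding wdist_def
    by (rule integral_mono[OF weight_mult_integrable[OF i]]) (use i weight_le in \<open>auto intro: mult_right_mono\<close>)
  then show ?thesis by simp
qed

lemma wdist_triangle:
  assumes "integrable lebesgue (\<lambda>x. weight x * (u x - v x)^2)" "integrable lebesgue (\<lambda>x. weight x * (v x - w x)^2)"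
    "integrable lebesgue (\<lambda>x. weight x * (u x - w x)^2)"
  shows "wdist u w \<le> 2 * wdist u v + 2 * wdist v w"
proof -
  have "wdist u w \<le> (LINT x|lebesgue. 2 * (weight x * (u x - v x)^2) + 2 * (weight x * (v x - w x)^2))" unfolding wdist_def
  proof (rule integral_mono[OF assms(3)])
    fix x
    have "weight x * ((u x - v x) + (v x - w x))^2 \<le> weight x * (2 * (u x - v x)^2 + 2 * (v x - w x)^2)"
      by (intro mult_left_mono sq_add_le weight_nonneg)
    then show "weight x * (u x - w x)^2 \<le> 2 * (weight x * (u x - v x)^2) + 2 * (weight x * (v x - w x)^2)" by (simp add: algebra_simps)
  qed (use assms in auto)
  then show ?thesis using assms by (simp add: wdist_def)
qed

text \<open>There are countably many pairs of generation and label, and for each pair the averages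
  form a bounded real sequence; a diagonal subsequence makes all of them converge.\<close>

lemma averages_subsequence:
  assumes bd: "\<And>n. norm (U n) \<le> M"
  obtains r where "strict_mono (r :: nat => nat)" "\<And>k x. convergent (\<lambda>n. avg k (rep (U (r n))) x)"
proof -
  define A where "A i n = 2 ^ fst (from_nat i :: nat \<times> (3 => int)) *
    (LINT y:{y. cell_index (fst (from_nat i :: nat \<times> (3 => int))) y = snd (from_nat i :: nat \<times> (3 => int))}|lebesgue. rep (U n) y)" for i n
  have A: "avg k (rep (U n)) x = A (to_nat (k, cell_index k x)) n" for k x n by (simp add: A_def avg_def cell_def)
  have bdA: "\<exists>B. \<forall>n. abs (A i n) \<le> B" for i
  proof -
    obtain k j where kj: "from_nat i = (k :: nat, j :: 3 => int)" by (cases "from_nat i :: nat \<times> (3 => int)") auto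
    show ?thesis
    proof (cases "\<exists>x. cell_index k x = j")
      case True
      then obtain x where "cell_index k x = j" by blast
      then have "A i n = avg k (rep (U n)) x" for n by (simp add: A_def kj avg_def cell_def)
      moreover have "abs (avg k (rep (U n)) x) \<le> sqrt (2 ^ k) * M" for n
        using abs_avg_le[of k "U n" x] bd[of n] by (meson mult_left_mono order_trans real_sqrt_ge_zero zero_le_numeral zero_le_power)
      ultimately show ?thesis by auto
    next
      case False
      then have "A i n = 0" for n by (simp add: A_def kj set_lebesgue_integral_def)
      then show ?thesis by auto
    qed
  qed
  interpret subseqs "\<lambda>i s. convergent (\<lambda>n. A i (s n))"
  proof
    fix i and s :: "nat => nat" assume "strict_mono s"
    obtain B where "\<And>n. abs (A i n) \<le> B" using bdA by blast
    then have "\<forall>n. (\<lambda>n. A i (s n)) n \<in> {-B..B}" by (auto simp: abs_le_iff minus_le_iff)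
    then obtain l r where "strict_mono r" "((\<lambda>n. A i (s n)) \<circ> r) \<longlonglongrightarrow> l"
      using compact_Icc[of "-B" B] unfolding compact_def by metis
    then show "\<exists>r'. strict_mono r' \<and> convergent (\<lambda>n. A i ((s \<circ> r') n))" by (auto simp: convergent_def o_def)
  qed
  have "convergent (\<lambda>n. A i (diagseq n))" for i
  proof -
    have "convergent (\<lambda>n. A i ((diagseq \<circ> (+) (Suc i)) n))"
    proof (rule diagseq_holds)
      fix r s :: "nat => nat" and n assume "strict_mono r" "convergent (\<lambda>m. A n (s m))"
      then show "convergent (\<lambda>m. A n ((s \<circ> r) m))" using convergent_subseq_convergent[of "\<lambda>m. A n (s m)" r] by (simp add: o_def)
    qed
    then have "convergent (\<lambda>n. A i (diagseq (n + Suc i)))" by (simp add: add.commute)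
    then show ?thesis by (subst (asm) convergent_ignore_initial_segment)
  qed
  then show ?thesis using that[of diagseq] subseq_diagseq A by simp
qed

text \<open>Local compactness of Rellich type. First \<open>k\<close> is fixed so that the functions
  are uniformly close to their averages; the averages are uniformly bounded and converge everywhere,
  hence also in the weighted norm, as the weight is integrable.\<close>

lemma wdist_Cauchy:
  assumes bd: "\<And>n. norm (U n) \<le> M" and conv: "\<And>k x. convergent (\<lambda>n. avg k (rep (U n)) x)" and e: "e > 0"
  shows "\<exists>N. \<forall>m\<ge>N. \<forall>n\<ge>N. wdist (rep (U m)) (rep (U n)) < e"
proof -
  obtain C \<theta> where C: "C > 0" "0 < \<theta>" "\<theta> < 1"
    "\<And>U k. integrable lebesgue (\<lambda>x. abs (rep U x - avg k (rep U) x) powr 2) \<and>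
      (LINT x|lebesgue. abs (rep U x - avg k (rep U) x) powr 2) \<le> C * \<theta> ^ k * norm U powr 2"
    by (rule rep_avg_approx[of 2]) (simp, simp, (rule that; assumption))
  \<comment> \<open>The 64 absorbs the factor 2 from \<open>wdist_le_L2\<close> and those from three
    uses of the weakened triangle inequality.\<close>
  obtain k where k: "\<theta> ^ k < e / (64 * (C * M^2 + 1))"
    using real_arch_pow_inv[of "e / (64 * (C * M^2 + 1))" \<theta>] C e by (auto simp: add_nonneg_pos)
  let ?u = "\<lambda>n. rep (U n)" and ?a = "\<lambda>n. avg k (rep (U n))"
  define c where "c x = lim (\<lambda>n. ?a n x)" for x
  have cl: "(\<lambda>n. ?a n x) \<longlonglongrightarrow> c x" for x using conv[of k x] by (simp add: c_def convergent_LIMSEQ_iff)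
  have [measurable]: "c \<in> borel_measurable lebesgue" unfolding c_def by (rule borel_measurable_lim_metric) measurable
  have ab: "abs (?a n x) \<le> sqrt (2 ^ k) * M" for n x
    using abs_avg_le[of k "U n" x] bd[of n] by (meson mult_left_mono order_trans real_sqrt_ge_zero zero_le_numeral zero_le_power)
  have cb: "abs (c x) \<le> sqrt (2 ^ k) * M" for x by (rule LIMSEQ_le_const2[OF tendsto_rabs[OF cl]]) (use ab in auto)
  let ?B = "(2 * (sqrt (2 ^ k) * M))^2"
  have acb: "weight x * (?a n x - c x)^2 \<le> ?B * weight x" for n x
  proof -
    have "abs (?a n x - c x) \<le> 2 * (sqrt (2 ^ k) * M)" using ab[of n x] cb[of x] by linarith
    from power_mono[OF this abs_ge_zero, of 2] have "(?a n x - c x)^2 \<le> ?B" by (simp only: power2_abs)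
    then have "weight x * (?a n x - c x)^2 \<le> weight x * ?B" by (rule mult_left_mono) (rule weight_nonneg)
    then show ?thesis by (simp add: mult.commute)
  qed
  have aci: "integrable lebesgue (\<lambda>x. weight x * (?a n x - c x)^2)" for n
    by (rule Bochner_Integration.integrable_bound[OF integrable_mult_right[OF weight_integrable, of ?B]])
      (measurable, use acb weight_nonneg in \<open>auto simp: abs_mult\<close>)
  have "(\<lambda>n. LINT x|lebesgue. weight x * (?a n x - c x)^2) \<longlonglongrightarrow> (LINT x|(lebesgue :: (real^3) measure). (0::real))"
  proof (rule integral_dominated_convergence[where w="\<lambda>x. ?B * weight x"])
    show "AE x in lebesgue. (\<lambda>n. weight x * (?a n x - c x)^2) \<longlonglongrightarrow> 0"
    proof (rule AE_I2)
      fix x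
      have "(\<lambda>n. weight x * (?a n x - c x)^2) \<longlonglongrightarrow> weight x * (c x - c x)^2" by (intro tendsto_intros cl)
      then show "(\<lambda>n. weight x * (?a n x - c x)^2) \<longlonglongrightarrow> 0" by simp
    qed
    show "AE x in lebesgue. norm (weight x * (?a n x - c x)^2) \<le> ?B * weight x" for n using acb weight_nonneg by (auto simp: abs_mult)
  qed (use weight_integrable in auto)
  then have "(\<lambda>n. wdist (?a n) c) \<longlonglongrightarrow> 0" by (simp add: wdist_def)
  then obtain N where N: "\<And>n. n \<ge> N ==> abs (wdist (?a n) c) < e / 64" using LIMSEQ_D[of "\<lambda>n. wdist (?a n) c" 0 "e / 64"] e by auto
  have wsym: "wdist f g = wdist g f" for f g by (simp add: wdist_def power2_commute)
  have sqp: "abs t powr 2 = t^2" for t :: real by (cases "t = 0") (auto simp: powr_numeral)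
  have uaL: "(\<lambda>x. ?u n x - ?a n x) \<in> L2" for n by (rule L2_diff[OF rep_L2(1) avg_L2(1)[OF rep_L2(1)]])
  have ua: "wdist (?u n) (?a n) \<le> e / 32" for n
  proof -
    have "wdist (?u n) (?a n) \<le> 2 * (LINT x|lebesgue. (?u n x - ?a n x)^2)" by (rule wdist_le_L2[OF uaL])
    also have "\<dots> \<le> 2 * (C * \<theta> ^ k * (norm (U n))^2)" using conjunct2[OF C(4)[of "U n" k]] sqp[of "norm (U n)"] unfolding sqp by simp
    also have "\<dots> \<le> 2 * (C * \<theta> ^ k * M^2)" using C bd[of n] by (intro mult_left_mono power_mono) auto
    also have "\<dots> \<le> 2 * (\<theta> ^ k * (C * M^2 + 1))" using C by (simp add: algebra_simps)
    also have "\<dots> \<le> 2 * (e / 64)"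
    proof -
      have "0 < 64 * (C * M^2 + 1)" using C by (simp add: add_nonneg_pos)
      then have "\<theta> ^ k * (64 * (C * M^2 + 1)) < e" using k by (simp add: less_divide_eq)
      then show ?thesis by (simp add: algebra_simps)
    qed
    finally show ?thesis by simp
  qed
  have L2i: "f \<in> L2 ==> integrable lebesgue (\<lambda>x. weight x * (f x)^2)" for f by (rule weight_mult_integrable) (simp add: L2_real_iff)
  have "wdist (?u m) (?u n) < e" if mn: "m \<ge> N" "n \<ge> N" for m n
  proof -
    have aL: "?a n \<in> L2" "?u n \<in> L2" for n by (rule avg_L2(1)[OF rep_L2(1)]) (rule rep_L2)
    have 1: "wdist (?a m) (?a n) \<le> 2 * wdist (?a m) c + 2 * wdist c (?a n)"
      by (rule wdist_triangle[OF aci _ L2i[OF L2_diff[OF aL(1) aL(1)]]]) (use aci[of n] in \<open>simp add: power2_commute\<close>)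
    have 2: "wdist (?u m) (?a n) \<le> 2 * wdist (?u m) (?a m) + 2 * wdist (?a m) (?a n)" by (rule wdist_triangle; rule L2i; rule L2_diff; rule aL)
    have 3: "wdist (?u m) (?u n) \<le> 2 * wdist (?u m) (?a n) + 2 * wdist (?a n) (?u n)" by (rule wdist_triangle; rule L2i; rule L2_diff; rule aL)
    show ?thesis using 1 2 3 ua[of m] ua[of n] N[OF mn(1)] N[OF mn(2)] wsym[of c "?a n"] wsym[of "?a n" "?u n"] e by linarith
  qed
  then show ?thesis by blast
qed

text \<open>Nearly shortest elements of the convex hulls of the tails form a Cauchy sequence by the
  parallelogram law: a midpoint stays in the hull and so cannot be much shorter. This stands in for
  weak sequential compactness.\<close>

lemma convex_combinations_convergent:
  fixes Y :: "nat => 'a::{real_inner, complete_space}"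
  assumes bd: "\<And>n. norm (Y n) \<le> M"
  obtains Z V where "\<And>n. Z n \<in> convex hull (Y ` {n..})" "Z \<longlonglongrightarrow> V"
proof -
  define C where "C n = convex hull (Y ` {n..})" for n
  define d where "d n = Inf (norm ` C n)" for n
  have YC: "Y n \<in> C n" for n unfolding C_def by (rule hull_inc) auto
  have Cmono: "C m \<subseteq> C n" if "n \<le> m" for m n unfolding C_def by (rule hull_mono) (use that in auto)
  have bb: "bdd_below (norm ` C n)" for n by (rule bdd_belowI[of _ 0]) auto
  have dle: "d n \<le> norm z" if "z \<in> C n" for n z unfolding d_def by (rule cInf_lower[OF imageI[OF that] bb])
  have "d n \<le> d m" if "n \<le> m" for m n unfolding d_def by (rule cInf_superset_mono) (use YC bb Cmono[OF that] in auto)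
  then have "incseq d" by (simp add: incseq_def)
  moreover have "d n \<le> M" for n using dle[OF YC] bd order_trans by blast
  ultimately obtain L where L: "d \<longlonglongrightarrow> L" using incseq_convergent by blast
  have "\<forall>n. \<exists>z\<in>C n. norm z < d n + inverse (real (Suc n))"
  proof
    fix n
    have "Inf (norm ` C n) < d n + inverse (real (Suc n))" by (simp add: d_def)
    then show "\<exists>z\<in>C n. norm z < d n + inverse (real (Suc n))" using cInf_lessD[of "norm ` C n"] YC by blast
  qed
  then obtain Z where Z: "\<And>n. Z n \<in> C n" "\<And>n. norm (Z n) < d n + inverse (real (Suc n))" by metis
  define s where "s n = (d n + inverse (real (Suc n)))^2" for n
  have "s \<longlonglongrightarrow> (L + 0)^2" unfolding s_def by (intro tendsto_intros L LIMSEQ_inverse_real_of_nat)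
  then have s: "s \<longlonglongrightarrow> L^2" by simp
  have d2: "(\<lambda>n. (d n)^2) \<longlonglongrightarrow> L^2" by (intro tendsto_intros L)
  have d0: "0 \<le> d n" for n unfolding d_def by (rule cInf_greatest) (use YC in auto)
  have est: "(norm (Z n - Z m))^2 \<le> 2 * s n + 2 * s m - 4 * (d n)^2" if "n \<le> m" for n m
  proof -
    have "Z m \<in> C n" using Z(1) Cmono[OF that] by blast
    then have "(1/2) *\<^sub>R Z n + (1/2) *\<^sub>R Z m \<in> C n" unfolding C_def by (intro convexD[OF convex_convex_hull]) (use Z(1) C_def in auto)
    then have "d n \<le> norm ((1/2) *\<^sub>R Z n + (1/2) *\<^sub>R Z m)" by (rule dle)
    then have "(d n)^2 \<le> (norm ((1/2) *\<^sub>R Z n + (1/2) *\<^sub>R Z m))^2" using d0 by (intro power_mono)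
    moreover have "4 * (norm ((1/2) *\<^sub>R Z n + (1/2) *\<^sub>R Z m))^2 = (norm (Z n + Z m))^2"
      by (simp flip: scaleR_add_right add: power_mult_distrib power2_eq_square)
    moreover have "(norm (Z n - Z m))^2 = 2 * (norm (Z n))^2 + 2 * (norm (Z m))^2 - (norm (Z n + Z m))^2"
      by (simp add: power2_norm_eq_inner inner_diff inner_add inner_commute)
    moreover have "(norm (Z k))^2 \<le> s k" for k unfolding s_def using Z(2)[of k] by (intro power_mono) auto
    ultimately show ?thesis by (smt (verit, best))
  qed
  have "Cauchy Z"
  proof (rule metric_CauchyI)
    fix e :: real assume e: "e > 0"
    have "eventually (\<lambda>n. abs (s n - L^2) < e^2/8 \<and> abs ((d n)^2 - L^2) < e^2/8) sequentially"
      using tendstoD[OF s, of "e^2/8"] tendstoD[OF d2, of "e^2/8"] e by (simp add: dist_real_def eventually_conj)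
    then obtain N where N: "\<And>n. n \<ge> N ==> abs (s n - L^2) < e^2/8 \<and> abs ((d n)^2 - L^2) < e^2/8" by (auto simp: eventually_sequentially)
    have lt: "dist (Z n) (Z m) < e" if "N \<le> n" "n \<le> m" for n m
    proof -
      have a: "abs (s n - L^2) < e^2/8" "abs ((d n)^2 - L^2) < e^2/8" "abs (s m - L^2) < e^2/8" using N[of n] N[of m] that by auto
      have "(norm (Z n - Z m))^2 < e^2" using est[OF that(2)] a by linarith
      then show ?thesis unfolding dist_norm by (rule power2_less_imp_less) (use e in simp)
    qed
    have "dist (Z m) (Z n) < e" if "N \<le> m" "N \<le> n" for m n using lt[of m n] lt[of n m] that by (cases "n \<le> m") (auto simp: dist_commute)
    then show "\<exists>M. \<forall>m\<ge>M. \<forall>n\<ge>M. dist (Z m) (Z n) < e" by blast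
  qed
  then obtain V where "Z \<longlonglongrightarrow> V" using Cauchy_convergent convergent_def by blast
  then show ?thesis using that Z(1) C_def by blast
qed

text \<open>\<open>V\<close> is a norm limit of convex combinations of tails, so closed convex
  conditions valid along the tails pass to it. Sublevel sets of the distance to the weighted limit
  \<open>g\<close> identify \<open>V\<close> as the pointwise limit; preimages of intervals identify
  the value of any functional that converges along the sequence.\<close>

lemma weak_compactness:
  assumes bd: "\<And>n. norm (U n) \<le> M"
  obtains r V where "strict_mono (r :: nat => nat)"
    "(\<lambda>n. wdist (rep (U (r n))) (rep V)) \<longlonglongrightarrow> 0"
    "AE x in lebesgue. (\<lambda>n. rep (U (r n)) x) \<longlonglongrightarrow> rep V x"
    "\<And>\<phi> \<beta>. bounded_linear \<phi> ==> (\<lambda>n. \<phi> (U (r n)) :: real) \<longlonglongrightarrow> \<beta> ==> \<phi> V = \<beta>"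
proof -
  obtain r1 where r1: "strict_mono (r1 :: nat => nat)" "\<And>k x. convergent (\<lambda>n. avg k (rep (U (r1 n))) x)"
    by (rule averages_subsequence[OF bd]) (rule that; assumption)
  \<comment> \<open>Multiplication by the root of the weight turns \<open>wdist\<close> into the
    plain squared L2 distance, to which completeness applies.\<close>
  define F where "F W x = sqrt (weight x) * rep W x" for W x
  have Fm[measurable]: "F W \<in> borel_measurable lebesgue" for W unfolding F_def by measurable
  have Fsq: "(F W x)^2 = weight x * (rep W x)^2" for W x by (simp add: F_def power_mult_distrib weight_nonneg)
  have FL: "F W \<in> L2" for W using weight_mult_integrable[of "\<lambda>x. (rep W x)^2"] rep_L2(1)[of W] by (simp add: L2_real_iff Fsq)
  have Fd: "(F W x - F W' x)^2 = weight x * (rep W x - rep W' x)^2" for W W' x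
    by (simp add: F_def power_mult_distrib weight_nonneg flip: right_diff_distrib)
  have wF: "wdist (rep W) (rep W') = (LINT x|lebesgue. (norm (F W x - F W' x))^2)" for W W' by (simp add: wdist_def Fd)
  obtain g r2 where g: "g \<in> L2" "strict_mono (r2 :: nat => nat)" "AE x in lebesgue. (\<lambda>n. F (U (r1 (r2 n))) x) \<longlonglongrightarrow> g x"
    "(\<lambda>n. LINT x|lebesgue. (norm (F (U (r1 n)) x - g x))^2) \<longlonglongrightarrow> 0"
  proof (rule L2_complete[of "\<lambda>n. F (U (r1 n))"])
    show "\<exists>N. \<forall>m\<ge>N. \<forall>n\<ge>N. (LINT x|lebesgue. (norm (F (U (r1 m)) x - F (U (r1 n)) x))^2) < e" if "e > 0" for e
      unfolding wF[symmetric] by (rule wdist_Cauchy[of "\<lambda>n. U (r1 n)", OF bd r1(2) that])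
  qed (rule FL, (rule that; assumption))
  define r where "r = r1 \<circ> r2"
  have r: "strict_mono r" unfolding r_def by (rule strict_mono_o[OF r1(1) g(2)])
  define N where "N W = (LINT x|lebesgue. (F W x - g x)^2)" for W
  have Ni: "integrable lebesgue (\<lambda>x. (F W x - g x)^2)" for W using L2_diff[OF FL g(1)] by (simp add: L2_real_iff)
  have N0: "0 \<le> N W" for W unfolding N_def by (rule integral_nonneg_AE) simp
  have "(\<lambda>n. N (U (r1 n))) \<longlonglongrightarrow> 0" using g(4) by (simp add: N_def)
  then have Nlim: "(\<lambda>n. N (U (r n))) \<longlonglongrightarrow> 0"
    unfolding r_def using LIMSEQ_subseq_LIMSEQ[OF _ g(2)] by (fastforce simp: o_def)
  obtain Z V where Z: "\<And>n. Z n \<in> convex hull ((\<lambda>n. U (r n)) ` {n..})" "Z \<longlonglongrightarrow> V"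
    by (rule convex_combinations_convergent[of "\<lambda>n. U (r n)", OF bd]) (rule that; assumption)
  have hull: "Z n \<in> S" if "convex S" "\<And>k. k \<ge> n ==> U (r k) \<in> S" for S n
    using Z(1)[of n] hull_minimal[of "(\<lambda>n. U (r n)) ` {n..}" S convex] that by auto
  have conv: "convex {W. N W \<le> e}" for e
  proof (rule convexI, clarify)
    fix W1 W2 and a b :: real assume W: "N W1 \<le> e" "N W2 \<le> e" and ab: "0 \<le> a" "0 \<le> b" "a + b = 1"
    have ae: "AE x in lebesgue. F (a *\<^sub>R W1 + b *\<^sub>R W2) x = a * F W1 x + b * F W2 x"
      using rep_plus_AE[of "a *\<^sub>R W1" "b *\<^sub>R W2"] rep_scaleR_AE[of a W1] rep_scaleR_AE[of b W2]
      by eventually_elim (simp add: F_def algebra_simps)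
    have "N (a *\<^sub>R W1 + b *\<^sub>R W2) \<le> (LINT x|lebesgue. a * (F W1 x - g x)^2 + b * (F W2 x - g x)^2)" unfolding N_def
    proof (rule integral_mono_AE[OF Ni])
      show "AE x in lebesgue. (F (a *\<^sub>R W1 + b *\<^sub>R W2) x - g x)^2 \<le> a * (F W1 x - g x)^2 + b * (F W2 x - g x)^2" using ae
      proof eventually_elim
        case (elim x)
        let ?X = "F W1 x - g x" and ?Y = "F W2 x - g x"
        have b: "b = 1 - a" using ab by simp
        have "(a + b) * g x = g x" using ab by simp
        then have "F (a *\<^sub>R W1 + b *\<^sub>R W2) x - g x = a * ?X + b * ?Y" unfolding elim by (simp add: algebra_simps)
        moreover have "a * ?X^2 + b * ?Y^2 - (a * ?X + b * ?Y)^2 = a * b * (?X - ?Y)^2" unfolding b by (simp add: power2_eq_square algebra_simps)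
        moreover have "0 \<le> a * b * (?X - ?Y)^2" using ab by simp
        ultimately show ?case by simp
      qed
    qed (use Ni in auto)
    also have "\<dots> = a * N W1 + b * N W2" using Ni by (simp add: N_def)
    also have "\<dots> \<le> a * e + b * e" using W ab by (intro add_mono mult_left_mono) auto
    also have "\<dots> = e" using ab by (simp flip: distrib_right)
    finally show "N (a *\<^sub>R W1 + b *\<^sub>R W2) \<le> e" .
  qed
  have NV: "N V = 0"
  proof (rule ccontr)
    assume "N V \<noteq> 0"
    then have pos: "N V > 0" using N0[of V] by linarith
    \<comment> \<open>The estimate below yields \<open>N V < 6 * e\<close>, so any fraction up to
      one sixth gives the contradiction.\<close>
    define e where "e = N V / 8"
    have e: "e > 0" using pos by (simp add: e_def)
    obtain n0 where n0: "\<And>n. n \<ge> n0 ==> N (U (r n)) \<le> e" using LIMSEQ_D[OF Nlim e] N0 by fastforce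
    have NZ: "N (Z n) \<le> e" if "n \<ge> n0" for n using hull[OF conv, of n e] n0 that by auto
    have "(\<lambda>n. (norm (V - Z n))^2) \<longlonglongrightarrow> (norm (V - V))^2" by (intro tendsto_intros Z(2))
    then obtain n1 where n1: "\<And>n. n \<ge> n1 ==> (norm (V - Z n))^2 < e" using LIMSEQ_D[of "\<lambda>n. (norm (V - Z n))^2" 0 e] e by auto
    let ?n = "max n0 n1"
    have "N V \<le> (LINT x|lebesgue. 2 * (F V x - F (Z ?n) x)^2 + 2 * (F (Z ?n) x - g x)^2)" unfolding N_def
    proof (rule integral_mono[OF Ni])
      show "integrable lebesgue (\<lambda>x. 2 * (F V x - F (Z ?n) x)^2 + 2 * (F (Z ?n) x - g x)^2)"
        using Ni L2_diff[OF FL FL, of V "Z ?n"] by (simp add: L2_real_iff)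
      show "(F V x - g x)^2 \<le> 2 * (F V x - F (Z ?n) x)^2 + 2 * (F (Z ?n) x - g x)^2" for x
        using sq_add_le[of "F V x - F (Z ?n) x" "F (Z ?n) x - g x"] by simp
    qed
    also have "\<dots> = 2 * wdist (rep V) (rep (Z ?n)) + 2 * N (Z ?n)" using Ni L2_diff[OF FL FL, of V "Z ?n"] by (simp add: L2_real_iff N_def wF)
    also have "wdist (rep V) (rep (Z ?n)) \<le> 2 * (LINT x|lebesgue. (rep V x - rep (Z ?n) x)^2)"
      by (rule wdist_le_L2) (rule L2_diff[OF rep_L2(1) rep_L2(1)])
    also have "(LINT x|lebesgue. (rep V x - rep (Z ?n) x)^2) = (LINT x|lebesgue. (rep (V - Z ?n) x)^2)"
      by (rule integral_cong_AE) (measurable, use rep_minus_AE[of V "Z ?n"] in eventually_elim, simp)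
    also have "\<dots> \<le> (norm (V - Z ?n))^2" by (rule integral_rep_sq_le)
    finally have "N V \<le> 2 * (2 * (norm (V - Z ?n))^2) + 2 * N (Z ?n)" by simp
    moreover have "(norm (V - Z ?n))^2 < e" "N (Z ?n) \<le> e" using n1[of ?n] NZ[of ?n] by auto
    ultimately have "N V < 6 * e" by linarith
    then show False using pos by (simp add: e_def)
  qed
  have FV: "AE x in lebesgue. F V x = g x" using NV unfolding N_def by (subst (asm) integral_nonneg_eq_0_iff_AE[OF Ni]) auto
  have lim: "AE x in lebesgue. (\<lambda>n. rep (U (r n)) x) \<longlonglongrightarrow> rep V x" using g(3) FV
  proof eventually_elim
    case (elim x)
    have w: "sqrt (weight x) > 0" using weight_pos[of x] by simp
    have "(\<lambda>n. F (U (r n)) x / sqrt (weight x)) \<longlonglongrightarrow> F V x / sqrt (weight x)"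
      using elim w by (intro tendsto_divide tendsto_const) (auto simp: r_def)
    then show ?case using w by (simp add: F_def)
  qed
  have wl: "(\<lambda>n. wdist (rep (U (r n))) (rep V)) \<longlonglongrightarrow> 0"
  proof -
    have [measurable]: "g \<in> borel_measurable lebesgue" using g(1) L2_D by auto
    have "wdist (rep W) (rep V) = N W" for W unfolding wF N_def by (rule integral_cong_AE) (measurable, use FV in eventually_elim, simp)
    then show ?thesis using Nlim by simp
  qed
  have "\<phi> V = \<beta>" if \<phi>: "bounded_linear \<phi>" "(\<lambda>n. \<phi> (U (r n)) :: real) \<longlonglongrightarrow> \<beta>" for \<phi> \<beta>
  proof -
    interpret bounded_linear \<phi> by (rule \<phi>(1))
    have cv: "convex (\<phi> -` cball \<beta> e)" for e by (rule convex_linear_vimage[OF linear_axioms convex_cball])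
    have "(\<lambda>n. \<phi> (Z n)) \<longlonglongrightarrow> \<beta>"
    proof (rule LIMSEQ_I)
      fix e :: real assume "e > 0"
      then obtain n0 where n0: "\<And>n. n \<ge> n0 ==> norm (\<phi> (U (r n)) - \<beta>) < e/2" using LIMSEQ_D[OF \<phi>(2), of "e/2"] by auto
      have "\<phi> (Z n) \<in> cball \<beta> (e/2)" if "n \<ge> n0" for n
      proof -
        have "Z n \<in> \<phi> -` cball \<beta> (e/2)"
        proof (rule hull[OF cv])
          fix k assume "k \<ge> n"
          then have "norm (\<phi> (U (r k)) - \<beta>) < e/2" using n0 that by simp
          then show "U (r k) \<in> \<phi> -` cball \<beta> (e/2)" by (simp add: dist_real_def abs_minus_commute)
        qed
        then show ?thesis by simp
      qed
      then have "norm (\<phi> (Z n) - \<beta>) < e" if "n \<ge> n0" for n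
        using that \<open>e > 0\<close> by (fastforce simp: dist_real_def abs_minus_commute)
      then show "\<exists>no. \<forall>n\<ge>no. norm (\<phi> (Z n) - \<beta>) < e" by blast
    qed
    moreover have "(\<lambda>n. \<phi> (Z n)) \<longlonglongrightarrow> \<phi> V" by (rule tendsto[OF Z(2)])
    ultimately show ?thesis using LIMSEQ_unique by blast
  qed
  then show ?thesis using that r wl lim by blast
qed

section \<open>Palais--Smale sequences on the Nehari manifold\<close>

text \<open>From \<open>w0\<close>, move repeatedly to an almost lowest point among those that beat
  the current one by \<open>e\<close> times their distance. The values decrease and bound the steps,
  so the path is Cauchy. A point violating the conclusion at the limit would compete at every stage,
  against almost minimality. The start may be any point of \<open>S\<close>, so only the level of
  \<open>w0\<close> is controlled.\<close>

lemma ekeland: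
  fixes S :: "'a::complete_space set" and \<Psi> :: "'a => real"
  assumes S: "closed S" "w0 \<in> S" and cont: "continuous_on S \<Psi>" and pos: "\<And>w. w \<in> S ==> 0 \<le> \<Psi> w" and e: "e > 0"
  obtains w where "w \<in> S" "\<Psi> w \<le> \<Psi> w0" "\<And>z. z \<in> S ==> \<Psi> z \<ge> \<Psi> w - e * dist z w"
proof -
  define A where "A w = {z \<in> S. \<Psi> z + e * dist z w \<le> \<Psi> w}" for w
  define I where "I w = Inf (\<Psi> ` A w)" for w
  have bb: "bdd_below (\<Psi> ` A w)" for w by (rule bdd_belowI[of _ 0]) (auto simp: A_def pos)
  have self: "w \<in> S ==> w \<in> A w" for w by (simp add: A_def)
  have Ile: "z \<in> A w ==> I w \<le> \<Psi> z" for z w unfolding I_def by (rule cInf_lower[OF imageI bb])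
  have step: "\<exists>z. z \<in> A w \<and> \<Psi> z < I w + inverse (real (Suc n))" if "w \<in> S" for w n
  proof -
    have "Inf (\<Psi> ` A w) < I w + inverse (real (Suc n))" by (simp add: I_def)
    then show ?thesis using cInf_lessD[of "\<Psi> ` A w"] self[OF that] by blast
  qed
  define nxt where "nxt n w = (SOME z. z \<in> A w \<and> \<Psi> z < I w + inverse (real (Suc n)))" for n w
  have nxt: "nxt n w \<in> A w" "\<Psi> (nxt n w) < I w + inverse (real (Suc n))" if "w \<in> S" for n w
    using someI_ex[OF step[OF that, of n]] by (auto simp: nxt_def)
  define x where "x = rec_nat w0 nxt"
  have x0: "x 0 = w0" and xS: "x (Suc n) = nxt n (x n)" for n by (simp_all add: x_def)
  have xin: "x n \<in> S" for n by (induction n) (use S nxt in \<open>auto simp: x0 xS A_def\<close>)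
  have xA: "x (Suc n) \<in> A (x n)" "\<Psi> (x (Suc n)) < I (x n) + inverse (real (Suc n))" for n using nxt[OF xin] xS by auto
  have d: "e * dist (x m) (x n) \<le> \<Psi> (x n) - \<Psi> (x m)" if "n \<le> m" for m n using that
  proof (induction m)
    case (Suc m)
    show ?case
    proof (cases "n = Suc m")
      case False
      then have IH: "e * dist (x m) (x n) \<le> \<Psi> (x n) - \<Psi> (x m)" using Suc by simp
      have "e * dist (x (Suc m)) (x n) \<le> e * (dist (x (Suc m)) (x m) + dist (x m) (x n))" using e by (intro mult_left_mono dist_triangle) auto
      then show ?thesis using IH xA(1)[of m] by (simp add: A_def algebra_simps)
    qed simp
  qed simp
  have "decseq (\<lambda>n. \<Psi> (x n))"
  proof (rule decseq_SucI)
    fix n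
    have "0 \<le> e * dist (x (Suc n)) (x n)" using e by simp
    then show "\<Psi> (x (Suc n)) \<le> \<Psi> (x n)" using d[of n "Suc n"] by simp
  qed
  then obtain l where l: "(\<lambda>n. \<Psi> (x n)) \<longlonglongrightarrow> l" using decseq_convergent[of _ 0] pos[OF xin] by blast
  have "Cauchy x"
  proof (rule metric_CauchyI)
    fix \<epsilon> :: real assume \<epsilon>: "\<epsilon> > 0"
    then have "e * \<epsilon> > 0" using e by simp
    then obtain M where M: "\<And>m n. m \<ge> M ==> n \<ge> M ==> abs (\<Psi> (x m) - \<Psi> (x n)) < e * \<epsilon>"
      using CauchyD[OF LIMSEQ_imp_Cauchy[OF l], of "e * \<epsilon>"] by auto
    have lt: "dist (x m) (x n) < \<epsilon>" if "M \<le> n" "n \<le> m" for m n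
    proof -
      have "e * dist (x m) (x n) < e * \<epsilon>" using d[OF that(2)] M[of n m] that by auto
      then show ?thesis using e by simp
    qed
    have "dist (x m) (x n) < \<epsilon>" if "m \<ge> M" "n \<ge> M" for m n
      using lt[of m n] lt[of n m] that by (cases "n \<le> m") (auto simp: dist_commute)
    then show "\<exists>M. \<forall>m\<ge>M. \<forall>n\<ge>M. dist (x m) (x n) < \<epsilon>" by blast
  qed
  then obtain w where w: "x \<longlonglongrightarrow> w" using Cauchy_convergent convergent_def by blast
  have wS: "w \<in> S" using closed_sequentially[OF S(1)] xin w by blast
  have "(\<lambda>n. \<Psi> (x n)) \<longlonglongrightarrow> \<Psi> w" using cont w wS xin continuous_on_tendsto_compose[OF cont w wS] by simp
  then have lw: "l = \<Psi> w" using l LIMSEQ_unique by blast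
  have dw: "e * dist w (x n) \<le> \<Psi> (x n) - \<Psi> w" for n
  proof -
    have "(\<lambda>m. e * dist (x m) (x n)) \<longlonglongrightarrow> e * dist w (x n)" by (intro tendsto_intros w)
    moreover have "(\<lambda>m. \<Psi> (x n) - \<Psi> (x m)) \<longlonglongrightarrow> \<Psi> (x n) - \<Psi> w" using l lw by (intro tendsto_intros) auto
    ultimately show ?thesis by (rule LIMSEQ_le) (use d in blast)
  qed
  show ?thesis
  proof (rule that[OF wS])
    have "0 \<le> e * dist w (x 0)" using e by simp
    then show "\<Psi> w \<le> \<Psi> w0" using dw[of 0] x0 by simp
    fix z assume z: "z \<in> S"
    show "\<Psi> z \<ge> \<Psi> w - e * dist z w"
    proof (rule ccontr)
      assume "\<not> \<Psi> z \<ge> \<Psi> w - e * dist z w"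
      then have lt: "\<Psi> z < \<Psi> w - e * dist z w" by simp
      have "z \<in> A (x n)" for n
      proof -
        have "e * dist z (x n) \<le> e * (dist z w + dist w (x n))" using e by (intro mult_left_mono dist_triangle) auto
        then show ?thesis using lt dw[of n] z by (simp add: A_def algebra_simps)
      qed
      then have "\<Psi> (x (Suc n)) - inverse (real (Suc n)) \<le> \<Psi> z" for n using Ile[of z "x n"] xA(2)[of n] by simp
      moreover have "(\<lambda>n. \<Psi> (x (Suc n)) - inverse (real (Suc n))) \<longlonglongrightarrow> \<Psi> w - 0"
        using LIMSEQ_Suc[OF l] lw by (intro tendsto_diff LIMSEQ_inverse_real_of_nat) auto
      ultimately have "\<Psi> w \<le> \<Psi> z" using LIMSEQ_le_const2 by (metis (no_types, lifting) diff_zero)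
      moreover have "0 \<le> e * dist z w" using e by simp
      ultimately show False using lt by simp
    qed
  qed
qed

text \<open>\<open>K'\<close> is jointly continuous but need not be differentiable, hence the
  ray-wise form of the assumptions. \<open>mono\<close> is weak monotonicity along rays,
  \<open>small\<close> keeps the Nehari set away from the origin, and \<open>large\<close> makes
  every ray reach it.\<close>

locale nehari =
  fixes b :: "'a::{real_inner, complete_space} => 'a => real" and K :: "'a => real" and K' :: "'a => 'a => real"
    and q \<rho> c :: real
  assumes bil: "bounded_bilinear b" and sym: "b u v = b v u" and coercive: "c > 0" "c * (norm u)^2 \<le> b u u"
    and K_deriv: "(K has_derivative K' u) (at u)"
    and K'_cont: "\<And>X Y x y. X \<longlonglongrightarrow> x ==> Y \<longlonglongrightarrow> y ==> (\<lambda>n. K' (X n) (Y n)) \<longlonglongrightarrow> K' x y"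
    and q: "2 < q" and AR: "q * K u \<le> K' u u"
    and mono: "0 < s ==> s \<le> t ==> K' (s *\<^sub>R u) u / s powr (q - 1) \<le> K' (t *\<^sub>R u) u / t powr (q - 1)"
    and small: "\<rho> > 0" "b u u \<le> \<rho>^2 ==> K' u u \<le> b u u / 2"
    and large: "u \<noteq> 0 ==> \<exists>t>0. b (t *\<^sub>R u) (t *\<^sub>R u) < K' (t *\<^sub>R u) (t *\<^sub>R u)"
begin

interpretation b: bounded_bilinear b by (rule bil)

definition J where "J u = b u u / 2 - K u"
definition J' where "J' u v = b u v - K' u v"

lemma K'_linear: "linear (K' u)" using has_derivative_linear[OF K_deriv] .

lemma J_deriv: "(J has_derivative J' u) (at u)"
proof -
  have "((\<lambda>u. b u u) has_derivative (\<lambda>h. b u h + b h u)) (at u)" by (rule b.FDERIV[OF has_derivative_ident has_derivative_ident])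
  then have "((\<lambda>u. b u u / 2 - K u) has_derivative (\<lambda>h. (b u h + b h u) / 2 - K' u h)) (at u)"
    by (intro has_derivative_diff K_deriv) (auto intro!: derivative_eq_intros)
  then show ?thesis by (simp add: J_def[abs_def] J'_def[abs_def] sym)
qed

lemma J'_tendsto: "u \<longlonglongrightarrow> u0 ==> v \<longlonglongrightarrow> v0 ==> (\<lambda>n. J' (u n) (v n)) \<longlonglongrightarrow> J' u0 v0"
  unfolding J'_def by (intro tendsto_diff K'_cont b.tendsto)

lemma J_line_deriv: "((\<lambda>t. J (a + t *\<^sub>R v)) has_real_derivative J' (a + t *\<^sub>R v) v) (at t)"
proof -
  have "((\<lambda>t. a + t *\<^sub>R v) has_derivative (\<lambda>h. h *\<^sub>R v)) (at t)" by (auto intro!: derivative_eq_intros)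
  from has_derivative_compose[OF this J_deriv]
  have "((\<lambda>t. J (a + t *\<^sub>R v)) has_derivative (\<lambda>h. J' (a + t *\<^sub>R v) (h *\<^sub>R v))) (at t)" .
  moreover have "J' u (h *\<^sub>R v) = J' u v * h" for u h by (simp add: J'_def b.scaleR_right linear_cmul[OF K'_linear] algebra_simps)
  ultimately show ?thesis by (simp add: has_field_derivative_def)
qed

lemma b_pos: "u \<noteq> 0 ==> b u u > 0" using coercive(2)[of u] coercive(1) by (smt (verit) mult_pos_pos zero_less_norm_iff zero_less_power)

text \<open>Divided by t^(q-1), the quadratic part becomes t^(2-q) times a positive constant,
  strictly decreasing because q > 2, and the nonlinear part is nondecreasing. Strictness, hence
  uniqueness of the Nehari point on a ray, comes from the quadratic part.\<close>

lemma J'_ray_less: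
  assumes "w \<noteq> 0" "0 < s" "s < t"
  shows "J' (t *\<^sub>R w) w / t powr (q - 1) < J' (s *\<^sub>R w) w / s powr (q - 1)"
proof -
  have e: "J' (r *\<^sub>R w) w / r powr (q - 1) = r powr (2 - q) * b w w - K' (r *\<^sub>R w) w / r powr (q - 1)" if "r > 0" for r
  proof -
    have "r / r powr (q - 1) = r powr 1 / r powr (q - 1)" using that by simp
    also have "\<dots> = r powr (2 - q)" by (simp only: powr_diff[symmetric]) simp
    finally show ?thesis by (simp add: J'_def b.scaleR_left diff_divide_distrib flip: times_divide_eq_left)
  qed
  have "t powr (2 - q) < s powr (2 - q)" using assms q by (intro powr_less_mono2_neg) auto
  then have "t powr (2 - q) * b w w < s powr (2 - q) * b w w" using b_pos[OF assms(1)] by simp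
  moreover have "K' (s *\<^sub>R w) w / s powr (q - 1) \<le> K' (t *\<^sub>R w) w / t powr (q - 1)" by (rule mono) (use assms in auto)
  ultimately show ?thesis using e[of s] e[of t] assms by simp
qed

lemma J'_ray_scale: "t > 0 ==> t * J' (t *\<^sub>R w) w = b (t *\<^sub>R w) (t *\<^sub>R w) - K' (t *\<^sub>R w) (t *\<^sub>R w)"
  by (simp add: J'_def b.scaleR_left b.scaleR_right linear_cmul[OF K'_linear] right_diff_distrib)

lemma ray_exists:
  assumes w: "w \<noteq> 0"
  shows "\<exists>t>0. J' (t *\<^sub>R w) w = 0"
proof -
  obtain t1 where t1: "t1 > 0" "b (t1 *\<^sub>R w) (t1 *\<^sub>R w) < K' (t1 *\<^sub>R w) (t1 *\<^sub>R w)" using large[OF w] by blast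
  \<comment> \<open>The first entry keeps the endpoints in order, the second puts
    \<open>t0 *\<^sub>R w\<close> into the region where \<open>small\<close> applies.\<close>
  define t0 where "t0 = min (t1 / 2) (\<rho> / sqrt (b w w))"
  have bw: "b w w > 0" by (rule b_pos[OF w])
  have t0: "t0 > 0" "t0 < t1" using t1 small(1) bw by (auto simp: t0_def)
  have "t0^2 * b w w \<le> \<rho>^2"
  proof -
    have "t0^2 \<le> (\<rho> / sqrt (b w w))^2" using t0 by (intro power_mono) (auto simp: t0_def)
    then show ?thesis using bw by (simp add: power_divide le_divide_eq)
  qed
  then have "b (t0 *\<^sub>R w) (t0 *\<^sub>R w) \<le> \<rho>^2" by (simp add: b.scaleR_left b.scaleR_right power2_eq_square)
  then have "K' (t0 *\<^sub>R w) (t0 *\<^sub>R w) \<le> b (t0 *\<^sub>R w) (t0 *\<^sub>R w) / 2" by (rule small)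
  moreover have "b (t0 *\<^sub>R w) (t0 *\<^sub>R w) > 0" using b_pos[of "t0 *\<^sub>R w"] w t0 by simp
  ultimately have p0: "t0 * J' (t0 *\<^sub>R w) w \<ge> 0" unfolding J'_ray_scale[OF t0(1)] by simp
  have p1: "t1 * J' (t1 *\<^sub>R w) w \<le> 0" unfolding J'_ray_scale[OF t1(1)] using t1(2) by simp
  have "continuous_on {t0..t1} (\<lambda>t. J' (t *\<^sub>R w) w)" unfolding continuous_on_sequentially
    by (auto simp: o_def intro!: J'_tendsto tendsto_intros)
  moreover have "J' (t0 *\<^sub>R w) w \<ge> 0" "J' (t1 *\<^sub>R w) w \<le> 0" using p0 p1 t0 t1 by (auto simp: zero_le_mult_iff mult_le_0_iff)
  ultimately obtain t where "t0 \<le> t" "t \<le> t1" "J' (t *\<^sub>R w) w = 0" using IVT2'[of "\<lambda>t. J' (t *\<^sub>R w) w" t1 0 t0] t0 by auto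
  then show ?thesis using t0 by (intro exI[of _ t]) auto
qed

definition T where "T w = (SOME t. t > 0 \<and> J' (t *\<^sub>R w) w = 0)"

lemma T: "w \<noteq> 0 ==> T w > 0" "w \<noteq> 0 ==> J' (T w *\<^sub>R w) w = 0" using someI_ex[OF ray_exists[of w]] by (auto simp: T_def)

lemma J'_ray_sign:
  assumes "w \<noteq> 0" "s > 0"
  shows "s < T w ==> J' (s *\<^sub>R w) w > 0" "s > T w ==> J' (s *\<^sub>R w) w < 0"
proof -
  assume "s < T w"
  from J'_ray_less[OF assms this] T[OF assms(1)] show "J' (s *\<^sub>R w) w > 0" using assms by (simp add: zero_less_divide_iff)
next
  assume "s > T w"
  from J'_ray_less[OF assms(1) T(1)[OF assms(1)] this] T[OF assms(1)] show "J' (s *\<^sub>R w) w < 0" using assms by (simp add: divide_less_0_iff)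
qed

lemma T_eqI: "w \<noteq> 0 ==> t > 0 ==> J' (t *\<^sub>R w) w = 0 ==> T w = t" using J'_ray_sign[of w t] by fastforce

lemma J_ray_max:
  assumes "w \<noteq> 0" "s > 0" shows "J (s *\<^sub>R w) \<le> J (T w *\<^sub>R w)"
proof -
  have d: "((\<lambda>t. J (t *\<^sub>R w)) has_real_derivative J' (t *\<^sub>R w) w) (at t)" for t using J_line_deriv[of 0 w t] by simp
  consider "s = T w" | "s < T w" | "s > T w" by linarith
  then show ?thesis
  proof cases
    case 2
    show ?thesis
    proof (rule DERIV_nonneg_imp_nondecreasing[where f="\<lambda>t. J (t *\<^sub>R w)"])
      show "s \<le> T w" using 2 by simp
      fix x assume x: "s \<le> x" "x \<le> T w"
      then have "0 \<le> J' (x *\<^sub>R w) w" using J'_ray_sign(1)[OF assms(1), of x] T[OF assms(1)] assms(2) by (cases "x = T w") auto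
      then show "\<exists>y. ((\<lambda>t. J (t *\<^sub>R w)) has_real_derivative y) (at x) \<and> 0 \<le> y" using d by blast
    qed
  next
    case 3
    show ?thesis
    proof (rule DERIV_nonpos_imp_nonincreasing[where f="\<lambda>t. J (t *\<^sub>R w)"])
      show "T w \<le> s" using 3 by simp
      fix x assume x: "T w \<le> x" "x \<le> s"
      then have "J' (x *\<^sub>R w) w \<le> 0" using J'_ray_sign(2)[OF assms(1), of x] T[OF assms(1)] by (cases "x = T w") auto
      then show "\<exists>y. ((\<lambda>t. J (t *\<^sub>R w)) has_real_derivative y) (at x) \<and> y \<le> 0" using d by blast
    qed
  qed simp
qed

text \<open>For a > 0 the relation of a to \<open>T w\<close> is read off from the sign of the
  derivative of the energy at a w, and a strict sign is an open condition on w. This replaces an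
  implicit function theorem.\<close>

lemma T_tendsto:
  assumes w: "w0 \<noteq> 0" "w \<longlonglongrightarrow> w0"
  shows "(\<lambda>n. T (w n)) \<longlonglongrightarrow> T w0"
proof (rule order_tendstoI)
  have nz: "eventually (\<lambda>n. w n \<noteq> 0) sequentially" using tendsto_imp_eventually_ne[OF w(2,1)] .
  fix a :: real
  show "eventually (\<lambda>n. a < T (w n)) sequentially" if "a < T w0"
  proof (cases "a \<le> 0")
    case True
    show ?thesis using nz by eventually_elim (use True T(1) in fastforce)
  next
    case False
    have "(\<lambda>n. J' (a *\<^sub>R w n) (w n)) \<longlonglongrightarrow> J' (a *\<^sub>R w0) w0" by (intro J'_tendsto tendsto_intros w)
    moreover have "J' (a *\<^sub>R w0) w0 > 0" using J'_ray_sign(1)[OF w(1)] that False by simp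
    ultimately have "eventually (\<lambda>n. J' (a *\<^sub>R w n) (w n) > 0) sequentially" by (rule order_tendstoD)
    with nz show ?thesis
    proof eventually_elim
      case (elim n)
      then show ?case using J'_ray_sign(2)[of "w n" a] T(2)[of "w n"] False by (cases "a = T (w n)") force+
    qed
  qed
  show "eventually (\<lambda>n. T (w n) < a) sequentially" if "a > T w0"
  proof -
    have a: "a > 0" using that T(1)[OF w(1)] by simp
    have "(\<lambda>n. J' (a *\<^sub>R w n) (w n)) \<longlonglongrightarrow> J' (a *\<^sub>R w0) w0" by (intro J'_tendsto tendsto_intros w)
    moreover have "J' (a *\<^sub>R w0) w0 < 0" using J'_ray_sign(2)[OF w(1)] that a by simp
    ultimately have "eventually (\<lambda>n. J' (a *\<^sub>R w n) (w n) < 0) sequentially" by (rule order_tendstoD)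
    with nz show ?thesis
    proof eventually_elim
      case (elim n)
      then show ?case using J'_ray_sign(1)[of "w n" a] T(2)[of "w n"] a by (cases "a = T (w n)") force+
    qed
  qed
qed

text \<open>The maximum of \<open>J\<close> on the ray through \<open>w\<close>. It is constant
  along open rays, hence a functional on the unit sphere.\<close>

definition \<Psi> where "\<Psi> w = J (T w *\<^sub>R w)"

lemma \<Psi>_scale:
  assumes "a > 0" "w \<noteq> 0" shows "\<Psi> (a *\<^sub>R w) = \<Psi> w"
proof -
  have "J' ((T w / a) *\<^sub>R a *\<^sub>R w) (a *\<^sub>R w) = 0"
    using assms T(2)[OF assms(2)] by (simp add: J'_def b.scaleR_right linear_cmul[OF K'_linear] flip: right_diff_distrib)
  then have "T (a *\<^sub>R w) = T w / a" using assms T(1)[OF assms(2)] by (intro T_eqI) auto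
  then show ?thesis using assms by (simp add: \<Psi>_def)
qed

lemma \<Psi>_tendsto: "w0 \<noteq> 0 ==> w \<longlonglongrightarrow> w0 ==> (\<lambda>n. \<Psi> (w n)) \<longlonglongrightarrow> \<Psi> w0"
  unfolding \<Psi>_def by (rule isCont_tendsto_compose[OF has_derivative_continuous[OF J_deriv, unfolded continuous_at_imp_continuous_at_within]])
    (intro tendsto_scaleR T_tendsto)

text \<open>Inside the ball of \<open>small\<close>, the Nehari identity would give b u u \<le> b u
  u / 2. The factor 1/2 - 1/q arises from inserting K' u u = b u u into \<open>AR\<close>.\<close>

lemma nehari_point:
  assumes "w \<noteq> 0" defines "u \<equiv> T w *\<^sub>R w"
  shows "K' u u = b u u" "b u u > \<rho>^2" "(1/2 - 1/q) * b u u \<le> \<Psi> w"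
proof -
  have u0: "u \<noteq> 0" using T(1)[OF assms(1)] assms by simp
  show e: "K' u u = b u u" using J'_ray_scale[OF T(1)[OF assms(1)], of w] T(2)[OF assms(1)] by (simp add: u_def)
  show "b u u > \<rho>^2" using small(2)[of u] e b_pos[OF u0] by (cases "b u u \<le> \<rho>^2") auto
  have "K u \<le> b u u / q" using AR[of u] e q by (simp add: le_divide_eq mult.commute)
  then show "(1/2 - 1/q) * b u u \<le> \<Psi> w" by (simp add: \<Psi>_def J_def u_def left_diff_distrib)
qed

lemma ekeland_point_derivative:
  assumes w: "norm w = 1" and ek: "\<And>z. norm z = 1 ==> \<Psi> z \<ge> \<Psi> w - e * dist z w" and e: "e > 0"
  shows "T w * J' (T w *\<^sub>R w) v \<ge> - (2 * e * norm v)"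
proof -
  have w0: "w \<noteq> 0" using w by auto
  define s where "s n = inverse (real (Suc n))" for n
  have s0: "s n > 0" for n by (simp add: s_def)
  have sl: "s \<longlonglongrightarrow> 0" unfolding s_def by (rule LIMSEQ_inverse_real_of_nat)
  define y where "y n = w + s n *\<^sub>R v" for n
  have "y \<longlonglongrightarrow> w + 0 *\<^sub>R v" unfolding y_def by (intro tendsto_intros sl)
  then have yl: "y \<longlonglongrightarrow> w" by simp
  have ny: "eventually (\<lambda>n. y n \<noteq> 0) sequentially" using tendsto_imp_eventually_ne[OF yl w0] .
  have ex: "eventually (\<lambda>n. \<exists>\<theta>. 0 < \<theta> \<and> \<theta> < s n \<and> T (y n) * J' (T (y n) *\<^sub>R (w + \<theta> *\<^sub>R v)) v \<ge> - (2 * e * norm v)) sequentially"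
    using ny
  proof eventually_elim
    case (elim n)
    let ?t = "T (y n)"
    have t: "?t > 0" using T(1)[OF elim] .
    define z where "z = inverse (norm (y n)) *\<^sub>R y n"
    have nz: "norm z = 1" using elim by (simp add: z_def)
    \<comment> \<open>Returning to the unit sphere moves the point by at most the perturbation
      itself, whence the factor 2.\<close>
    have "dist z w \<le> norm (z - y n) + norm (y n - w)" unfolding dist_norm by (rule order_trans[OF _ norm_triangle_ineq]) simp
    also have "norm (z - y n) \<le> norm (y n - w)"
    proof -
      have "norm (z - y n) = norm ((inverse (norm (y n)) - 1) *\<^sub>R y n)" by (simp add: z_def scaleR_diff_left)
      also have "\<dots> = abs ((inverse (norm (y n)) - 1) * norm (y n))" by (simp add: abs_mult)
      also have "\<dots> = abs (norm w - norm (y n))" using elim w by (simp add: left_diff_distrib)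
      also have "\<dots> \<le> norm (y n - w)" by (metis norm_minus_commute norm_triangle_ineq3)
      finally show ?thesis .
    qed
    also have "norm (y n - w) = s n * norm v" using s0[of n] by (simp add: y_def)
    finally have dz: "dist z w \<le> 2 * (s n * norm v)" by (simp add: mult.commute)
    have "e * dist z w \<le> e * (2 * (s n * norm v))" using dz e by (intro mult_left_mono) auto
    then have "\<Psi> z \<ge> \<Psi> w - e * (2 * (s n * norm v))" using ek[OF nz] by linarith
    moreover have "\<Psi> z = J (?t *\<^sub>R y n)"
    proof -
      have "\<Psi> z = \<Psi> (y n)" unfolding z_def by (rule \<Psi>_scale) (use elim in auto)
      then show ?thesis by (simp add: \<Psi>_def)
    qed
    moreover have "\<Psi> w \<ge> J (?t *\<^sub>R w)" unfolding \<Psi>_def by (rule J_ray_max[OF w0 t])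
    ultimately have df: "J (?t *\<^sub>R w + s n *\<^sub>R (?t *\<^sub>R v)) - J (?t *\<^sub>R w + 0 *\<^sub>R (?t *\<^sub>R v)) \<ge> - (e * (2 * (s n * norm v)))"
      by (simp add: y_def scaleR_add_right mult.commute)
    obtain \<theta> where \<theta>: "0 < \<theta>" "\<theta> < s n" and mv: "J (?t *\<^sub>R w + s n *\<^sub>R (?t *\<^sub>R v)) - J (?t *\<^sub>R w + 0 *\<^sub>R (?t *\<^sub>R v))
        = (s n - 0) * J' (?t *\<^sub>R w + \<theta> *\<^sub>R (?t *\<^sub>R v)) (?t *\<^sub>R v)"
      using MVT2[OF s0, of n "\<lambda>r. J (?t *\<^sub>R w + r *\<^sub>R (?t *\<^sub>R v))" "\<lambda>r. J' (?t *\<^sub>R w + r *\<^sub>R (?t *\<^sub>R v)) (?t *\<^sub>R v)"]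
        J_line_deriv by blast
    have "J' (?t *\<^sub>R w + \<theta> *\<^sub>R (?t *\<^sub>R v)) (?t *\<^sub>R v) = ?t * J' (?t *\<^sub>R (w + \<theta> *\<^sub>R v)) v"
      by (simp add: J'_def b.scaleR_right linear_cmul[OF K'_linear] right_diff_distrib scaleR_add_right mult.commute)
    then have "s n * (?t * J' (?t *\<^sub>R (w + \<theta> *\<^sub>R v)) v) \<ge> s n * (- (2 * e * norm v))" using df mv by (simp add: algebra_simps)
    then have "?t * J' (?t *\<^sub>R (w + \<theta> *\<^sub>R v)) v \<ge> - (2 * e * norm v)" using s0[of n] mult_le_cancel_left_pos by blast
    then show ?case using \<theta> by blast
  qed
  define P where "P n \<theta> \<longleftrightarrow> 0 < \<theta> \<and> \<theta> < s n \<and> T (y n) * J' (T (y n) *\<^sub>R (w + \<theta> *\<^sub>R v)) v \<ge> - (2 * e * norm v)" for n \<theta>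
  \<comment> \<open>The default 0 covers the finitely many indices without an intermediate point, so
    that the sequence is total and still tends to 0.\<close>
  define \<theta> where "\<theta> n = (if \<exists>t. P n t then SOME t. P n t else 0)" for n
  have P\<theta>: "\<exists>t. P n t ==> P n (\<theta> n)" for n unfolding \<theta>_def by (auto intro: someI)
  have \<theta>b: "norm (\<theta> n) \<le> s n" for n using P\<theta>[of n] s0[of n] by (cases "\<exists>t. P n t") (auto simp: P_def \<theta>_def)
  have \<theta>l: "\<theta> \<longlonglongrightarrow> 0" by (rule Lim_null_comparison[OF _ sl]) (use \<theta>b in auto)
  have Tl: "(\<lambda>n. T (y n)) \<longlonglongrightarrow> T w" by (rule T_tendsto[OF w0 yl])
  have "(\<lambda>n. T (y n) * J' (T (y n) *\<^sub>R (w + \<theta> n *\<^sub>R v)) v) \<longlonglongrightarrow> T w * J' (T w *\<^sub>R (w + 0 *\<^sub>R v)) v"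
    by (intro tendsto_mult Tl J'_tendsto tendsto_intros \<theta>l)
  moreover have "eventually (\<lambda>n. - (2 * e * norm v) \<le> T (y n) * J' (T (y n) *\<^sub>R (w + \<theta> n *\<^sub>R v)) v) sequentially"
    using ex by eventually_elim (use P\<theta> in \<open>auto simp: P_def\<close>)
  ultimately have "- (2 * e * norm v) \<le> T w * J' (T w *\<^sub>R (w + 0 *\<^sub>R v)) v" by (rule tendsto_lowerbound) simp
  then show ?thesis by simp
qed

theorem palais_smale_sequence:
  assumes "\<exists>w::'a. w \<noteq> 0"
  obtains u M where "\<And>n. norm (u n) \<le> M" "\<And>n. \<rho>^2 < b (u n) (u n)" "\<And>n. K' (u n) (u n) = b (u n) (u n)"
    "\<And>n v. abs (b (u n) v - K' (u n) v) \<le> inverse (real (Suc n)) * norm v"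
proof -
  let ?S = "sphere (0::'a) 1"
  obtain a :: 'a where "a \<noteq> 0" using assms by blast
  define w0 where "w0 = inverse (norm a) *\<^sub>R a"
  have w0: "norm w0 = 1" using \<open>a \<noteq> 0\<close> by (simp add: w0_def)
  obtain Cb where Cb: "Cb > 0" "\<And>x y. norm (b x y) \<le> norm x * norm y * Cb" using b.pos_bounded by blast
  \<comment> \<open>Nehari points satisfy b u u > \<rho>^2, so T is at least \<open>d\<close> on the
    unit sphere. The Ekeland slope d / 2 times 1/(n+1) then cancels both the factor 2 and T.\<close>
  define d where "d = \<rho> / sqrt Cb"
  have d0: "d > 0" using small(1) Cb by (simp add: d_def)
  have Td: "T w \<ge> d" if "norm w = 1" for w
  proof -
    let ?u = "T w *\<^sub>R w"
    have w: "w \<noteq> 0" using that by auto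
    have "\<rho>^2 < b ?u ?u" by (rule nehari_point(2)[OF w])
    also have "\<dots> \<le> norm ?u * norm ?u * Cb" using Cb(2)[of ?u ?u] by simp
    also have "norm ?u = T w" using that T(1)[OF w] by simp
    finally have "\<rho>^2 / Cb \<le> (T w)^2" using Cb by (simp add: divide_le_eq power2_eq_square)
    then have "d^2 \<le> (T w)^2" using Cb by (simp add: d_def power_divide)
    then show ?thesis by (rule power2_le_imp_le) (use T(1)[OF w] in simp)
  qed
  have cont: "continuous_on ?S \<Psi>" unfolding continuous_on_sequentially by (auto simp: o_def intro!: \<Psi>_tendsto)
  have q0: "1/2 - 1/q > 0" using q by (simp add: field_simps)
  have pos: "0 \<le> \<Psi> w" if "w \<in> ?S" for w
  proof -
    have w: "w \<noteq> 0" using that by auto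
    have "0 \<le> b (T w *\<^sub>R w) (T w *\<^sub>R w)" using nehari_point(2)[OF w] zero_le_power2[of \<rho>] by linarith
    then have "0 \<le> (1/2 - 1/q) * b (T w *\<^sub>R w) (T w *\<^sub>R w)" using q0 by simp
    then show ?thesis using nehari_point(3)[OF w] by linarith
  qed
  have "\<exists>w. norm w = 1 \<and> \<Psi> w \<le> \<Psi> w0 \<and> (\<forall>z. norm z = 1 \<longrightarrow> \<Psi> z \<ge> \<Psi> w - (d / 2 * inverse (real (Suc n))) * dist z w)" for n
  proof -
    have e: "d / 2 * inverse (real (Suc n)) > 0" using d0 by simp
    have w0S: "w0 \<in> ?S" using w0 by simp
    obtain w where "w \<in> ?S" "\<Psi> w \<le> \<Psi> w0" "\<And>z. z \<in> ?S ==> \<Psi> z \<ge> \<Psi> w - (d / 2 * inverse (real (Suc n))) * dist z w"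
    proof (rule ekeland[of ?S w0 \<Psi> "d / 2 * inverse (real (Suc n))"])
      have "closed {w::'a. norm w = 1}" by (intro closed_Collect_eq continuous_intros)
      then show "closed ?S" by (simp add: sphere_def)
      show "0 \<le> \<Psi> w" if "w \<in> ?S" for w by (rule pos[OF that])
      show "w0 \<in> ?S" by (rule w0S)
      show "continuous_on ?S \<Psi>" by (rule cont)
      show "0 < d / 2 * inverse (real (Suc n))" by (rule e)
    qed (rule that; assumption)
    then show ?thesis by auto
  qed
  then obtain w where w: "\<And>n. norm (w n) = 1" "\<And>n. \<Psi> (w n) \<le> \<Psi> w0"
    "\<And>n z. norm z = 1 ==> \<Psi> z \<ge> \<Psi> (w n) - (d / 2 * inverse (real (Suc n))) * dist z (w n)" by metis
  have wn: "w n \<noteq> 0" for n using w(1)[of n] by auto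
  define u where "u n = T (w n) *\<^sub>R w n" for n
  show ?thesis
  \<comment> \<open>The bound is the largest norm compatible with (1/2 - 1/q) c |u|^2 \<le> \<Psi>
    w0.\<close>
  proof (rule that[of u "sqrt (\<Psi> w0 / ((1/2 - 1/q) * c))"])
    fix n
    show "\<rho>^2 < b (u n) (u n)" "K' (u n) (u n) = b (u n) (u n)" unfolding u_def by (rule nehari_point[OF wn])+
    have "(1/2 - 1/q) * (c * (norm (u n))^2) \<le> (1/2 - 1/q) * b (u n) (u n)" using q0 coercive(2) by (intro mult_left_mono) auto
    also have "\<dots> \<le> \<Psi> w0" unfolding u_def by (rule order_trans[OF nehari_point(3)[OF wn] w(2)])
    finally have "(norm (u n))^2 \<le> \<Psi> w0 / ((1/2 - 1/q) * c)" using q0 coercive(1) by (simp add: le_divide_eq mult.commute mult.left_commute)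
    then show "norm (u n) \<le> sqrt (\<Psi> w0 / ((1/2 - 1/q) * c))" by (rule real_le_rsqrt)
    fix v
    have e: "d / 2 * inverse (real (Suc n)) > 0" using d0 by simp
    have 1: "T (w n) * J' (u n) x \<ge> - (d * inverse (real (Suc n)) * norm x)" for x
      using ekeland_point_derivative[OF w(1)[of n] w(3)[of _ n] e, of x] by (simp add: u_def)
    have neg: "J' (u n) (- v) = - J' (u n) v" by (simp add: J'_def b.minus_right linear_neg[OF K'_linear])
    have "abs (T (w n) * J' (u n) v) \<le> d * inverse (real (Suc n)) * norm v" using 1[of v] 1[of "- v"] by (simp add: neg)
    then have "T (w n) * abs (J' (u n) v) \<le> d * inverse (real (Suc n)) * norm v" using T(1)[OF wn[of n]] by (simp add: abs_mult)
    moreover have "d * abs (J' (u n) v) \<le> T (w n) * abs (J' (u n) v)" by (rule mult_right_mono[OF Td[OF w(1)]]) simp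
    ultimately have "d * abs (J' (u n) v) \<le> d * (inverse (real (Suc n)) * norm v)" by simp
    then show "abs (b (u n) v - K' (u n) v) \<le> inverse (real (Suc n)) * norm v" using d0 by (simp only: mult_le_cancel_left_pos J'_def)
  qed
qed

end

section \<open>Superposition functionals\<close>

lemma borel_measurable_lebesgue_cong_AE:
  fixes f g :: "real^3 => real"
  assumes f[measurable]: "f \<in> borel_measurable lebesgue" and ae: "AE x in lebesgue. f x = g x"
  shows "g \<in> borel_measurable lebesgue"
proof (rule measurableI)
  fix A :: "real set" assume A: "A \<in> sets borel"
  have f': "f -` A \<in> sets lebesgue" using measurable_sets[OF f A] by simp
  have ae': "AE x in lebesgue. x \<in> f -` A \<longleftrightarrow> x \<in> g -` A" using ae by eventually_elim simp
  have "g -` A \<in> sets lebesgue" by (rule completion.in_sets_AE[OF ae' f']) simp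
  then show "g -` A \<inter> space lebesgue \<in> sets lebesgue" by simp
qed simp

lemma borel_measurable_AE_limit:
  fixes f :: "nat => real^3 => real"
  assumes [measurable]: "\<And>n. f n \<in> borel_measurable lebesgue" and "AE x in lebesgue. (\<lambda>n. f n x) \<longlonglongrightarrow> g x"
  shows "g \<in> borel_measurable lebesgue"
proof (rule borel_measurable_lebesgue_cong_AE)
  show "(\<lambda>x. lim (\<lambda>n. f n x)) \<in> borel_measurable lebesgue" by (rule borel_measurable_lim_metric) measurable
  show "AE x in lebesgue. lim (\<lambda>n. f n x) = g x" using assms(2) by eventually_elim (rule limI)
qed

text \<open>Along a simple function the composition is a finite sum of measurable slices times
  indicators; continuity in the second variable carries measurability to pointwise limits of simple
  functions.\<close>

lemma caratheodory_measurable: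
  fixes h :: "real^3 => real => real"
  assumes m: "\<And>t. (\<lambda>x. h x t) \<in> borel_measurable lebesgue" and c: "AE x in lebesgue. continuous_on UNIV (h x)"
    and u: "u \<in> borel_measurable lebesgue"
  shows "(\<lambda>x. h x (u x)) \<in> borel_measurable lebesgue"
proof -
  obtain F where F: "\<And>i::nat. simple_function lebesgue (F i)" "\<And>x. (\<lambda>i. F i x) \<longlonglongrightarrow> u x"
    using borel_measurable_implies_sequence_metric[OF u, of 0] by auto
  show ?thesis
  proof (rule borel_measurable_AE_limit)
    fix i
    have "(\<lambda>x. \<Sum>y\<in>range (F i). h x y * indicator (F i -` {y}) x) \<in> borel_measurable lebesgue"
    proof (intro borel_measurable_sum borel_measurable_times m borel_measurable_indicator)
      fix y show "F i -` {y} \<in> sets lebesgue" using simple_functionD(2)[OF F(1)[of i], of "{y}"] by simp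
    qed
    moreover have "(\<Sum>y\<in>range (F i). h x y * indicator (F i -` {y}) x) = h x (F i x)" for x
    proof -
      have fin: "finite (range (F i))" using simple_functionD(1)[OF F(1)[of i]] by simp
      have "(\<Sum>y\<in>range (F i). h x y * indicator (F i -` {y}) x) = (\<Sum>y\<in>{F i x}. h x y * indicator (F i -` {y}) x)"
        by (rule sum.mono_neutral_right[OF fin]) (auto simp: indicator_def)
      then show ?thesis by simp
    qed
    ultimately show "(\<lambda>x. h x (F i x)) \<in> borel_measurable lebesgue" by simp
  next
    show "AE x in lebesgue. (\<lambda>i. h x (F i x)) \<longlonglongrightarrow> h x (u x)"
      using c by eventually_elim (rule continuous_on_tendsto_compose[OF _ F(2)], auto)
  qed
qed

section \<open>Primitives of Caratheodory functions\<close>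

lemma primitive_0: "primitive h x 0 = 0" by (simp add: primitive_def)

lemma primitive_DERIV:
  assumes "continuous_on UNIV (h x)"
  shows "(primitive h x has_real_derivative h x t) (at t)"
proof -
  let ?R = "abs t + 1"
  have "((\<lambda>u. LBINT y=ereal 0..ereal u. h x y) has_vector_derivative h x t) (at t within {-?R..?R})"
    using interval_integral_FTC2[of "-?R" 0 ?R "h x" t] continuous_on_subset[OF assms] by auto
  moreover have "at t within {-?R..?R} = at t" by (rule at_within_Icc_at) auto
  ultimately show ?thesis by (simp add: primitive_def[abs_def] has_real_derivative_iff_has_vector_derivative)
qed

lemma primitive_MVT:
  assumes "continuous_on UNIV (h x)"
  shows "\<exists>\<xi>. abs (\<xi> - s) \<le> abs (t - s) \<and> min s t \<le> \<xi> \<and> \<xi> \<le> max s t \<and> primitive h x t - primitive h x s = (t - s) * h x \<xi>"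
proof -
  note D = primitive_DERIV[where h=h and x=x, OF assms]
  consider "s < t" | "t < s" | "s = t" by linarith
  then show ?thesis
  proof cases
    case 1
    then obtain z where "z > s" "z < t" "primitive h x t - primitive h x s = (t - s) * h x z" using MVT2[of s t "primitive h x" "h x"] D by blast
    then show ?thesis by (intro exI[of _ z]) auto
  next
    case 2
    then obtain z where "z > t" "z < s" "primitive h x s - primitive h x t = (s - t) * h x z" using MVT2[of t s "primitive h x" "h x"] D by blast
    then show ?thesis by (intro exI[of _ z]) (auto simp: algebra_simps)
  qed auto
qed

text \<open>Meant for measurability: with t = u x each sum is measurable in x, so the primitive
  composed with \<open>u\<close> is a limit of measurable functions.\<close>

lemma riemann_sum_primitive:
  assumes c: "continuous_on UNIV (h x)"
  shows "(\<lambda>n. \<Sum>i<n. h x (real i / real n * t) * (t / real n)) \<longlonglongrightarrow> primitive h x t"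
proof (rule LIMSEQ_I)
  fix e :: real assume e: "e > 0"
  define e' where "e' = e / (abs t + 1)"
  have e': "e' > 0" using e by (simp add: e'_def)
  have "uniformly_continuous_on {-abs t..abs t} (h x)" by (intro compact_uniformly_continuous continuous_on_subset[OF c]) auto
  then obtain d where d: "d > 0" "\<And>a b. a \<in> {-abs t..abs t} ==> b \<in> {-abs t..abs t} ==> dist b a < d ==> dist (h x b) (h x a) < e'"
    using e' unfolding uniformly_continuous_on_def by metis
  obtain N where N: "real N > abs t / d" using reals_Archimedean2 by blast
  have "norm ((\<Sum>i<n. h x (real i / real n * t) * (t / real n)) - primitive h x t) < e" if n: "n \<ge> Suc N" for n
  proof -
    have n0: "real n > 0" using n by simp
    let ?s = "\<lambda>i. real i / real n * t"
    have sd: "?s (Suc i) - ?s i = t / real n" for i by (simp add: field_simps add_divide_distrib)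
    have td: "abs (t / real n) < d"
    proof -
      have "abs t < d * real N" using N d(1) by (simp add: divide_less_eq mult.commute)
      also have "\<dots> \<le> d * real n" using n d(1) by simp
      finally show ?thesis using n0 by (simp add: abs_divide divide_less_eq)
    qed
    have "primitive h x t = primitive h x (?s n) - primitive h x (?s 0)" using n0 by (simp add: primitive_0)
    also have "\<dots> = (\<Sum>i<n. primitive h x (?s (Suc i)) - primitive h x (?s i))" by (rule sum_lessThan_telescope[symmetric])
    finally have "(\<Sum>i<n. h x (?s i) * (t / real n)) - primitive h x t
       = (\<Sum>i<n. h x (?s i) * (t / real n) - (primitive h x (?s (Suc i)) - primitive h x (?s i)))" by (simp add: sum_subtractf)
    also have "norm \<dots> \<le> (\<Sum>i<n. e' * abs t / real n)"
    proof (rule sum_norm_le)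
      fix i assume "i \<in> {..<n}"
      then have i: "Suc i \<le> n" by simp
      obtain \<xi> where \<xi>: "abs (\<xi> - ?s i) \<le> abs (?s (Suc i) - ?s i)" "min (?s i) (?s (Suc i)) \<le> \<xi>" "\<xi> \<le> max (?s i) (?s (Suc i))"
        "primitive h x (?s (Suc i)) - primitive h x (?s i) = (?s (Suc i) - ?s i) * h x \<xi>"
        using primitive_MVT[where h=h and x=x and s="?s i" and t="?s (Suc i)", OF c] by blast
      have sb: "abs (?s j) \<le> abs t" if "j \<le> n" for j
      proof -
        have "real j / real n \<le> 1" using that n0 by (simp add: divide_le_eq)
        then have "real j / real n * abs t \<le> 1 * abs t" by (intro mult_right_mono) auto
        then show ?thesis by (simp add: abs_mult)
      qed
      have between: "abs a \<le> m ==> abs b \<le> m ==> min a b \<le> z ==> z \<le> max a b ==> z \<in> {-m..m}" for a b m z :: real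
        by (auto simp: min_def max_def split: if_splits)
      have "\<xi> \<in> {-abs t..abs t}" by (rule between[OF sb[of i] sb[of "Suc i"] \<xi>(2,3)]) (use i in auto)
      moreover have "?s i \<in> {-abs t..abs t}" by (rule between[OF sb[OF Suc_leD[OF i]] sb[OF Suc_leD[OF i]]]) simp_all
      moreover have "dist \<xi> (?s i) < d" using \<xi>(1) td unfolding sd dist_real_def by linarith
      ultimately have "abs (h x \<xi> - h x (?s i)) \<le> e'" using d(2)[of "?s i" \<xi>] by (simp add: dist_real_def)
      then have "abs (h x (?s i) - h x \<xi>) * (abs t / real n) \<le> e' * (abs t / real n)"
        by (intro mult_right_mono) (auto simp: abs_minus_commute)
      moreover have "h x (?s i) * (t / real n) - (primitive h x (?s (Suc i)) - primitive h x (?s i)) = (h x (?s i) - h x \<xi>) * (t / real n)"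
        unfolding \<xi>(4) sd left_diff_distrib by (simp only: mult.commute[of "t / real n"])
      ultimately show "norm (h x (?s i) * (t / real n) - (primitive h x (?s (Suc i)) - primitive h x (?s i))) \<le> e' * abs t / real n"
        by (simp add: abs_mult abs_divide)
    qed
    also have "\<dots> = e' * abs t" using n0 by simp
    also have "\<dots> < e' * (abs t + 1)" using e' by simp
    also have "\<dots> = e" by (simp add: e'_def add_nonneg_eq_0_iff)
    finally show ?thesis .
  qed
  then show "\<exists>no. \<forall>n\<ge>no. norm ((\<Sum>i<n. h x (real i / real n * t) * (t / real n)) - primitive h x t) < e" by blast
qed

lemma primitive_measurable:
  assumes m: "\<And>t. (\<lambda>x. h x t) \<in> borel_measurable lebesgue" and c: "AE x in lebesgue. continuous_on UNIV (h x)"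
    and u: "u \<in> borel_measurable lebesgue"
  shows "(\<lambda>x. primitive h x (u x)) \<in> borel_measurable lebesgue"
proof (rule borel_measurable_AE_limit)
  show "(\<lambda>x. \<Sum>i<n. h x (real i / real n * u x) * (u x / real n)) \<in> borel_measurable lebesgue" for n
    by (intro borel_measurable_sum borel_measurable_times caratheodory_measurable[OF m c] borel_measurable_divide u) (use u in auto)
  show "AE x in lebesgue. (\<lambda>n. \<Sum>i<n. h x (real i / real n * u x) * (u x / real n)) \<longlonglongrightarrow> primitive h x (u x)"
    using c by eventually_elim (rule riemann_sum_primitive)
qed

text \<open>\<open>mixed_power p y = min y\<^sup>2 y\<^sup>p'\<close> with \<open>1/p + 1/p' = 1\<close> measures the size of \<open>y\<close> in
  \<open>L\<^sup>2 + L\<^sup>p'\<close>, the dual of \<open>L\<^sup>2 \<inter> L\<^sup>p\<close>.\<close>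

definition mixed_power :: "real => real => real" where
  "mixed_power p y = min (y^2) (abs y powr (p / (p - 1)))"

definition sum_power :: "real => real => real" where
  "sum_power p t = t^2 + abs t powr p"

lemma mixed_power_nonneg: "0 \<le> mixed_power p y" by (simp add: mixed_power_def)

lemma sum_power_nonneg: "0 \<le> sum_power p t" by (simp add: sum_power_def)

lemma mixed_power_measurable[measurable]:
  assumes [measurable]: "u \<in> borel_measurable M" shows "(\<lambda>x. mixed_power p (u x)) \<in> borel_measurable M"
  unfolding mixed_power_def by measurable

lemma sum_power_measurable[measurable]:
  assumes [measurable]: "u \<in> borel_measurable M" shows "(\<lambda>x. sum_power p (u x)) \<in> borel_measurable M"
  unfolding sum_power_def by measurable

text \<open>Young's inequality with a free parameter, by comparing |v| with a |y| for the quadratic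
  bound and with a |y|^(1/(p-1)) for the other; both are needed because \<open>mixed_power\<close>
  is a minimum. A large \<open>a\<close> makes the weight of \<open>v\<close> small, a small
  \<open>a\<close> that of \<open>y\<close>.\<close>

lemma mixed_young:
  assumes p: "p > 2" and a: "a > 0"
  shows "abs y * abs v \<le> a * mixed_power p y + (1 / a + a powr (1 - p)) * sum_power p v"
proof -
  have 1: "abs y * abs v \<le> a * y^2 + 1 / a * v^2"
  proof (cases "abs v \<le> a * abs y")
    case True
    have "abs y * abs v \<le> abs y * (a * abs y)" by (rule mult_left_mono[OF True]) simp
    also have "\<dots> = a * y^2" by (simp add: power2_eq_square)
    finally show ?thesis using a by (simp add: add_increasing2)
  next
    case False
    then have "abs y \<le> 1 / a * abs v" using a by (simp add: le_divide_eq mult.commute)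
    then have "abs y * abs v \<le> 1 / a * abs v * abs v" by (rule mult_right_mono) simp
    also have "\<dots> = 1 / a * v^2" by (simp add: power2_eq_square)
    finally show ?thesis using a by (simp add: add_increasing)
  qed
  have 2: "abs y * abs v \<le> a * abs y powr (p / (p - 1)) + a powr (1 - p) * abs v powr p"
  proof (cases "abs v \<le> a * abs y powr (1 / (p - 1))")
    case True
    have "abs y * abs v \<le> abs y * (a * abs y powr (1 / (p - 1)))" by (rule mult_left_mono[OF True]) simp
    also have "\<dots> = a * abs y powr (p / (p - 1))"
    proof (cases "y = 0")
      case False
      have "p / (p - 1) = 1 + 1 / (p - 1)" using p by (simp add: field_simps)
      then show ?thesis using False by (simp add: powr_add)
    qed simp
    finally show ?thesis by (simp add: add_increasing2)
  next
    case False
    then have "abs y powr (1 / (p - 1)) \<le> abs v / a" using a by (simp add: le_divide_eq mult.commute)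
    then have "(abs y powr (1 / (p - 1))) powr (p - 1) \<le> (abs v / a) powr (p - 1)" using p by (intro powr_mono2) auto
    then have "abs y \<le> abs v powr (p - 1) / a powr (p - 1)" using p a by (simp add: powr_powr powr_divide)
    then have "abs y * abs v \<le> abs v powr (p - 1) / a powr (p - 1) * abs v" by (rule mult_right_mono) simp
    also have "\<dots> = a powr (1 - p) * (abs v powr (p - 1) * abs v)" using powr_minus_divide[of a "p - 1"] by simp
    also have "abs v powr (p - 1) * abs v = abs v powr p" using powr_add[of "abs v" "p - 1" 1] by simp
    finally show ?thesis using a by (simp add: add_increasing)
  qed
  have "abs y * abs v \<le> a * (y^2) + (1 / a * v^2 + a powr (1 - p) * abs v powr p)"
    "abs y * abs v \<le> a * abs y powr (p / (p - 1)) + (1 / a * v^2 + a powr (1 - p) * abs v powr p)"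
    using 1 2 a by (simp_all add: add_increasing add_increasing2)
      (smt (verit) divide_nonneg_pos zero_le_power2 powr_ge_zero mult_nonneg_nonneg)+
  then have "abs y * abs v \<le> a * mixed_power p y + (1 / a * v^2 + a powr (1 - p) * abs v powr p)" by (simp add: mixed_power_def min_def)
  also have "1 / a * v^2 + a powr (1 - p) * abs v powr p \<le> (1 / a + a powr (1 - p)) * sum_power p v"
  proof -
    have "0 \<le> 1 / a * abs v powr p" "0 \<le> a powr (1 - p) * v^2" using a by simp_all
    then show ?thesis by (simp add: sum_power_def distrib_left distrib_right)
  qed
  finally show ?thesis by simp
qed

lemma sum_power_add:
  assumes p: "p > 2" shows "sum_power p (abs a + abs b) \<le> 2 powr p * (sum_power p a + sum_power p b)"
proof -
  have "(abs a + abs b)^2 \<le> 2 * a^2 + 2 * b^2" using sq_add_le[of "abs a" "abs b"] by simp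
  also have "\<dots> \<le> 2 powr p * (a^2 + b^2)"
  proof -
    have "(2::real) powr 1 \<le> 2 powr p" using p by (intro powr_mono) auto
    then have "2 * (a^2 + b^2) \<le> 2 powr p * (a^2 + b^2)" by (intro mult_right_mono) auto
    then show ?thesis by simp
  qed
  finally have 1: "(abs a + abs b)^2 \<le> 2 powr p * (a^2 + b^2)" .
  have 2: "(abs a + abs b) powr p \<le> 2 powr p * (abs a powr p + abs b powr p)" using p by (intro powr_add_le) auto
  have "sum_power p (abs a + abs b) = (abs a + abs b)^2 + (abs a + abs b) powr p" by (simp add: sum_power_def)
  then show ?thesis using 1 2 by (simp add: sum_power_def distrib_left)
qed

text \<open>If the linear term dominates, the square is taken; otherwise the conjugate power, which
  turns T^(p-1) into T^p. The factor 2 anticipates a difference of two values of the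
  nonlinearity.\<close>

lemma mixed_power_growth:
  assumes p: "p > 2" and C: "C \<ge> 0"
  shows "\<exists>B\<ge>0. \<forall>T\<ge>0. \<forall>y. abs y \<le> 2 * (T + C * T powr (p - 1)) \<longrightarrow> mixed_power p y \<le> B * sum_power p T"
proof (intro exI[of _ "16 + (4 * C) powr (p / (p - 1))"] conjI allI impI)
  fix T y :: real assume T: "T \<ge> 0" and y: "abs y \<le> 2 * (T + C * T powr (p - 1))"
  show "mixed_power p y \<le> (16 + (4 * C) powr (p / (p - 1))) * sum_power p T"
  proof (cases "C * T powr (p - 1) \<le> T")
    case True
    then have "2 * (T + C * T powr (p - 1)) \<le> 2 * (T + T)" by (intro mult_left_mono add_left_mono) auto
    then have "abs y \<le> 4 * T" using y by simp
    then have "y^2 \<le> 16 * T^2" using power_mono[of "abs y" "4 * T" 2] by (simp add: power_mult_distrib)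
    then have "mixed_power p y \<le> 16 * T^2" by (simp add: mixed_power_def min_le_iff_disj)
    also have "\<dots> \<le> 16 * sum_power p T" by (simp add: sum_power_def)
    also have "16 * sum_power p T \<le> (16 + (4 * C) powr (p / (p - 1))) * sum_power p T" by (intro mult_right_mono sum_power_nonneg) simp
    finally show ?thesis .
  next
    case False
    then have "2 * (T + C * T powr (p - 1)) \<le> 2 * (C * T powr (p - 1) + C * T powr (p - 1))" by (intro mult_left_mono add_right_mono) auto
    then have "abs y \<le> 4 * C * T powr (p - 1)" using y by simp
    then have "abs y powr (p / (p - 1)) \<le> (4 * C * T powr (p - 1)) powr (p / (p - 1))" using p by (intro powr_mono2) auto
    also have "\<dots> = (4 * C) powr (p / (p - 1)) * T powr p" using p C by (simp add: powr_mult powr_powr)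
    also have "\<dots> \<le> (4 * C) powr (p / (p - 1)) * sum_power p T" using T by (intro mult_left_mono) (auto simp: sum_power_def)
    also have "\<dots> \<le> (16 + (4 * C) powr (p / (p - 1))) * sum_power p T" by (intro mult_right_mono sum_power_nonneg) simp
    finally show ?thesis by (simp add: mixed_power_def min_le_iff_disj)
  qed
qed simp

definition power_energy :: "real => xfun => real" where
  "power_energy p U = (LINT x|lebesgue. sum_power p (rep U x))"

lemma power_energy:
  assumes p: "2 < p" "p < 6"
  shows "integrable lebesgue (\<lambda>x. sum_power p (rep U x))" "0 \<le> power_energy p U"
    "\<exists>C>0. \<forall>U. power_energy p U \<le> C * sum_power p (norm U)"
proof -
  obtain C where C: "C > 0" "\<And>U. integrable lebesgue (\<lambda>x. abs (rep U x) powr p)"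
    "\<And>U. (LINT x|lebesgue. abs (rep U x) powr p) \<le> C * norm U powr p" by (rule sobolev[OF less_imp_le[OF p(1)] p(2)]) (rule that; assumption)
  have i2: "integrable lebesgue (\<lambda>x. (rep U x)^2)" for U using rep_L2(1)[of U] by (simp add: L2_real_iff)
  show i: "integrable lebesgue (\<lambda>x. sum_power p (rep U x))" unfolding sum_power_def by (intro Bochner_Integration.integrable_add C i2)
  show "0 \<le> power_energy p U" unfolding power_energy_def by (rule integral_nonneg_AE) (simp add: sum_power_nonneg)
  have "power_energy p U \<le> (C + 1) * sum_power p (norm U)" for U
  proof -
    have "power_energy p U = (LINT x|lebesgue. (rep U x)^2) + (LINT x|lebesgue. abs (rep U x) powr p)"
      unfolding power_energy_def sum_power_def by (rule Bochner_Integration.integral_add[OF i2 C(2)])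
    also have "\<dots> \<le> (norm U)^2 + C * norm U powr p" by (intro add_mono C integral_rep_sq_le)
    also have "\<dots> \<le> (C + 1) * sum_power p (norm U)" using C(1) by (simp add: sum_power_def algebra_simps)
    finally show ?thesis .
  qed
  then show "\<exists>C>0. \<forall>U. power_energy p U \<le> C * sum_power p (norm U)" using C(1) by (intro exI[of _ "C + 1"]) auto
qed

lemma power_energy_bounded:
  assumes p: "2 < p" "p < 6" and "\<And>n. norm (U n) \<le> M"
  shows "\<exists>R. \<forall>n. power_energy p (U n) \<le> R"
proof -
  obtain C where C: "C > 0" "\<And>U. power_energy p U \<le> C * sum_power p (norm U)" using power_energy(3)[OF p] by blast
  have "power_energy p (U n) \<le> C * sum_power p M" for n
  proof -
    have "sum_power p (norm (U n)) \<le> sum_power p M" unfolding sum_power_def using assms(3)[of n] p by (intro add_mono power_mono powr_mono2) auto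
    then show ?thesis using C by (meson mult_left_mono order_trans less_imp_le)
  qed
  then show ?thesis by blast
qed

lemma power_energy_tendsto_0:
  assumes p: "2 < p" "p < 6" and U: "U \<longlonglongrightarrow> 0"
  shows "(\<lambda>n. power_energy p (U n)) \<longlonglongrightarrow> 0"
proof -
  obtain C where C: "C > 0" "\<And>U. power_energy p U \<le> C * sum_power p (norm U)" using power_energy(3)[OF p] by blast
  have n: "(\<lambda>n. norm (U n)) \<longlonglongrightarrow> 0" using tendsto_norm[OF U] by simp
  have "(\<lambda>n. norm (U n) powr p) \<longlonglongrightarrow> 0 powr p" by (rule tendsto_powr2[OF n tendsto_const]) (use p in auto)
  then have "(\<lambda>n. C * ((norm (U n))^2 + norm (U n) powr p)) \<longlonglongrightarrow> C * (0^2 + 0 powr p)"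
    by (intro tendsto_mult tendsto_add tendsto_power tendsto_const n)
  then have "(\<lambda>n. C * sum_power p (norm (U n))) \<longlonglongrightarrow> 0" by (simp add: sum_power_def)
  then show ?thesis by (rule Lim_null_comparison[rotated]) (use C power_energy(2)[OF p] in auto)
qed

lemma AE_subsequence:
  assumes U: "U \<longlonglongrightarrow> V"
  shows "\<exists>r. strict_mono (r :: nat => nat) \<and> (AE x in lebesgue. (\<lambda>n. rep (U (r n)) x) \<longlonglongrightarrow> rep V x)"
proof -
  have "(\<lambda>n. LINT x|lebesgue. norm ((rep (U n - V) x)^2)) \<longlonglongrightarrow> 0"
  proof (rule Lim_null_comparison)
    have "(\<lambda>n. (norm (U n - V))^2) \<longlonglongrightarrow> (norm (V - V))^2" by (intro tendsto_intros U)
    then show "(\<lambda>n. (norm (U n - V))^2) \<longlonglongrightarrow> 0" by simp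
  qed (use integral_rep_sq_le(1) in auto)
  then obtain r where r: "strict_mono (r :: nat => nat)" "AE x in lebesgue. (\<lambda>n. (rep (U (r n) - V) x)^2) \<longlonglongrightarrow> 0"
    using tendsto_L1_AE_subseq[of lebesgue "\<lambda>n x. (rep (U n - V) x)^2"] rep_L2(1) by (auto simp: L2_real_iff)
  have "AE x in lebesgue. \<forall>n. rep (U (r n) - V) x = rep (U (r n)) x - rep V x" unfolding AE_all_countable using rep_minus_AE by blast
  with r(2) have "AE x in lebesgue. (\<lambda>n. rep (U (r n)) x) \<longlonglongrightarrow> rep V x"
  proof eventually_elim
    case (elim x)
    have "(\<lambda>n. sqrt ((rep (U (r n) - V) x)^2)) \<longlonglongrightarrow> sqrt 0" by (intro tendsto_real_sqrt elim)
    then have "(\<lambda>n. rep (U (r n) - V) x) \<longlonglongrightarrow> 0" by (simp add: tendsto_rabs_zero_iff)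
    then show ?case using elim(2) by (simp add: LIM_zero_iff)
  qed
  with r(1) show ?thesis by blast
qed

text \<open>Norm convergence yields almost everywhere convergence only along subsequences; this
  principle restores the full sequence.\<close>

lemma tendsto_subsequence_principle:
  fixes f :: "nat => real"
  assumes "\<And>r. strict_mono (r :: nat => nat) ==> \<exists>s. strict_mono (s :: nat => nat) \<and> (\<lambda>n. f (r (s n))) \<longlonglongrightarrow> l"
  shows "f \<longlonglongrightarrow> l"
proof (rule ccontr)
  assume "\<not> f \<longlonglongrightarrow> l"
  then obtain e where e: "e > 0" "\<And>N. \<exists>n\<ge>N. norm (f n - l) \<ge> e" unfolding LIMSEQ_iff by (meson not_less)
  then have "infinite {n. norm (f n - l) \<ge> e}" unfolding infinite_nat_iff_unbounded_le by blast
  then obtain r where r: "strict_mono (r :: nat => nat)" "\<And>n. r n \<in> {n. norm (f n - l) \<ge> e}" using infinite_enumerate by blast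
  obtain s where "strict_mono (s :: nat => nat)" "(\<lambda>n. f (r (s n))) \<longlonglongrightarrow> l" using assms[OF r(1)] by blast
  then obtain n where "norm (f (r (s n)) - l) < e" using LIMSEQ_D[OF _ e(1)] by blast
  then show False using r(2)[of "s n"] by simp
qed

text \<open>Dominated convergence with a majorant whose varying part tends to 0 in mean: the
  positive excess over the varying part has a fixed majorant.\<close>

lemma mixed_power_tendsto_0:
  fixes u :: "real^3 => real"
  assumes p: "2 < p" and ym[measurable]: "\<And>n. y n \<in> borel_measurable lebesgue"
    and y0: "AE x in lebesgue. (\<lambda>n. y n x) \<longlonglongrightarrow> 0"
    and bd: "\<And>n. AE x in lebesgue. mixed_power p (y n x) \<le> B * (sum_power p (u x) + sum_power p (w n x))" and B: "0 \<le> B"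
    and u: "integrable lebesgue (\<lambda>x. sum_power p (u x))"
    and w: "\<And>n. integrable lebesgue (\<lambda>x. sum_power p (w n x))" "(\<lambda>n. LINT x|lebesgue. sum_power p (w n x)) \<longlonglongrightarrow> 0"
  shows "\<And>n. integrable lebesgue (\<lambda>x. mixed_power p (y n x))"
    "(\<lambda>n. LINT x|lebesgue. mixed_power p (y n x)) \<longlonglongrightarrow> 0"
proof -
  show mi: "integrable lebesgue (\<lambda>x. mixed_power p (y n x))" for n
  proof (rule Bochner_Integration.integrable_bound)
    show "integrable lebesgue (\<lambda>x. B * (sum_power p (u x) + sum_power p (w n x)))" using u w by simp
    show "AE x in lebesgue. norm (mixed_power p (y n x)) \<le> norm (B * (sum_power p (u x) + sum_power p (w n x)))"
      using bd[of n] by eventually_elim (use B in \<open>simp add: mixed_power_nonneg sum_power_nonneg\<close>)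
  qed simp
  define z where "z n x = max 0 (mixed_power p (y n x) - B * sum_power p (w n x))" for n x
  have wm[measurable]: "(\<lambda>x. sum_power p (w n x)) \<in> borel_measurable lebesgue" for n using w(1) by auto
  have zm[measurable]: "z n \<in> borel_measurable lebesgue" for n unfolding z_def by measurable
  have zb: "AE x in lebesgue. norm (z n x) \<le> B * sum_power p (u x)" for n
    using bd[of n] by eventually_elim (use B in \<open>simp add: z_def distrib_left sum_power_nonneg\<close>)
  have zl: "AE x in lebesgue. (\<lambda>n. z n x) \<longlonglongrightarrow> 0" using y0
  proof eventually_elim
    case (elim x)
    have "(\<lambda>n. (y n x)^2) \<longlonglongrightarrow> 0^2" by (intro tendsto_power elim)
    then have "(\<lambda>n. (y n x)^2) \<longlonglongrightarrow> 0" by simp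
    then show ?case
    proof (rule Lim_null_comparison[rotated], intro always_eventually allI)
      fix n
      have "0 \<le> B * sum_power p (w n x)" using B by (simp add: sum_power_nonneg)
      moreover have "mixed_power p (y n x) \<le> (y n x)^2" by (simp add: mixed_power_def)
      ultimately show "norm (z n x) \<le> (y n x)^2" by (simp add: z_def)
    qed
  qed
  have "(\<lambda>n. LINT x|lebesgue. z n x) \<longlonglongrightarrow> (LINT x|(lebesgue :: (real^3) measure). (0::real))"
    by (rule integral_dominated_convergence[where w="\<lambda>x. B * sum_power p (u x)"]) (use u zl zb in auto)
  then have "(\<lambda>n. (LINT x|lebesgue. z n x) + B * (LINT x|lebesgue. sum_power p (w n x))) \<longlonglongrightarrow> 0 + B * 0"
    by (intro tendsto_intros w) simp
  then have lim: "(\<lambda>n. (LINT x|lebesgue. z n x) + B * (LINT x|lebesgue. sum_power p (w n x))) \<longlonglongrightarrow> 0" by simp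
  show "(\<lambda>n. LINT x|lebesgue. mixed_power p (y n x)) \<longlonglongrightarrow> 0"
  proof (rule Lim_null_comparison[OF _ lim], intro always_eventually allI)
    fix n
    have zi: "integrable lebesgue (z n)" by (rule Bochner_Integration.integrable_bound[OF integrable_mult_right[OF u, of B] zm])
        (use zb[of n] in eventually_elim, simp)
    have "(LINT x|lebesgue. mixed_power p (y n x)) \<le> (LINT x|lebesgue. z n x + B * sum_power p (w n x))"
    proof (rule integral_mono[OF mi])
      show "mixed_power p (y n x) \<le> z n x + B * sum_power p (w n x)" for x by (simp add: z_def)
    qed (use zi w in auto)
    also have "\<dots> = (LINT x|lebesgue. z n x) + B * (LINT x|lebesgue. sum_power p (w n x))" using zi w by simp
    finally show "norm (LINT x|lebesgue. mixed_power p (y n x)) \<le> (LINT x|lebesgue. z n x) + B * (LINT x|lebesgue. sum_power p (w n x))"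
      by (simp add: integral_nonneg_AE mixed_power_nonneg)
  qed
qed

section \<open>Pairing of L2 + L^p' with the intersection of L2 and L^p\<close>

lemma young_integrable:
  fixes y v :: "real^3 => real"
  assumes p: "2 < p" and [measurable]: "y \<in> borel_measurable lebesgue" "v \<in> borel_measurable lebesgue"
    and i: "integrable lebesgue (\<lambda>x. mixed_power p (y x))" "integrable lebesgue (\<lambda>x. sum_power p (v x))"
  shows "integrable lebesgue (\<lambda>x. y x * v x)"
    "a > 0 ==> (LINT x|lebesgue. abs (y x * v x)) \<le> a * (LINT x|lebesgue. mixed_power p (y x))
      + (1 / a + a powr (1 - p)) * (LINT x|lebesgue. sum_power p (v x))"
proof -
  have le: "abs (y x * v x) \<le> a * mixed_power p (y x) + (1 / a + a powr (1 - p)) * sum_power p (v x)" if "a > 0" for a x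
    using mixed_young[OF p that, of "y x" "v x"] by (simp add: abs_mult)
  have ii: "integrable lebesgue (\<lambda>x. a * mixed_power p (y x) + (1 / a + a powr (1 - p)) * sum_power p (v x))" for a using i by simp
  show yv: "integrable lebesgue (\<lambda>x. y x * v x)"
  proof (rule Bochner_Integration.integrable_bound[OF ii[of 1] _ AE_I2])
    show "norm (y x * v x) \<le> norm (1 * mixed_power p (y x) + (1 / 1 + 1 powr (1 - p)) * sum_power p (v x))" for x
      unfolding real_norm_def by (rule order_trans[OF le[OF zero_less_one] abs_ge_self])
  qed simp
  show "(LINT x|lebesgue. abs (y x * v x)) \<le> a * (LINT x|lebesgue. mixed_power p (y x))
      + (1 / a + a powr (1 - p)) * (LINT x|lebesgue. sum_power p (v x))" if "a > 0"
  proof -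
    have "(LINT x|lebesgue. abs (y x * v x)) \<le> (LINT x|lebesgue. a * mixed_power p (y x) + (1 / a + a powr (1 - p)) * sum_power p (v x))"
      by (rule integral_mono[OF integrable_abs[OF yv] ii]) (rule le[OF that])
    then show ?thesis using i by simp
  qed
qed

lemma young_constant_small:
  fixes p e :: real
  assumes p: "2 < p" and e: "e > 0"
  obtains a where "a > 0" "1 / a + a powr (1 - p) < e"
proof -
  have "((\<lambda>a::real. 1 / a + a powr (1 - p)) \<longlongrightarrow> 0 + 0) at_top"
    using p by (intro tendsto_add tendsto_neg_powr tendsto_divide_0[OF tendsto_const] filterlim_at_top_imp_at_infinity filterlim_ident) auto
  then have "eventually (\<lambda>a::real. 1 / a + a powr (1 - p) < e) at_top" using e by (intro order_tendstoD) auto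
  then have "eventually (\<lambda>a::real. 1 / a + a powr (1 - p) < e \<and> a > 0) at_top" using eventually_gt_at_top[of 0] by eventually_elim auto
  then obtain a :: real where "1 / a + a powr (1 - p) < e \<and> a > 0" by (auto simp: eventually_at_top_linorder)
  then show ?thesis using that by blast
qed

text \<open>The Young parameter is fixed large, so that the merely bounded factor contributes
  little, and then \<open>n\<close> is taken large.\<close>

lemma product_tendsto_0_uniform:
  fixes y v :: "nat => real^3 => real"
  assumes p: "2 < p" and m: "\<And>n. y n \<in> borel_measurable lebesgue" "\<And>n. v n \<in> borel_measurable lebesgue"
    and i: "\<And>n. integrable lebesgue (\<lambda>x. mixed_power p (y n x))" "\<And>n. integrable lebesgue (\<lambda>x. sum_power p (v n x))"
    and y: "(\<lambda>n. LINT x|lebesgue. mixed_power p (y n x)) \<longlonglongrightarrow> 0"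
    and v: "\<And>n. (LINT x|lebesgue. sum_power p (v n x)) \<le> R"
  shows "(\<lambda>n. LINT x|lebesgue. abs (y n x * v n x)) \<longlonglongrightarrow> 0"
proof (rule LIMSEQ_I)
  fix e :: real assume e: "e > 0"
  have R0: "0 \<le> R" using order_trans[OF _ v[of 0], of 0] by (simp add: integral_nonneg_AE sum_power_nonneg)
  obtain a where a: "a > 0" "1 / a + a powr (1 - p) < e / (2 * (R + 1))"
    by (rule young_constant_small[OF p, of "e / (2 * (R + 1))"]) (use e R0 in simp, (rule that; assumption))
  obtain N where N: "\<And>n. n \<ge> N ==> norm ((LINT x|lebesgue. mixed_power p (y n x)) - 0) < e / (2 * a)"
    using LIMSEQ_D[OF y, of "e / (2 * a)"] e a by auto
  have "norm ((LINT x|lebesgue. abs (y n x * v n x)) - 0) < e" if "n \<ge> N" for n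
  proof -
    have "(LINT x|lebesgue. abs (y n x * v n x)) \<le> a * (LINT x|lebesgue. mixed_power p (y n x))
      + (1 / a + a powr (1 - p)) * (LINT x|lebesgue. sum_power p (v n x))" by (rule young_integrable(2)[OF p m i a(1)])
    also have "a * (LINT x|lebesgue. mixed_power p (y n x)) < a * (e / (2 * a))" using N[OF that] a by (intro mult_strict_left_mono) auto
    also have "a * (e / (2 * a)) = e / 2" using a by simp
    also have "(1 / a + a powr (1 - p)) * (LINT x|lebesgue. sum_power p (v n x)) \<le> (e / (2 * (R + 1))) * (R + 1)"
      using a v[of n] R0 e by (intro mult_mono) (auto intro!: integral_nonneg_AE simp: sum_power_nonneg)
    also have "(e / (2 * (R + 1))) * (R + 1) = e / 2"
    proof -
      have key: "S > 0 ==> e / (2 * S) * S = e / 2" for S :: real by simp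
      show ?thesis by (rule key) (use R0 in simp)
    qed
    finally have "(LINT x|lebesgue. abs (y n x * v n x)) < e" by simp
    then show ?thesis by (simp add: integral_nonneg_AE)
  qed
  then show "\<exists>no. \<forall>n\<ge>no. norm ((LINT x|lebesgue. abs (y n x * v n x)) - 0) < e" by blast
qed

text \<open>The reverse choice: a small Young parameter makes the bounded \<open>mixed_power\<close>
  part contribute little, and the excess over it is dominated by a multiple of
  \<open>sum_power\<close> of the fixed \<open>v\<close>.\<close>

lemma product_tendsto_0_fixed:
  fixes y :: "nat => real^3 => real" and v :: "real^3 => real"
  assumes p: "2 < p" and m[measurable]: "\<And>n. y n \<in> borel_measurable lebesgue" "v \<in> borel_measurable lebesgue"
    and i: "\<And>n. integrable lebesgue (\<lambda>x. mixed_power p (y n x))" "integrable lebesgue (\<lambda>x. sum_power p (v x))"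
    and y0: "AE x in lebesgue. (\<lambda>n. y n x) \<longlonglongrightarrow> 0"
    and R: "\<And>n. (LINT x|lebesgue. mixed_power p (y n x)) \<le> R"
  shows "(\<lambda>n. LINT x|lebesgue. abs (y n x * v x)) \<longlonglongrightarrow> 0"
proof (rule LIMSEQ_I)
  fix e :: real assume e: "e > 0"
  have R0: "0 \<le> R" using order_trans[OF _ R[of 0], of 0] by (simp add: integral_nonneg_AE mixed_power_nonneg)
  define a where "a = e / (2 * (R + 1))"
  have a: "a > 0" using e R0 by (simp add: a_def)
  let ?c = "1 / a + a powr (1 - p)"
  have c0: "0 \<le> ?c" using a by simp
  define z where "z n x = max 0 (abs (y n x * v x) - a * mixed_power p (y n x))" for n x
  have zm[measurable]: "z n \<in> borel_measurable lebesgue" for n unfolding z_def by measurable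
  have zb: "norm (z n x) \<le> ?c * sum_power p (v x)" for n x
  proof -
    have "abs (y n x * v x) - a * mixed_power p (y n x) \<le> ?c * sum_power p (v x)"
      using mixed_young[OF p a, of "y n x" "v x"] by (simp add: abs_mult)
    moreover have "0 \<le> ?c * sum_power p (v x)" using c0 by (intro mult_nonneg_nonneg sum_power_nonneg)
    ultimately show ?thesis by (simp add: z_def)
  qed
  have zl: "AE x in lebesgue. (\<lambda>n. z n x) \<longlonglongrightarrow> 0" using y0
  proof eventually_elim
    case (elim x)
    have "(\<lambda>n. abs (y n x * v x)) \<longlonglongrightarrow> abs (0 * v x)" by (intro tendsto_intros elim)
    then have "(\<lambda>n. abs (y n x * v x)) \<longlonglongrightarrow> 0" by simp
    then show ?case by (rule Lim_null_comparison[rotated]) (use a in \<open>simp add: z_def mixed_power_nonneg\<close>)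
  qed
  have "(\<lambda>n. LINT x|lebesgue. z n x) \<longlonglongrightarrow> (LINT x|(lebesgue :: (real^3) measure). (0::real))"
    by (rule integral_dominated_convergence[where w="\<lambda>x. ?c * sum_power p (v x)"]) (use i zl zb in auto)
  then have "(\<lambda>n. LINT x|lebesgue. z n x) \<longlonglongrightarrow> 0" by simp
  then obtain N where N: "\<And>n. n \<ge> N ==> norm ((LINT x|lebesgue. z n x) - 0) < e / 2" using LIMSEQ_D[of "\<lambda>n. LINT x|lebesgue. z n x" 0 "e/2"] e by auto
  have "norm ((LINT x|lebesgue. abs (y n x * v x)) - 0) < e" if "n \<ge> N" for n
  proof -
    have zi: "integrable lebesgue (z n)"
      by (rule Bochner_Integration.integrable_bound[OF integrable_mult_right[OF i(2), of ?c] zm]) (use zb in \<open>auto intro: order_trans[OF _ abs_ge_self]\<close>)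
    have "(LINT x|lebesgue. abs (y n x * v x)) \<le> (LINT x|lebesgue. z n x + a * mixed_power p (y n x))"
    proof (rule integral_mono)
      show "integrable lebesgue (\<lambda>x. abs (y n x * v x))" by (rule integrable_abs[OF young_integrable(1)[OF p m(1) m(2) i(1) i(2)]])
      show "abs (y n x * v x) \<le> z n x + a * mixed_power p (y n x)" for x by (simp add: z_def)
    qed (use zi i(1) in simp)
    also have "\<dots> = (LINT x|lebesgue. z n x) + a * (LINT x|lebesgue. mixed_power p (y n x))" using zi i(1) by simp
    also have "\<dots> < e / 2 + a * (R + 1)" using N[OF that] a R[of n] by (intro add_less_le_mono mult_left_mono) auto
    also have "\<dots> = e"
    proof -
      have key: "S > 0 ==> e / 2 + e / (2 * S) * S = e" for S :: real by simp
      show ?thesis unfolding a_def by (rule key) (use R0 in simp)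
    qed
    finally show ?thesis by (simp add: integral_nonneg_AE)
  qed
  then show "\<exists>no. \<forall>n\<ge>no. norm ((LINT x|lebesgue. abs (y n x * v x)) - 0) < e" by blast
qed

text \<open>\<open>h_growth\<close> merges the condition at 0 and the power growth into one
  inequality with arbitrarily small linear coefficient, the form in which both are used
  below.\<close>

locale superposition =
  fixes h :: "real^3 => real => real" and p :: real
  assumes p: "2 < p" "p < 6"
    and h_measurable: "\<And>t. (\<lambda>x. h x t) \<in> borel_measurable lebesgue"
    and h_continuous: "AE x in lebesgue. continuous_on UNIV (h x)"
    and h_growth: "\<And>e. e > 0 ==> \<exists>C\<ge>0. AE x in lebesgue. \<forall>t. abs (h x t) \<le> e * abs t + C * abs t powr (p - 1)"
begin

definition \<K> where "\<K> U = (LINT x|lebesgue. primitive h x (rep U x))"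
definition \<K>' where "\<K>' U V = (LINT x|lebesgue. h x (rep U x) * rep V x)"

lemma growth_1: "\<exists>C\<ge>0. AE x in lebesgue. continuous_on UNIV (h x) \<and> (\<forall>t. abs (h x t) \<le> abs t + C * abs t powr (p - 1))"
proof -
  obtain C where "C \<ge> 0" "AE x in lebesgue. \<forall>t. abs (h x t) \<le> 1 * abs t + C * abs t powr (p - 1)" using h_growth[of 1] by auto
  moreover from this(2) h_continuous have "AE x in lebesgue. continuous_on UNIV (h x) \<and> (\<forall>t. abs (h x t) \<le> abs t + C * abs t powr (p - 1))"
    by eventually_elim simp
  ultimately show ?thesis by blast
qed

lemma h_comp_measurable: "u \<in> borel_measurable lebesgue ==> (\<lambda>x. h x (u x)) \<in> borel_measurable lebesgue"
  by (rule caratheodory_measurable[OF h_measurable h_continuous])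

lemma primitive_comp_measurable: "u \<in> borel_measurable lebesgue ==> (\<lambda>x. primitive h x (u x)) \<in> borel_measurable lebesgue"
  by (rule primitive_measurable[OF h_measurable h_continuous])

lemma mixed_bound:
  "\<exists>B\<ge>0. AE x in lebesgue. continuous_on UNIV (h x) \<and> (\<forall>s t y. abs y \<le> 2 * ((abs s + abs t) + C * (abs s + abs t) powr (p - 1)) \<longrightarrow>
    mixed_power p y \<le> B * (sum_power p s + sum_power p t))" if C: "C \<ge> 0" for C
proof -
  obtain B where B: "B \<ge> 0" "\<And>T y. T \<ge> 0 ==> abs y \<le> 2 * (T + C * T powr (p - 1)) ==> mixed_power p y \<le> B * sum_power p T"
    using mixed_power_growth[OF p(1) C] by blast
  have "mixed_power p y \<le> (B * 2 powr p) * (sum_power p s + sum_power p t)"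
    if "abs y \<le> 2 * ((abs s + abs t) + C * (abs s + abs t) powr (p - 1))" for s t y
  proof -
    have "mixed_power p y \<le> B * sum_power p (abs s + abs t)" by (rule B(2)[OF _ that]) simp
    also have "\<dots> \<le> B * (2 powr p * (sum_power p s + sum_power p t))" by (intro mult_left_mono sum_power_add p B)
    finally show ?thesis by simp
  qed
  then have *: "\<forall>s t y. abs y \<le> 2 * ((abs s + abs t) + C * (abs s + abs t) powr (p - 1)) \<longrightarrow>
    mixed_power p y \<le> B * 2 powr p * (sum_power p s + sum_power p t)" by blast
  show ?thesis
  proof (intro exI[of _ "B * 2 powr p"] conjI)
    show "0 \<le> B * 2 powr p" using B(1) by simp
    show "AE x in lebesgue. continuous_on UNIV (h x) \<and> (\<forall>s t y. abs y \<le> 2 * ((abs s + abs t) + C * (abs s + abs t) powr (p - 1)) \<longrightarrow>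
      mixed_power p y \<le> B * 2 powr p * (sum_power p s + sum_power p t))" using h_continuous by eventually_elim (use * in blast)
  qed
qed

text \<open>The increment \<open>abs (h x t - h x s)\<close> and the defect of the difference quotient of the primitive are
  both bounded through \<open>abs (h x \<xi>) + abs (h x s)\<close> with \<open>\<xi>\<close> between \<open>s\<close> and \<open>s + t\<close>.\<close>

lemma increment_bound:
  "\<exists>B\<ge>0. AE x in lebesgue. continuous_on UNIV (h x) \<and>
     (\<forall>s t \<xi> y. abs (\<xi> - s) \<le> abs t \<longrightarrow> abs y \<le> abs (h x \<xi> - h x s) \<longrightarrow> mixed_power p y \<le> B * (sum_power p s + sum_power p t))"
proof -
  obtain C where C: "C \<ge> 0" "AE x in lebesgue. continuous_on UNIV (h x) \<and> (\<forall>t. abs (h x t) \<le> abs t + C * abs t powr (p - 1))"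
    using growth_1 by blast
  obtain B where B: "B \<ge> 0" "AE x in lebesgue. continuous_on UNIV (h x) \<and> (\<forall>s t y. abs y \<le> 2 * ((abs s + abs t) + C * (abs s + abs t) powr (p - 1)) \<longrightarrow>
    mixed_power p y \<le> B * (sum_power p s + sum_power p t))" using mixed_bound[OF C(1)] by blast
  show ?thesis
  proof (intro exI[of _ B] conjI B(1))
    show "AE x in lebesgue. continuous_on UNIV (h x) \<and> (\<forall>s t \<xi> y. abs (\<xi> - s) \<le> abs t \<longrightarrow> abs y \<le> abs (h x \<xi> - h x s) \<longrightarrow> mixed_power p y \<le> B * (sum_power p s + sum_power p t))"
      using C(2) B(2)
    proof eventually_elim
      case (elim x)
      have "mixed_power p y \<le> B * (sum_power p s + sum_power p t)" if "abs (\<xi> - s) \<le> abs t" "abs y \<le> abs (h x \<xi> - h x s)" for s t \<xi> y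
      proof -
        let ?T = "abs s + abs t"
        have a: "abs (h x r) \<le> ?T + C * ?T powr (p - 1)" if "abs r \<le> ?T" for r
        proof -
          have "abs (h x r) \<le> abs r + C * abs r powr (p - 1)" using elim(1) by blast
          also have "\<dots> \<le> ?T + C * ?T powr (p - 1)" using that C(1) p by (intro add_mono mult_left_mono powr_mono2) auto
          finally show ?thesis .
        qed
        have "abs \<xi> \<le> ?T" "abs s \<le> ?T" using that(1) by linarith+
        from a[OF this(1)] a[OF this(2)] that(2)
        have "abs y \<le> 2 * (?T + C * ?T powr (p - 1))" by (smt (verit))
        then show ?thesis using elim(2) by blast
      qed
      then show ?case using elim by blast
    qed
  qed
qed

text \<open>The common core of continuity and differentiability: \<open>y n\<close> may be an
  increment of \<open>h\<close> or the quotient of a Taylor remainder, as long as it is bounded by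
  an increment from \<open>rep U\<close> over a distance of at most |rep (W n)|. The second
  conclusion serves bounded \<open>W\<close>, the last one strong convergence.\<close>

lemma increment_convergence:
  assumes y[measurable]: "\<And>n. y n \<in> borel_measurable lebesgue"
    and bd: "\<And>n. AE x in lebesgue. \<exists>\<xi>. abs (\<xi> - rep U x) \<le> abs (rep (W n) x) \<and> abs (y n x) \<le> abs (h x \<xi> - h x (rep U x))"
  shows "\<And>n. integrable lebesgue (\<lambda>x. mixed_power p (y n x))"
    "\<exists>B\<ge>0. \<forall>n. (LINT x|lebesgue. mixed_power p (y n x)) \<le> B * (power_energy p U + power_energy p (W n))"
    "AE x in lebesgue. (\<lambda>n. rep (W n) x) \<longlonglongrightarrow> 0 ==> AE x in lebesgue. (\<lambda>n. y n x) \<longlonglongrightarrow> 0"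
    "AE x in lebesgue. (\<lambda>n. rep (W n) x) \<longlonglongrightarrow> 0 ==> W \<longlonglongrightarrow> 0 ==> (\<lambda>n. LINT x|lebesgue. mixed_power p (y n x)) \<longlonglongrightarrow> 0"
proof -
  obtain B where B: "B \<ge> 0" "AE x in lebesgue. continuous_on UNIV (h x) \<and>
     (\<forall>s t \<xi> y. abs (\<xi> - s) \<le> abs t \<longrightarrow> abs y \<le> abs (h x \<xi> - h x s) \<longrightarrow> mixed_power p y \<le> B * (sum_power p s + sum_power p t))"
    using increment_bound by blast
  have mb: "AE x in lebesgue. mixed_power p (y n x) \<le> B * (sum_power p (rep U x) + sum_power p (rep (W n) x))" for n
    using bd[of n] B(2) by eventually_elim blast
  have ii: "integrable lebesgue (\<lambda>x. B * (sum_power p (rep U x) + sum_power p (rep (W n) x)))" for n using power_energy(1)[OF p] by simp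
  show mi: "integrable lebesgue (\<lambda>x. mixed_power p (y n x))" for n by (rule Bochner_Integration.integrable_bound[OF ii[of n]])
      (measurable, use mb[of n] in eventually_elim, use B in \<open>simp add: mixed_power_nonneg sum_power_nonneg\<close>)
  have "(LINT x|lebesgue. mixed_power p (y n x)) \<le> B * (power_energy p U + power_energy p (W n))" for n
  proof -
    have "(LINT x|lebesgue. mixed_power p (y n x)) \<le> (LINT x|lebesgue. B * (sum_power p (rep U x) + sum_power p (rep (W n) x)))"
      by (rule integral_mono_AE[OF mi ii mb])
    then show ?thesis using power_energy(1)[OF p] by (simp add: power_energy_def)
  qed
  then show "\<exists>B\<ge>0. \<forall>n. (LINT x|lebesgue. mixed_power p (y n x)) \<le> B * (power_energy p U + power_energy p (W n))" using B(1) by blast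
  assume w0: "AE x in lebesgue. (\<lambda>n. rep (W n) x) \<longlonglongrightarrow> 0"
  have "AE x in lebesgue. \<forall>n. \<exists>\<xi>. abs (\<xi> - rep U x) \<le> abs (rep (W n) x) \<and> abs (y n x) \<le> abs (h x \<xi> - h x (rep U x))"
    unfolding AE_all_countable using bd by blast
  with w0 h_continuous show y0: "AE x in lebesgue. (\<lambda>n. y n x) \<longlonglongrightarrow> 0"
  proof eventually_elim
    case (elim x)
    then obtain \<xi> where \<xi>: "\<And>n. abs (\<xi> n - rep U x) \<le> abs (rep (W n) x)" "\<And>n. abs (y n x) \<le> abs (h x (\<xi> n) - h x (rep U x))"
      by metis
    have "(\<lambda>n. \<xi> n - rep U x) \<longlonglongrightarrow> 0"
      by (rule Lim_null_comparison[OF _ tendsto_rabs_zero[OF elim(1)]]) (use \<xi>(1) in auto)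
    then have "\<xi> \<longlonglongrightarrow> rep U x" by (simp add: LIM_zero_iff)
    then have "(\<lambda>n. h x (\<xi> n)) \<longlonglongrightarrow> h x (rep U x)" using continuous_on_tendsto_compose[OF elim(2)] by auto
    then have "(\<lambda>n. abs (h x (\<xi> n) - h x (rep U x))) \<longlonglongrightarrow> 0" by (intro tendsto_rabs_zero) (simp add: LIM_zero_iff)
    then show ?case by (rule Lim_null_comparison[rotated]) (use \<xi>(2) in auto)
  qed
  assume W: "W \<longlonglongrightarrow> 0"
  show "(\<lambda>n. LINT x|lebesgue. mixed_power p (y n x)) \<longlonglongrightarrow> 0"
    by (rule mixed_power_tendsto_0(2)[OF p(1) y y0 mb B(1) power_energy(1)[OF p] power_energy(1)[OF p]])
      (use power_energy_tendsto_0[OF p W] in \<open>simp add: power_energy_def\<close>)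
qed

lemma h_zero: "AE x in lebesgue. h x 0 = 0"
proof -
  obtain C where "AE x in lebesgue. continuous_on UNIV (h x) \<and> (\<forall>t. abs (h x t) \<le> abs t + C * abs t powr (p - 1))"
    using growth_1 by blast
  then show ?thesis
  proof eventually_elim
    case (elim x)
    then have "abs (h x 0) \<le> abs 0 + C * abs 0 powr (p - 1)" by blast
    then show ?case by simp
  qed
qed

lemma h_rep_measurable[measurable]: "(\<lambda>x. h x (rep U x)) \<in> borel_measurable lebesgue" by (rule h_comp_measurable) measurable

text \<open>Since \<open>h\<close> vanishes at 0, its value is an increment from 0; hence base point
  0 and displacement \<open>U\<close>.\<close>

lemma h_rep_mixed: "integrable lebesgue (\<lambda>x. mixed_power p (h x (rep U x)))"
proof (rule increment_convergence(1)[of "\<lambda>_::nat. \<lambda>x. h x (rep U x)" 0 "\<lambda>_. U"])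
  show "AE x in lebesgue. \<exists>\<xi>. abs (\<xi> - rep 0 x) \<le> abs (rep U x) \<and> abs (h x (rep U x)) \<le> abs (h x \<xi> - h x (rep 0 x))"
    using rep_zero_AE h_zero by eventually_elim (auto intro: exI[of _ "rep U _"])
qed measurable

lemma integrable_h_rep: "integrable lebesgue (\<lambda>x. h x (rep U x) * rep V x)"
  by (rule young_integrable(1)[OF p(1) _ _ h_rep_mixed power_energy(1)[OF p]]) measurable

text \<open>Young's inequality is not homogeneous, so the bound is proved on unit vectors and then
  extended by scaling.\<close>

lemma \<K>'_bounded_linear: "bounded_linear (\<K>' U)"
proof -
  have add: "\<K>' U (V + W) = \<K>' U V + \<K>' U W" for V W
  proof -
    have "\<K>' U (V + W) = (LINT x|lebesgue. h x (rep U x) * rep V x + h x (rep U x) * rep W x)" unfolding \<K>'_def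
      by (rule integral_cong_AE) (measurable, use rep_plus_AE[of V W] in eventually_elim, simp add: distrib_left)
    then show ?thesis using integrable_h_rep by (simp add: \<K>'_def)
  qed
  have scale: "\<K>' U (a *\<^sub>R V) = a *\<^sub>R \<K>' U V" for a V
  proof -
    have "\<K>' U (a *\<^sub>R V) = (LINT x|lebesgue. a * (h x (rep U x) * rep V x))" unfolding \<K>'_def
      by (rule integral_cong_AE) (measurable, use rep_scaleR_AE[of a V] in eventually_elim, simp)
    then show ?thesis by (simp add: \<K>'_def)
  qed
  obtain C where C: "C > 0" "\<And>U. power_energy p U \<le> C * sum_power p (norm U)" using power_energy(3)[OF p] by blast
  define A where "A = (LINT x|lebesgue. mixed_power p (h x (rep U x))) + 2 * (C * 2)"
  have unit: "abs (\<K>' U V) \<le> A" if "norm V = 1" for V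
  proof -
    have "abs (\<K>' U V) \<le> (LINT x|lebesgue. abs (h x (rep U x) * rep V x))" unfolding \<K>'_def by (rule integral_abs_bound)
    also have "\<dots> \<le> 1 * (LINT x|lebesgue. mixed_power p (h x (rep U x))) + (1 / 1 + 1 powr (1 - p)) * (LINT x|lebesgue. sum_power p (rep V x))"
      by (rule young_integrable(2)[OF p(1) _ _ h_rep_mixed power_energy(1)[OF p]]) auto
    also have "(LINT x|lebesgue. sum_power p (rep V x)) = power_energy p V" by (simp add: power_energy_def)
    also have "1 * (LINT x|lebesgue. mixed_power p (h x (rep U x))) + (1 / 1 + 1 powr (1 - p)) * power_energy p V \<le> A"
      using C(2)[of V] that by (simp add: A_def sum_power_def)
    finally show ?thesis .
  qed
  show ?thesis
  proof (rule bounded_linear_intro[OF add scale])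
    fix V
    show "norm (\<K>' U V) \<le> norm V * A"
    proof (cases "V = 0")
      case True
      then show ?thesis using scale[of 0 0] by simp
    next
      case False
      have "abs (\<K>' U (inverse (norm V) *\<^sub>R V)) \<le> A" by (rule unit) (use False in simp)
      then have "inverse (norm V) * abs (\<K>' U V) \<le> A" by (simp add: scale abs_mult)
      then show ?thesis using False by (simp add: field_simps)
    qed
  qed
qed

lemma \<K>'_difference:
  "\<K>' U V - \<K>' U0 V = (LINT x|lebesgue. (h x (rep U x) - h x (rep U0 x)) * rep V x)" unfolding \<K>'_def left_diff_distrib
  by (rule Bochner_Integration.integral_diff[symmetric, OF integrable_h_rep integrable_h_rep])

lemma increment_h:
  "AE x in lebesgue. \<exists>\<xi>. abs (\<xi> - rep U0 x) \<le> abs (rep (U - U0) x) \<and>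
     \<bar>h x (rep U x) - h x (rep U0 x)\<bar> \<le> abs (h x \<xi> - h x (rep U0 x))"
  using rep_minus_AE[of U U0] by eventually_elim (auto intro: exI[of _ "rep U _"])

lemma rep_diff_tendsto_0:
  assumes "AE x in lebesgue. (\<lambda>n. rep (U n) x) \<longlonglongrightarrow> rep U0 x"
  shows "AE x in lebesgue. (\<lambda>n. rep (U n - U0) x) \<longlonglongrightarrow> 0"
proof -
  have "AE x in lebesgue. \<forall>n. rep (U n - U0) x = rep (U n) x - rep U0 x" unfolding AE_all_countable using rep_minus_AE by blast
  with assms show ?thesis by eventually_elim (simp add: LIM_zero_iff)
qed

text \<open>Without norm convergence the increments are only bounded in mixed size and vanish
  pointwise, which is enough against the fixed \<open>V\<close>.\<close>

lemma \<K>'_weakly_continuous: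
  assumes bd: "\<And>n. norm (U n) \<le> M" and ae: "AE x in lebesgue. (\<lambda>n. rep (U n) x) \<longlonglongrightarrow> rep U0 x"
  shows "(\<lambda>n. \<K>' (U n) V) \<longlonglongrightarrow> \<K>' U0 V"
proof -
  define y where "y n x = h x (rep (U n) x) - h x (rep U0 x)" for n x
  have ym[measurable]: "y n \<in> borel_measurable lebesgue" for n unfolding y_def by measurable
  have yb: "AE x in lebesgue. \<exists>\<xi>. abs (\<xi> - rep U0 x) \<le> abs (rep (U n - U0) x) \<and> abs (y n x) \<le> abs (h x \<xi> - h x (rep U0 x))" for n
    unfolding y_def by (rule increment_h)
  note ic = increment_convergence[of y U0 "\<lambda>n. U n - U0", OF ym yb]
  obtain B where B: "B \<ge> 0" "\<And>n. (LINT x|lebesgue. mixed_power p (y n x)) \<le> B * (power_energy p U0 + power_energy p (U n - U0))"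
    using ic(2) by blast
  have "norm (U n - U0) \<le> M + norm U0" for n using bd[of n] norm_triangle_ineq4[of "U n" U0] by linarith
  then obtain R where R: "\<And>n. power_energy p (U n - U0) \<le> R" using power_energy_bounded[OF p, of "\<lambda>n. U n - U0"] by blast
  have mR: "(LINT x|lebesgue. mixed_power p (y n x)) \<le> B * (power_energy p U0 + R)" for n
    by (rule order_trans[OF B(2)]) (intro mult_left_mono add_left_mono R B(1))
  have "(\<lambda>n. LINT x|lebesgue. abs (y n x * rep V x)) \<longlonglongrightarrow> 0"
    by (rule product_tendsto_0_fixed[OF p(1) ym rep_measurable ic(1) power_energy(1)[OF p] ic(3)[OF rep_diff_tendsto_0[OF ae]] mR])
  then have "(\<lambda>n. \<K>' (U n) V - \<K>' U0 V) \<longlonglongrightarrow> 0" by (rule Lim_null_comparison[rotated])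
      (intro always_eventually allI, unfold \<K>'_difference y_def real_norm_def, rule integral_abs_bound)
  then show ?thesis by (simp add: LIM_zero_iff)
qed

text \<open>Strong convergence of the first arguments sends the increments to 0 in mixed size, so
  they can be paired with the bounded second arguments; what remains is linear in the second
  argument.\<close>

lemma \<K>'_continuous:
  assumes U: "U \<longlonglongrightarrow> U0" and V: "V \<longlonglongrightarrow> V0"
  shows "(\<lambda>n. \<K>' (U n) (V n)) \<longlonglongrightarrow> \<K>' U0 V0"
proof (rule tendsto_subsequence_principle)
  fix r :: "nat => nat" assume r: "strict_mono r"
  have Ur: "(\<lambda>n. U (r n)) \<longlonglongrightarrow> U0" using LIMSEQ_subseq_LIMSEQ[OF U r] by (simp add: o_def)
  obtain s where s: "strict_mono (s :: nat => nat)" and ae: "AE x in lebesgue. (\<lambda>n. rep (U (r (s n))) x) \<longlonglongrightarrow> rep U0 x"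
    using AE_subsequence[OF Ur] by blast
  define u where "u n = U (r (s n))" for n
  define v where "v n = V (r (s n))" for n
  have rs: "strict_mono (r \<circ> s)" by (rule strict_mono_o[OF r s])
  have u: "u \<longlonglongrightarrow> U0" and v: "v \<longlonglongrightarrow> V0"
    using LIMSEQ_subseq_LIMSEQ[OF U rs] LIMSEQ_subseq_LIMSEQ[OF V rs] by (simp_all add: o_def u_def[abs_def] v_def[abs_def])
  define y where "y n x = h x (rep (u n) x) - h x (rep U0 x)" for n x
  have ym[measurable]: "y n \<in> borel_measurable lebesgue" for n unfolding y_def by measurable
  have yb: "AE x in lebesgue. \<exists>\<xi>. abs (\<xi> - rep U0 x) \<le> abs (rep (u n - U0) x) \<and> abs (y n x) \<le> abs (h x \<xi> - h x (rep U0 x))" for n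
    unfolding y_def by (rule increment_h)
  note ic = increment_convergence[of y U0 "\<lambda>n. u n - U0", OF ym yb]
  have ae0: "AE x in lebesgue. (\<lambda>n. rep (u n - U0) x) \<longlonglongrightarrow> 0"
    by (rule rep_diff_tendsto_0) (use ae in \<open>simp add: u_def\<close>)
  have m0: "(\<lambda>n. LINT x|lebesgue. mixed_power p (y n x)) \<longlonglongrightarrow> 0"
    by (rule ic(4)[OF ae0]) (use u in \<open>simp add: LIM_zero_iff\<close>)
  have "Bseq v" by (rule convergent_imp_Bseq[OF convergentI[OF v]])
  then obtain M where "\<And>n. norm (v n) \<le> M" unfolding Bseq_def by blast
  then obtain R where R: "\<And>n. power_energy p (v n) \<le> R" using power_energy_bounded[OF p] by blast
  have "(\<lambda>n. LINT x|lebesgue. abs (y n x * rep (v n) x)) \<longlonglongrightarrow> 0"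
    by (rule product_tendsto_0_uniform[OF p(1) ym rep_measurable ic(1) power_energy(1)[OF p] m0 R[unfolded power_energy_def]])
  then have "(\<lambda>n. \<K>' (u n) (v n) - \<K>' U0 (v n)) \<longlonglongrightarrow> 0" by (rule Lim_null_comparison[rotated])
      (intro always_eventually allI, unfold \<K>'_difference y_def real_norm_def, rule integral_abs_bound)
  moreover have "(\<lambda>n. \<K>' U0 (v n)) \<longlonglongrightarrow> \<K>' U0 V0" by (rule bounded_linear.tendsto[OF \<K>'_bounded_linear v])
  ultimately have "(\<lambda>n. \<K>' (u n) (v n) - \<K>' U0 (v n) + \<K>' U0 (v n)) \<longlonglongrightarrow> 0 + \<K>' U0 V0" by (rule tendsto_add)
  then have "(\<lambda>n. \<K>' (U (r (s n))) (V (r (s n)))) \<longlonglongrightarrow> \<K>' U0 V0" by (simp add: u_def v_def)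
  with s show "\<exists>s. strict_mono s \<and> (\<lambda>n. \<K>' (U (r (s n))) (V (r (s n)))) \<longlonglongrightarrow> \<K>' U0 V0" by blast
qed

lemma primitive_bound:
  "\<exists>C\<ge>0. AE x in lebesgue. \<forall>t. abs (primitive h x t) \<le> C * sum_power p t"
proof -
  obtain C where C: "C \<ge> 0" "AE x in lebesgue. continuous_on UNIV (h x) \<and> (\<forall>t. abs (h x t) \<le> abs t + C * abs t powr (p - 1))"
    using growth_1 by blast
  have "AE x in lebesgue. \<forall>t. abs (primitive h x t) \<le> (1 + C) * sum_power p t" using C(2)
  proof eventually_elim
    case (elim x)
    show ?case
    proof
      fix t
      obtain \<xi> where \<xi>: "abs (\<xi> - 0) \<le> abs (t - 0)" "primitive h x t - primitive h x 0 = (t - 0) * h x \<xi>"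
        using primitive_MVT[where h=h and x=x and s=0 and t=t] elim by blast
      have "abs (h x \<xi>) \<le> abs \<xi> + C * abs \<xi> powr (p - 1)" using elim by blast
      also have "\<dots> \<le> abs t + C * abs t powr (p - 1)" using \<xi>(1) C(1) p by (intro add_mono mult_left_mono powr_mono2) auto
      finally have "abs t * abs (h x \<xi>) \<le> abs t * (abs t + C * abs t powr (p - 1))" by (rule mult_left_mono) simp
      also have "\<dots> = t^2 + C * (abs t powr (p - 1) * abs t)" by (simp add: algebra_simps power2_eq_square)
      also have "abs t powr (p - 1) * abs t = abs t powr p" using powr_add[of "abs t" "p - 1" 1] by simp
      also have "t^2 + C * abs t powr p \<le> (1 + C) * sum_power p t" using C(1) by (simp add: sum_power_def algebra_simps)
      finally show "abs (primitive h x t) \<le> (1 + C) * sum_power p t" using \<xi>(2) by (simp add: primitive_0 abs_mult)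
    qed
  qed
  then show ?thesis using C(1) by (intro exI[of _ "1 + C"]) auto
qed

lemma integrable_primitive: "integrable lebesgue (\<lambda>x. primitive h x (rep U x))"
proof -
  obtain C where C: "C \<ge> 0" "AE x in lebesgue. \<forall>t. abs (primitive h x t) \<le> C * sum_power p t" using primitive_bound by blast
  have m: "(\<lambda>x. primitive h x (rep U x)) \<in> borel_measurable lebesgue" by (rule primitive_comp_measurable) measurable
  show ?thesis by (rule Bochner_Integration.integrable_bound[OF integrable_mult_right[OF power_energy(1)[OF p, of U], of C] m])
      (use C(2) in eventually_elim, use C(1) in \<open>simp add: sum_power_nonneg\<close>)
qed

text \<open>The remainder divided by \<open>rep (W n)\<close> is bounded by an increment of
  \<open>h\<close>, by the mean value theorem. Multiplied by the normalised direction it pairs a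
  vanishing factor with a bounded one.\<close>

lemma \<K>_remainder_tendsto:
  assumes W: "W \<longlonglongrightarrow> 0" "\<And>n. W n \<noteq> 0" and ae: "AE x in lebesgue. (\<lambda>n. rep (W n) x) \<longlonglongrightarrow> 0"
  shows "(\<lambda>n. norm (\<K> (U + W n) - \<K> U - \<K>' U (W n)) / norm (W n)) \<longlonglongrightarrow> 0"
proof -
  define P where "P n x = primitive h x (rep (U + W n) x) - primitive h x (rep U x) - h x (rep U x) * rep (W n) x" for n x
  \<comment> \<open>Where \<open>rep (W n)\<close> vanishes the quotient is 0 by convention, and
    \<open>P n\<close> vanishes there as well up to a null set.\<close>
  define y where "y n x = P n x / rep (W n) x" for n x
  have pm[measurable]: "(\<lambda>x. primitive h x (rep V x)) \<in> borel_measurable lebesgue" for V by (rule primitive_comp_measurable) measurable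
  have ym[measurable]: "y n \<in> borel_measurable lebesgue" for n unfolding y_def P_def by measurable
  have mvt: "AE x in lebesgue. \<exists>\<xi>. abs (\<xi> - rep U x) \<le> abs (rep (W n) x) \<and> P n x = rep (W n) x * (h x \<xi> - h x (rep U x))" for n
    using h_continuous rep_plus_AE[of U "W n"]
  proof eventually_elim
    case (elim x)
    obtain \<xi> where "abs (\<xi> - rep U x) \<le> abs (rep (U + W n) x - rep U x)"
      "primitive h x (rep (U + W n) x) - primitive h x (rep U x) = (rep (U + W n) x - rep U x) * h x \<xi>"
      using primitive_MVT[where h=h and x=x and s="rep U x" and t="rep (U + W n) x", OF elim(1)] by blast
    then show ?case using elim(2) by (intro exI[of _ \<xi>]) (simp add: P_def right_diff_distrib)
  qed
  have yb: "AE x in lebesgue. \<exists>\<xi>. abs (\<xi> - rep U x) \<le> abs (rep (W n) x) \<and> abs (y n x) \<le> abs (h x \<xi> - h x (rep U x))" for n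
    using mvt[of n]
  proof eventually_elim
    case (elim x)
    then obtain \<xi> where "abs (\<xi> - rep U x) \<le> abs (rep (W n) x)" "P n x = rep (W n) x * (h x \<xi> - h x (rep U x))" by blast
    then show ?case by (intro exI[of _ \<xi>]) (cases "rep (W n) x = 0"; simp add: y_def)
  qed
  note ic = increment_convergence[of y U W, OF ym yb]
  define v where "v n = inverse (norm (W n)) *\<^sub>R W n" for n
  have "norm (v n) \<le> 1" for n using W(2) by (simp add: v_def)
  then obtain R where R: "\<And>n. power_energy p (v n) \<le> R" using power_energy_bounded[OF p] by blast
  have lim: "(\<lambda>n. LINT x|lebesgue. abs (y n x * rep (v n) x)) \<longlonglongrightarrow> 0"
    by (rule product_tendsto_0_uniform[OF p(1) ym rep_measurable ic(1) power_energy(1)[OF p] ic(4)[OF ae W(1)] R[unfolded power_energy_def]])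
  show ?thesis
  proof (rule Lim_null_comparison[OF _ lim], intro always_eventually allI)
    fix n
    have "\<K> (U + W n) - \<K> U - \<K>' U (W n) = (LINT x|lebesgue. P n x)"
      unfolding P_def \<K>_def \<K>'_def using integrable_primitive integrable_h_rep by simp
    also have "\<dots> = (LINT x|lebesgue. norm (W n) * (y n x * rep (v n) x))"
    proof (rule integral_cong_AE)
      show "P n \<in> borel_measurable lebesgue" unfolding P_def by measurable
      show "AE x in lebesgue. P n x = norm (W n) * (y n x * rep (v n) x)" using mvt[of n] rep_scaleR_AE[of "inverse (norm (W n))" "W n"]
      proof eventually_elim
        case (elim x)
        then have "rep (W n) x = 0 ==> P n x = 0" by auto
        then have "P n x = y n x * rep (W n) x" by (cases "rep (W n) x = 0") (simp_all add: y_def)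
        then show ?case using elim(2) W(2)[of n] by (simp add: v_def)
      qed
    qed measurable
    also have "\<dots> = norm (W n) * (LINT x|lebesgue. y n x * rep (v n) x)" by simp
    finally have "norm (\<K> (U + W n) - \<K> U - \<K>' U (W n)) / norm (W n) = \<bar>LINT x|lebesgue. y n x * rep (v n) x\<bar>"
      using W(2)[of n] by (simp add: abs_mult)
    then show "norm (norm (\<K> (U + W n) - \<K> U - \<K>' U (W n)) / norm (W n)) \<le> (LINT x|lebesgue. abs (y n x * rep (v n) x))"
      using integral_abs_bound[of lebesgue "\<lambda>x. y n x * rep (v n) x"] by (simp del: abs_mult norm_divide)
  qed
qed

lemma \<K>_has_derivative: "(\<K> has_derivative \<K>' U) (at U)" unfolding has_derivative_at
proof (intro conjI \<K>'_bounded_linear)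
  show "((\<lambda>W. norm (\<K> (U + W) - \<K> U - \<K>' U W) / norm W) \<longlongrightarrow> 0) (at 0)" unfolding tendsto_at_iff_sequentially o_def
  proof (intro allI impI tendsto_subsequence_principle)
    fix W :: "nat => xfun" and r :: "nat => nat"
    assume W: "\<forall>i. W i \<in> UNIV - {0}" "W \<longlonglongrightarrow> 0" and r: "strict_mono r"
    have Wr: "(\<lambda>n. W (r n)) \<longlonglongrightarrow> 0" using LIMSEQ_subseq_LIMSEQ[OF W(2) r] by (simp add: o_def)
    obtain s where s: "strict_mono (s :: nat => nat)" and ae: "AE x in lebesgue. (\<lambda>n. rep (W (r (s n))) x) \<longlonglongrightarrow> rep 0 x"
      using AE_subsequence[OF Wr] by blast
    have "(\<lambda>n. norm (\<K> (U + W (r (s n))) - \<K> U - \<K>' U (W (r (s n)))) / norm (W (r (s n)))) \<longlonglongrightarrow> 0"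
    proof (rule \<K>_remainder_tendsto)
      show "(\<lambda>n. W (r (s n))) \<longlonglongrightarrow> 0" using LIMSEQ_subseq_LIMSEQ[OF Wr s] by (simp add: o_def)
      show "AE x in lebesgue. (\<lambda>n. rep (W (r (s n))) x) \<longlonglongrightarrow> 0" using ae rep_zero_AE by eventually_elim simp
    qed (use W(1) in auto)
    with s show "\<exists>s. strict_mono s \<and> (\<lambda>n. norm (\<K> (U + W (r (s n))) - \<K> U - \<K>' U (W (r (s n)))) / norm (W (r (s n)))) \<longlonglongrightarrow> 0"
      by blast
  qed
qed

text \<open>The L^p integral is kept instead of being estimated by the norm: this inequality will
  bound it from below on the Palais-Smale sequence.\<close>

lemma \<K>'_self_bound:
  assumes e: "e > 0"
  shows "\<exists>C\<ge>0. \<forall>U. abs (\<K>' U U) \<le> e * (norm U)^2 + C * (LINT x|lebesgue. abs (rep U x) powr p)"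
proof -
  obtain C where C: "C \<ge> 0" "AE x in lebesgue. \<forall>t. abs (h x t) \<le> e * abs t + C * abs t powr (p - 1)" using h_growth[OF e] by blast
  have "abs (\<K>' U U) \<le> e * (norm U)^2 + C * (LINT x|lebesgue. abs (rep U x) powr p)" for U
  proof -
    have i2: "integrable lebesgue (\<lambda>x. (rep U x)^2)" using rep_L2(1)[of U] by (simp add: L2_real_iff)
    have ip: "integrable lebesgue (\<lambda>x. abs (rep U x) powr p)" by (rule sobolev[OF less_imp_le[OF p(1)] p(2)]) blast
    have "abs (\<K>' U U) \<le> (LINT x|lebesgue. abs (h x (rep U x) * rep U x))" unfolding \<K>'_def by (rule integral_abs_bound)
    also have "\<dots> \<le> (LINT x|lebesgue. e * (rep U x)^2 + C * abs (rep U x) powr p)"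
    proof (rule integral_mono_AE)
      show "AE x in lebesgue. abs (h x (rep U x) * rep U x) \<le> e * (rep U x)^2 + C * abs (rep U x) powr p" using C(2)
      proof eventually_elim
        case (elim x)
        let ?t = "rep U x"
        have "abs (h x ?t) * abs ?t \<le> (e * abs ?t + C * abs ?t powr (p - 1)) * abs ?t" using elim by (intro mult_right_mono) auto
        also have "\<dots> = e * ?t^2 + C * (abs ?t powr (p - 1) * abs ?t)" by (simp add: algebra_simps power2_eq_square)
        also have "abs ?t powr (p - 1) * abs ?t = abs ?t powr p" using powr_add[of "abs ?t" "p - 1" 1] by simp
        finally show ?case by (simp add: abs_mult)
      qed
    qed (use i2 ip integrable_h_rep in auto)
    also have "\<dots> = e * (LINT x|lebesgue. (rep U x)^2) + C * (LINT x|lebesgue. abs (rep U x) powr p)" using i2 ip by simp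
    also have "\<dots> \<le> e * (norm U)^2 + C * (LINT x|lebesgue. abs (rep U x) powr p)"
      using e by (intro add_right_mono mult_left_mono integral_rep_sq_le) auto
    finally show ?thesis .
  qed
  then show ?thesis using C(1) by blast
qed

lemma \<K>'_small:
  assumes e: "e > 0"
  shows "\<exists>\<rho>>0. \<forall>U. norm U \<le> \<rho> \<longrightarrow> abs (\<K>' U U) \<le> e * (norm U)^2"
proof -
  obtain C where C: "C \<ge> 0" "\<And>U. abs (\<K>' U U) \<le> (e/2) * (norm U)^2 + C * (LINT x|lebesgue. abs (rep U x) powr p)"
    using \<K>'_self_bound[of "e/2"] e by auto
  obtain S where S: "S > 0" "\<And>U. (LINT x|lebesgue. abs (rep U x) powr p) \<le> S * norm U powr p"
    by (rule sobolev[OF less_imp_le[OF p(1)] p(2)]) blast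
  \<comment> \<open>Chosen so that C S \<rho>^(p-2) is at most e/2; the added 1 keeps the
    denominator positive.\<close>
  define \<rho> where "\<rho> = (e / (2 * (C * S + 1))) powr (1 / (p - 2))"
  have CS: "C * S + 1 > 0" using C(1) S(1) by (simp add: add_nonneg_pos)
  have \<rho>: "\<rho> > 0" using e CS by (simp add: \<rho>_def)
  have "abs (\<K>' U U) \<le> e * (norm U)^2" if "norm U \<le> \<rho>" for U
  proof (cases "U = 0")
    case True
    then show ?thesis using bounded_linear.linear[OF \<K>'_bounded_linear[of U]] linear_0 by fastforce
  next
    case False
    have "norm U powr (p - 2) \<le> \<rho> powr (p - 2)" using that p by (intro powr_mono2) auto
    also have "\<dots> = e / (2 * (C * S + 1))" using p e CS by (simp add: \<rho>_def powr_powr)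
    finally have n: "norm U powr (p - 2) \<le> e / (2 * (C * S + 1))" .
    have "norm U powr 2 = (norm U)^2" using False powr_realpow[of "norm U" 2] by simp
    then have np: "norm U powr p = norm U powr (p - 2) * (norm U)^2" using powr_add[of "norm U" "p - 2" 2] by simp
    have "C * (LINT x|lebesgue. abs (rep U x) powr p) \<le> C * (S * norm U powr p)" by (rule mult_left_mono[OF S(2) C(1)])
    also have "\<dots> = (C * S) * norm U powr (p - 2) * (norm U)^2" by (simp add: np)
    also have "\<dots> \<le> (C * S + 1) * (e / (2 * (C * S + 1))) * (norm U)^2" using n CS C(1) S(1) by (intro mult_right_mono mult_mono) auto
    also have "(C * S + 1) * (e / (2 * (C * S + 1))) = e / 2"
    proof -
      have key: "z > 0 ==> z * (e / (2 * z)) = e / 2" for z :: real by simp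
      show ?thesis by (rule key[OF CS])
    qed
    finally show ?thesis using C(2)[of U] by (simp add: algebra_simps)
  qed
  with \<rho> show ?thesis by blast
qed

end

section \<open>The quadratic form\<close>

lemma Linf_bound:
  assumes "V \<in> Linf" obtains C where "C \<ge> 0" "V \<in> borel_measurable lebesgue" "AE x in lebesgue. abs (V x) \<le> C"
proof -
  obtain C where C: "V \<in> borel_measurable lebesgue" "AE x in lebesgue. abs (V x) \<le> C" using assms by (auto simp: Linf_def)
  have "AE x in lebesgue. abs (V x) \<le> abs C" using C(2) by eventually_elim simp
  then show ?thesis using that[of "abs C"] C(1) by simp
qed

lemma integrable_Linf_mult:
  assumes V: "V \<in> Linf" and f: "integrable lebesgue (f :: real^3 => real)"
  shows "integrable lebesgue (\<lambda>x. V x * f x)"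
proof -
  obtain C where C: "C \<ge> 0" "V \<in> borel_measurable lebesgue" "AE x in lebesgue. abs (V x) \<le> C"
    by (rule Linf_bound[OF V]) (rule that; assumption)
  note [measurable] = C(2) borel_measurable_integrable[OF f]
  show ?thesis by (rule Bochner_Integration.integrable_bound[OF integrable_mult_right[OF f, of C]])
      (measurable, use C(3) in eventually_elim, use C(1) in \<open>auto simp: abs_mult intro: mult_right_mono\<close>)
qed

section \<open>The form on its full domain and its lower bound\<close>

definition L2_inner_product :: "(real^3 => real) => (real^3 => real) => real" where
  "L2_inner_product u v = (LINT x|lebesgue. u x * v x)"

lemma L2_inner_product_lin:
  assumes "u \<in> L2" "v \<in> L2" "w \<in> L2"
  shows "L2_inner_product (\<lambda>x. a * u x + b * v x) w = a * L2_inner_product u w + b * L2_inner_product v w"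
proof -
  have "L2_inner_product (\<lambda>x. a * u x + b * v x) w = (LINT x|lebesgue. a * (u x * w x) + b * (v x * w x))"
    by (simp add: L2_inner_product_def algebra_simps)
  then show ?thesis using assms by (simp add: L2_inner_product_def L2_mult(1))
qed

lemma L2_inner_product_commute: "L2_inner_product u v = L2_inner_product v u" by (simp add: L2_inner_product_def mult.commute)

text \<open>Splitting off the inner product of jets leaves multiplication by the bounded function V
  - 1.\<close>

lemma qform_integrable:
  assumes V: "V \<in> Linf" and u: "u \<in> form_dom" and v: "v \<in> form_dom"
  shows "integrable lebesgue (\<lambda>x. wgrad u x \<bullet> wgrad v x + u x * v x / (rad x)^2 + V x * u x * v x)"
    "qform V u v = (LINT x|lebesgue. jet u x \<bullet> jet v x) + (LINT x|lebesgue. (V x - 1) * (u x * v x))"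
proof -
  have uv: "integrable lebesgue (\<lambda>x. u x * v x)" by (rule L2_mult(1)[OF form_domD(1)[OF u] form_domD(1)[OF v]])
  have V1: "integrable lebesgue (\<lambda>x. (V x - 1) * (u x * v x))" using integrable_Linf_mult[OF V uv] uv by (simp add: left_diff_distrib)
  have j: "integrable lebesgue (\<lambda>x. jet u x \<bullet> jet v x)" by (rule L2_inner[OF jet_L2[OF u] jet_L2[OF v]])
  have eq: "wgrad u x \<bullet> wgrad v x + u x * v x / (rad x)^2 + V x * u x * v x = jet u x \<bullet> jet v x + (V x - 1) * (u x * v x)" for x
    by (simp add: inner_jet algebra_simps)
  show "integrable lebesgue (\<lambda>x. wgrad u x \<bullet> wgrad v x + u x * v x / (rad x)^2 + V x * u x * v x)" unfolding eq using j V1 by simp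
  show "qform V u v = (LINT x|lebesgue. jet u x \<bullet> jet v x) + (LINT x|lebesgue. (V x - 1) * (u x * v x))"
    unfolding qform_def eq by (rule Bochner_Integration.integral_add[OF j V1])
qed

lemma qform_commute: "qform V u v = qform V v u" by (simp add: qform_def inner_commute mult.commute mult.left_commute)

lemma qform_cong_AE:
  assumes V: "V \<in> Linf" and u: "u \<in> form_dom" "u' \<in> form_dom" "AE x in lebesgue. u x = u' x"
    and v: "v \<in> form_dom" "v' \<in> form_dom" "AE x in lebesgue. v x = v' x"
  shows "qform V u v = qform V u' v'" unfolding qform_def
proof (rule integral_cong_AE)
  show "AE x in lebesgue. wgrad u x \<bullet> wgrad v x + u x * v x / (rad x)^2 + V x * u x * v x
      = wgrad u' x \<bullet> wgrad v' x + u' x * v' x / (rad x)^2 + V x * u' x * v' x"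
    using form_dom_AE[OF u] form_dom_AE[OF v] by eventually_elim (simp add: jet_def)
qed (rule borel_measurable_integrable[OF qform_integrable(1)[OF V]]; fact)+

lemma qform_lin:
  assumes V: "V \<in> Linf" and u: "u \<in> form_dom" and v: "v \<in> form_dom" and w: "w \<in> form_dom"
  shows "qform V (\<lambda>x. a * u x + b * v x) w = a * qform V u w + b * qform V v w"
proof -
  let ?I = "\<lambda>u x. wgrad u x \<bullet> wgrad w x + u x * w x / (rad x)^2 + V x * u x * w x"
  have "qform V (\<lambda>x. a * u x + b * v x) w = (LINT x|lebesgue. a * ?I u x + b * ?I v x)" unfolding qform_def
  proof (rule integral_cong_AE)
    show "AE x in lebesgue. ?I (\<lambda>x. a * u x + b * v x) x = a * ?I u x + b * ?I v x" using form_dom_lin(2)[OF u v, of a b]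
      by eventually_elim (simp add: jet_def inner_add_left algebra_simps add_divide_distrib)
    show "?I (\<lambda>x. a * u x + b * v x) \<in> borel_measurable lebesgue"
      by (rule borel_measurable_integrable[OF qform_integrable(1)[OF V form_dom_lin(1)[OF u v] w]])
    show "(\<lambda>x. a * ?I u x + b * ?I v x) \<in> borel_measurable lebesgue" using qform_integrable(1)[OF V u w] qform_integrable(1)[OF V v w]
      by (intro borel_measurable_add borel_measurable_times borel_measurable_const borel_measurable_integrable)
  qed
  also have "\<dots> = a * qform V u w + b * qform V v w"
    unfolding qform_def using qform_integrable(1)[OF V u w] qform_integrable(1)[OF V v w] by simp
  finally show ?thesis .
qed

lemma qform_scale: "V \<in> Linf ==> u \<in> form_dom ==> w \<in> form_dom ==> qform V (\<lambda>x. a * u x) w = a * qform V u w"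
  using qform_lin[of V u u w a 0] by simp

lemma qform_combination:
  assumes V: "V \<in> Linf" and u: "u \<in> form_dom" and w: "w \<in> form_dom"
  shows "qform V (\<lambda>x. 1 * u x + (- t) * w x) (\<lambda>x. 1 * u x + (- t) * w x) = qform V u u - 2 * t * qform V w u + t^2 * qform V w w"
proof -
  let ?y = "\<lambda>x. 1 * u x + (- t) * w x"
  have y: "?y \<in> form_dom" by (rule form_dom_lin(1)[OF u w])
  have "qform V ?y ?y = 1 * qform V u ?y + (- t) * qform V w ?y" by (rule qform_lin[OF V u w y])
  also have "qform V u ?y = 1 * qform V u u + (- t) * qform V w u" by (subst qform_commute) (rule qform_lin[OF V u w u])
  also have "qform V w ?y = 1 * qform V u w + (- t) * qform V w w" by (subst qform_commute) (rule qform_lin[OF V u w w])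
  finally show ?thesis by (simp add: qform_commute[of V u w] algebra_simps power2_eq_square)
qed

lemma L2_inner_product_combination:
  assumes u: "u \<in> L2" and w: "w \<in> L2"
  shows "L2_inner_product (\<lambda>x. 1 * u x + (- t) * w x) (\<lambda>x. 1 * u x + (- t) * w x)
    = L2_inner_product u u - 2 * t * L2_inner_product w u + t^2 * L2_inner_product w w"
proof -
  let ?y = "\<lambda>x. 1 * u x + (- t) * w x"
  have y: "?y \<in> L2" using L2_lin[OF u w, of 1 "-t"] by simp
  have "L2_inner_product ?y ?y = 1 * L2_inner_product u ?y + (- t) * L2_inner_product w ?y" by (rule L2_inner_product_lin[OF u w y])
  also have "L2_inner_product u ?y = 1 * L2_inner_product u u + (- t) * L2_inner_product w u"
    by (subst L2_inner_product_commute) (rule L2_inner_product_lin[OF u w u])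
  also have "L2_inner_product w ?y = 1 * L2_inner_product u w + (- t) * L2_inner_product w w"
    by (subst L2_inner_product_commute) (rule L2_inner_product_lin[OF u w w])
  finally show ?thesis by (simp add: L2_inner_product_commute[of u w] algebra_simps power2_eq_square)
qed

text \<open>If the bottom \<open>m\<close> of the form were in the resolvent set, solve \<open>(A - m) w = u\<close> for almost
  minimal normalised \<open>u\<close>; the nonnegative form of \<open>A - m\<close> is then negative at \<open>u - t w\<close>.\<close>

lemma form_infimum_in_spectrum:
  assumes V: "V \<in> Linf"
    and ge: "\<And>u. u \<in> form_dom ==> m * L2_inner_product u u \<le> qform V u u"
    and inf: "\<And>e. e > 0 ==> \<exists>u\<in>form_dom. L2_inner_product u u = 1 \<and> qform V u u < m + e"
  shows "m \<in> op_spectrum V"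
proof (rule ccontr)
  assume "m \<notin> op_spectrum V"
  then have "m \<in> resolvent_set V" by (simp add: op_spectrum_def)
  then obtain C where solve: "\<And>h. h \<in> L2 ==> \<exists>(u, w)\<in>op_graph V. AE x in lebesgue. w x - m * u x = h x"
    and C: "\<And>u w. (u, w) \<in> op_graph V ==> L2_norm u \<le> C * L2_norm (\<lambda>x. w x - m * u x)" unfolding resolvent_set_def by blast
  \<comment> \<open>A positive bound for the resolvent. The slack 1/c in the choice of
    \<open>u\<close> and the step t = 1/c are matched so that 1/c - 2 t + t^2 c = 0.\<close>
  define c where "c = abs C + 1"
  have c: "c > 0" by (simp add: c_def)
  obtain u where u: "u \<in> form_dom" "L2_inner_product u u = 1" "qform V u u < m + 1 / c" using inf[of "1 / c"] c by auto
  obtain w z where wz: "(w, z) \<in> op_graph V" "AE x in lebesgue. z x - m * w x = u x" using solve[OF form_domD(1)[OF u(1)]] by blast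
  have w: "w \<in> form_dom" "z \<in> L2" "\<And>v. v \<in> form_dom ==> qform V w v = (LINT x|lebesgue. z x * v x)"
    using wz(1) by (auto simp: op_graph_def)
  note uL = form_domD(1)[OF u(1)] and wL = form_domD(1)[OF w(1)]
  have [measurable]: "u \<in> borel_measurable lebesgue" "w \<in> borel_measurable lebesgue" "z \<in> borel_measurable lebesgue"
    using uL wL w(2) L2_D by auto
  have eq: "qform V w v - m * L2_inner_product w v = L2_inner_product u v" if v: "v \<in> form_dom" for v
  proof -
    note vL = form_domD(1)[OF v]
    have [measurable]: "v \<in> borel_measurable lebesgue" using vL L2_D by auto
    have "qform V w v - m * L2_inner_product w v = (LINT x|lebesgue. z x * v x - m * (w x * v x))"
      unfolding w(3)[OF v] L2_inner_product_def using L2_mult(1)[OF w(2) vL] L2_mult(1)[OF wL vL] by simp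
    also have "\<dots> = L2_inner_product u v" unfolding L2_inner_product_def
      by (rule integral_cong_AE) (measurable, use wz(2) in eventually_elim, simp add: left_diff_distrib[symmetric] mult.assoc[symmetric])
    finally show ?thesis .
  qed
  have nu: "L2_norm u = 1" using u(2) by (simp add: L2_norm_def L2_inner_product_def power2_eq_square)
  have "L2_norm (\<lambda>x. z x - m * w x) = L2_norm u" unfolding L2_norm_def
    by (rule arg_cong[where f=sqrt], rule integral_cong_AE) (measurable, use wz(2) in eventually_elim, simp)
  then have nw: "L2_norm w \<le> c" using C[OF wz(1)] nu by (simp add: c_def)
  have "L2_inner_product u w \<le> L2_norm u * L2_norm w"
    using L2_mult(2)[OF uL wL] unfolding L2_inner_product_def L2_norm_def by (rule order_trans[OF abs_ge_self])
  then have uw: "L2_inner_product u w \<le> c" using nu nw by simp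
  define t where "t = 1 / c"
  let ?y = "\<lambda>x. 1 * u x + (- t) * w x"
  have y: "?y \<in> form_dom" by (rule form_dom_lin(1)[OF u(1) w(1)])
  have "0 \<le> qform V ?y ?y - m * L2_inner_product ?y ?y" using ge[OF y] by simp
  also have "\<dots> = (qform V u u - m * L2_inner_product u u) - 2 * t * (qform V w u - m * L2_inner_product w u)
      + t^2 * (qform V w w - m * L2_inner_product w w)"
    unfolding qform_combination[OF V u(1) w(1)] L2_inner_product_combination[OF uL wL] by (simp add: algebra_simps)
  also have "\<dots> = (qform V u u - m) - 2 * t + t^2 * L2_inner_product u w" unfolding eq[OF u(1)] eq[OF w(1)] u(2) by simp
  also have "\<dots> < 1 / c - 2 * t + t^2 * c" using u(3) uw by (intro add_less_le_mono mult_left_mono) auto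
  also have "\<dots> = 0" using c by (simp add: t_def power2_eq_square)
  finally show False by simp
qed

text \<open>The infimum of the form over L2-normalised members of its domain is finite, as V is
  bounded, and lies in the spectrum, so the spectral hypothesis makes it positive.\<close>

lemma qform_positive:
  assumes V: "V \<in> Linf" and spec: "(INF l\<in>op_spectrum V. ereal l) > 0"
  obtains m where "m > 0" "\<And>u. u \<in> form_dom ==> m * L2_inner_product u u \<le> qform V u u"
proof -
  obtain C where C: "C \<ge> 0" "V \<in> borel_measurable lebesgue" "AE x in lebesgue. abs (V x) \<le> C"
    by (rule Linf_bound[OF V]) (rule that; assumption)
  have lower: "- C * L2_inner_product u u \<le> qform V u u" if u: "u \<in> form_dom" for u
  proof -
    have i: "integrable lebesgue (\<lambda>x. - C * (u x * u x))" using L2_mult(1)[OF form_domD(1)[OF u] form_domD(1)[OF u]] by simp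
    have "(LINT x|lebesgue. - C * (u x * u x)) \<le> qform V u u" unfolding qform_def
    proof (rule integral_mono_AE[OF i qform_integrable(1)[OF V u u]])
      show "AE x in lebesgue. - C * (u x * u x) \<le> wgrad u x \<bullet> wgrad u x + u x * u x / (rad x)^2 + V x * u x * u x" using C(3)
      proof eventually_elim
        case (elim x)
        have "- C * (u x * u x) \<le> V x * (u x * u x)" using elim by (intro mult_right_mono) auto
        moreover have "0 \<le> wgrad u x \<bullet> wgrad u x" "0 \<le> u x * u x / (rad x)^2" by simp_all
        moreover have "V x * u x * u x = V x * (u x * u x)" by (rule mult.assoc)
        ultimately show ?case by linarith
      qed
    qed
    then show ?thesis by (simp add: L2_inner_product_def)
  qed
  have n0: "0 \<le> L2_inner_product u u" for u unfolding L2_inner_product_def by (rule integral_nonneg_AE) simp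
  define S where "S = {qform V u u | u. u \<in> form_dom \<and> L2_inner_product u u = 1}"
  have zero: "qform V u u \<ge> 0" if u: "u \<in> form_dom" "L2_inner_product u u = 0" for u using lower[OF u(1)] u(2) by simp
  have normalise: "\<exists>s\<in>S. qform V u u = s * L2_inner_product u u" if u: "u \<in> form_dom" "L2_inner_product u u > 0" for u
  proof -
    define a where "a = inverse (sqrt (L2_inner_product u u))"
    have a: "a * a * L2_inner_product u u = 1" using u(2) by (simp add: a_def divide_simps flip: real_sqrt_mult)
    let ?v = "\<lambda>x. a * u x"
    have v: "?v \<in> form_dom" using form_dom_lin(1)[OF u(1) u(1), of a 0] by simp
    have "L2_inner_product ?v ?v = (LINT x|lebesgue. (a * a) * (u x * u x))" by (simp add: L2_inner_product_def ac_simps)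
    also have "\<dots> = 1" using a by (simp add: L2_inner_product_def)
    finally have v1: "L2_inner_product ?v ?v = 1" .
    have "qform V ?v ?v = a * (a * qform V u u)" unfolding qform_scale[OF V u(1) v] qform_commute[of V u ?v] qform_scale[OF V u(1) u(1)] ..
    then have "qform V ?v ?v * L2_inner_product u u = (a * a * L2_inner_product u u) * qform V u u" by (simp only: mult_ac)
    then have "qform V u u = qform V ?v ?v * L2_inner_product u u" unfolding a by simp
    then show ?thesis using v v1 unfolding S_def by blast
  qed
  show ?thesis
  \<comment> \<open>Without normalised functions, all members of the form domain have zero L2 norm
    and any positive constant serves.\<close>
  proof (cases "S = {}")
    case True
    have "1 * L2_inner_product u u \<le> qform V u u" if "u \<in> form_dom" for u
      using normalise[OF that] n0[of u] zero[OF that] True by (cases "L2_inner_product u u = 0") auto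
    then show ?thesis using that[of 1] by simp
  next
    case False
    define m where "m = Inf S"
    have bb: "bdd_below S" by (rule bdd_belowI[of _ "-C"]) (use lower in \<open>fastforce simp: S_def\<close>)
    have ge: "m * L2_inner_product u u \<le> qform V u u" if u: "u \<in> form_dom" for u
    proof (cases "L2_inner_product u u = 0")
      case True
      then show ?thesis using zero[OF u] by simp
    next
      case False
      then obtain s where s: "s \<in> S" "qform V u u = s * L2_inner_product u u" using normalise[OF u] n0[of u] by fastforce
      have "m \<le> s" unfolding m_def by (rule cInf_lower[OF s(1) bb])
      then show ?thesis unfolding s(2) using n0[of u] by (rule mult_right_mono)
    qed
    have "m \<in> op_spectrum V"
    proof (rule form_infimum_in_spectrum[OF V ge])
      fix e :: real assume "e > 0"
      then have "Inf S < m + e" by (simp add: m_def)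
      then obtain s where "s \<in> S" "s < m + e" using cInf_lessD[OF False] by blast
      then show "\<exists>u\<in>form_dom. L2_inner_product u u = 1 \<and> qform V u u < m + e" by (auto simp: S_def)
    qed
    then have "(INF l\<in>op_spectrum V. ereal l) \<le> ereal m" by (rule INF_lower)
    with spec have "m > 0" by (metis ereal_less(2) less_le_trans)
    then show ?thesis using that ge by blast
  qed
qed

section \<open>The form on classes: boundedness and coercivity\<close>

definition xform :: "(real^3 => real) => xfun => xfun => real" where
  "xform V U W = qform V (rep U) (rep W)"

lemma xform_eq:
  "V \<in> Linf ==> xform V U W = inner U W + (LINT x|lebesgue. (V x - 1) * (rep U x * rep W x))"
  unfolding xform_def inner_xfun_def by (rule qform_integrable(2)[OF _ rep_form_dom rep_form_dom])

lemma xform_commute: "xform V U W = xform V W U" unfolding xform_def by (rule qform_commute)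

lemma xform_bounded_bilinear:
  assumes V: "V \<in> Linf" shows "bounded_bilinear (xform V)"
proof -
  obtain C where C: "C \<ge> 0" "V \<in> borel_measurable lebesgue" "AE x in lebesgue. abs (V x) \<le> C"
    by (rule Linf_bound[OF V]) (rule that; assumption)
  have lin: "xform V (a *\<^sub>R U + b *\<^sub>R U') W = a * xform V U W + b * xform V U' W" for a b U U' W
  proof -
    have "xform V (a *\<^sub>R U + b *\<^sub>R U') W = qform V (\<lambda>x. a * rep U x + b * rep U' x) (rep W)" unfolding xform_def
    proof (rule qform_cong_AE[OF V rep_form_dom form_dom_lin(1)[OF rep_form_dom rep_form_dom] _ rep_form_dom rep_form_dom])
      show "AE x in lebesgue. rep (a *\<^sub>R U + b *\<^sub>R U') x = a * rep U x + b * rep U' x"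
        using rep_plus_AE[of "a *\<^sub>R U" "b *\<^sub>R U'"] rep_scaleR_AE[of a U] rep_scaleR_AE[of b U'] by eventually_elim simp
    qed simp
    then show ?thesis unfolding xform_def qform_lin[OF V rep_form_dom rep_form_dom rep_form_dom] .
  qed
  have add: "xform V (U + U') W = xform V U W + xform V U' W" for U U' W using lin[of 1 U 1 U' W] by simp
  have scale: "xform V (a *\<^sub>R U) W = a *\<^sub>R xform V U W" for a U W using lin[of a U 0 U W] by simp
  have bound: "norm (xform V U W) \<le> norm U * norm W * (C + 2)" for U W
  proof -
    let ?u = "rep U" and ?w = "rep W"
    have uw: "integrable lebesgue (\<lambda>x. ?u x * ?w x)" by (rule L2_mult(1)[OF rep_L2(1) rep_L2(1)])
    have i: "integrable lebesgue (\<lambda>x. (V x - 1) * (?u x * ?w x))" using integrable_Linf_mult[OF V uw] uw by (simp add: left_diff_distrib)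
    have "\<bar>LINT x|lebesgue. (V x - 1) * (?u x * ?w x)\<bar> \<le> (LINT x|lebesgue. abs ((V x - 1) * (?u x * ?w x)))" by (rule integral_abs_bound)
    also have "\<dots> \<le> (LINT x|lebesgue. (C + 1) * (abs (?u x) * abs (?w x)))"
    proof (rule integral_mono_AE[OF integrable_abs[OF i]])
      show "integrable lebesgue (\<lambda>x. (C + 1) * (abs (?u x) * abs (?w x)))" using integrable_abs[OF uw] by (simp add: abs_mult)
      show "AE x in lebesgue. abs ((V x - 1) * (?u x * ?w x)) \<le> (C + 1) * (abs (?u x) * abs (?w x))" using C(3)
      proof eventually_elim
        case (elim x)
        have "abs (V x - 1) * (abs (?u x) * abs (?w x)) \<le> (C + 1) * (abs (?u x) * abs (?w x))" using elim by (intro mult_right_mono) auto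
        then show ?case by (simp add: abs_mult)
      qed
    qed
    also have "\<dots> = (C + 1) * (LINT x|lebesgue. abs (?u x) * abs (?w x))" by simp
    also have "\<dots> \<le> (C + 1) * (sqrt (LINT x|lebesgue. abs (?u x)^2) * sqrt (LINT x|lebesgue. abs (?w x)^2))"
      using C(1) L2_mult(2)[OF L2_abs[OF rep_L2(1)[of U]] L2_abs[OF rep_L2(1)[of W]]]
      by (intro mult_left_mono) (auto intro: order_trans[OF abs_ge_self])
    also have "\<dots> \<le> (C + 1) * (norm U * norm W)"
    proof -
      have "sqrt (LINT x|lebesgue. abs (rep U x)^2) \<le> norm U" for U using integral_rep_sq_le(1)[of U] by (intro real_le_lsqrt) auto
      then show ?thesis using C(1) by (intro mult_left_mono mult_mono) (auto intro!: integral_nonneg_AE)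
    qed
    finally have "\<bar>LINT x|lebesgue. (V x - 1) * (?u x * ?w x)\<bar> \<le> (C + 1) * (norm U * norm W)" .
    moreover have "abs (inner U W) \<le> norm U * norm W" by (rule Cauchy_Schwarz_ineq2)
    ultimately show ?thesis unfolding xform_eq[OF V] by (simp add: algebra_simps)
  qed
  show ?thesis
  proof
    show "xform V U (W + W') = xform V U W + xform V U W'" for U W W' by (simp add: xform_commute[of V U] add)
    show "xform V U (a *\<^sub>R W) = a *\<^sub>R xform V U W" for a U W by (simp add: xform_commute[of V U] scale)
    show "\<exists>K. \<forall>U W. norm (xform V U W) \<le> norm U * norm W * K" using bound by blast
  qed (fact add scale)+
qed

lemma xform_coercive:
  assumes V: "V \<in> Linf" and spec: "(INF l\<in>op_spectrum V. ereal l) > 0"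
  obtains c where "c > 0" "\<And>U. c * (norm U)^2 \<le> xform V U U"
proof -
  obtain C where C: "C \<ge> 0" "V \<in> borel_measurable lebesgue" "AE x in lebesgue. abs (V x) \<le> C"
    by (rule Linf_bound[OF V]) (rule that; assumption)
  obtain m where m: "m > 0" "\<And>u. u \<in> form_dom ==> m * L2_inner_product u u \<le> qform V u u"
    by (rule qform_positive[OF V spec]) (rule that; assumption)
  \<comment> \<open>Two lower bounds of the form, the squared norm minus (C + 1) times the squared
    L2 norm, and m times the squared L2 norm, are combined with weights s and 1 - s so that the L2
    terms cancel.\<close>
  define s where "s = m / (m + C + 1)"
  have mC: "0 < m + C + 1" using m(1) C(1) by linarith
  have s: "0 < s" unfolding s_def using m(1) mC by (rule divide_pos_pos)
  have s1: "s < 1" unfolding s_def using mC C(1) by (subst divide_less_eq_1_pos) linarith+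
  have "s * (m + C + 1) = m" unfolding s_def using mC by simp
  then have sm: "(1 - s) * m = s * (C + 1)" by (simp add: algebra_simps)
  have "s * (norm U)^2 \<le> xform V U U" for U
  proof -
    let ?u = "rep U"
    let ?n = "L2_inner_product ?u ?u"
    have uu: "integrable lebesgue (\<lambda>x. ?u x * ?u x)" by (rule L2_mult(1)[OF rep_L2(1) rep_L2(1)])
    have "- (C + 1) * ?n = (LINT x|lebesgue. - (C + 1) * (?u x * ?u x))" by (simp add: L2_inner_product_def)
    also have "\<dots> \<le> (LINT x|lebesgue. (V x - 1) * (?u x * ?u x))"
    proof (rule integral_mono_AE)
      show "integrable lebesgue (\<lambda>x. (V x - 1) * (?u x * ?u x))" using integrable_Linf_mult[OF V uu] uu by (simp add: left_diff_distrib)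
      show "AE x in lebesgue. - (C + 1) * (?u x * ?u x) \<le> (V x - 1) * (?u x * ?u x)" using C(3) by eventually_elim (intro mult_right_mono, auto)
    qed (use uu in simp)
    finally have low: "- (C + 1) * ?n \<le> (LINT x|lebesgue. (V x - 1) * (?u x * ?u x))" .
    have "xform V U U \<ge> (norm U)^2 - (C + 1) * ?n" unfolding xform_eq[OF V] power2_norm_eq_inner using low by linarith
    then have "s * xform V U U \<ge> s * ((norm U)^2 - (C + 1) * ?n)" using less_imp_le[OF s] by (rule mult_left_mono)
    moreover have "(1 - s) * xform V U U \<ge> (1 - s) * (m * ?n)"
      unfolding xform_def using s1 by (intro mult_left_mono[OF m(2)[OF rep_form_dom]]) linarith
    ultimately have "s * (norm U)^2 - (s * (C + 1)) * ?n + ((1 - s) * m) * ?n \<le> xform V U U" by (simp add: algebra_simps)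
    moreover have "(s * (C + 1)) * ?n = ((1 - s) * m) * ?n" by (simp only: sm)
    ultimately show ?thesis by linarith
  qed
  then show ?thesis by (rule that[OF s])
qed

section \<open>Symmetries\<close>

text \<open>Invariance of the Borel measure passes to its completion, together with measurability
  for Lebesgue sets.\<close>

lemma lebesgue_distr:
  fixes f :: "'a::euclidean_space => 'a"
  assumes f[measurable]: "f \<in> borel_measurable borel" and d: "distr lborel borel f = lborel"
  shows "f \<in> lebesgue \<rightarrow>\<^sub>M lebesgue" "distr lebesgue lebesgue f = lebesgue"
proof -
  have f': "f \<in> lebesgue \<rightarrow>\<^sub>M lborel" using f by (simp add: measurable_completion)
  have eq: "distr lebesgue lborel f = lborel" using d f by (simp add: distr_completion cong: distr_cong)
  show "f \<in> lebesgue \<rightarrow>\<^sub>M lebesgue" by (rule completion.measurable_completion2[OF f']) (simp add: eq)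
  show "distr lebesgue lebesgue f = lebesgue" using completion.completion_distr_eq[OF f'] by (simp add: eq)
qed

locale measure_symmetry =
  fixes f :: "real^3 => real^3"
  assumes borel: "f \<in> borel_measurable borel" and distr: "distr lborel borel f = lborel"
begin

lemma measurable[measurable]: "f \<in> lebesgue \<rightarrow>\<^sub>M lebesgue" by (rule lebesgue_distr[OF borel distr])

lemma integral_comp: "g \<in> borel_measurable lebesgue ==> (LINT x|lebesgue. g (f x)) = (LINT x|lebesgue. (g x :: real))"
  using integral_distr[OF measurable, of g] lebesgue_distr(2)[OF borel distr] by simp

lemma integrable_comp: "integrable lebesgue (g :: real^3 => real) ==> integrable lebesgue (\<lambda>x. g (f x))"
  using integrable_distr[OF measurable, of g] lebesgue_distr(2)[OF borel distr] by simp

lemma AE_comp: "AE x in lebesgue. P x ==> AE x in lebesgue. P (f x)"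
  using AE_distrD[OF measurable, of P] unfolding lebesgue_distr(2)[OF borel distr] .

lemma L2_comp: "u \<in> L2 ==> (\<lambda>x. u (f x)) \<in> L2"
  using integrable_comp[of "\<lambda>x. (norm (u x))^2"] measurable_compose[OF measurable, of u] by (auto simp: L2_def)

end

lemma measure_symmetry_shift: "measure_symmetry (\<lambda>x. x + a)"
proof
  have "distr lborel borel ((+) a) = (lborel :: (real^3) measure)" by (rule lborel_distr_plus)
  moreover have "(+) a = (\<lambda>x. x + a)" by (auto simp: add.commute)
  ultimately show "distr lborel borel (\<lambda>x. x + a) = lborel" by simp
qed measurable

lemma pderiv_at_shift:
  assumes "\<phi> differentiable (at (x + a))" shows "pderiv_at i (\<lambda>x. \<phi> (x + a)) x = pderiv_at i \<phi> (x + a)"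
    "(\<lambda>x. \<phi> (x + a)) differentiable (at x)"
proof -
  have d: "(\<phi> has_derivative frechet_derivative \<phi> (at (x + a))) (at (x + a))" using assms frechet_derivative_works by blast
  have "((\<lambda>x. x + a) has_derivative (\<lambda>h. h)) (at x)" by (auto intro!: derivative_eq_intros)
  from has_derivative_compose[OF this d]
  have c: "((\<lambda>x. \<phi> (x + a)) has_derivative frechet_derivative \<phi> (at (x + a))) (at x)" by simp
  from frechet_derivative_at[OF c] show "pderiv_at i (\<lambda>x. \<phi> (x + a)) x = pderiv_at i \<phi> (x + a)" by (simp add: pderiv_at_def)
  from c show "(\<lambda>x. \<phi> (x + a)) differentiable (at x)" by (rule differentiableI)
qed

lemma Ck_shift: "Ck k \<phi> ==> Ck k (\<lambda>x. \<phi> (x + a))"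
proof (induction k arbitrary: \<phi>)
  case 0
  then show ?case by (auto intro!: continuous_on_compose2[of UNIV \<phi>] continuous_intros)
next
  case (Suc k)
  then have "pderiv_at i (\<lambda>x. \<phi> (x + a)) = (\<lambda>x. pderiv_at i \<phi> (x + a))" for i by (intro ext pderiv_at_shift) simp
  then show ?case using Suc pderiv_at_shift(2) by simp
qed

lemma test_fun_shift: "test_fun \<phi> ==> test_fun (\<lambda>x. \<phi> (x + a))" unfolding test_fun_def
proof (elim conjE exE, intro conjI allI)
  fix K assume K: "compact K" "\<forall>x. x \<notin> K \<longrightarrow> \<phi> x = 0"
  show "\<exists>K. compact K \<and> (\<forall>x. x \<notin> K \<longrightarrow> \<phi> (x + a) = 0)"
  proof (intro exI[of _ "(\<lambda>x. x - a) ` K"] conjI allI impI)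
    show "compact ((\<lambda>x. x - a) ` K)" using compact_translation[OF K(1), of "- a"] by simp
    fix x assume "x \<notin> (\<lambda>x. x - a) ` K"
    then have "x + a \<notin> K" by (metis add_diff_cancel_right' imageI)
    then show "\<phi> (x + a) = 0" using K(2) by blast
  qed
qed (simp add: Ck_shift)

lemma has_weak_grad_shift:
  assumes u: "u \<in> L2" and D: "D \<in> L2" and w: "has_weak_grad u D"
  shows "has_weak_grad (\<lambda>x. u (x + a)) (\<lambda>x. D (x + a))"
proof -
  interpret measure_symmetry "\<lambda>x. x + a" by (rule measure_symmetry_shift)
  show ?thesis unfolding has_weak_grad_def
  proof (intro conjI allI impI)
    show "loc_integrable (\<lambda>x. u (x + a))" "loc_integrable (\<lambda>x. D (x + a))" by (intro L2_loc_integrable L2_comp u D)+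
    fix \<phi> i assume \<phi>: "test_fun \<phi>"
    let ?\<psi> = "\<lambda>x. \<phi> (x + - a)"
    have \<psi>: "test_fun ?\<psi>" by (rule test_fun_shift[OF \<phi>])
    have "Ck (Suc 0) \<phi>" using \<phi> by (simp add: test_fun_def del: Ck.simps)
    then have pd: "pderiv_at i ?\<psi> x = pderiv_at i \<phi> (x + - a)" for x by (intro pderiv_at_shift) simp
    obtain K where K: "compact K" "continuous_on UNIV ?\<psi>" "\<And>x. x \<notin> K ==> ?\<psi> x = 0"
      "\<And>i. continuous_on UNIV (pderiv_at i ?\<psi>)" "\<And>i x. x \<notin> K ==> pderiv_at i ?\<psi> x = 0"
      by (rule test_fun_cases[OF \<psi>]) (rule that; assumption)
    have m: "(\<lambda>x. u x * pderiv_at i ?\<psi> x) \<in> borel_measurable lebesgue" "(\<lambda>x. D x $ i * ?\<psi> x) \<in> borel_measurable lebesgue"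
      by (intro borel_measurable_times L2_D(1)[OF u] L2_D(1)[OF L2_component[OF D]] continuous_lebesgue_measurable K)+
    have "(LINT x|lebesgue. u (x + a) * pderiv_at i \<phi> x) = (LINT x|lebesgue. u (x + a) * pderiv_at i ?\<psi> (x + a))" unfolding pd by simp
    also have "\<dots> = (LINT x|lebesgue. u x * pderiv_at i ?\<psi> x)" by (rule integral_comp[OF m(1)])
    also have "\<dots> = - (LINT x|lebesgue. D x $ i * ?\<psi> x)" by (rule has_weak_gradD[OF w \<psi>])
    also have "(LINT x|lebesgue. D x $ i * ?\<psi> x) = (LINT x|lebesgue. D (x + a) $ i * ?\<psi> (x + a))" by (rule integral_comp[OF m(2), symmetric])
    finally show "(LINT x|lebesgue. u (x + a) * pderiv_at i \<phi> x) = - (LINT x|lebesgue. D (x + a) $ i * \<phi> x)" by simp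
  qed
qed

abbreviation up :: "int => real^3 => real^3" where
  "up k x \<equiv> x + of_int k *\<^sub>R e3"

lemma rad_up: "rad (up k x) = rad x" by (simp add: rad_def e3_def axis_def)

lemma up_3: "up k x $ 3 = x $ 3 + of_int k" by (simp add: e3_def)

interpretation up: measure_symmetry "up k" for k by (rule measure_symmetry_shift)

lemma form_dom_up:
  assumes u: "u \<in> form_dom"
  shows "(\<lambda>x. u (up k x)) \<in> form_dom" "AE x in lebesgue. jet (\<lambda>x. u (up k x)) x = jet u (up k x)"
proof -
  note f = form_domD[OF u]
  have w: "has_weak_grad (\<lambda>x. u (up k x)) (\<lambda>x. wgrad u (up k x))" by (rule has_weak_grad_shift[OF f(1,2,3)])
  show "(\<lambda>x. u (up k x)) \<in> form_dom"
    by (rule form_domI[OF up.L2_comp[OF f(1)] up.L2_comp[OF f(2)] w]) (use up.L2_comp[OF f(4), of k] in \<open>simp add: rad_up\<close>)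
  show "AE x in lebesgue. jet (\<lambda>x. u (up k x)) x = jet u (up k x)" using wgrad_eq_AE[OF w] by eventually_elim (simp add: jet_def rad_up)
qed

lemma X_space_up: "u \<in> X_space ==> (\<lambda>x. u (up k x)) \<in> X_space"
proof -
  assume u: "u \<in> X_space"
  then obtain w where "AE x in lebesgue. u x = w (rad x) (x $ 3)" by (auto simp: X_space_iff cyl_sym_def)
  from up.AE_comp[OF this, of k]
  have "AE x in lebesgue. u (up k x) = w (rad (up k x)) (up k x $ 3)" .
  then have "AE x in lebesgue. u (up k x) = w (rad x) (x $ 3 + of_int k)" unfolding rad_up up_3 .
  then have "cyl_sym (\<lambda>x. u (up k x))" unfolding cyl_sym_def by (rule exI[where x="\<lambda>r z. w r (z + of_int k)"])
  then show ?thesis using u form_dom_up(1) by (simp add: X_space_iff)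
qed

definition xshift :: "int => xfun => xfun" where
  "xshift k U = cls (\<lambda>x. rep U (up k x))"

lemma rep_xshift_AE: "AE x in lebesgue. rep (xshift k U) x = rep U (up k x)" unfolding xshift_def by (rule rep_abs[OF X_space_up[OF rep_X]])

lemma jet_xshift_AE: "AE x in lebesgue. jet (rep (xshift k U)) x = jet (rep U) (up k x)"
  using form_dom_AE[OF rep_form_dom form_dom_up(1)[OF rep_form_dom] rep_xshift_AE[of k U]] form_dom_up(2)[OF rep_form_dom[of U], of k]
  by eventually_elim simp

lemma xshift_inverse: "xshift k (xshift (- k) U) = U"
proof (rule xfun_eqI)
  show "AE x in lebesgue. rep (xshift k (xshift (- k) U)) x = rep U x"
    using rep_xshift_AE[of k "xshift (- k) U"] up.AE_comp[OF rep_xshift_AE[of "- k" U], of k] by eventually_elim (simp add: scaleR_minus_left)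
qed

lemma norm_xshift: "norm (xshift k U) = norm U"
proof -
  have "(norm (xshift k U))^2 = (LINT x|lebesgue. (norm (jet (rep U) (up k x)))^2)" unfolding norm_xfun_sq
    by (rule integral_cong_AE) (measurable, use jet_xshift_AE[of k U] in eventually_elim, simp)
  also have "\<dots> = (norm U)^2" unfolding norm_xfun_sq by (rule up.integral_comp) measurable
  finally show ?thesis by simp
qed

text \<open>The codomain is arbitrary so that the lemma also covers \<open>h\<close>, whose values
  are functions of the second variable. Negative shifts follow by translating back.\<close>

lemma periodic_up:
  fixes F :: "real^3 => 'z"
  assumes "AE x in lebesgue. F (x + e3) = F x"
  shows "AE x in lebesgue. F (up k x) = F x"
proof -
  have pos: "AE x in lebesgue. F (up (int n) x) = F x" for n
  proof (induction n)
    case (Suc n)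
    have "AE x in lebesgue. F (up (int n) x + e3) = F (up (int n) x)" by (rule up.AE_comp[OF assms])
    with Suc show ?case by eventually_elim (simp add: algebra_simps)
  qed simp
  show ?thesis
  proof (cases "k \<ge> 0")
    case True
    then show ?thesis using pos[of "nat k"] by simp
  next
    case False
    then have e: "up (int (nat (- k))) (up k x) = x" for x by (simp add: scaleR_minus_left)
    have "AE x in lebesgue. F (up (int (nat (- k))) (up k x)) = F (up k x)" by (intro up.AE_comp pos)
    then show ?thesis unfolding e by eventually_elim (rule sym)
  qed
qed

lemma xform_xshift:
  assumes V: "V \<in> Linf" and per: "AE x in lebesgue. V (x + e3) = V x"
  shows "xform V (xshift k U) (xshift k W) = xform V U W"
proof -
  let ?I = "\<lambda>U W x. wgrad (rep U) x \<bullet> wgrad (rep W) x + rep U x * rep W x / (rad x)^2 + V x * rep U x * rep W x"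
  have i: "integrable lebesgue (?I U W)" for U W by (rule qform_integrable(1)[OF V rep_form_dom rep_form_dom])
  have "xform V (xshift k U) (xshift k W) = (LINT x|lebesgue. ?I U W (up k x))" unfolding xform_def qform_def
  proof (rule integral_cong_AE)
    show "AE x in lebesgue. ?I (xshift k U) (xshift k W) x = ?I U W (up k x)"
      using jet_xshift_AE[of k U] jet_xshift_AE[of k W] periodic_up[OF per, of k] by eventually_elim (simp add: jet_def rad_up)
  qed (rule borel_measurable_integrable[OF i] borel_measurable_integrable[OF up.integrable_comp[OF i]])+
  also have "\<dots> = xform V U W" unfolding xform_def qform_def by (rule up.integral_comp[OF borel_measurable_integrable[OF i]])
  finally show ?thesis .
qed

lemma (in superposition) \<K>'_xshift:
  assumes per: "AE x in lebesgue. \<forall>t. h (x + e3) t = h x t"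
  shows "\<K>' (xshift k U) (xshift k W) = \<K>' U W"
proof -
  have i: "integrable lebesgue (\<lambda>x. h x (rep U x) * rep W x)" for U W by (rule integrable_h_rep)
  have p: "AE x in lebesgue. h (x + e3) = h x" using per by eventually_elim auto
  have "\<K>' (xshift k U) (xshift k W) = (LINT x|lebesgue. h (up k x) (rep U (up k x)) * rep W (up k x))" unfolding \<K>'_def
  proof (rule integral_cong_AE)
    show "AE x in lebesgue. h x (rep (xshift k U) x) * rep (xshift k W) x = h (up k x) (rep U (up k x)) * rep W (up k x)"
      using rep_xshift_AE[of k U] rep_xshift_AE[of k W] periodic_up[OF p, of k] by eventually_elim simp
  qed (rule borel_measurable_integrable[OF i] borel_measurable_integrable[OF up.integrable_comp[OF i]])+
  also have "\<dots> = \<K>' U W" unfolding \<K>'_def by (rule up.integral_comp[OF borel_measurable_integrable[OF i]])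
  finally show ?thesis .
qed

text \<open>Difference quotients integrate to zero by translation invariance, and compact support
  with a bounded derivative dominates them by a multiple of the indicator of a slightly larger
  ball.\<close>

lemma integral_partial_derivative:
  fixes \<psi> :: "real^3 => real"
  assumes d: "\<And>x. (\<psi> has_derivative L x) (at x)" and g: "continuous_on UNIV (\<lambda>x. L x (axis i 1))"
    and K: "compact K" "\<And>x. x \<notin> K ==> \<psi> x = 0"
  shows "(LINT x|lebesgue. L x (axis i 1)) = 0"
proof -
  let ?g = "\<lambda>x. L x (axis i 1)" and ?e = "axis i 1 :: real^3"
  have "continuous_on UNIV \<psi>" using d by (intro continuous_at_imp_continuous_on ballI has_derivative_continuous) auto
  then have \<psi>L: "\<psi> \<in> L2" and \<psi>m[measurable]: "\<psi> \<in> borel_measurable lebesgue"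
    using compact_support_L2 K continuous_lebesgue_measurable by blast+
  have gm[measurable]: "?g \<in> borel_measurable lebesgue" by (rule continuous_lebesgue_measurable[OF g])
  have g0: "?g x = 0" if "x \<notin> K" for x
  proof -
    have "pderiv_at i \<psi> x = 0" by (rule pderiv_at_outside[OF compact_imp_closed[OF K(1)] K(2) that])
    then show ?thesis using frechet_derivative_at[OF d[of x]] by (simp add: pderiv_at_def)
  qed
  obtain B where B: "B > 0" "\<And>x. abs (?g x) \<le> B * indicator K x"
    by (rule compact_support_bounded[OF g K(1) g0]) (assumption, (rule that; assumption))
  have Bg: "abs (?g x) \<le> B" for x using B(2)[of x] B(1) by (cases "x \<in> K") auto
  obtain R where R: "K \<subseteq> cball 0 R" using bounded_subset_ballD[OF compact_imp_bounded[OF K(1)], of 0] ball_subset_cball by (metis subset_trans)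
  define s where "s n = inverse (real (Suc n))" for n
  have s: "0 < s n" "s n \<le> 1" for n by (auto simp: s_def field_simps)
  define q where "q n x = (\<psi> (x + s n *\<^sub>R ?e) - \<psi> x) / s n" for n x
  have line: "((\<lambda>t. \<psi> (x + t *\<^sub>R ?e)) has_real_derivative ?g (x + t *\<^sub>R ?e)) (at t)" for x t
  proof -
    have "((\<lambda>t. x + t *\<^sub>R ?e) has_derivative (\<lambda>h. h *\<^sub>R ?e)) (at t)" by (auto intro!: derivative_eq_intros)
    from has_derivative_compose[OF this d]
    have "((\<lambda>t. \<psi> (x + t *\<^sub>R ?e)) has_derivative (\<lambda>h. L (x + t *\<^sub>R ?e) (h *\<^sub>R ?e))) (at t)" .
    moreover have "L y (h *\<^sub>R ?e) = ?g y * h" for y h using linear_cmul[OF has_derivative_linear[OF d], of y h ?e] by simp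
    ultimately show ?thesis by (simp add: has_field_derivative_def)
  qed
  have qb: "abs (q n x) \<le> B * indicator (cball 0 (R + 1)) x" for n x
  proof (cases "x \<in> cball 0 (R + 1)")
    case True
    obtain z where "\<psi> (x + s n *\<^sub>R ?e) - \<psi> (x + 0 *\<^sub>R ?e) = (s n - 0) * ?g (x + z *\<^sub>R ?e)"
      using MVT2[OF s(1)[of n] line] by blast
    then have "q n x = ?g (x + z *\<^sub>R ?e)" using s(1)[of n] by (simp add: q_def)
    then show ?thesis using True Bg by simp
  next
    case False
    then have n: "norm x > R + 1" by simp
    have "norm x \<le> norm (x + s n *\<^sub>R ?e) + norm (s n *\<^sub>R ?e)" using norm_triangle_ineq4[of "x + s n *\<^sub>R ?e" "s n *\<^sub>R ?e"] by simp
    moreover have "norm (s n *\<^sub>R ?e) \<le> 1" using s[of n] by (simp add: norm_axis_1)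
    ultimately have "norm (x + s n *\<^sub>R ?e) > R" using n by linarith
    then have "x + s n *\<^sub>R ?e \<notin> K" "x \<notin> K" using R n by auto
    then show ?thesis using K(2) less_imp_le[OF B(1)] by (simp add: q_def)
  qed
  have sl: "s \<longlonglongrightarrow> 0" unfolding s_def by (rule LIMSEQ_inverse_real_of_nat)
  have s0: "s n \<noteq> 0" for n using s(1)[of n] by simp
  have sf: "filterlim s (at 0) sequentially" unfolding filterlim_at using sl by (simp add: s0)
  have ql: "(\<lambda>n. q n x) \<longlonglongrightarrow> ?g x" for x
  proof -
    have "((\<lambda>h. (\<psi> (x + h *\<^sub>R ?e) - \<psi> (x + 0 *\<^sub>R ?e)) / h) \<longlongrightarrow> ?g (x + 0 *\<^sub>R ?e)) (at 0)"
      using line[of x 0] by (simp add: DERIV_def)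
    then have "(\<lambda>n. (\<psi> (x + s n *\<^sub>R ?e) - \<psi> (x + 0 *\<^sub>R ?e)) / s n) \<longlonglongrightarrow> ?g (x + 0 *\<^sub>R ?e)"
      by (rule filterlim_compose[OF _ sf])
    then show ?thesis by (simp add: q_def)
  qed
  have qm: "q n \<in> borel_measurable lebesgue" for n
  proof -
    interpret measure_symmetry "\<lambda>x. x + s n *\<^sub>R ?e" by (rule measure_symmetry_shift)
    have [measurable]: "(\<lambda>x. \<psi> (x + s n *\<^sub>R ?e)) \<in> borel_measurable lebesgue" by (rule measurable_compose[OF measurable \<psi>m])
    show ?thesis unfolding q_def by measurable
  qed
  have q0: "(LINT x|lebesgue. q n x) = 0" for n
  proof -
    interpret measure_symmetry "\<lambda>x. x + s n *\<^sub>R ?e" by (rule measure_symmetry_shift)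
    have i: "integrable lebesgue \<psi>"
    proof -
      have "integrable lebesgue (indicator S :: real^3 => real)" if "compact S" for S
        using lmeasurable_compact[OF that] by (intro integrable_real_indicator) (auto simp: fmeasurable_def)
      then have "loc_integrable (\<lambda>x. 1::real)" by (simp add: loc_integrable_def set_integrable_def)
      then have "integrable lebesgue (\<lambda>x. (1::real) * \<psi> x)"
        by (rule integrable_loc_compact_support[OF _ \<open>continuous_on UNIV \<psi>\<close> K])
      then show ?thesis by simp
    qed
    have "(LINT x|lebesgue. q n x) = ((LINT x|lebesgue. \<psi> (x + s n *\<^sub>R ?e)) - (LINT x|lebesgue. \<psi> x)) / s n"
      unfolding q_def using i integrable_comp[OF i] by simp
    then show ?thesis by (simp add: integral_comp)
  qed
  have "(\<lambda>n. LINT x|lebesgue. q n x) \<longlonglongrightarrow> (LINT x|lebesgue. ?g x)"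
  proof (rule integral_dominated_convergence[where w="\<lambda>x. B * indicator (cball 0 (R + 1)) x"])
    show "integrable lebesgue (\<lambda>x::real^3. B * indicator (cball 0 (R + 1)) x)"
      using lmeasurable_cball[of "0::real^3" "R + 1"] by (intro integrable_mult_right) (auto simp: fmeasurable_def)
  qed (use ql qb qm in auto)
  then show ?thesis unfolding q0 by (simp add: LIMSEQ_const_iff)
qed

text \<open>The product with a test function has compact support, so its partial derivatives
  integrate to zero; the product rule then is the integration by parts.\<close>

lemma has_weak_grad_C1:
  fixes u :: "real^3 => real" and D :: "real^3 => real^3"
  assumes d: "\<And>x. (u has_derivative (\<lambda>h. D x \<bullet> h)) (at x)" and D: "continuous_on UNIV D" "D \<in> L2"
    and K: "compact K" "\<And>x. x \<notin> K ==> u x = 0"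
  shows "has_weak_grad u D"
proof -
  have cu: "continuous_on UNIV u" using d by (intro continuous_at_imp_continuous_on ballI has_derivative_continuous) auto
  have uL: "u \<in> L2" by (rule compact_support_L2[OF cu K(1)]) (rule K)
  show ?thesis unfolding has_weak_grad_def
  proof (intro conjI allI impI L2_loc_integrable uL D)
    fix \<phi> i assume \<phi>: "test_fun \<phi>"
    obtain K' where K': "compact K'" "continuous_on UNIV \<phi>" "\<And>x. x \<notin> K' ==> \<phi> x = 0"
      "\<And>i. continuous_on UNIV (pderiv_at i \<phi>)" "\<And>i x. x \<notin> K' ==> pderiv_at i \<phi> x = 0"
      by (rule test_fun_cases[OF \<phi>]) (rule that; assumption)
    have "Ck (Suc 0) \<phi>" using \<phi> by (simp add: test_fun_def del: Ck.simps)
    then have d\<phi>: "(\<phi> has_derivative frechet_derivative \<phi> (at x)) (at x)" for x using frechet_derivative_works by auto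
    let ?L = "\<lambda>x h. u x * frechet_derivative \<phi> (at x) h + (D x \<bullet> h) * \<phi> x"
    have eq: "?L x (axis i 1) = u x * pderiv_at i \<phi> x + D x $ i * \<phi> x" for x by (simp add: pderiv_at_def inner_axis)
    have Di: "continuous_on UNIV (\<lambda>x. D x $ i)" by (intro continuous_intros D)
    have "(LINT x|lebesgue. ?L x (axis i 1)) = 0"
    proof (rule integral_partial_derivative)
      show "((\<lambda>x. u x * \<phi> x) has_derivative ?L x) (at x)" for x by (rule has_derivative_mult[OF d d\<phi>])
      show "continuous_on UNIV (\<lambda>x. ?L x (axis i 1))" unfolding eq by (intro continuous_intros cu K' Di)
      show "compact K" by (rule K)
      show "u x * \<phi> x = 0" if "x \<notin> K" for x using K(2)[OF that] by simp
    qed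
    moreover have "integrable lebesgue (\<lambda>x. u x * pderiv_at i \<phi> x)"
      by (rule integrable_loc_compact_support[OF L2_loc_integrable[OF uL] K'(4,1,5)])
    moreover have "integrable lebesgue (\<lambda>x. D x $ i * \<phi> x)"
      by (rule integrable_loc_compact_support[OF loc_integrable_component[OF L2_loc_integrable[OF D(2)]] K'(2,1,3)])
    ultimately show "(LINT x|lebesgue. u x * pderiv_at i \<phi> x) = - (LINT x|lebesgue. D x $ i * \<phi> x)" unfolding eq by simp
  qed
qed

text \<open>The witness is r^2 exp(-1/(1-|x|^2)) inside the unit ball, 0 outside. The factor r^2 is
  smooth, in contrast to r, and makes u/r continuous.\<close>

lemma xfun_nontrivial: "\<exists>U::xfun. U \<noteq> 0"
proof -
  let ?P = "monom 1 2 * (1 - pderiv 1) :: real poly"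
  let ?m = "\<lambda>x::real^3. exp_bump 1 (1 - x \<bullet> x)" and ?m' = "\<lambda>x::real^3. exp_bump ?P (1 - x \<bullet> x)"
  define g :: "real^3 => real" where "g x = (x$1)^2 + (x$2)^2" for x
  define u where "u x = g x * ?m x" for x
  define D where "D x = ?m x *\<^sub>R ((2 * x$1) *\<^sub>R axis 1 1 + (2 * x$2) *\<^sub>R axis 2 1) - (2 * g x * ?m' x) *\<^sub>R x" for x
  have ce: "continuous_on UNIV (exp_bump Q)" for Q using smooth_upto_exp_bump[of 0 Q] by simp
  have cm: "continuous_on UNIV (\<lambda>x::real^3. exp_bump Q (1 - x \<bullet> x))" for Q
    by (rule continuous_on_compose2[OF ce]) (auto intro!: continuous_intros)
  have out: "exp_bump Q (1 - x \<bullet> x) = 0" if "x \<notin> cball 0 1" for x :: "real^3" and Q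
  proof -
    have "norm x > 1" using that by simp
    then have "1 < (norm x)^2" by (simp add: one_less_power)
    then show ?thesis by (simp add: exp_bump_def power2_norm_eq_inner)
  qed
  have dm: "(?m has_derivative (\<lambda>h. ?m' x * (- (2 * (x \<bullet> h))))) (at x)" for x
  proof -
    have "((\<lambda>x::real^3. 1 - x \<bullet> x) has_derivative (\<lambda>h. - (2 * (x \<bullet> h)))) (at x)"
      by (auto intro!: derivative_eq_intros simp: inner_commute)
    from has_derivative_compose[OF this exp_bump_DERIV[of 1, unfolded has_field_derivative_def]]
    show ?thesis by simp
  qed
  have dg: "(g has_derivative (\<lambda>h. 2 * x$1 * h$1 + 2 * x$2 * h$2)) (at x)" for x
  proof -
    have c: "((\<lambda>x::real^3. x$i) has_derivative (\<lambda>h. h$i)) (at x)" for i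
      by (rule bounded_linear_imp_has_derivative) (rule bounded_linear_vec_nth)
    have "((\<lambda>x. (x$1)^2 + (x$2)^2) has_derivative (\<lambda>h. 2 * x$1 * h$1 + 2 * x$2 * h$2)) (at x)"
      by (auto intro!: derivative_eq_intros c)
    then show ?thesis by (simp add: g_def[abs_def])
  qed
  have du: "(u has_derivative (\<lambda>h. D x \<bullet> h)) (at x)" for x
  proof -
    have "(u has_derivative (\<lambda>h. g x * (?m' x * (- (2 * (x \<bullet> h)))) + (2 * x$1 * h$1 + 2 * x$2 * h$2) * ?m x)) (at x)"
      unfolding u_def[abs_def] by (rule has_derivative_mult[OF dg dm])
    moreover have "(\<lambda>h. g x * (?m' x * (- (2 * (x \<bullet> h)))) + (2 * x$1 * h$1 + 2 * x$2 * h$2) * ?m x) = (\<lambda>h. D x \<bullet> h)"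
      by (auto simp: D_def inner_diff_left inner_add_left inner_axis' algebra_simps)
    ultimately show ?thesis by simp
  qed
  have cg: "continuous_on UNIV g" unfolding g_def[abs_def] by (intro continuous_intros)
  have cD: "continuous_on UNIV D" unfolding D_def[abs_def] by (intro continuous_intros cm cg)
  have D0: "D x = 0" if "x \<notin> cball 0 1" for x using out[OF that] by (simp add: D_def)
  have "(\<lambda>x. norm (D x)) \<in> L2" by (rule compact_support_L2[of _ "cball 0 1"]) (use D0 in \<open>auto intro!: continuous_intros cD\<close>)
  then have DL: "D \<in> L2" using borel_measurable_continuous_onI[OF cD] by (simp add: L2_def measurable_completion)
  have u0: "u x = 0" if "x \<notin> cball 0 1" for x using out[OF that] by (simp add: u_def)
  have cu: "continuous_on UNIV u" unfolding u_def[abs_def] by (intro continuous_intros cm cg)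
  have uL: "u \<in> L2" by (rule compact_support_L2[OF cu compact_cball u0])
  have hw: "has_weak_grad u D" by (rule has_weak_grad_C1[OF du cD DL compact_cball u0])
  have ur: "u x / rad x = rad x * ?m x" for x
  proof -
    have "(rad x)^2 = g x" by (simp add: rad_def g_def)
    then have "u x = rad x * (rad x * ?m x)" by (simp add: u_def power2_eq_square)
    then show ?thesis by (cases "rad x = 0") auto
  qed
  have cr: "continuous_on UNIV rad" unfolding rad_def[abs_def] by (intro continuous_intros)
  have rL: "(\<lambda>x. u x / rad x) \<in> L2"
    unfolding ur by (rule compact_support_L2[of _ "cball 0 1"]) (use out in \<open>auto intro!: continuous_intros cr cm\<close>)
  have cs: "cyl_sym u"
  proof -
    have "x \<bullet> x = (rad x)^2 + (x$3)^2" "g x = (rad x)^2" for x :: "real^3"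
      by (simp_all add: rad_def g_def inner_vec_def sum_3 power2_eq_square)
    then have "AE x in lebesgue. u x = (\<lambda>r z. r^2 * exp_bump 1 (1 - (r^2 + z^2))) (rad x) (x$3)" by (simp add: u_def)
    then show ?thesis unfolding cyl_sym_def by (rule exI[where x="\<lambda>r z. r^2 * exp_bump 1 (1 - (r^2 + z^2))"])
  qed
  have uX: "u \<in> X_space" using form_domI[OF uL DL hw rL] cs by (simp add: X_space_iff)
  have "cls u \<noteq> 0"
  proof
    assume "cls u = 0"
    then have "AE x in lebesgue. u x = 0" using rep_abs[OF uX] rep_zero_AE by (auto elim: AE_mp)
    then have "{x. u x \<noteq> 0} \<in> null_sets lebesgue" using completion.AE_iff_null_sets[of "\<lambda>x. u x = 0" lborel] by simp
    then have "negligible {x. u x \<noteq> 0}" by (simp add: negligible_iff_null_sets)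
    moreover have "open {x. u x \<noteq> 0}" using open_Collect_neq[OF cu continuous_on_const, of 0] by simp
    moreover have "(1/2) *\<^sub>R axis 1 1 \<in> {x. u x \<noteq> 0}" by (simp add: u_def g_def axis_def exp_bump_def inner_vec_def sum_3)
    ultimately show False using open_not_negligible by blast
  qed
  then show ?thesis by blast
qed

section \<open>Non-vanishing\<close>

text \<open>It suffices to measure preimages of boxes, and these are images of boxes under the
  inverse orthogonal map.\<close>

lemma measure_symmetry_orthogonal:
  fixes f :: "real^3 => real^3"
  assumes f: "orthogonal_transformation f"
  shows "measure_symmetry f"
proof
  have lin: "linear f" by (rule orthogonal_transformation_linear[OF f])
  have c: "continuous_on UNIV f" by (rule linear_continuous_on) (use lin linear_conv_bounded_linear in blast)
  show b: "f \<in> borel_measurable borel" by (rule borel_measurable_continuous_onI[OF c])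
  show "distr lborel borel f = lborel"
  proof (rule lborel_eqI[symmetric])
    fix l u :: "real^3" assume le: "\<And>b. b \<in> Basis ==> l \<bullet> b \<le> u \<bullet> b"
    have im: "f -` box l u = inv f ` box l u" by (rule bij_vimage_eq_inv_image[OF orthogonal_transformation_bij[OF f]])
    have inv: "orthogonal_transformation (inv f)" by (rule orthogonal_transformation_inv[OF f])
    have S: "f -` box l u \<in> sets borel" using open_vimage[OF open_box c] by simp
    have "emeasure (distr lborel borel f) (box l u) = emeasure lebesgue (f -` box l u)" using b S by (simp add: emeasure_distr)
    also have "\<dots> = ennreal (measure lebesgue (inv f ` box l u))"
      unfolding im using fmeasurableD2[OF measurable_orthogonal_image[OF inv lmeasurable_box]] by (intro emeasure_eq_ennreal_measure) simp
    also have "\<dots> = ennreal (measure lebesgue (box l u))" unfolding measure_orthogonal_image[OF inv lmeasurable_box] ..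
    also have "\<dots> = (\<Prod>b\<in>Basis. (u - l) \<bullet> b)" using le by simp
    finally show "emeasure (distr lborel borel f) (box l u) = (\<Prod>b\<in>Basis. (u - l) \<bullet> b)" .
  qed simp
qed

text \<open>Rotation about the third axis, parametrised by the cosine of the angle.\<close>

definition rot :: "real => real^3 => real^3" where
  "rot c x = vector [c * x$1 - sqrt (1 - c^2) * x$2, sqrt (1 - c^2) * x$1 + c * x$2, x$3]"

lemma rot_simps[simp]:
  "rot c x $ 1 = c * x$1 - sqrt (1 - c^2) * x$2" "rot c x $ 2 = sqrt (1 - c^2) * x$1 + c * x$2" "rot c x $ 3 = x$3" by (simp_all add: rot_def)

lemma measure_symmetry_rot: assumes c: "abs c \<le> 1" shows "measure_symmetry (rot c)" "rad (rot c x) = rad x"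
proof -
  have "c^2 \<le> 1" using c by (simp add: abs_square_le_1)
  then have s: "(sqrt (1 - c^2))^2 = 1 - c^2" by simp
  have l: "linear (rot c)" by (rule linearI) (simp_all add: vec_eq_iff forall_3 algebra_simps)
  have i: "rot c v \<bullet> rot c w = v \<bullet> w" for v w
  proof -
    have "rot c v \<bullet> rot c w = (c^2 + (sqrt (1 - c^2))^2) * (v$1 * w$1 + v$2 * w$2) + v$3 * w$3"
      by (simp only: inner_vec_def sum_3 rot_simps inner_real_def) algebra
    then show ?thesis unfolding s by (simp add: inner_vec_def sum_3)
  qed
  show "measure_symmetry (rot c)" by (rule measure_symmetry_orthogonal) (simp add: orthogonal_transformation_def l i)
  have "(rot c x $ 1)^2 + (rot c x $ 2)^2 = (c^2 + (sqrt (1 - c^2))^2) * ((x$1)^2 + (x$2)^2)" by (simp only: rot_simps) algebra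
  then show "rad (rot c x) = rad x" unfolding s by (simp add: rad_def)
qed

lemma plane_norm_le: "sqrt ((v$1)^2 + (v$2)^2) \<le> norm (v :: real^3)"
  unfolding norm_eq_sqrt_inner inner_vec_def sum_3 by (intro real_sqrt_le_mono) (simp add: power2_eq_square)

text \<open>The squared planar distance is the sum of the squared differences of cosines and sines
  times r^2. Dropping the sines leaves a separation proportional to the difference of the cosines,
  the reason for this parametrisation.\<close>

lemma rot_separated: "abs (c - d) * rad x \<le> dist (rot c x) (rot d x)"
proof -
  let ?v = "rot c x - rot d x" and ?s = "sqrt (1 - c^2) - sqrt (1 - d^2)"
  have "(?v$1)^2 + (?v$2)^2 = ((c - d)^2 + ?s^2) * (rad x)^2"
  proof -
    have "(rad x)^2 = (x$1)^2 + (x$2)^2" by (simp add: rad_def)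
    moreover have "(c * a - s * b - (d * a - t * b))^2 + (s * a + c * b - (t * a + d * b))^2 = ((c - d)^2 + (s - t)^2) * (a^2 + b^2)"
      for a b s t :: real by algebra
    ultimately show ?thesis by (simp only: vector_minus_component rot_simps)
  qed
  moreover have "(c - d)^2 * (rad x)^2 \<le> ((c - d)^2 + ?s^2) * (rad x)^2" by (intro mult_right_mono) auto
  ultimately have "(abs (c - d) * rad x)^2 \<le> (?v$1)^2 + (?v$2)^2" by (simp add: power_mult_distrib)
  then have "abs (c - d) * rad x \<le> sqrt ((?v$1)^2 + (?v$2)^2)" by (rule real_le_rsqrt)
  also have "\<dots> \<le> norm ?v" by (rule plane_norm_le)
  finally show ?thesis by (simp add: dist_norm)
qed

lemma rad_triangle: "rad y \<le> rad x + dist y x"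
proof -
  have c: "rad x = cmod (Complex (x$1) (x$2))" for x by (simp add: rad_def cmod_def)
  have "cmod (Complex (y$1) (y$2) - Complex (x$1) (x$2)) = sqrt (((y - x)$1)^2 + ((y - x)$2)^2)" by (simp add: cmod_def)
  also have "\<dots> \<le> dist y x" unfolding dist_norm by (rule plane_norm_le)
  finally show ?thesis unfolding c using norm_triangle_sub[of "Complex (y$1) (y$2)" "Complex (x$1) (x$2)"] by linarith
qed

lemma cyl_sym_rot:
  assumes "cyl_sym u" "abs c \<le> 1" shows "AE x in lebesgue. u (rot c x) = u x"
proof -
  obtain w where w: "AE x in lebesgue. u x = w (rad x) (x$3)" using assms(1) by (auto simp: cyl_sym_def)
  interpret measure_symmetry "rot c" by (rule measure_symmetry_rot(1)[OF assms(2)])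
  from AE_comp[OF w] w show ?thesis by eventually_elim (simp add: measure_symmetry_rot(2)[OF assms(2)])
qed

text \<open>Rotated copies of a cell far from the axis are pairwise disjoint and carry the same mass.\<close>

lemma cell_mass_far:
  assumes N: "0 < N" and far: "6 * real N + 4 \<le> rad z"
  shows "real N * (LINT y:cell k z|lebesgue. (rep U y)^2) \<le> (norm U)^2"
proof -
  let ?u = "rep U" and ?A = "cell k z"
  \<comment> \<open>Equally spaced cosines j/N stay in [0,1) and differ by at least 1/N.\<close>
  define R where "R j = rot (real j / real N)" for j
  have c1: "abs (real j / real N) \<le> 1" if "j < N" for j using that by simp
  have uu: "integrable lebesgue (\<lambda>x. (?u x)^2)" using L2_D(2)[OF rep_L2(1)[of U]] by simp
  define a where "a = (LINT y:?A|lebesgue. (?u y)^2)"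
  define g where "g j x = indicator ?A (R j x) * (?u x)^2" for j x
  have ig: "integrable lebesgue (g j) \<and> (LINT x|lebesgue. g j x) = a" if j: "j < N" for j
  proof -
    interpret measure_symmetry "R j" unfolding R_def by (rule measure_symmetry_rot(1)[OF c1[OF j]])
    let ?w = "\<lambda>x. indicator ?A x * (?u x)^2"
    have iw: "integrable lebesgue ?w" using integrable_mult_indicator[OF cell_lebesgue uu, of k z] by simp
    have cs: "cyl_sym ?u" using rep_X[of U] by (simp add: X_space_iff)
    have ae: "AE x in lebesgue. ?w (R j x) = g j x" using cyl_sym_rot[OF cs c1[OF j]] by eventually_elim (simp add: g_def R_def)
    have "(\<lambda>x. indicator ?A (R j x) :: real) \<in> borel_measurable lebesgue"
      by (rule measurable_compose[OF measurable borel_measurable_indicator[OF cell_lebesgue]])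
    then have gm: "g j \<in> borel_measurable lebesgue" unfolding g_def using borel_measurable_integrable[OF uu] by (rule borel_measurable_times)
    have i1: "integrable lebesgue (g j)" by (rule integrable_cong_AE_imp[OF integrable_comp[OF iw] gm ae])
    have "(LINT x|lebesgue. g j x) = (LINT x|lebesgue. ?w (R j x))"
      by (rule integral_cong_AE[OF gm borel_measurable_integrable[OF integrable_comp[OF iw]]]) (use ae in eventually_elim, simp)
    also have "\<dots> = a" unfolding integral_comp[OF borel_measurable_integrable[OF iw]] by (simp add: a_def set_lebesgue_integral_def)
    finally show ?thesis using i1 by simp
  qed
  \<comment> \<open>If two rotates of x lay in the cell, they would be within 6 of each other. But x
    has radius at least 6 N + 1, the assumed 6 N + 4 minus 3, and so its rotates are at least (6 N +
    1)/N > 6 apart.\<close>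
  have cd: "dist y z \<le> 3" if "y \<in> ?A" for y using cell_dist[OF that] power_le_one[of "1/2::real" "k div 3"] by linarith
  have disj: "i = j" if i: "i < N" "R i x \<in> ?A" and j: "j < N" "R j x \<in> ?A" for i j x
  proof (rule ccontr)
    assume ij: "i \<noteq> j"
    have "dist (R i x) (R j x) \<le> 6" using cd[OF i(2)] cd[OF j(2)] dist_triangle2[of "R i x" "R j x" z] by linarith
    moreover have "abs (real i / real N - real j / real N) * rad x \<le> dist (R i x) (R j x)" unfolding R_def by (rule rot_separated)
    moreover have "1 / real N \<le> abs (real i / real N - real j / real N)"
    proof -
      have "1 \<le> abs (real i - real j)" using ij by linarith
      then show ?thesis using N by (simp add: divide_right_mono flip: diff_divide_distrib)
    qed
    moreover have "6 * real N + 1 \<le> rad x"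
    proof -
      have "rad (R i x) = rad x" unfolding R_def by (rule measure_symmetry_rot(2)[OF c1[OF i(1)]])
      then show ?thesis using rad_triangle[of z "R i x"] cd[OF i(2)] far by (simp add: dist_commute)
    qed
    moreover have "1 / real N * (6 * real N + 1) \<le> abs (real i / real N - real j / real N) * rad x" using calculation by (intro mult_mono) auto
    moreover have "1 / real N * (6 * real N + 1) > 6" using N by (simp add: field_simps)
    ultimately show False by linarith
  qed
  have le: "(\<Sum>j<N. g j x) \<le> (?u x)^2" for x
  proof -
    have "(\<Sum>j<N. indicator ?A (R j x)) \<le> (1::real)"
    proof (cases "\<exists>i<N. R i x \<in> ?A")
      case True
      then obtain i where i: "i < N" "R i x \<in> ?A" by blast
      have "(\<Sum>j<N. indicator ?A (R j x)) = (\<Sum>j<N. if j = i then 1 else (0::real))"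
        by (rule sum.cong) (use i disj in \<open>auto simp: indicator_def\<close>)
      then show ?thesis by simp
    next
      case False
      then have "(\<Sum>j<N. indicator ?A (R j x)) = (\<Sum>j<N. (0::real))" by (intro sum.cong) auto
      then show ?thesis by simp
    qed
    then have "(\<Sum>j<N. indicator ?A (R j x)) * (?u x)^2 \<le> 1 * (?u x)^2" by (rule mult_right_mono) simp
    then show ?thesis by (simp add: g_def sum_distrib_right)
  qed
  have "real N * a = (\<Sum>j<N. (LINT x|lebesgue. g j x))" using ig by simp
  also have "\<dots> = (LINT x|lebesgue. (\<Sum>j<N. g j x))" using ig by (intro Bochner_Integration.integral_sum[symmetric]) simp
  also have "\<dots> \<le> (LINT x|lebesgue. (?u x)^2)"
    by (rule integral_mono[OF _ uu le]) (use ig in \<open>intro Bochner_Integration.integrable_sum, simp\<close>)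
  also have "\<dots> \<le> (norm U)^2" by (rule integral_rep_sq_le(1))
  finally show ?thesis unfolding a_def .
qed

text \<open>If every average of generation \<open>k\<close> were at most t in modulus, the L^p
  integral would fall below \<eta>: interpolation bounds the averaged part by t^(p-2) M^2, and the
  approximation estimate bounds the rest. So some average exceeds t, and by Cauchy-Schwarz its cell
  carries L2 mass t^2 / 2^k.\<close>

lemma cell_mass_large:
  assumes p: "2 < p" "p < 6" and M: "0 < M" and \<eta>: "0 < \<eta>"
  obtains k s where "0 < s" "\<And>U. norm U \<le> M ==> \<eta> \<le> (LINT x|lebesgue. abs (rep U x) powr p) ==>
      \<exists>z. s \<le> (LINT y:cell k z|lebesgue. (rep U y)^2)"
proof -
  have p2: "2 \<le> p" using p by simp
  obtain C \<theta> where C: "C > 0" "0 < \<theta>" "\<theta> < 1" and approx: "\<And>U k. integrable lebesgue (\<lambda>x. abs (rep U x - avg k (rep U) x) powr p) \<and>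
      (LINT x|lebesgue. abs (rep U x - avg k (rep U) x) powr p) \<le> C * \<theta> ^ k * norm U powr p"
    by (rule rep_avg_approx[OF p2 p(2)]) (rule that; assumption)
  obtain C' where C': "\<And>U. integrable lebesgue (\<lambda>x. abs (rep U x) powr p)" using sobolev[OF p2 p(2)] by blast
  \<comment> \<open>Two parts are allowed \<eta>' each, and 2^p is the cost of splitting the p-th
    power of a sum.\<close>
  define \<eta>' where "\<eta>' = \<eta> / 2 powr p / 2"
  have \<eta>': "\<eta>' > 0" "2 powr p * (2 * \<eta>') = \<eta>" using \<eta> by (auto simp: \<eta>'_def)
  have "\<exists>k. \<theta> ^ k < \<eta>' / (C * M powr p)" using C M \<eta>' by (intro real_arch_pow_inv) auto
  then obtain k where "\<theta> ^ k < \<eta>' / (C * M powr p)" ..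
  then have k: "C * \<theta> ^ k * M powr p < \<eta>'" using C M by (simp add: field_simps)
  \<comment> \<open>Half of the solution of t^(p-2) M^2 = \<eta>', to make the inequality
    strict.\<close>
  define t where "t = (\<eta>' / M^2) powr (1 / (p - 2)) / 2"
  have t: "t > 0" using \<eta>' M by (simp add: t_def)
  have tp: "t powr (p - 2) * M^2 < \<eta>'"
  proof -
    have "t powr (p - 2) < (2 * t) powr (p - 2)" using t p by (intro powr_less_mono2) auto
    also have "(2 * t) powr (p - 2) = \<eta>' / M^2" using \<eta>' M p by (simp add: t_def powr_powr)
    finally show ?thesis using M by (simp add: field_simps)
  qed
  show ?thesis
  proof (rule that[of "t^2 / 2 ^ k" k])
    show "0 < t^2 / 2 ^ k" using t by simp
    fix U assume U: "norm U \<le> M" and big: "\<eta> \<le> (LINT x|lebesgue. abs (rep U x) powr p)"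
    let ?u = "rep U"
    have "\<exists>z. t < abs (avg k ?u z)"
    proof (rule ccontr)
      assume "\<not> ?thesis"
      then have bd: "abs (avg k ?u z) \<le> t" for z by (auto simp: not_less)
      note A = avg_powr_le[OF rep_L2(1) p2 bd]
      have "(LINT x|lebesgue. abs (?u x) powr p)
          \<le> (LINT x|lebesgue. 2 powr p * (abs (avg k ?u x) powr p + abs (?u x - avg k ?u x) powr p))"
      proof (rule integral_mono[OF C'])
        show "integrable lebesgue (\<lambda>x. 2 powr p * (abs (avg k ?u x) powr p + abs (?u x - avg k ?u x) powr p))"
          using A(1) approx by (intro integrable_mult_right Bochner_Integration.integrable_add) auto
        fix x
        have "abs (?u x) powr p \<le> (abs (avg k ?u x) + abs (?u x - avg k ?u x)) powr p" using p by (intro powr_mono2) auto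
        also have "\<dots> \<le> 2 powr p * (abs (avg k ?u x) powr p + abs (?u x - avg k ?u x) powr p)" using p by (intro powr_add_le) auto
        finally show "abs (?u x) powr p \<le> 2 powr p * (abs (avg k ?u x) powr p + abs (?u x - avg k ?u x) powr p)" .
      qed
      also have "\<dots> = 2 powr p * ((LINT x|lebesgue. abs (avg k ?u x) powr p) + (LINT x|lebesgue. abs (?u x - avg k ?u x) powr p))"
        using A(1) approx[of U k] by simp
      also have "\<dots> < 2 powr p * (2 * \<eta>')"
      proof (rule mult_strict_left_mono)
        have "(LINT x|lebesgue. abs (avg k ?u x) powr p) \<le> t powr (p - 2) * M^2"
          using U by (intro order_trans[OF A(2)] mult_left_mono order_trans[OF integral_rep_sq_le(1)[of U]] power_mono) auto
        moreover have "(LINT x|lebesgue. abs (?u x - avg k ?u x) powr p) \<le> C * \<theta> ^ k * M powr p"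
          using U C p by (intro order_trans[OF conjunct2[OF approx]] mult_left_mono powr_mono2) auto
        ultimately show "(LINT x|lebesgue. abs (avg k ?u x) powr p) + (LINT x|lebesgue. abs (?u x - avg k ?u x) powr p) < 2 * \<eta>'"
          using tp k by linarith
      qed simp
      finally show False using big \<eta>'(2) by linarith
    qed
    then obtain z where z: "t < abs (avg k ?u z)" ..
    have "t^2 \<le> (avg k ?u z)^2" using z t by (simp add: abs_le_square_iff[symmetric])
    also have "\<dots> \<le> 2 ^ k * (LINT y:cell k z|lebesgue. (?u y)^2)" by (rule avg_sq_le[OF rep_L2(1)])
    finally have "t^2 / 2 ^ k \<le> (LINT y:cell k z|lebesgue. (?u y)^2)" by (simp add: field_simps)
    then show "\<exists>z. t^2 / 2 ^ k \<le> (LINT y:cell k z|lebesgue. (?u y)^2)" ..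
  qed
qed

theorem nonvanishing:
  assumes p: "2 < p" "p < 6" and M: "0 < M" and \<eta>: "0 < \<eta>"
  obtains n :: nat and \<delta> where "0 < \<delta>" "\<And>U. norm U \<le> M ==> \<eta> \<le> (LINT x|lebesgue. abs (rep U x) powr p) ==>
      \<exists>l. \<delta> \<le> (LINT x:cball 0 (real n)|lebesgue. (rep (xshift l U) x)^2)"
proof -
  obtain k s where s: "0 < s" and cell: "\<And>U. norm U \<le> M ==> \<eta> \<le> (LINT x|lebesgue. abs (rep U x) powr p) ==>
      \<exists>z. s \<le> (LINT y:cell k z|lebesgue. (rep U y)^2)" by (rule cell_mass_large[OF p M \<eta>]) (rule that; assumption)
  \<comment> \<open>\<open>N\<close> disjoint copies of mass \<open>s\<close> would exceed the total
    mass, so the cell found for \<open>U\<close> must lie within radius 6 N + 4.\<close>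
  obtain N :: nat where N: "M^2 / s < real N" using reals_Archimedean2 by blast
  have "0 \<le> M^2 / s" using s by simp
  then have N0: "0 < N" using N by (cases N) auto
  have Ns: "M^2 < real N * s" using N s by (simp add: field_simps)
  show ?thesis
  \<comment> \<open>The radius adds 3 for the extent of the cell, 6 N + 4 for its distance from the
    axis and 1 for the fractional part of its height.\<close>
  proof (rule that[of s "6 * N + 8"])
    fix U assume U: "norm U \<le> M" "\<eta> \<le> (LINT x|lebesgue. abs (rep U x) powr p)"
    let ?u = "rep U"
    obtain z where z: "s \<le> (LINT y:cell k z|lebesgue. (?u y)^2)" using cell[OF U] by blast
    have rz: "rad z < 6 * real N + 4"
    proof (rule ccontr)
      assume "\<not> ?thesis"
      then have "real N * (LINT y:cell k z|lebesgue. (?u y)^2) \<le> (norm U)^2" by (intro cell_mass_far N0) simp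
      moreover have "real N * s \<le> real N * (LINT y:cell k z|lebesgue. (?u y)^2)" using z by (rule mult_left_mono) simp
      moreover have "(norm U)^2 \<le> M^2" using U(1) by (rule power_mono) simp
      ultimately show False using Ns by linarith
    qed
    define l where "l = \<lfloor>z$3\<rfloor>"
    let ?B = "cball (0::real^3) (real (6 * N + 8))"
    have inB: "x \<in> ?B" if x: "up l x \<in> cell k z" for x
    proof -
      have "dist (up l x) z \<le> 3" using cell_dist[OF x] power_le_one[of "1/2::real" "k div 3"] by linarith
      moreover have "norm x \<le> dist (up l x) z + norm (z - of_int l *\<^sub>R e3)"
        using norm_triangle_ineq[of "up l x - z" "z - of_int l *\<^sub>R e3"] by (simp add: dist_norm)
      moreover have "norm (z - of_int l *\<^sub>R e3) \<le> rad z + 1"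
      proof -
        have zl: "0 \<le> z$3 - of_int l" "z$3 - of_int l \<le> 1" unfolding l_def by linarith+
        have r: "0 \<le> rad z" by (simp add: rad_def)
        have "(norm (z - of_int l *\<^sub>R e3))^2 = (rad z)^2 + (z$3 - of_int l)^2"
          unfolding power2_norm_eq_inner inner_vec_def sum_3 by (simp add: e3_def axis_def rad_def power2_eq_square)
        also have "\<dots> \<le> (rad z)^2 + 1^2" using zl by (intro add_left_mono power_mono) auto
        also have "\<dots> \<le> (rad z + 1)^2" using r by (simp add: power2_sum)
        finally show ?thesis by (rule power2_le_imp_le) (use r in simp)
      qed
      ultimately have "norm x \<le> 3 + (6 * real N + 4) + 1" using rz by linarith
      then show ?thesis by simp
    qed
    let ?w = "\<lambda>x. indicator (cell k z) x * (?u x)^2"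
    have uu: "integrable lebesgue (\<lambda>x. (?u x)^2)" using L2_D(2)[OF rep_L2(1)[of U]] by simp
    have vv: "integrable lebesgue (\<lambda>x. (rep (xshift l U) x)^2)" using L2_D(2)[OF rep_L2(1)[of "xshift l U"]] by simp
    have iw: "integrable lebesgue ?w" using integrable_mult_indicator[OF cell_lebesgue uu, of k z] by simp
    have iv: "integrable lebesgue (\<lambda>x. indicator ?B x * (rep (xshift l U) x)^2)"
      using integrable_mult_indicator[OF cball_lebesgue vv, of 0 "real (6 * N + 8)"] by simp
    have "s \<le> (LINT x|lebesgue. ?w x)" using z by (simp add: set_lebesgue_integral_def)
    also have "\<dots> = (LINT x|lebesgue. ?w (up l x))" by (rule up.integral_comp[OF borel_measurable_integrable[OF iw], symmetric])
    also have "\<dots> \<le> (LINT x|lebesgue. indicator ?B x * (rep (xshift l U) x)^2)"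
    proof (rule integral_mono_AE[OF up.integrable_comp[OF iw] iv])
      show "AE x in lebesgue. ?w (up l x) \<le> indicator ?B x * (rep (xshift l U) x)^2" using rep_xshift_AE[of l U]
      proof eventually_elim
        case (elim x)
        show ?case unfolding elim using inB[of x] by (intro mult_right_mono) (auto simp: indicator_def)
      qed
    qed
    finally show "\<exists>l. s \<le> (LINT x:?B|lebesgue. (rep (xshift l U) x)^2)" by (intro exI[of _ l]) (simp add: set_lebesgue_integral_def)
  qed (rule s)
qed

section \<open>Nonlinearities with monotone quotients\<close>

text \<open>Below \<delta> the linear bound applies; above it both terms of the growth bound are
  multiples of the power p - 1, with constants \<delta>^(1-p) and \<delta>^(r-p). The exponent r
  \<le> p lets \<open>f\<close> and \<open>g\<close> share the lemma.\<close>

lemma superposition_intro: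
  fixes h :: "real^3 => real => real"
  assumes p: "2 < p" "p < 6" and r: "r \<le> p"
    and m: "\<And>t. (\<lambda>x. h x t) \<in> borel_measurable lebesgue" and c: "AE x in lebesgue. continuous_on UNIV (h x)"
    and growth: "\<exists>c>0. AE x in lebesgue. \<forall>u. abs (h x u) \<le> c * (1 + abs u powr (r - 1))"
    and small: "\<forall>\<epsilon>>0. \<exists>\<delta>>0. AE x in lebesgue. \<forall>u. abs u < \<delta> \<longrightarrow> abs (h x u) \<le> \<epsilon> * abs u"
  shows "superposition h p"
proof (rule superposition.intro[OF p m c])
  fix e :: real assume e: "e > 0"
  obtain \<delta> where \<delta>: "\<delta> > 0" "AE x in lebesgue. \<forall>u. abs u < \<delta> \<longrightarrow> abs (h x u) \<le> e * abs u"
    using small e by blast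
  obtain c where c: "c > 0" "AE x in lebesgue. \<forall>u. abs (h x u) \<le> c * (1 + abs u powr (r - 1))" using growth by blast
  define C where "C = c * (\<delta> powr (1 - p) + \<delta> powr (r - p))"
  have C: "C \<ge> 0" using c by (simp add: C_def)
  have large: "c * (1 + T powr (r - 1)) \<le> C * T powr (p - 1)" if T: "\<delta> \<le> T" for T
  proof -
    have T0: "T > 0" using T \<delta>(1) by linarith
    have "1 = T powr (1 - p) * T powr (p - 1)" using T0 by (simp flip: powr_add)
    also have "\<dots> \<le> \<delta> powr (1 - p) * T powr (p - 1)" using p T \<delta>(1) by (intro mult_right_mono powr_mono2') auto
    finally have 1: "1 \<le> \<delta> powr (1 - p) * T powr (p - 1)" .
    have "T powr (r - 1) = T powr (r - p) * T powr (p - 1)" by (simp flip: powr_add)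
    also have "\<dots> \<le> \<delta> powr (r - p) * T powr (p - 1)" using r T \<delta>(1) by (intro mult_right_mono powr_mono2') auto
    finally have "1 + T powr (r - 1) \<le> (\<delta> powr (1 - p) + \<delta> powr (r - p)) * T powr (p - 1)" using 1 by (simp add: distrib_right)
    then have "c * (1 + T powr (r - 1)) \<le> c * ((\<delta> powr (1 - p) + \<delta> powr (r - p)) * T powr (p - 1))"
      using c(1) by (intro mult_left_mono) auto
    then show ?thesis by (simp add: C_def mult.assoc)
  qed
  have "AE x in lebesgue. \<forall>t. abs (h x t) \<le> e * abs t + C * abs t powr (p - 1)" using \<delta>(2) c(2)
  proof eventually_elim
    case (elim x)
    have "abs (h x t) \<le> e * abs t + C * abs t powr (p - 1)" for t
    proof (cases "abs t < \<delta>")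
      case True
      have "0 \<le> C * abs t powr (p - 1)" using C by simp
      then show ?thesis using elim(1) True by fastforce
    next
      case False
      have "abs (h x t) \<le> c * (1 + abs t powr (r - 1))" using elim(2) by blast
      also have "\<dots> \<le> C * abs t powr (p - 1)" using False by (intro large) simp
      also have "\<dots> \<le> e * abs t + C * abs t powr (p - 1)" using e by simp
      finally show ?thesis .
    qed
    then show ?case by blast
  qed
  then show "\<exists>C\<ge>0. AE x in lebesgue. \<forall>t. abs (h x t) \<le> e * abs t + C * abs t powr (p - 1)" using C by blast
qed

lemma superposition_diff:
  assumes f: "superposition f p" and g: "superposition g p"
  shows "superposition (\<lambda>x t. f x t - g x t) p"
proof -
  interpret F: superposition f p by (rule f)
  interpret G: superposition g p by (rule g)
  show ?thesis
  proof (rule superposition.intro[OF F.p])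
    show "(\<lambda>x. f x t - g x t) \<in> borel_measurable lebesgue" for t by (rule borel_measurable_diff[OF F.h_measurable G.h_measurable])
    show "AE x in lebesgue. continuous_on UNIV (\<lambda>t. f x t - g x t)"
      using F.h_continuous G.h_continuous by eventually_elim (rule continuous_on_diff)
    fix e :: real assume e: "e > 0"
    then have e2: "e / 2 > 0" by simp
    obtain C where C: "C \<ge> 0" "AE x in lebesgue. \<forall>t. abs (f x t) \<le> e/2 * abs t + C * abs t powr (p - 1)" using F.h_growth[OF e2] by blast
    obtain D where D: "D \<ge> 0" "AE x in lebesgue. \<forall>t. abs (g x t) \<le> e/2 * abs t + D * abs t powr (p - 1)" using G.h_growth[OF e2] by blast
    have "AE x in lebesgue. \<forall>t. abs (f x t - g x t) \<le> e * abs t + (C + D) * abs t powr (p - 1)" using C(2) D(2)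
    proof eventually_elim
      case (elim x)
      show ?case
      proof
      fix t
      have "abs (f x t) \<le> e/2 * abs t + C * abs t powr (p - 1)" "abs (g x t) \<le> e/2 * abs t + D * abs t powr (p - 1)" using elim by blast+
      moreover have "abs (f x t - g x t) \<le> abs (f x t) + abs (g x t)" by linarith
      moreover have "e * abs t + (C + D) * abs t powr (p - 1) = (e/2 * abs t + C * abs t powr (p - 1)) + (e/2 * abs t + D * abs t powr (p - 1))"
        by (simp add: algebra_simps)
      ultimately show "abs (f x t - g x t) \<le> e * abs t + (C + D) * abs t powr (p - 1)" by linarith
      qed
    qed
    then show "\<exists>C\<ge>0. AE x in lebesgue. \<forall>t. abs (f x t - g x t) \<le> e * abs t + C * abs t powr (p - 1)"
      using C(1) D(1) by (intro exI[of _ "C + D"]) simp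
  qed
qed

lemma primitive_unique:
  assumes c: "continuous_on UNIV (h x)" and d: "\<And>t. (\<phi> has_real_derivative h x t) (at t)" and 0: "\<phi> 0 = 0"
  shows "primitive h x t = \<phi> t"
proof -
  have "\<forall>t. ((\<lambda>t. primitive h x t - \<phi> t) has_real_derivative 0) (at t)"
    using DERIV_diff[OF primitive_DERIV[where h=h and x=x, OF c] d] by simp
  from DERIV_isconst_all[OF this, of t 0] show ?thesis by (simp add: primitive_0 0)
qed

lemma primitive_diff:
  assumes "continuous_on UNIV (f x)" "continuous_on UNIV (g x)"
  shows "primitive (\<lambda>x t. f x t - g x t) x t = primitive f x t - primitive g x t"
proof (rule primitive_unique)
  show "continuous_on UNIV (\<lambda>t. f x t - g x t)" using assms by (rule continuous_on_diff)
  show "((\<lambda>t. primitive f x t - primitive g x t) has_real_derivative f x t - g x t) (at t)" for t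
    by (rule DERIV_diff[OF primitive_DERIV[where h=f and x=x, OF assms(1)] primitive_DERIV[where h=g and x=x, OF assms(2)]])
qed (simp add: primitive_0)

lemma primitive_reflect:
  assumes "continuous_on UNIV (h x)"
  shows "primitive (\<lambda>x t. - h x (- t)) x t = primitive h x (- t)"
proof (rule primitive_unique)
  show "continuous_on UNIV (\<lambda>t. - h x (- t))" by (intro continuous_intros continuous_on_compose2[OF assms]) auto
  show "((\<lambda>t. primitive h x (- t)) has_real_derivative - h x (- t)) (at t)" for t
    using DERIV_chain2[OF primitive_DERIV[where h=h and x=x and t="- t", OF assms] DERIV_minus[OF DERIV_ident]] by simp
qed (simp add: primitive_0)

text \<open>Monotonicity of the quotient gives h(s) \<le> a s^(q-1) on (0, t), with equality at t;
  comparing primitives of the two sides is the Ambrosetti-Rabinowitz inequality.\<close>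

lemma primitive_le_pos:
  assumes c: "continuous_on UNIV (h x)" and q: "0 < q" and t: "0 < t"
    and mono: "mono_on {0<..} (\<lambda>u. h x u / abs u powr (q - 1))"
  shows "q * primitive h x t \<le> h x t * t"
proof -
  define a where "a = h x t / t powr (q - 1)"
  let ?\<phi> = "\<lambda>s. a * (s powr q / q) - primitive h x s"
  have "?\<phi> 0 \<le> ?\<phi> t"
  proof (rule DERIV_nonneg_imp_increasing_open[where f="?\<phi>" and a=0 and b=t])
    show "0 \<le> t" using t by simp
    fix s assume s: "0 < s" "s < t"
    have "(?\<phi> has_real_derivative a * s powr (q - 1) - h x s) (at s)"
      using q s by (auto intro!: derivative_eq_intros primitive_DERIV[where h=h and x=x, OF c])
    moreover have "h x s / s powr (q - 1) \<le> a" using monotone_onD[OF mono, of s t] s t by (simp add: a_def)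
    then have "h x s \<le> a * s powr (q - 1)" using s by (simp add: pos_divide_le_eq)
    ultimately show "\<exists>y. (?\<phi> has_real_derivative y) (at s) \<and> 0 \<le> y" by fastforce
  next
    have "continuous_on UNIV (primitive h x)" by (meson DERIV_isCont continuous_at_imp_continuous_on primitive_DERIV[where h=h and x=x, OF c])
    then have "continuous_on {0..t} (primitive h x)" by (rule continuous_on_subset) simp
    then show "continuous_on {0..t} ?\<phi>" using q by (auto intro!: continuous_intros continuous_on_powr')
  qed
  moreover have "a * t powr q = h x t * t"
  proof -
    have "t powr q = t powr (q - 1) * t" using t powr_add[of t "q - 1" 1] by simp
    then show ?thesis using t by (simp add: a_def)
  qed
  ultimately have "primitive h x t \<le> h x t * t / q" by (simp add: primitive_0)
  then show ?thesis using q by (simp add: pos_le_divide_eq mult.commute)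
qed

text \<open>Negative arguments are reflected to positive ones, which exchanges the two
  half-lines.\<close>

lemma primitive_le:
  assumes c: "continuous_on UNIV (h x)" and q: "0 < q"
    and mono: "mono_on {..<0} (\<lambda>u. h x u / abs u powr (q - 1))" "mono_on {0<..} (\<lambda>u. h x u / abs u powr (q - 1))"
  shows "q * primitive h x t \<le> h x t * t"
proof -
  consider "t = 0" | "t > 0" | "t < 0" by linarith
  then show ?thesis
  proof cases
    case 3
    have "q * primitive (\<lambda>x s. - h x (- s)) x (- t) \<le> - h x (- (- t)) * (- t)"
    proof (rule primitive_le_pos[OF _ q])
      show "continuous_on UNIV (\<lambda>s. - h x (- s))" by (intro continuous_intros continuous_on_compose2[OF c]) auto
      show "mono_on {0<..} (\<lambda>u. - h x (- u) / abs u powr (q - 1))"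
      proof (rule monotone_onI)
        fix u v :: real assume uv: "u \<in> {0<..}" "v \<in> {0<..}" "u \<le> v"
        show "- h x (- u) / abs u powr (q - 1) \<le> - h x (- v) / abs v powr (q - 1)" using monotone_onD[OF mono(1), of "- v" "- u"] uv by simp
      qed
    qed (use 3 in simp)
    then show ?thesis unfolding primitive_reflect[where h=h and x=x, OF c] by simp
  qed (use primitive_le_pos[where h=h and x=x, OF c q _ mono(2)] in \<open>simp_all add: primitive_0\<close>)
qed

text \<open>The factor \<open>u\<close> aligns the half-lines: for u < 0 the order of s u and t u is
  reversed, and multiplication by u reverses the inequality once more.\<close>

lemma quotient_along_ray:
  assumes mono: "mono_on {..<0} (\<lambda>u. h u / abs u powr (q - 1))" "mono_on {0<..} (\<lambda>u. h u / abs u powr (q - 1))"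
    and st: "0 < s" "s \<le> t"
  shows "h (s * u) * u / s powr (q - 1) \<le> h (t * u) * u / t powr (q - 1 :: real)"
proof (cases "u = 0")
  case False
  let ?k = "\<lambda>u. h u / abs u powr (q - 1)"
  have eq: "h (r * u) * u / r powr (q - 1) = ?k (r * u) * abs u powr (q - 1) * u" if "r > 0" for r using that False by (simp add: abs_mult powr_mult)
  have "?k (s * u) * u \<le> ?k (t * u) * u"
  proof (cases "u > 0")
    case True
    then show ?thesis using st by (intro mult_right_mono monotone_onD[OF mono(2)]) auto
  next
    case False
    then have "u < 0" using \<open>u \<noteq> 0\<close> by simp
    then show ?thesis using st by (intro mult_right_mono_neg monotone_onD[OF mono(1)]) (auto simp: mult_pos_neg)
  qed
  then have "?k (s * u) * u * abs u powr (q - 1) \<le> ?k (t * u) * u * abs u powr (q - 1)" by (rule mult_right_mono) simp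
  then show ?thesis using eq[of s] eq[of t] st by (simp add: mult_ac)
qed simp

lemma sum_power_scale:
  assumes "2 \<le> q" "1 \<le> t" shows "sum_power q (t * w) \<le> t powr q * sum_power q w"
proof -
  have "t^2 \<le> t powr q" using assms powr_mono[of 2 q t] by simp
  then have "t^2 * w^2 \<le> t powr q * w^2" by (rule mult_right_mono) simp
  then show ?thesis using assms by (simp add: sum_power_def abs_mult powr_mult power_mult_distrib distrib_left)
qed

section \<open>The problem of the theorem in variational form\<close>

locale difference_problem =
  fixes p q :: real
    and V :: "real^3 => real"
    and f g :: "real^3 => real => real"
  assumes exponents: "2 < q" "q < p" "p < 6"
    and odd: "AE x in lebesgue. \<forall>u. f x (- u) - g x (- u) = - (f x u - g x u)"
    and V_bounded: "V \<in> Linf"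
    and V_periodic: "AE x in lebesgue. V (x + e3) = V x"
    and V_spectrum: "(INF l\<in>op_spectrum V. ereal l) > 0"
    and F1_measurable: "\<And>u. (\<lambda>x. f x u) \<in> borel_measurable lebesgue"
    and F1_periodic: "AE x in lebesgue. \<forall>u. f (x + e3) u = f x u"
    and F1_continuous: "AE x in lebesgue. continuous_on UNIV (f x)"
    and F1_growth: "\<exists>c>0. AE x in lebesgue. \<forall>u. abs (f x u) \<le> c * (1 + abs u powr (p - 1))"
    and F2: "\<forall>\<epsilon>>0. \<exists>\<delta>>0. AE x in lebesgue. \<forall>u. abs u < \<delta> \<longrightarrow> abs (f x u) \<le> \<epsilon> * abs u"
    and F3_superlinear: "\<forall>M. \<exists>R>0. AE x in lebesgue. \<forall>u. abs u > R \<longrightarrow> primitive f x u / abs u powr q \<ge> M"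
    and F3_nonneg: "AE x in lebesgue. \<forall>u. primitive f x u \<ge> 0"
    and F4: "AE x in lebesgue. mono_on {..<0} (\<lambda>u. f x u / abs u powr (q - 1))
                             \<and> mono_on {0<..} (\<lambda>u. f x u / abs u powr (q - 1))"
    and G1_measurable: "\<And>u. (\<lambda>x. g x u) \<in> borel_measurable lebesgue"
    and G1_periodic: "AE x in lebesgue. \<forall>u. g (x + e3) u = g x u"
    and G1_continuous: "AE x in lebesgue. continuous_on UNIV (g x)"
    and G1_growth: "\<exists>c>0. AE x in lebesgue. \<forall>u. abs (g x u) \<le> c * (1 + abs u powr (q - 1))"
    and G2: "\<forall>\<epsilon>>0. \<exists>\<delta>>0. AE x in lebesgue. \<forall>u. abs u < \<delta> \<longrightarrow> abs (g x u) \<le> \<epsilon> * abs u"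
    and G3_antimono: "AE x in lebesgue. antimono_on {..<0} (\<lambda>u. g x u / abs u powr (q - 1))
                                      \<and> antimono_on {0<..} (\<lambda>u. g x u / abs u powr (q - 1))"
begin

definition h :: "real^3 => real => real" where "h x t = f x t - g x t"

lemma h_eq: "h = (\<lambda>x t. f x t - g x t)" by (simp add: fun_eq_iff h_def)

sublocale F: superposition f p by (rule superposition_intro[OF _ _ _ F1_measurable F1_continuous F1_growth F2]) (use exponents in auto)

text \<open>Here \<open>g\<close> keeps its own exponent \<open>q\<close>, so that its primitive is
  bounded by \<open>sum_power q\<close> and grows along rays no faster than t^q. Inside
  \<open>h\<close> it is treated at the exponent \<open>p\<close>.\<close>

sublocale G: superposition g q by (rule superposition_intro[OF _ _ _ G1_measurable G1_continuous G1_growth G2]) (use exponents in auto)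

sublocale H: superposition h p unfolding h_eq
  by (rule superposition_diff[OF F.superposition_axioms superposition_intro[OF _ _ _ G1_measurable G1_continuous G1_growth G2]])
    (use exponents in auto)

lemma h_quotient:
  "AE x in lebesgue. continuous_on UNIV (h x) \<and> mono_on {..<0} (\<lambda>u. h x u / abs u powr (q - 1))
     \<and> mono_on {0<..} (\<lambda>u. h x u / abs u powr (q - 1))"
proof -
  have *: "mono_on S (\<lambda>u. h x u / abs u powr (q - 1))"
    if "mono_on S (\<lambda>u. f x u / abs u powr (q - 1))" "antimono_on S (\<lambda>u. g x u / abs u powr (q - 1))" for S x
    using that by (auto simp: monotone_on_def h_def diff_divide_distrib intro!: diff_mono)
  show ?thesis using H.h_continuous F4 G3_antimono by eventually_elim (simp add: *)
qed

lemma primitive_h: "AE x in lebesgue. \<forall>t. primitive h x t = primitive f x t - primitive g x t" using F1_continuous G1_continuous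
proof eventually_elim
  case (elim x)
  then show ?case unfolding h_eq by (intro allI primitive_diff)
qed

lemma h_periodic: "AE x in lebesgue. \<forall>t. h (x + e3) t = h x t" using F1_periodic G1_periodic by eventually_elim (simp add: h_def)

lemma ambrosetti_rabinowitz: "q * H.\<K> U \<le> H.\<K>' U U"
proof -
  have q: "0 < q" using exponents by simp
  have "(LINT x|lebesgue. q * primitive h x (rep U x)) \<le> H.\<K>' U U" unfolding H.\<K>'_def
  proof (rule integral_mono_AE[OF _ H.integrable_h_rep])
    show "integrable lebesgue (\<lambda>x. q * primitive h x (rep U x))" using H.integrable_primitive by simp
    show "AE x in lebesgue. q * primitive h x (rep U x) \<le> h x (rep U x) * rep U x" using h_quotient
    proof eventually_elim
      case (elim x)
      show ?case by (rule primitive_le[where h=h and x=x, OF _ q]) (use elim in simp_all)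
    qed
  qed
  then show ?thesis by (simp add: H.\<K>_def)
qed

lemma derivative_along_ray:
  assumes st: "0 < s" "s \<le> t"
  shows "H.\<K>' (s *\<^sub>R U) U / s powr (q - 1) \<le> H.\<K>' (t *\<^sub>R U) U / t powr (q - 1)"
proof -
  have "(LINT x|lebesgue. h x (rep (s *\<^sub>R U) x) * rep U x / s powr (q - 1))
      \<le> (LINT x|lebesgue. h x (rep (t *\<^sub>R U) x) * rep U x / t powr (q - 1))"
  proof (rule integral_mono_AE)
    show "AE x in lebesgue. h x (rep (s *\<^sub>R U) x) * rep U x / s powr (q - 1)
        \<le> h x (rep (t *\<^sub>R U) x) * rep U x / t powr (q - 1)" using h_quotient rep_scaleR_AE[of s U] rep_scaleR_AE[of t U]
    proof eventually_elim
      case (elim x)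
      show ?case unfolding elim(2,3) by (rule quotient_along_ray[OF _ _ st]) (use elim(1) in simp_all)
    qed
  qed (intro integrable_divide H.integrable_h_rep)+
  then show ?thesis by (simp add: H.\<K>'_def)
qed

lemma nonzero_level:
  assumes "U \<noteq> 0" obtains e where "e > 0" "\<not> (AE x in lebesgue. abs (rep U x) \<le> e)"
proof -
  have "\<exists>n. \<not> (AE x in lebesgue. abs (rep U x) \<le> inverse (real (Suc n)))"
  proof (rule ccontr)
    assume "\<not> ?thesis"
    then have "AE x in lebesgue. \<forall>n. abs (rep U x) \<le> inverse (real (Suc n))" by (simp add: AE_all_countable)
    then have "AE x in lebesgue. rep U x = rep 0 x" using rep_zero_AE
    proof eventually_elim
      case (elim x)
      have "abs (rep U x) \<le> 0" by (rule LIMSEQ_le_const[OF LIMSEQ_inverse_real_of_nat]) (use elim(1) in blast)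
      then show ?case using elim(2) by simp
    qed
    then show False using assms xfun_eqI by blast
  qed
  then show ?thesis using that by (metis inverse_positive_iff_positive of_nat_0_less_iff zero_less_Suc)
qed

text \<open>Where |w| > e, the scaled function exceeds R as soon as t \<ge> R / e, so the primitive
  of \<open>f\<close> is at least A |t w|^q there; elsewhere it is nonnegative. The primitive of
  \<open>g\<close> costs at most C t^q times a fixed energy, which a large \<open>A\<close>
  outweighs.\<close>

lemma superpower_along_ray:
  assumes U: "U \<noteq> 0" shows "\<exists>t\<ge>1. B * t powr q \<le> H.\<K> (t *\<^sub>R U)"
proof -
  let ?w = "rep U"
  have q2: "2 \<le> q" "q < 6" using exponents by auto
  obtain e where e: "e > 0" "\<not> (AE x in lebesgue. abs (?w x) \<le> e)" by (rule nonzero_level[OF U])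
  define S where "S = {x. e < abs (?w x)}"
  have S: "S \<in> sets lebesgue"
  proof -
    have "{x \<in> space lebesgue. e < abs (?w x)} \<in> sets lebesgue" by measurable
    then show ?thesis by (simp add: S_def)
  qed
  define k where "k x = indicator S x * abs (?w x) powr q" for x
  obtain C0 where "\<And>U. integrable lebesgue (\<lambda>x. abs (rep U x) powr q)" using sobolev[OF q2] by blast
  then have ik: "integrable lebesgue k" unfolding k_def using integrable_mult_indicator[OF S, of "\<lambda>x. abs (?w x) powr q"] by simp
  define I where "I = (LINT x|lebesgue. k x)"
  have "I \<noteq> 0"
  proof
    assume "I = 0"
    then have "AE x in lebesgue. k x = 0" unfolding I_def by (subst (asm) integral_nonneg_eq_0_iff_AE[OF ik]) (auto simp: k_def)
    then have "AE x in lebesgue. abs (?w x) \<le> e"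
    proof eventually_elim
      case (elim x)
      then show ?case using e(1) by (cases "x \<in> S") (auto simp: k_def S_def)
    qed
    with e(2) show False ..
  qed
  moreover have "0 \<le> I" unfolding I_def by (rule integral_nonneg_AE) (simp add: k_def)
  ultimately have I: "0 < I" by simp
  obtain C where C: "C \<ge> 0" "AE x in lebesgue. \<forall>t. abs (primitive g x t) \<le> C * sum_power q t" using G.primitive_bound by blast
  define E where "E = power_energy q U"
  \<comment> \<open>Solves A I - C E = B, so that the lower bound becomes exactly B t^q.\<close>
  define A where "A = (B + C * E) / I"
  obtain R where R: "R > 0" "AE x in lebesgue. \<forall>u. abs u > R \<longrightarrow> primitive f x u / abs u powr q \<ge> A" using F3_superlinear by blast
  define t where "t = max 1 (R / e)"
  have t: "1 \<le> t" "R \<le> t * e" using e(1) by (auto simp: t_def max_def field_simps)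
  have isum: "integrable lebesgue (\<lambda>x. sum_power q (?w x))" by (rule power_energy(1)) (use exponents in auto)
  have ik': "integrable lebesgue (\<lambda>x. A * t powr q * k x)" "integrable lebesgue (\<lambda>x. C * t powr q * sum_power q (?w x))"
    using ik isum by simp_all
  have "(LINT x|lebesgue. A * t powr q * k x - C * t powr q * sum_power q (?w x)) \<le> H.\<K> (t *\<^sub>R U)" unfolding H.\<K>_def
  proof (rule integral_mono_AE[OF Bochner_Integration.integrable_diff[OF ik'] H.integrable_primitive])
    show "AE x in lebesgue. A * t powr q * k x - C * t powr q * sum_power q (?w x) \<le> primitive h x (rep (t *\<^sub>R U) x)"
      using R(2) C(2) F3_nonneg primitive_h rep_scaleR_AE[of t U]
    proof eventually_elim
      case (elim x)
      have "A * t powr q * k x \<le> primitive f x (t * ?w x)"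
      proof (cases "x \<in> S")
        case True
        then have "e < abs (?w x)" by (simp add: S_def)
        then have "t * e < abs (t * ?w x)" using t(1) by (simp add: abs_mult)
        then have "R < abs (t * ?w x)" using t(2) by linarith
        then have "A \<le> primitive f x (t * ?w x) / abs (t * ?w x) powr q" using elim(1) by blast
        then have "A * abs (t * ?w x) powr q \<le> primitive f x (t * ?w x)"
          using \<open>R < abs (t * ?w x)\<close> R(1) by (subst (asm) pos_le_divide_eq) auto
        then show ?thesis using True t(1) by (simp add: k_def abs_mult powr_mult mult.assoc)
      next
        case False
        then show ?thesis using elim(3) by (simp add: k_def)
      qed
      moreover have "abs (primitive g x (t * ?w x)) \<le> C * t powr q * sum_power q (?w x)"
      proof -
        have "abs (primitive g x (t * ?w x)) \<le> C * sum_power q (t * ?w x)" using elim(2) by blast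
        also have "\<dots> \<le> C * (t powr q * sum_power q (?w x))" by (rule mult_left_mono[OF sum_power_scale[OF q2(1) t(1)] C(1)])
        finally show ?thesis by (simp add: mult.assoc)
      qed
      moreover have "primitive h x (rep (t *\<^sub>R U) x) = primitive f x (t * ?w x) - primitive g x (t * ?w x)"
        unfolding elim(5) using elim(4) by blast
      ultimately show ?case by linarith
    qed
  qed
  moreover have "(LINT x|lebesgue. A * t powr q * k x - C * t powr q * sum_power q (?w x)) = A * t powr q * I - C * t powr q * E"
    using ik' by (simp add: I_def E_def power_energy_def)
  moreover have "A * t powr q * I - C * t powr q * E = B * t powr q"
  proof -
    have "A * I = B + C * E" using I by (simp add: A_def)
    then have "A * t powr q * I = (B + C * E) * t powr q" by (simp add: mult_ac)
    then show ?thesis by (simp add: algebra_simps)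
  qed
  ultimately show ?thesis using t(1) by (intro exI[of _ t]) simp
qed

text \<open>By \<open>ambrosetti_rabinowitz\<close> it is enough that q times \<open>H.\<K>\<close>
  beats t^2 b, where b is the form at \<open>U\<close>. The choice B = (b + 1)/q achieves this, as
  t^2 \<le> t^q for t \<ge> 1.\<close>

lemma superquadratic_along_ray:
  assumes U: "U \<noteq> 0" and b: "0 \<le> xform V U U"
  shows "\<exists>t>0. xform V (t *\<^sub>R U) (t *\<^sub>R U) < H.\<K>' (t *\<^sub>R U) (t *\<^sub>R U)"
proof -
  interpret b: bounded_bilinear "xform V" by (rule xform_bounded_bilinear[OF V_bounded])
  let ?b = "xform V U U"
  obtain t where t: "1 \<le> t" "(?b + 1) / q * t powr q \<le> H.\<K> (t *\<^sub>R U)" using superpower_along_ray[OF U] by blast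
  have q: "0 < q" using exponents by simp
  have tq: "t^2 \<le> t powr q" using exponents t(1) powr_mono[of 2 q t] by simp
  have "xform V (t *\<^sub>R U) (t *\<^sub>R U) = t^2 * ?b" by (simp add: b.scaleR_left b.scaleR_right power2_eq_square)
  also have "\<dots> < t powr q * (?b + 1)"
  proof -
    have "t^2 * ?b \<le> t powr q * ?b" using tq b by (rule mult_right_mono)
    moreover have "0 < t powr q" using t(1) by simp
    ultimately show ?thesis unfolding distrib_left mult_1_right by linarith
  qed
  also have "\<dots> = q * ((?b + 1) / q * t powr q)" using q by simp
  also have "\<dots> \<le> q * H.\<K> (t *\<^sub>R U)" using t(2) q by (intro mult_left_mono) auto
  also have "\<dots> \<le> H.\<K>' (t *\<^sub>R U) (t *\<^sub>R U)" by (rule ambrosetti_rabinowitz)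
  finally show ?thesis using t(1) by (intro exI[of _ t]) simp
qed

lemma palais_smale:
  obtains U M \<eta> where "M > 0" "\<eta> > 0" "\<And>n. norm (U n) \<le> M" "\<And>n. \<eta> \<le> (LINT x|lebesgue. abs (rep (U n) x) powr p)"
    "\<And>n W. \<bar>xform V (U n) W - H.\<K>' (U n) W\<bar> \<le> inverse (real (Suc n)) * norm W"
proof -
  obtain c where c: "c > 0" "\<And>U. c * (norm U)^2 \<le> xform V U U" by (rule xform_coercive[OF V_bounded V_spectrum]) (rule that; assumption)
  have b0: "0 \<le> xform V U U" for U using c(2)[of U] c(1) by (meson mult_nonneg_nonneg order_trans less_imp_le zero_le_power2)
  have c2: "c / 2 > 0" using c by simp
  obtain \<rho> where \<rho>: "\<rho> > 0" "\<And>U. norm U \<le> \<rho> ==> \<bar>H.\<K>' U U\<bar> \<le> c / 2 * (norm U)^2" using H.\<K>'_small[OF c2] by blast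
  \<comment> \<open>Coercivity explains the radius: b u u \<le> (sqrt c \<rho>)^2 forces |u| \<le>
    \<rho>, where K' u u is at most c/2 |u|^2 and hence at most b u u / 2.\<close>
  have N: "nehari (xform V) H.\<K> H.\<K>' q (sqrt c * \<rho>) c"
  proof (rule nehari.intro)
    show "bounded_bilinear (xform V)" by (rule xform_bounded_bilinear[OF V_bounded])
    show "xform V u v = xform V v u" for u v by (rule xform_commute)
    show "xform V u u \<le> (sqrt c * \<rho>)^2 ==> H.\<K>' u u \<le> xform V u u / 2" for u
    proof -
      assume "xform V u u \<le> (sqrt c * \<rho>)^2"
      moreover have "(sqrt c * \<rho>)^2 = c * \<rho>^2" unfolding power_mult_distrib using c(1) by simp
      ultimately have "c * (norm u)^2 \<le> c * \<rho>^2" using c(2)[of u] by linarith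
      then have "(norm u)^2 \<le> \<rho>^2" using c(1) by (rule mult_left_le_imp_le)
      then have "norm u \<le> \<rho>" by (rule power2_le_imp_le) (use \<rho>(1) in simp)
      from \<rho>(2)[OF this] c(2)[of u] show ?thesis by linarith
    qed
    show "u \<noteq> 0 ==> \<exists>t>0. xform V (t *\<^sub>R u) (t *\<^sub>R u) < H.\<K>' (t *\<^sub>R u) (t *\<^sub>R u)" for u
      by (rule superquadratic_along_ray[OF _ b0])
    show "(H.\<K> has_derivative H.\<K>' u) (at u)" for u by (rule H.\<K>_has_derivative)
    show "X \<longlonglongrightarrow> x ==> Y \<longlonglongrightarrow> y ==> (\<lambda>n. H.\<K>' (X n) (Y n)) \<longlonglongrightarrow> H.\<K>' x y" for X Y x y by (rule H.\<K>'_continuous)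
    show "q * H.\<K> u \<le> H.\<K>' u u" for u by (rule ambrosetti_rabinowitz)
    show "0 < s ==> s \<le> t ==> H.\<K>' (s *\<^sub>R u) u / s powr (q - 1) \<le> H.\<K>' (t *\<^sub>R u) u / t powr (q - 1)" for s t u
      by (rule derivative_along_ray)
  qed (use c \<rho> exponents in auto)
  obtain U M where U: "\<And>n. norm (U n) \<le> M" "\<And>n. (sqrt c * \<rho>)^2 < xform V (U n) (U n)" "\<And>n. H.\<K>' (U n) (U n) = xform V (U n) (U n)"
    "\<And>n W. \<bar>xform V (U n) W - H.\<K>' (U n) W\<bar> \<le> inverse (real (Suc n)) * norm W"
    by (rule nehari.palais_smale_sequence[OF N xfun_nontrivial]) (rule that; assumption)
  obtain C where C: "C \<ge> 0" "\<And>U. \<bar>H.\<K>' U U\<bar> \<le> c / 2 * (norm U)^2 + C * (LINT x|lebesgue. abs (rep U x) powr p)"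
    using H.\<K>'_self_bound[OF c2] by blast
  \<comment> \<open>On the Nehari set b u u = K' u u is at most c/2 |u|^2 plus C times the L^p
    integral. The first term is absorbed by half of b u u, and the other half still exceeds (sqrt c
    \<rho>)^2 / 2.\<close>
  define \<eta> where "\<eta> = (sqrt c * \<rho>)^2 / (2 * (C + 1))"
  have C1: "0 < C + 1" using C(1) by linarith
  show ?thesis
  proof (rule that[of "abs M + 1" \<eta> U])
    show "\<eta> > 0" using c(1) \<rho>(1) C1 by (simp add: \<eta>_def)
    show "norm (U n) \<le> abs M + 1" for n using U(1)[of n] by linarith
    show "\<eta> \<le> (LINT x|lebesgue. abs (rep (U n) x) powr p)" for n
    proof -
      let ?I = "LINT x|lebesgue. abs (rep (U n) x) powr p"
      have I: "0 \<le> ?I" by (rule integral_nonneg_AE) simp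
      have "xform V (U n) (U n) / 2 \<le> C * ?I" using C(2)[of "U n"] U(3)[of n] c(2)[of "U n"] by linarith
      also have "\<dots> \<le> (C + 1) * ?I" using I by (intro mult_right_mono) auto
      finally have "(sqrt c * \<rho>)^2 \<le> ?I * (2 * (C + 1))" using U(2)[of n] by (simp add: algebra_simps)
      then show ?thesis unfolding \<eta>_def using C1 by (simp add: pos_divide_le_eq)
    qed
  qed (use U(4) in auto)
qed

text \<open>Form, derivative and norm are invariant under the axial translations, so the translated
  sequence is as good as the original. The equation passes to the limit because the form is bounded
  and linear in its first argument and \<open>H.\<K>'\<close> is weakly continuous; the mass kept on
  a fixed ball excludes the limit 0.\<close>

theorem nontrivial_critical_point:
  obtains U where "U \<noteq> 0" "\<And>W. xform V U W = H.\<K>' U W"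
proof -
  interpret b: bounded_bilinear "xform V" by (rule xform_bounded_bilinear[OF V_bounded])
  obtain U M \<eta> where M: "M > 0" "\<eta> > 0" and U: "\<And>n. norm (U n) \<le> M" "\<And>n. \<eta> \<le> (LINT x|lebesgue. abs (rep (U n) x) powr p)"
    "\<And>n W. \<bar>xform V (U n) W - H.\<K>' (U n) W\<bar> \<le> inverse (real (Suc n)) * norm W" by (rule palais_smale) (rule that; assumption)
  obtain n :: nat and \<delta> where \<delta>: "0 < \<delta>" and nv: "\<And>U. norm U \<le> M ==> \<eta> \<le> (LINT x|lebesgue. abs (rep U x) powr p) ==>
      \<exists>l. \<delta> \<le> (LINT x:cball 0 (real n)|lebesgue. (rep (xshift l U) x)^2)" by (rule nonvanishing[OF H.p M]) (rule that; assumption)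
  have "\<forall>k. \<exists>l. \<delta> \<le> (LINT x:cball 0 (real n)|lebesgue. (rep (xshift l (U k)) x)^2)" using nv[OF U(1,2)] by blast
  then obtain l where l: "\<And>k. \<delta> \<le> (LINT x:cball 0 (real n)|lebesgue. (rep (xshift (l k) (U k)) x)^2)" by metis
  define Y where "Y k = xshift (l k) (U k)" for k
  have Y: "norm (Y k) \<le> M" for k using U(1) by (simp add: Y_def norm_xshift)
  have crit: "\<bar>xform V (Y k) W - H.\<K>' (Y k) W\<bar> \<le> inverse (real (Suc k)) * norm W" for k W
  proof -
    \<comment> \<open>The test direction is translated back, so that the estimate for
      \<open>U k\<close> applies with the same norm.\<close>
    let ?W = "xshift (- l k) W"
    have W: "xshift (l k) ?W = W" by (rule xshift_inverse)
    have "xform V (Y k) W = xform V (U k) ?W" unfolding Y_def using xform_xshift[OF V_bounded V_periodic, of "l k" "U k" ?W] by (simp add: W)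
    moreover have "H.\<K>' (Y k) W = H.\<K>' (U k) ?W" unfolding Y_def using H.\<K>'_xshift[OF h_periodic, of "l k" "U k" ?W] by (simp add: W)
    ultimately show ?thesis using U(3)[of k ?W] by (simp add: norm_xshift)
  qed
  obtain r V0 where r: "strict_mono (r :: nat => nat)"
    and wd: "(\<lambda>k. wdist (rep (Y (r k))) (rep V0)) \<longlonglongrightarrow> 0"
    and ae: "AE x in lebesgue. (\<lambda>k. rep (Y (r k)) x) \<longlonglongrightarrow> rep V0 x"
    and weak: "\<And>\<phi> \<beta>. bounded_linear \<phi> ==> (\<lambda>k. \<phi> (Y (r k)) :: real) \<longlonglongrightarrow> \<beta> ==> \<phi> V0 = \<beta>"
    by (rule weak_compactness[of Y M, OF Y]) (rule that; assumption)
  show ?thesis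
  proof (rule that[of V0])
    show "xform V V0 W = H.\<K>' V0 W" for W
    proof (rule weak[of "\<lambda>U. xform V U W", OF b.bounded_linear_left])
      have "(\<lambda>k. inverse (real (Suc (r k))) * norm W) \<longlonglongrightarrow> 0 * norm W"
        using LIMSEQ_subseq_LIMSEQ[OF LIMSEQ_inverse_real_of_nat r] by (intro tendsto_mult_right) (simp add: o_def)
      then have z: "(\<lambda>k. inverse (real (Suc (r k))) * norm W) \<longlonglongrightarrow> 0" unfolding mult_zero_left .
      have "\<forall>\<^sub>F k in sequentially. norm (xform V (Y (r k)) W - H.\<K>' (Y (r k)) W) \<le> inverse (real (Suc (r k))) * norm W"
        unfolding real_norm_def by (rule always_eventually) (rule allI, rule crit)
      from Lim_null_comparison[OF this z] have "(\<lambda>k. xform V (Y (r k)) W - H.\<K>' (Y (r k)) W) \<longlonglongrightarrow> 0" .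
      from tendsto_add[OF this H.\<K>'_weakly_continuous[of "\<lambda>k. Y (r k)" M V0 W, OF Y ae]]
      show "(\<lambda>k. xform V (Y (r k)) W) \<longlonglongrightarrow> H.\<K>' V0 W" by simp
    qed
    show "V0 \<noteq> 0"
    proof
      assume V0: "V0 = 0"
      \<comment> \<open>Local mass is visible to the weighted distance because the weight is at
        least \<open>a\<close> on the ball.\<close>
      obtain a where a: "a > 0" "\<And>x. x \<in> cball 0 (real n) ==> a \<le> weight x" using weight_lower[of n] by blast
      let ?B = "cball (0::real^3) (real n)"
      have "a * \<delta> \<le> wdist (rep (Y (r k))) (rep V0)" for k
      proof -
        let ?y = "rep (Y (r k))"
        have d: "integrable lebesgue (\<lambda>x. (?y x - rep V0 x)^2)" using L2_D(2)[OF L2_diff[OF rep_L2(1)[of "Y (r k)"] rep_L2(1)[of V0]]] by simp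
        have y: "integrable lebesgue (\<lambda>x. (?y x)^2)" using L2_D(2)[OF rep_L2(1)[of "Y (r k)"]] by simp
        have iB: "integrable lebesgue (\<lambda>x. a * (indicator ?B x * (?y x)^2))"
          using integrable_mult_indicator[OF cball_lebesgue y, of 0 "real n"] by simp
        have "a * \<delta> \<le> a * (LINT x:?B|lebesgue. (?y x)^2)" using l[of "r k"] a(1) by (simp add: Y_def)
        also have "\<dots> = (LINT x|lebesgue. a * (indicator ?B x * (?y x)^2))" by (simp add: set_lebesgue_integral_def)
        also have "\<dots> \<le> wdist ?y (rep V0)" unfolding wdist_def
        proof (rule integral_mono_AE[OF iB weight_mult_integrable[OF d]])
          show "AE x in lebesgue. a * (indicator ?B x * (?y x)^2) \<le> weight x * (?y x - rep V0 x)^2" using rep_zero_AE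
          proof eventually_elim
            case (elim x)
            show ?case
            proof (cases "x \<in> ?B")
              case True
              then have "a * (?y x)^2 \<le> weight x * (?y x)^2" using a(2) by (intro mult_right_mono) auto
              then show ?thesis using True elim by (simp add: V0)
            next
              case False
              then show ?thesis using weight_nonneg[of x] by simp
            qed
          qed
        qed
        finally show ?thesis .
      qed
      then have "a * \<delta> \<le> 0" by (intro LIMSEQ_le_const[OF wd]) blast
      then show False using a(1) \<delta> by (simp add: mult_le_0_iff)
    qed
  qed
qed

text \<open>Passage from functions to classes: form and primitives see a function only up to null
  sets, so the energy becomes a functional on the Hilbert space type.\<close>

lemma energy_eq:
  assumes w: "w \<in> X_space"
  shows "energy V f g w = 1/2 * xform V (cls w) (cls w) - H.\<K> (cls w)"
proof -
  have wd: "w \<in> form_dom" using w by (simp add: X_space_iff)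
  have wm: "w \<in> borel_measurable lebesgue" by (rule L2_D(1)[OF form_domD(1)[OF wd]])
  let ?U = "cls w"
  note ae = rep_abs[OF w]
  have "(LINT x|lebesgue. (norm (wgrad w x))^2 + (w x)^2 / (rad x)^2 + V x * (w x)^2) = qform V w w"
    unfolding qform_def power2_norm_eq_inner by (simp add: power2_eq_square mult.assoc)
  also have "\<dots> = xform V ?U ?U" unfolding xform_def by (rule sym, rule qform_cong_AE[OF V_bounded rep_form_dom wd ae rep_form_dom wd ae])
  finally have 1: "(LINT x|lebesgue. (norm (wgrad w x))^2 + (w x)^2 / (rad x)^2 + V x * (w x)^2) = xform V ?U ?U" .
  have 2: "(LINT x|lebesgue. primitive f x (w x)) = F.\<K> ?U" unfolding F.\<K>_def
    by (rule integral_cong_AE[OF F.primitive_comp_measurable[OF wm] F.primitive_comp_measurable[OF rep_measurable]])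
      (use ae in eventually_elim, simp)
  have 3: "(LINT x|lebesgue. primitive g x (w x)) = G.\<K> ?U" unfolding G.\<K>_def
    by (rule integral_cong_AE[OF G.primitive_comp_measurable[OF wm] G.primitive_comp_measurable[OF rep_measurable]])
      (use ae in eventually_elim, simp)
  have "H.\<K> ?U = (LINT x|lebesgue. primitive f x (rep ?U x) - primitive g x (rep ?U x))" unfolding H.\<K>_def
    by (rule integral_cong_AE[OF borel_measurable_integrable[OF H.integrable_primitive]
          borel_measurable_integrable[OF Bochner_Integration.integrable_diff[OF F.integrable_primitive G.integrable_primitive]]])
      (use primitive_h in eventually_elim, simp)
  also have "\<dots> = F.\<K> ?U - G.\<K> ?U"
    unfolding F.\<K>_def G.\<K>_def by (rule Bochner_Integration.integral_diff[OF F.integrable_primitive G.integrable_primitive])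
  finally show ?thesis unfolding energy_def 1 2 3 by simp
qed

text \<open>By symmetry of the form, the derivative of the energy on classes is the form minus
  \<open>H.\<K>'\<close>, which vanishes by assumption. \<open>has_X_derivative\<close> is the same
  estimate read on representatives.\<close>

lemma weak_solutionI:
  assumes w: "w \<in> X_space" and crit: "\<And>W. xform V (cls w) W = H.\<K>' (cls w) W"
  shows "weak_solution V f g w"
proof -
  let ?U = "cls w" and ?E = "\<lambda>U. 1/2 * xform V U U - H.\<K> U"
  have E: "(?E has_derivative (\<lambda>_. 0)) (at ?U)"
  proof -
    have d: "((\<lambda>U. xform V U U) has_derivative (\<lambda>H. xform V ?U H + xform V H ?U)) (at ?U)"
      by (rule bounded_bilinear.FDERIV[OF xform_bounded_bilinear[OF V_bounded] has_derivative_ident has_derivative_ident])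
    have "(?E has_derivative (\<lambda>W. 1/2 * (xform V ?U W + xform V W ?U) - H.\<K>' ?U W)) (at ?U)"
      by (rule has_derivative_diff[OF has_derivative_mult_right[OF d] H.\<K>_has_derivative])
    moreover have "(\<lambda>W. 1/2 * (xform V ?U W + xform V W ?U) - H.\<K>' ?U W) = (\<lambda>_. 0)"
      by (rule ext) (simp add: xform_commute[of V _ ?U] crit)
    ultimately show ?thesis by simp
  qed
  have add: "cls (\<lambda>x. w x + v x) = ?U + cls v" if v: "v \<in> X_space" for v
  proof (rule xfun_eqI)
    show "AE x in lebesgue. rep (cls (\<lambda>x. w x + v x)) x = rep (?U + cls v) x"
      using rep_abs[OF X_space_add[OF w v]] rep_plus_AE[of ?U "cls v"] rep_abs[OF w] rep_abs[OF v] by eventually_elim simp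
  qed
  have "has_X_derivative (energy V f g) (\<lambda>_. 0) w" unfolding has_X_derivative_def
  proof (intro conjI allI impI)
    show "\<exists>C. \<forall>v\<in>X_space. abs 0 \<le> C * X_norm v" by (rule exI[of _ 0]) simp
    fix e :: real assume e: "e > 0"
    then obtain d where d: "d > 0" "\<And>W. norm (W - ?U) < d ==> norm (?E W - ?E ?U - 0) \<le> e * norm (W - ?U)"
      using E unfolding has_derivative_at_alt by blast
    show "\<exists>d>0. \<forall>v\<in>X_space. X_norm v < d \<longrightarrow> \<bar>energy V f g (\<lambda>x. w x + v x) - energy V f g w - 0\<bar> \<le> e * X_norm v"
    proof (intro exI[of _ d] conjI ballI impI d(1))
      fix v assume v: "v \<in> X_space" and small: "X_norm v < d"
      have "norm (?E (?U + cls v) - ?E ?U - 0) \<le> e * norm (?U + cls v - ?U)"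
        by (rule d(2)) (use small in \<open>simp add: X_norm_abs[OF v]\<close>)
      then show "\<bar>energy V f g (\<lambda>x. w x + v x) - energy V f g w - 0\<bar> \<le> e * X_norm v"
        unfolding energy_eq[OF w] energy_eq[OF X_space_add[OF w v]] add[OF v] X_norm_abs[OF v] by simp
    qed
  qed simp
  then show ?thesis using w by (simp add: weak_solution_def X_critical_point_def)
qed

text \<open>By oddness the derivative at the negative of \<open>U\<close> is the negative of the
  derivative at \<open>U\<close>, for the form and for \<open>H.\<K>'\<close> alike.\<close>

lemma weak_solution_pair:
  assumes crit: "\<And>W. xform V U W = H.\<K>' U W"
  shows "weak_solution V f g (rep U)" "weak_solution V f g (\<lambda>x. - rep U x)"
proof -
  show "weak_solution V f g (rep U)" by (rule weak_solutionI[OF rep_X]) (simp add: abs_rep crit)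
  interpret b: bounded_bilinear "xform V" by (rule xform_bounded_bilinear[OF V_bounded])
  have neg: "cls (\<lambda>x. - rep U x) = - U"
    by (rule xfun_eqI) (use rep_abs[OF X_space_uminus[OF rep_X[of U]]] rep_uminus_AE[of U] in eventually_elim, simp)
  show "weak_solution V f g (\<lambda>x. - rep U x)"
  proof (rule weak_solutionI[OF X_space_uminus[OF rep_X]])
    fix W
    have "H.\<K>' (- U) W = (LINT x|lebesgue. - (h x (rep U x) * rep W x))" unfolding H.\<K>'_def
    proof (rule integral_cong_AE)
      show "AE x in lebesgue. h x (rep (- U) x) * rep W x = - (h x (rep U x) * rep W x)"
        using odd rep_uminus_AE[of U] by eventually_elim (simp only: h_def mult_minus_left)
    qed (intro borel_measurable_uminus borel_measurable_integrable[OF H.integrable_h_rep])+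
    then show "xform V (cls (\<lambda>x. - rep U x)) W = H.\<K>' (cls (\<lambda>x. - rep U x)) W"
      unfolding neg by (simp add: b.minus_left crit H.\<K>'_def)
  qed
qed

lemma critical_xshift:
  assumes crit: "\<And>W. xform V U W = H.\<K>' U W" shows "xform V (xshift k U) W = H.\<K>' (xshift k U) W"
proof -
  have W: "xshift k (xshift (- k) W) = W" by (rule xshift_inverse)
  show ?thesis using xform_xshift[OF V_bounded V_periodic, of k U "xshift (- k) W"] H.\<K>'_xshift[OF h_periodic, of k U "xshift (- k) W"]
      crit[of "xshift (- k) W"] by (simp add: W)
qed

end

text \<open>By periodicity a slab around x3 = 0 has the same mass as its translates by multiples of
  \<open>m\<close>. These translates eventually leave every point, so their masses tend to 0 by
  dominated convergence.\<close>

lemma periodic_integrable_zero: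
  fixes w :: "real^3 => real"
  assumes w: "integrable lebesgue w" and pos: "\<And>x. 0 \<le> w x" and m: "m \<noteq> 0" and per: "AE x in lebesgue. w (up m x) = w x"
  shows "AE x in lebesgue. w x = 0"
proof -
  have per': "AE x in lebesgue. w (up (int j * m) x) = w x" for j
  proof (induction j)
    case (Suc j)
    from up.AE_comp[OF per, of "int j * m"] Suc show ?case by eventually_elim (simp add: algebra_simps)
  qed simp
  define I :: "nat => real^3 => real" where "I n = indicator {x. abs (x$3) \<le> real n}" for n
  have Sm: "{x::real^3. abs (x$3) \<le> real n} \<in> sets lebesgue" for n
  proof -
    have "closed {x::real^3. abs (x$3) \<le> real n}" by (intro closed_Collect_le continuous_intros)
    then show ?thesis by simp
  qed
  have Im: "I n \<in> borel_measurable lebesgue" for n unfolding I_def by (rule borel_measurable_indicator[OF Sm])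
  have iI: "integrable lebesgue (\<lambda>x. I n x * w x)" for n unfolding I_def using integrable_mult_indicator[OF Sm w] by simp
  have zero: "(LINT x|lebesgue. I n x * w x) = 0" for n
  proof -
    have Ium: "(\<lambda>x. I n (up (int j * m) x)) \<in> borel_measurable lebesgue" for j by (rule measurable_compose[OF up.measurable Im])
    have eq: "(LINT x|lebesgue. I n (up (int j * m) x) * w x) = (LINT x|lebesgue. I n x * w x)" for j
    proof -
      have "(LINT x|lebesgue. I n x * w x) = (LINT x|lebesgue. I n (up (int j * m) x) * w (up (int j * m) x))"
        by (rule up.integral_comp[OF borel_measurable_integrable[OF iI], symmetric])
      also have "\<dots> = (LINT x|lebesgue. I n (up (int j * m) x) * w x)"
        by (rule integral_cong_AE[OF borel_measurable_integrable[OF up.integrable_comp[OF iI]]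
              borel_measurable_times[OF Ium borel_measurable_integrable[OF w]]]) (use per'[of j] in eventually_elim, simp)
      finally show ?thesis by simp
    qed
    have "(\<lambda>j. LINT x|lebesgue. I n (up (int j * m) x) * w x) \<longlonglongrightarrow> (LINT x|(lebesgue :: (real^3) measure). (0::real))"
    proof (rule integral_dominated_convergence[where w=w])
      show "AE x in lebesgue. (\<lambda>j. I n (up (int j * m) x) * w x) \<longlonglongrightarrow> 0"
      proof (rule AE_I2)
        fix x :: "real^3"
        obtain J :: nat where J: "abs (x$3) + real n < real J" using reals_Archimedean2 by blast
        have "I n (up (int j * m) x) = 0" if j: "j \<ge> J" for j
        proof -
          have "1 \<le> abs (real_of_int m)" using m by linarith
          then have "real j * 1 \<le> real j * abs (real_of_int m)" by (intro mult_left_mono) auto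
          then have "real j \<le> abs (real j * real_of_int m)" by (simp add: abs_mult)
          moreover have "up (int j * m) x $ 3 = x$3 + real j * real_of_int m" unfolding up_3 by simp
          ultimately have "real n < abs (up (int j * m) x $ 3)" using J j by linarith
          then show ?thesis unfolding I_def by (simp del: vector_add_component)
        qed
        then show "(\<lambda>j. I n (up (int j * m) x) * w x) \<longlonglongrightarrow> 0"
          by (intro tendsto_eventually eventually_sequentiallyI[of J]) simp
      qed
      show "AE x in lebesgue. norm (I n (up (int j * m) x) * w x) \<le> w x" for j using pos by (intro AE_I2) (auto simp: I_def indicator_def)
    qed (use w Ium in auto)
    then show ?thesis unfolding eq by (simp add: LIMSEQ_const_iff)
  qed
  have "AE x in lebesgue. \<forall>n. I n x * w x = 0" unfolding AE_all_countable
  proof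
    fix n
    show "AE x in lebesgue. I n x * w x = 0" using zero[of n] by (subst (asm) integral_nonneg_eq_0_iff_AE[OF iI]) (auto simp: I_def pos)
  qed
  then show ?thesis
  proof eventually_elim
    case (elim x)
    obtain n :: nat where "abs (x$3) \<le> real n" using real_arch_simple by blast
    then have "I n x = 1" by (simp add: I_def)
    then show ?case using elim by (metis mult_1)
  qed
qed

lemma ae_class_eqD:
  assumes "v \<in> borel_measurable lebesgue" "ae_class u = ae_class v" shows "AE x in lebesgue. v x = u x"
proof -
  have "v \<in> ae_class v" using assms(1) by (simp add: ae_class_def)
  then have "v \<in> ae_class u" using assms(2) by simp
  then show ?thesis by (simp add: ae_class_def)
qed

theorem theorem8p1:
  fixes p q :: real
    and V :: "real^3 \<Rightarrow> real"
    and f g :: "real^3 \<Rightarrow> real \<Rightarrow> real"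
  assumes exponents: "2 < q" "q < p" "p < 6"
    and odd: "AE x in lebesgue. \<forall>u. f x (- u) - g x (- u) = - (f x u - g x u)"
    and V_bounded: "V \<in> Linf"
    and V_sym: "cyl_sym V"
    and V_periodic: "AE x in lebesgue. V (x + e3) = V x"
    and V_spectrum: "(INF l\<in>op_spectrum V. ereal l) > 0"
    and F1_measurable: "\<And>u. (\<lambda>x. f x u) \<in> borel_measurable lebesgue"
    and F1_periodic: "AE x in lebesgue. \<forall>u. f (x + e3) u = f x u"
    and F1_continuous: "AE x in lebesgue. continuous_on UNIV (f x)"
    and F1_invariant: "\<And>B. orthogonal_matrix B \<Longrightarrow> AE x in lebesgue. \<forall>u. f (O2_act B x) u = f x u"
    and F1_growth: "\<exists>c>0. AE x in lebesgue. \<forall>u. \<bar>f x u\<bar> \<le> c * (1 + \<bar>u\<bar> powr (p - 1))"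
    and F2: "\<forall>\<epsilon>>0. \<exists>\<delta>>0. AE x in lebesgue. \<forall>u. \<bar>u\<bar> < \<delta> \<longrightarrow> \<bar>f x u\<bar> \<le> \<epsilon> * \<bar>u\<bar>"
    and F3_superlinear: "\<forall>M. \<exists>R>0. AE x in lebesgue. \<forall>u. \<bar>u\<bar> > R \<longrightarrow> primitive f x u / \<bar>u\<bar> powr q \<ge> M"
    and F3_nonneg: "AE x in lebesgue. \<forall>u. primitive f x u \<ge> 0"
    and F4: "AE x in lebesgue. mono_on {..<0} (\<lambda>u. f x u / \<bar>u\<bar> powr (q - 1))
                             \<and> mono_on {0<..} (\<lambda>u. f x u / \<bar>u\<bar> powr (q - 1))"
    and G1_measurable: "\<And>u. (\<lambda>x. g x u) \<in> borel_measurable lebesgue"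
    and G1_periodic: "AE x in lebesgue. \<forall>u. g (x + e3) u = g x u"
    and G1_continuous: "AE x in lebesgue. continuous_on UNIV (g x)"
    and G1_invariant: "\<And>B. orthogonal_matrix B \<Longrightarrow> AE x in lebesgue. \<forall>u. g (O2_act B x) u = g x u"
    and G1_growth: "\<exists>c>0. AE x in lebesgue. \<forall>u. \<bar>g x u\<bar> \<le> c * (1 + \<bar>u\<bar> powr (q - 1))"
    and G2: "\<forall>\<epsilon>>0. \<exists>\<delta>>0. AE x in lebesgue. \<forall>u. \<bar>u\<bar> < \<delta> \<longrightarrow> \<bar>g x u\<bar> \<le> \<epsilon> * \<bar>u\<bar>"
    and G3_antimono: "AE x in lebesgue. antimono_on {..<0} (\<lambda>u. g x u / \<bar>u\<bar> powr (q - 1))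
                                      \<and> antimono_on {0<..} (\<lambda>u. g x u / \<bar>u\<bar> powr (q - 1))"
    and G3_sign: "AE x in lebesgue. \<forall>u. g x u * u \<ge> 0"
  shows "infinite {{ae_class u, ae_class (\<lambda>x. - u x)} | u.
           weak_solution V f g u \<and> weak_solution V f g (\<lambda>x. - u x)}"
proof -
  interpret difference_problem p q V f g by unfold_locales (fact assms)+
  obtain U where U: "U \<noteq> 0" and crit: "\<And>W. xform V U W = H.\<K>' U W" by (rule nontrivial_critical_point) (rule that; assumption)
  let ?u = "rep U"
  define u where "u k = rep (xshift (int k) U)" for k :: nat
  define P where "P k = {ae_class (u k), ae_class (\<lambda>x. - u k x)}" for k
  have um: "u k \<in> borel_measurable lebesgue" "(\<lambda>x. - u k x) \<in> borel_measurable lebesgue" for k unfolding u_def by measurable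
  have sol: "weak_solution V f g (u k)" "weak_solution V f g (\<lambda>x. - u k x)" for k
    unfolding u_def by (rule weak_solution_pair[OF critical_xshift[OF crit]])+
  have "inj P"
  proof (rule injI, rule ccontr)
    fix k l assume kl: "P k = P l" "k \<noteq> l"
    have "ae_class (u k) = ae_class (u l) \<or> ae_class (u k) = ae_class (\<lambda>x. - u l x)" using kl(1) unfolding P_def by blast
    \<comment> \<open>Squares treat the two possible matchings of the pairs alike, and they are
      integrable.\<close>
    then have "AE x in lebesgue. (u l x)^2 = (u k x)^2"
    proof
      assume "ae_class (u k) = ae_class (u l)"
      from ae_class_eqD[OF um(1) this] show ?thesis by eventually_elim simp
    next
      assume "ae_class (u k) = ae_class (\<lambda>x. - u l x)"
      from ae_class_eqD[OF um(2) this] show ?thesis by eventually_elim (metis power2_minus)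
    qed
    then have "AE x in lebesgue. (?u (up (int l) x))^2 = (?u (up (int k) x))^2"
      using rep_xshift_AE[of "int k" U] rep_xshift_AE[of "int l" U] by eventually_elim (simp add: u_def)
    from up.AE_comp[OF this, of "- int k"]
    have "AE x in lebesgue. (?u (up (int l - int k) x))^2 = (?u x)^2" by eventually_elim (simp add: algebra_simps)
    then have "AE x in lebesgue. (?u x)^2 = 0"
      by (intro periodic_integrable_zero[where m="int l - int k"]) (use L2_D(2)[OF rep_L2(1)[of U]] kl(2) in auto)
    then have "AE x in lebesgue. ?u x = rep 0 x" using rep_zero_AE by eventually_elim simp
    then show False using U xfun_eqI by blast
  qed
  then have "infinite (range P)" by (rule range_inj_infinite)
  moreover have "range P \<subseteq> {{ae_class u, ae_class (\<lambda>x. - u x)} | u. weak_solution V f g u \<and> weak_solution V f g (\<lambda>x. - u x)}"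
    using sol unfolding P_def by blast
  ultimately show ?thesis using infinite_super by blast
qed

end
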